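(* Let $R$ be a commutative ring, $\overline{R} := R \otimes^{\mathbb{L}}_{\mathbb{Z}} \mathbb{F}_p$, let $M$ be an $R/p = \pi_0(\overline{R})$-module (concentrated in degree $0$), and $m \in M$ an element, viewed as a map $m : \overline{R} \to M$ of $\overline{R}$-modules. Then the arithmetic extension $W_2(R, M, m)$ fits into a pullback diagram of derived rings $$\begin{array}{ccc} W_2(R, M, m) & \longrightarrow & R \\ \downarrow & & \downarrow \\ \overline{R} \oplus \mathrm{cofib}(m) & \longrightarrow & \overline{R} \oplus \overline{R}[1] \end{array}$$ where the bottom map is the map of trivial square-zero extensions induced by the boundary map $\mathrm{cofib}(m) \to \overline{R}[1]$, and the right vertical map is the composite map $$R \xrightarrow{\mathrm{id}_R \otimes 1 \otimes 1} R \otimes^{\mathbb{L}}_{\mathbb{Z}} \mathbb{F}_p \otimes^{\mathbb{L}}_{\mathbb{Z}} \mathbb{F}_p \xrightarrow{\mathrm{Frob}} R \otimes^{\mathbb{L}}_{\mathbb{Z}} \mathbb{F}_p \otimes^{\mathbb{L}}_{\mathbb{Z}} \mathbb{F}_p = \overline{R} \otimes^{\mathbb{L}}_{\mathbb{Z}} \mathbb{F}_p = \overline{R} \oplus \overline{R}[1]$$ of animated rings, $\mathrm{Frob}$ being the Frobenius with respect to the last tensor factor $\mathbb{F}_p$.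
   Context: Fix a prime $p$. Derived rings are derived commutative rings (possibly nonconnective, theory of Mathew as presented by Raksit); connective derived rings are animated commutative rings. Modules are module spectra and $[1]$ is suspension. Arithmetic extension: for a commutative ring $R$, an $R/p$-module $M$ and $m \in M$, $W_2(R,M,m)$ is the commutative ring with underlying set $R \times M$, operations $$(a,x)+(b,y) = \Big(a+b,\; x+y-\sum_{j=1}^{p-1}\tfrac{1}{p}\tbinom{p}{j}a^{p-j}b^{j}m\Big),\qquad (a,x)(b,y) = (ab,\; a^p y+b^p x),$$ and unit $(1,0)$. The top horizontal map of the diagram is the projection $(a,x)\mapsto a$. For a derived $\mathbb{F}_p$-algebra $A$, the derived ring $A \otimes^{\mathbb{L}}_{\mathbb{Z}} \mathbb{F}_p$, as an $A$-algebra via the canonical map $\mathrm{can}: A \to A\otimes^{\mathbb{L}}_{\mathbb{Z}}\mathbb{F}_p$, is identified with the trivial square-zero extension $A\oplus A[1]$: writing $\mathbb{F}_p = \mathbb{Z}\otimes^{\mathbb{L}}_{\mathbb{Z}[t]}\mathbb{Z}$ (with $t\mapsto 0$ and $t \mapsto p$), one has $A\otimes^{\mathbb{L}}_{\mathbb{Z}}\mathbb{F}_p = A\otimes^{\mathbb{L}}_{A[t]}A = \mathrm{LSym}_A(A[1]) = A\oplus A[1]$. This is applied to $A=\overline{R}$. *)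

theory Defs
  imports
    "HOL-Algebra.QuotRing"
    "HOL-Algebra.Module"
    "HOL-Library.Multiset"
    "HOL-Computational_Algebra.Primes"
begin

text \<open>
  Connective derived rings (animated commutative rings) are modelled by simplicial commutative
  rings up to weak equivalence. All four corners of the square in the theorem are connective.
\<close>

section \<open>Simplicial commutative rings\<close>

text \<open>
  Indices of faces count from the target: \<open>face X n i\<close> is the \<open>i\<close>-th face map from level
  \<open>n + 1\<close> to level \<open>n\<close> (\<open>i \<le> n + 1\<close>), and \<open>dgn X n i\<close> is the \<open>i\<close>-th degeneracy from level
  \<open>n\<close> to level \<open>n + 1\<close> (\<open>i \<le> n\<close>).
\<close>

record 'a sring =
  lev :: "nat \<Rightarrow> 'a ring"
  face :: "nat \<Rightarrow> nat \<Rightarrow> 'a \<Rightarrow> 'a"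
  dgn :: "nat \<Rightarrow> nat \<Rightarrow> 'a \<Rightarrow> 'a"

locale simplicial_cring =
  fixes X :: "'a sring"
  assumes lev_cring: "cring (lev X n)"
    and face_hom: "i \<le> Suc n \<Longrightarrow> face X n i \<in> ring_hom (lev X (Suc n)) (lev X n)"
    and dgn_hom: "i \<le> n \<Longrightarrow> dgn X n i \<in> ring_hom (lev X n) (lev X (Suc n))"
    and face_face: "\<lbrakk>i < j; j \<le> Suc (Suc n); x \<in> carrier (lev X (Suc (Suc n)))\<rbrakk> \<Longrightarrow>
      face X n i (face X (Suc n) j x) = face X n (j - 1) (face X (Suc n) i x)"
    and dgn_dgn: "\<lbrakk>i \<le> j; j \<le> n; x \<in> carrier (lev X n)\<rbrakk> \<Longrightarrow>
      dgn X (Suc n) i (dgn X n j x) = dgn X (Suc n) (Suc j) (dgn X n i x)"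
    and face_dgn_less: "\<lbrakk>i < j; j \<le> Suc n; x \<in> carrier (lev X (Suc n))\<rbrakk> \<Longrightarrow>
      face X (Suc n) i (dgn X (Suc n) j x) = dgn X n (j - 1) (face X n i x)"
    and face_dgn_same: "\<lbrakk>i \<le> n; x \<in> carrier (lev X n)\<rbrakk> \<Longrightarrow> face X n i (dgn X n i x) = x"
    and face_dgn_Suc: "\<lbrakk>i \<le> n; x \<in> carrier (lev X n)\<rbrakk> \<Longrightarrow> face X n (Suc i) (dgn X n i x) = x"
    and face_dgn_greater: "\<lbrakk>Suc j < i; i \<le> Suc (Suc n); x \<in> carrier (lev X (Suc n))\<rbrakk> \<Longrightarrow>
      face X (Suc n) i (dgn X (Suc n) j x) = dgn X n j (face X n (i - 1) x)"

definition shom :: "'a sring \<Rightarrow> 'b sring \<Rightarrow> (nat \<Rightarrow> 'a \<Rightarrow> 'b) \<Rightarrow> bool" where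
  "shom X Y f \<longleftrightarrow>
    (\<forall>n. f n \<in> ring_hom (lev X n) (lev Y n)) \<and>
    (\<forall>n i. i \<le> Suc n \<longrightarrow> (\<forall>x\<in>carrier (lev X (Suc n)). f n (face X n i x) = face Y n i (f (Suc n) x))) \<and>
    (\<forall>n i. i \<le> n \<longrightarrow> (\<forall>x\<in>carrier (lev X n). f (Suc n) (dgn X n i x) = dgn Y n i (f n x)))"

definition sconst :: "'a ring \<Rightarrow> 'a sring" where
  "sconst S = \<lparr>lev = (\<lambda>_. S), face = (\<lambda>_ _ x. x), dgn = (\<lambda>_ _ x. x)\<rparr>"

definition sfibprod ::
  "'a sring \<Rightarrow> 'b sring \<Rightarrow> (nat \<Rightarrow> 'a \<Rightarrow> 'c) \<Rightarrow> (nat \<Rightarrow> 'b \<Rightarrow> 'c) \<Rightarrow> ('a \<times> 'b) sring" where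
  "sfibprod X Y f g =
    \<lparr>lev = (\<lambda>n. \<lparr>
        carrier = {(x, y). x \<in> carrier (lev X n) \<and> y \<in> carrier (lev Y n) \<and> f n x = g n y},
        monoid.mult = (\<lambda>(x, y) (x', y'). (x \<otimes>\<^bsub>lev X n\<^esub> x', y \<otimes>\<^bsub>lev Y n\<^esub> y')),
        one = (\<one>\<^bsub>lev X n\<^esub>, \<one>\<^bsub>lev Y n\<^esub>),
        zero = (\<zero>\<^bsub>lev X n\<^esub>, \<zero>\<^bsub>lev Y n\<^esub>),
        add = (\<lambda>(x, y) (x', y'). (x \<oplus>\<^bsub>lev X n\<^esub> x', y \<oplus>\<^bsub>lev Y n\<^esub> y'))\<rparr>),
     face = (\<lambda>n i (x, y). (face X n i x, face Y n i y)),
     dgn = (\<lambda>n i (x, y). (dgn X n i x, dgn Y n i y))\<rparr>"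


section \<open>Weak equivalences and pullback squares\<close>

text \<open>
  The homotopy groups of a simplicial commutative ring are the homology groups of the associated
  (unnormalised) chain complex. Of the rings \<open>grp C n\<close> only the additive group is used;
  \<open>bnd C n\<close> is the differential from degree \<open>n + 1\<close> to degree \<open>n\<close>.
\<close>

record 'a complx =
  grp :: "nat \<Rightarrow> 'a ring"
  bnd :: "nat \<Rightarrow> 'a \<Rightarrow> 'a"

definition chains :: "'a sring \<Rightarrow> 'a complx" where
  "chains X = \<lparr>grp = lev X,
    bnd = (\<lambda>n x. \<Oplus>\<^bsub>lev X n\<^esub>i\<in>{0..Suc n}. if even i then face X n i x else \<ominus>\<^bsub>lev X n\<^esub> face X n i x)\<rparr>"

definition cycles :: "'a complx \<Rightarrow> nat \<Rightarrow> 'a set" where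
  "cycles C n = {c \<in> carrier (grp C n). \<forall>k. n = Suc k \<longrightarrow> bnd C k c = \<zero>\<^bsub>grp C k\<^esub>}"

definition boundaries :: "'a complx \<Rightarrow> nat \<Rightarrow> 'a set" where
  "boundaries C n = bnd C n ` carrier (grp C (Suc n))"

text \<open>A chain map inducing injections, respectively surjections, on all homology groups:\<close>

definition quasi_iso :: "'a complx \<Rightarrow> 'b complx \<Rightarrow> (nat \<Rightarrow> 'a \<Rightarrow> 'b) \<Rightarrow> bool" where
  "quasi_iso C D f \<longleftrightarrow>
    (\<forall>n. \<forall>c\<in>cycles C n. f n c \<in> boundaries D n \<longrightarrow> c \<in> boundaries C n) \<and>
    (\<forall>n. \<forall>d\<in>cycles D n. \<exists>c\<in>cycles C n. d \<ominus>\<^bsub>grp D n\<^esub> f n c \<in> boundaries D n)"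

text \<open>
  The mapping cone of \<open>f : C \<rightarrow> D\<close>, with degree \<open>n\<close> part \<open>D n \<oplus> C (n - 1)\<close>
  (\<open>C (- 1) = 0\<close>, represented by the zero of \<open>C 0\<close>) and differential
  \<open>(d, c) \<mapsto> (\<partial> d + f c, - \<partial> c)\<close>.
\<close>

definition mcone :: "'a complx \<Rightarrow> 'b complx \<Rightarrow> (nat \<Rightarrow> 'a \<Rightarrow> 'b) \<Rightarrow> ('b \<times> 'a) complx" where
  "mcone C D f =
    \<lparr>grp = (\<lambda>n. \<lparr>
        carrier = carrier (grp D n) \<times> (if n = 0 then {\<zero>\<^bsub>grp C 0\<^esub>} else carrier (grp C (n - 1))),
        monoid.mult = undefined, one = undefined,
        zero = (\<zero>\<^bsub>grp D n\<^esub>, \<zero>\<^bsub>grp C (n - 1)\<^esub>),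
        add = (\<lambda>(d, c) (d', c'). (d \<oplus>\<^bsub>grp D n\<^esub> d', c \<oplus>\<^bsub>grp C (n - 1)\<^esub> c'))\<rparr>),
     bnd = (\<lambda>n (d, c).
        (bnd D n d \<oplus>\<^bsub>grp D n\<^esub> f n c,
         if n = 0 then \<zero>\<^bsub>grp C 0\<^esub> else \<ominus>\<^bsub>grp C (n - 1)\<^esub> bnd C (n - 1) c))\<rparr>"

definition weak_equiv :: "'a sring \<Rightarrow> 'b sring \<Rightarrow> (nat \<Rightarrow> 'a \<Rightarrow> 'b) \<Rightarrow> bool" where
  "weak_equiv X Y f \<longleftrightarrow> simplicial_cring X \<and> simplicial_cring Y \<and> shom X Y f \<and>
    quasi_iso (chains X) (chains Y) f"

text \<open>
  A commutative square with top \<open>a\<close>, left \<open>b\<close>, right \<open>h\<close> and bottom \<open>k\<close> that is a pullback in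
  derived rings. The forgetful functor from derived rings to the derived category of the integers
  is conservative and preserves limits, and a square in a stable category is a pullback iff the
  map from the cofibre of \<open>a\<close> to the cofibre of \<open>k\<close> is an equivalence.
\<close>

definition derived_pullback_square ::
  "'e sring \<Rightarrow> 'x sring \<Rightarrow> 'y sring \<Rightarrow> 'z sring \<Rightarrow>
   (nat \<Rightarrow> 'e \<Rightarrow> 'x) \<Rightarrow> (nat \<Rightarrow> 'e \<Rightarrow> 'y) \<Rightarrow> (nat \<Rightarrow> 'x \<Rightarrow> 'z) \<Rightarrow> (nat \<Rightarrow> 'y \<Rightarrow> 'z) \<Rightarrow> bool" where
  "derived_pullback_square E X Y Z a b h k \<longleftrightarrow>
    simplicial_cring E \<and> simplicial_cring X \<and> simplicial_cring Y \<and> simplicial_cring Z \<and>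
    shom E X a \<and> shom E Y b \<and> shom X Z h \<and> shom Y Z k \<and>
    (\<forall>n. \<forall>e\<in>carrier (lev E n). h n (a n e) = k n (b n e)) \<and>
    quasi_iso (mcone (chains E) (chains X) a) (mcone (chains Y) (chains Z) k)
      (\<lambda>n (x, e). (h n x, b (n - 1) e))"


section \<open>Reduction modulo \<open>p\<close>\<close>

definition pideal :: "nat \<Rightarrow> 'a ring \<Rightarrow> 'a set" where
  "pideal p S = PIdl\<^bsub>S\<^esub> ([p] \<cdot>\<^bsub>S\<^esub> \<one>\<^bsub>S\<^esub>)"

abbreviation modp :: "nat \<Rightarrow> 'a ring \<Rightarrow> 'a set ring" where
  "modp p S \<equiv> S Quot (pideal p S)"

definition pcls :: "nat \<Rightarrow> 'a ring \<Rightarrow> 'a \<Rightarrow> 'a set" where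
  "pcls p S x = pideal p S +>\<^bsub>S\<^esub> x"

text \<open>The map \<open>S/p \<rightarrow> S'/p\<close> induced by a ring homomorphism \<open>f : S \<rightarrow> S'\<close>:\<close>

definition modp_map :: "nat \<Rightarrow> 'b ring \<Rightarrow> ('a \<Rightarrow> 'b) \<Rightarrow> 'a set \<Rightarrow> 'b set" where
  "modp_map p S' f C = (\<Union>x\<in>C. pcls p S' (f x))"

definition smodp :: "nat \<Rightarrow> 'a sring \<Rightarrow> 'a set sring" where
  "smodp p X =
    \<lparr>lev = (\<lambda>n. modp p (lev X n)),
     face = (\<lambda>n i. modp_map p (lev X n) (face X n i)),
     dgn = (\<lambda>n i. modp_map p (lev X (Suc n)) (dgn X n i))\<rparr>"

text \<open>
  If \<open>Q \<rightarrow> R\<close> is a weak equivalence and all \<open>Q n\<close> have no \<open>p\<close>-torsion (for instance, if they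
  are polynomial rings over the integers), then \<open>smodp p Q\<close> represents the derived tensor
  product of \<open>R\<close> with the field with \<open>p\<close> elements, as a derived algebra over that field.
  Such \<open>Q\<close> always exist, for instance the simplicial ring whose \<open>n\<close>-th level consists of the
  \<open>(n + 1)\<close>-tuples with equal images under a surjection from an integral polynomial ring to \<open>R\<close>.
\<close>

definition ptf_resolution :: "nat \<Rightarrow> 'q sring \<Rightarrow> 'a sring \<Rightarrow> (nat \<Rightarrow> 'q \<Rightarrow> 'a) \<Rightarrow> bool" where
  "ptf_resolution p Q X eps \<longleftrightarrow> weak_equiv Q X eps \<and>
    (\<forall>n. \<forall>x\<in>carrier (lev Q n). [p] \<cdot>\<^bsub>lev Q n\<^esub> x = \<zero>\<^bsub>lev Q n\<^esub> \<longrightarrow> x = \<zero>\<^bsub>lev Q n\<^esub>)"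

text \<open>The Frobenius of a simplicial algebra over the field with \<open>p\<close> elements is levelwise:\<close>

definition sfrob :: "nat \<Rightarrow> 'a sring \<Rightarrow> nat \<Rightarrow> 'a \<Rightarrow> 'a" where
  "sfrob p X n x = x [^]\<^bsub>lev X n\<^esub> p"


section \<open>Polynomial rings\<close>

text \<open>
  Polynomials over \<open>S\<close> in the variables \<open>V\<close>; a monomial is the multiset of its variables.
\<close>

definition mpolys :: "'a ring \<Rightarrow> 'v set \<Rightarrow> ('v multiset \<Rightarrow> 'a) ring" where
  "mpolys S V = \<lparr>
    carrier = {f. (\<forall>u. f u \<in> carrier S) \<and> finite {u. f u \<noteq> \<zero>\<^bsub>S\<^esub>} \<and>
                  (\<forall>u. f u \<noteq> \<zero>\<^bsub>S\<^esub> \<longrightarrow> set_mset u \<subseteq> V)},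
    monoid.mult = (\<lambda>f g u. \<Oplus>\<^bsub>S\<^esub>v\<in>{v. v \<subseteq># u}. f v \<otimes>\<^bsub>S\<^esub> g (u - v)),
    one = (\<lambda>u. if u = {#} then \<one>\<^bsub>S\<^esub> else \<zero>\<^bsub>S\<^esub>),
    zero = (\<lambda>u. \<zero>\<^bsub>S\<^esub>),
    add = (\<lambda>f g u. f u \<oplus>\<^bsub>S\<^esub> g u)\<rparr>"

definition mconst :: "'a ring \<Rightarrow> 'a \<Rightarrow> 'v multiset \<Rightarrow> 'a" where
  "mconst S a = (\<lambda>u. if u = {#} then a else \<zero>\<^bsub>S\<^esub>)"

definition mvar :: "'a ring \<Rightarrow> 'v \<Rightarrow> 'v multiset \<Rightarrow> 'a" where
  "mvar S v = (\<lambda>u. if u = {#v#} then \<one>\<^bsub>S\<^esub> else \<zero>\<^bsub>S\<^esub>)"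

text \<open>The ring homomorphism \<open>S[V] \<rightarrow> T\<close> given by \<open>phi : S \<rightarrow> T\<close> and \<open>v \<mapsto> val v\<close>:\<close>

definition meval ::
  "'a ring \<Rightarrow> 'b ring \<Rightarrow> ('a \<Rightarrow> 'b) \<Rightarrow> ('v \<Rightarrow> 'b) \<Rightarrow> ('v multiset \<Rightarrow> 'a) \<Rightarrow> 'b" where
  "meval S T phi val f =
    (\<Oplus>\<^bsub>T\<^esub>u\<in>{u. f u \<noteq> \<zero>\<^bsub>S\<^esub>}. phi (f u) \<otimes>\<^bsub>T\<^esub> (\<Otimes>\<^bsub>T\<^esub>v\<in>set_mset u. val v [^]\<^bsub>T\<^esub> count u v))"


section \<open>The bar construction\<close>

text \<open>
  \<open>bar p A\<close> is the two-sided bar construction computing the derived tensor product of \<open>A\<close> with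
  the field with \<open>p\<close> elements, the latter written as the derived tensor product of two copies of
  the integers over the polynomial ring in \<open>t\<close>, along \<open>t \<mapsto> 0\<close> (left) and \<open>t \<mapsto> p\<close> (right).
  Its \<open>n\<close>-th level is \<open>A n [t 1, ..., t n]\<close>, where \<open>t j\<close> is \<open>t\<close> in the \<open>j\<close>-th of the \<open>n\<close> middle
  tensor factors. The \<open>k\<close>-th face multiplies the \<open>k\<close>-th and \<open>(k + 1)\<close>-st factors, the outermost
  ones being the two copies of the integers; so face \<open>0\<close> sends \<open>t 1\<close> to \<open>0\<close>, and the last face
  sends the last variable to \<open>p\<close>.

  If \<open>p = 0\<close> in \<open>A\<close>, this is the bar construction of \<open>A \<otimes> A\<close> over \<open>A[t]\<close> (both maps \<open>t \<mapsto> 0\<close>),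
  and it is levelwise the symmetric algebra on \<open>sshift A\<close> below, with \<open>t j\<close> the \<open>j\<close>-th
  generator.
\<close>

definition face_index :: "nat \<Rightarrow> nat \<Rightarrow> nat" where
  "face_index k j = (if j \<le> k then j else j - 1)"

definition bar_value :: "nat \<Rightarrow> 'a ring \<Rightarrow> nat \<Rightarrow> nat \<Rightarrow> nat multiset \<Rightarrow> 'a" where
  "bar_value p S n j =
    (if j = 0 then \<zero>\<^bsub>mpolys S {1..n}\<^esub>
     else if j = Suc n then [p] \<cdot>\<^bsub>mpolys S {1..n}\<^esub> \<one>\<^bsub>mpolys S {1..n}\<^esub>
     else mvar S j)"

definition bar :: "nat \<Rightarrow> 'a sring \<Rightarrow> (nat multiset \<Rightarrow> 'a) sring" where
  "bar p A =
    \<lparr>lev = (\<lambda>n. mpolys (lev A n) {1..n}),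
     face = (\<lambda>n k. meval (lev A (Suc n)) (mpolys (lev A n) {1..n})
        (\<lambda>a. mconst (lev A n) (face A n k a))
        (\<lambda>j. bar_value p (lev A n) n (face_index k j))),
     dgn = (\<lambda>n k. meval (lev A n) (mpolys (lev A (Suc n)) {1..Suc n})
        (\<lambda>a. mconst (lev A (Suc n)) (dgn A n k a))
        (\<lambda>j. mvar (lev A (Suc n)) (if j \<le> k then j else Suc j)))\<rparr>"

definition bar_unit :: "'a sring \<Rightarrow> nat \<Rightarrow> 'a \<Rightarrow> nat multiset \<Rightarrow> 'a" where
  "bar_unit A n a = mconst (lev A n) a"

text \<open>
  The augmentation \<open>t j \<mapsto> 0\<close> to \<open>A/p\<close>, the base change to \<open>A\<close> of the augmentation of the bar
  construction to the field with \<open>p\<close> elements. It is a levelwise surjective weak equivalence if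
  \<open>A\<close> has no \<open>p\<close>-torsion.
\<close>

definition bar_aug :: "nat \<Rightarrow> 'a sring \<Rightarrow> nat \<Rightarrow> (nat multiset \<Rightarrow> 'a) \<Rightarrow> 'a set" where
  "bar_aug p A n f = pcls p (lev A n) (f {#})"

definition bar_map :: "(nat \<Rightarrow> 'a \<Rightarrow> 'b) \<Rightarrow> nat \<Rightarrow> (nat multiset \<Rightarrow> 'a) \<Rightarrow> nat multiset \<Rightarrow> 'b" where
  "bar_map r n f = (\<lambda>u. r n (f u))"


section \<open>Simplicial modules and trivial square-zero extensions\<close>

record ('a, 'm) smodule =
  mlev :: "nat \<Rightarrow> ('a, 'm) module"
  mface :: "nat \<Rightarrow> nat \<Rightarrow> 'm \<Rightarrow> 'm"
  mdgn :: "nat \<Rightarrow> nat \<Rightarrow> 'm \<Rightarrow> 'm"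

definition sself :: "'a sring \<Rightarrow> ('a, 'a) smodule" where
  "sself A =
    \<lparr>mlev = (\<lambda>n. \<lparr>carrier = carrier (lev A n), monoid.mult = undefined, one = undefined,
        zero = \<zero>\<^bsub>lev A n\<^esub>, add = (\<lambda>x y. x \<oplus>\<^bsub>lev A n\<^esub> y), smult = (\<lambda>a x. a \<otimes>\<^bsub>lev A n\<^esub> x)\<rparr>),
     mface = face A, mdgn = dgn A\<rparr>"

text \<open>
  A module over the target of an augmentation \<open>pi : A \<rightarrow> sconst S\<close>, as a constant simplicial
  \<open>A\<close>-module:
\<close>

definition sconst_module :: "(nat \<Rightarrow> 'a \<Rightarrow> 's) \<Rightarrow> ('s, 'm) module \<Rightarrow> ('a, 'm) smodule" where
  "sconst_module pi M =
    \<lparr>mlev = (\<lambda>n. \<lparr>carrier = carrier M, monoid.mult = undefined, one = undefined,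
        zero = \<zero>\<^bsub>M\<^esub>, add = (\<lambda>x y. x \<oplus>\<^bsub>M\<^esub> y), smult = (\<lambda>a x. pi n a \<odot>\<^bsub>M\<^esub> x)\<rparr>),
     mface = (\<lambda>_ _ x. x), mdgn = (\<lambda>_ _ x. x)\<rparr>"

text \<open>
  \<open>sshift L\<close> is \<open>L[1]\<close>, as the pushout of \<open>0\<close> and \<open>0\<close> under \<open>L\<close>: the bar construction
  \<open>B(0, L, 0)\<close>, that is, the levelwise tensor product of \<open>L\<close> with the reduced chains on the
  simplicial circle. Its \<open>n\<close>-th level is the \<open>n\<close>-fold power of \<open>L n\<close>.
\<close>

definition tuple_face :: "('a, 'm) smodule \<Rightarrow> nat \<Rightarrow> nat \<Rightarrow> (nat \<Rightarrow> 'm) \<Rightarrow> nat \<Rightarrow> 'm" where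
  "tuple_face L n k x = (\<lambda>j\<in>{1..n}.
    if j < k then mface L n k (x j)
    else if j = k then mface L n k (x j) \<oplus>\<^bsub>mlev L n\<^esub> mface L n k (x (Suc j))
    else mface L n k (x (Suc j)))"

definition tuple_dgn :: "('a, 'm) smodule \<Rightarrow> nat \<Rightarrow> nat \<Rightarrow> (nat \<Rightarrow> 'm) \<Rightarrow> nat \<Rightarrow> 'm" where
  "tuple_dgn L n k x = (\<lambda>j\<in>{1..Suc n}.
    if j \<le> k then mdgn L n k (x j)
    else if j = Suc k then \<zero>\<^bsub>mlev L (Suc n)\<^esub>
    else mdgn L n k (x (j - 1)))"

definition sshift :: "('a, 'm) smodule \<Rightarrow> ('a, nat \<Rightarrow> 'm) smodule" where
  "sshift L =
    \<lparr>mlev = (\<lambda>n. \<lparr>carrier = {1..n} \<rightarrow>\<^sub>E carrier (mlev L n), monoid.mult = undefined, one = undefined,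
        zero = (\<lambda>j\<in>{1..n}. \<zero>\<^bsub>mlev L n\<^esub>),
        add = (\<lambda>x y. \<lambda>j\<in>{1..n}. x j \<oplus>\<^bsub>mlev L n\<^esub> y j),
        smult = (\<lambda>a x. \<lambda>j\<in>{1..n}. a \<odot>\<^bsub>mlev L n\<^esub> x j)\<rparr>),
     mface = tuple_face L, mdgn = tuple_dgn L\<rparr>"

text \<open>
  The cofibre of a map \<open>g : L \<rightarrow> N\<close> of simplicial modules, as the pushout of \<open>N\<close> and \<open>0\<close> under
  \<open>L\<close>: the bar construction \<open>B(N, L, 0)\<close>, in which face \<open>0\<close> adds the image under \<open>g\<close> of the
  first entry to the component in \<open>N\<close>. The boundary map to \<open>sshift L = B(0, L, 0)\<close> is induced by
  \<open>N \<rightarrow> 0\<close> and hence is the projection \<open>snd\<close>.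
\<close>

definition scofib ::
  "('a, 'l) smodule \<Rightarrow> ('a, 'm) smodule \<Rightarrow> (nat \<Rightarrow> 'l \<Rightarrow> 'm) \<Rightarrow> ('a, 'm \<times> (nat \<Rightarrow> 'l)) smodule" where
  "scofib L N g =
    \<lparr>mlev = (\<lambda>n. \<lparr>carrier = carrier (mlev N n) \<times> carrier (mlev (sshift L) n),
        monoid.mult = undefined, one = undefined,
        zero = (\<zero>\<^bsub>mlev N n\<^esub>, \<zero>\<^bsub>mlev (sshift L) n\<^esub>),
        add = (\<lambda>(y, x) (y', x'). (y \<oplus>\<^bsub>mlev N n\<^esub> y', x \<oplus>\<^bsub>mlev (sshift L) n\<^esub> x')),
        smult = (\<lambda>a (y, x). (a \<odot>\<^bsub>mlev N n\<^esub> y, a \<odot>\<^bsub>mlev (sshift L) n\<^esub> x))\<rparr>),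
     mface = (\<lambda>n k (y, x).
        (if k = 0 then mface N n k y \<oplus>\<^bsub>mlev N n\<^esub> g n (mface L n k (x 1)) else mface N n k y,
         tuple_face L n k x)),
     mdgn = (\<lambda>n k (y, x). (mdgn N n k y, tuple_dgn L n k x))\<rparr>"

definition sqzero :: "'a sring \<Rightarrow> ('a, 'm) smodule \<Rightarrow> ('a \<times> 'm) sring" where
  "sqzero A N =
    \<lparr>lev = (\<lambda>n. \<lparr>
        carrier = carrier (lev A n) \<times> carrier (mlev N n),
        monoid.mult = (\<lambda>(a, x) (b, y).
          (a \<otimes>\<^bsub>lev A n\<^esub> b, (a \<odot>\<^bsub>mlev N n\<^esub> y) \<oplus>\<^bsub>mlev N n\<^esub> (b \<odot>\<^bsub>mlev N n\<^esub> x))),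
        one = (\<one>\<^bsub>lev A n\<^esub>, \<zero>\<^bsub>mlev N n\<^esub>),
        zero = (\<zero>\<^bsub>lev A n\<^esub>, \<zero>\<^bsub>mlev N n\<^esub>),
        add = (\<lambda>(a, x) (b, y). (a \<oplus>\<^bsub>lev A n\<^esub> b, x \<oplus>\<^bsub>mlev N n\<^esub> y))\<rparr>),
     face = (\<lambda>n i (a, x). (face A n i a, mface N n i x)),
     dgn = (\<lambda>n i (a, x). (dgn A n i a, mdgn N n i x))\<rparr>"

definition sqzero_map :: "(nat \<Rightarrow> 'm \<Rightarrow> 'l) \<Rightarrow> nat \<Rightarrow> 'a \<times> 'm \<Rightarrow> 'a \<times> 'l" where
  "sqzero_map g n = (\<lambda>(a, x). (a, g n x))"

text \<open>
  For \<open>A\<close> with \<open>p = 0\<close>, the identification of \<open>bar p A\<close> with \<open>sqzero A (sshift (sself A))\<close>: the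
  map out of the symmetric algebra on \<open>A[1]\<close> that extends the inclusion of \<open>A[1]\<close>. It kills the
  symmetric powers of degree at least 2, which are contractible.
\<close>

definition bar_to_sqzero :: "nat \<Rightarrow> (nat multiset \<Rightarrow> 'a) \<Rightarrow> 'a \<times> (nat \<Rightarrow> 'a)" where
  "bar_to_sqzero n f = (f {#}, \<lambda>j\<in>{1..n}. f {#j#})"


section \<open>The square\<close>

definition W2 :: "nat \<Rightarrow> 'r ring \<Rightarrow> ('r set, 'm) module \<Rightarrow> 'm \<Rightarrow> ('r \<times> 'm) ring" where
  "W2 p R M m = \<lparr>
    carrier = carrier R \<times> carrier M,
    monoid.mult = (\<lambda>(a, x) (b, y).
      (a \<otimes>\<^bsub>R\<^esub> b,
       (pcls p R (a [^]\<^bsub>R\<^esub> p) \<odot>\<^bsub>M\<^esub> y) \<oplus>\<^bsub>M\<^esub> (pcls p R (b [^]\<^bsub>R\<^esub> p) \<odot>\<^bsub>M\<^esub> x))),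
    one = (\<one>\<^bsub>R\<^esub>, \<zero>\<^bsub>M\<^esub>),
    zero = (\<zero>\<^bsub>R\<^esub>, \<zero>\<^bsub>M\<^esub>),
    add = (\<lambda>(a, x) (b, y).
      (a \<oplus>\<^bsub>R\<^esub> b,
       (x \<oplus>\<^bsub>M\<^esub> y) \<ominus>\<^bsub>M\<^esub>
         (\<Oplus>\<^bsub>M\<^esub>j\<in>{1..p - 1}.
            pcls p R ([((p choose j) div p)] \<cdot>\<^bsub>R\<^esub> (a [^]\<^bsub>R\<^esub> (p - j) \<otimes>\<^bsub>R\<^esub> b [^]\<^bsub>R\<^esub> j)) \<odot>\<^bsub>M\<^esub> m)))\<rparr>"

text \<open>
  In the following \<open>Q\<close> is a resolution of \<open>R\<close> without \<open>p\<close>-torsion, with augmentation \<open>eps\<close>.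
  The derived reduction of \<open>R\<close> is represented both by \<open>smodp p Q\<close>, in which \<open>p = 0\<close>, and by
  \<open>bar p Q\<close>, which has no \<open>p\<close>-torsion; \<open>bar_aug p Q\<close> is a weak equivalence between them.

  Accordingly the derived tensor product of \<open>R\<close> with two copies of the field with \<open>p\<close> elements
  is represented by
    \<^item> \<open>smodp p (bar p Q)\<close>, strictly an algebra over the last factor, so that the Frobenius with
      respect to that factor is \<open>sfrob\<close>;
    \<^item> \<open>bar p (bar p Q)\<close>;
    \<^item> \<open>bar p (smodp p Q)\<close>, which maps to the trivial square-zero extension by
      \<open>bar_to_sqzero\<close>.
  The second maps to the first by \<open>bar_aug\<close> on the last factor, and to the third by \<open>bar_aug\<close> on
  the first factor; these maps are the identifications.
\<close>

definition frob_can :: "nat \<Rightarrow> 'q sring \<Rightarrow> nat \<Rightarrow> 'q \<Rightarrow> (nat multiset \<Rightarrow> 'q) set" where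
  "frob_can p Q n x =
    sfrob p (smodp p (bar p Q)) n (pcls p (lev (bar p Q) n) (bar_unit Q n x))"

text \<open>
  The composite \<open>R \<rightarrow> R \<otimes> F \<otimes> F \<rightarrow> R \<otimes> F \<otimes> F\<close> is represented by \<open>frob_can p Q\<close>, with target
  \<open>smodp p (bar p Q)\<close>. To continue along the identification with \<open>bar p (bar p Q)\<close>, replace \<open>Q\<close>
  by its fibre product \<open>frob_source p Q\<close> with \<open>bar p (bar p Q)\<close>. As \<open>bar_aug\<close> is levelwise
  surjective and a weak equivalence, so is the projection from \<open>frob_source p Q\<close> to \<open>Q\<close>.
\<close>

definition frob_source :: "nat \<Rightarrow> 'q sring \<Rightarrow> ('q \<times> (nat multiset \<Rightarrow> nat multiset \<Rightarrow> 'q)) sring" where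
  "frob_source p Q = sfibprod Q (bar p (bar p Q)) (frob_can p Q) (bar_aug p (bar p Q))"

definition frob_map ::
  "nat \<Rightarrow> 'q sring \<Rightarrow> nat \<Rightarrow> 'q \<times> (nat multiset \<Rightarrow> nat multiset \<Rightarrow> 'q) \<Rightarrow> 'q set \<times> (nat \<Rightarrow> 'q set)" where
  "frob_map p Q n = (\<lambda>(x, f). bar_to_sqzero n (bar_map (bar_aug p Q) n f))"

text \<open>The augmentation from the derived reduction to \<open>R/p\<close>, and \<open>m\<close> as a map out of it:\<close>

definition aug_modp :: "nat \<Rightarrow> 'r ring \<Rightarrow> (nat \<Rightarrow> 'q \<Rightarrow> 'r) \<Rightarrow> nat \<Rightarrow> 'q set \<Rightarrow> 'r set" where
  "aug_modp p R eps n = modp_map p R (eps n)"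

definition elt_map ::
  "nat \<Rightarrow> 'r ring \<Rightarrow> (nat \<Rightarrow> 'q \<Rightarrow> 'r) \<Rightarrow> ('r set, 'm) module \<Rightarrow> 'm \<Rightarrow> nat \<Rightarrow> 'q set \<Rightarrow> 'm" where
  "elt_map p R eps M m n a = aug_modp p R eps n a \<odot>\<^bsub>M\<^esub> m"

definition cofib_elt ::
  "nat \<Rightarrow> 'r ring \<Rightarrow> 'q sring \<Rightarrow> (nat \<Rightarrow> 'q \<Rightarrow> 'r) \<Rightarrow> ('r set, 'm) module \<Rightarrow> 'm \<Rightarrow>
   ('q set, 'm \<times> (nat \<Rightarrow> 'q set)) smodule" where
  "cofib_elt p R Q eps M m =
    scofib (sself (smodp p Q)) (sconst_module (aug_modp p R eps) M) (elt_map p R eps M m)"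

end

theory Submission
  imports Defs
begin

text \<open>
  As \<open>cofib(m) \<rightarrow> Q/p[1]\<close> is levelwise surjective with kernel \<open>M\<close>, the strict fibre product \<open>E\<close> of
  \<open>frob_source\<close> with the square-zero extensions is a derived pullback, and it is an extension of
  \<open>frob_source\<close> by the constant simplicial module \<open>M\<close>. Its equivalence with \<open>W\<^sub>2(R, M, m)\<close> can be written
  down. An element of \<open>E\<close> consists of \<open>x\<close> in \<open>Q\<close>, a polynomial \<open>f\<close> over \<open>bar p Q\<close> whose constant coefficient
  is congruent to \<open>x ^ p\<close> modulo \<open>p\<close>, and \<open>y\<close> in \<open>M\<close>; it is sent to \<open>(eps x, y + lam m)\<close>, where \<open>lam\<close> is
  the class in \<open>R/p\<close> of \<open>(f {#} - x ^ p) / p\<close> plus the sum of the linear coefficients of \<open>f\<close>. The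
  failure of \<open>(f {#} - x ^ p) / p\<close> to be additive is exactly the cocycle defining the addition of
  \<open>W\<^sub>2(R, M, m)\<close>, and the linear coefficients make the map compatible with face \<open>0\<close>, which acts on the
  cofibre through \<open>m\<close>, and with the last face, which sends the last variable to \<open>p\<close>.

  That \<open>frob_source\<close> still resolves \<open>R\<close> amounts to the acyclicity of the kernel of the augmentation
  \<open>bar p A \<rightarrow> A/p\<close> for \<open>A\<close> without \<open>p\<close>-torsion.
\<close>

section \<open>Polynomial rings\<close>

text \<open>The obstacle is that the Frobenius lives on the reduction modulo \<open>p\<close> of
  \<open>bar p Q\<close>, while the square-zero extension is reached only from
  \<open>bar p (bar p Q)\<close>, where taking \<open>p\<close>-th powers is not additive. An
  element of \<open>frob_source\<close> therefore carries its own lift \<open>f\<close> of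
  \<open>x ^ p\<close>, and the failure of additivity becomes visible as a quotient by
  \<open>p\<close>. Torsion-freeness passes from \<open>Q\<close> to \<open>bar p Q\<close> and
  enters there twice: it makes this quotient unique, and it makes the kernel of the augmentation
  acyclic. The bar construction is treated as a polynomial algebra on the simplicial interval: the
  indices 0, ..., n + 1 are the n-simplices of the interval, and its two ends are set to 0 and
  \<open>p\<close>. With both ends fixed the interval cannot be contracted; freeing the end at 0
  (the variable \<open>t 0\<close>) permits it, at the price of comparing multiplication by
  \<open>t 0\<close> with multiplication by \<open>p\<close>. The ring axioms of \<open>W2\<close>
  are never checked on its formulas: the map from \<open>E\<close> is onto and respects the
  operations, so they are inherited.\<close>

lemma finite_submultisets: "finite {v. v \<subseteq># (u :: 'v multiset)}"
proof (induction u)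
  case (add x u)
  have "{v. v \<subseteq># add_mset x u} \<subseteq> {v. v \<subseteq># u} \<union> add_mset x ` {v. v \<subseteq># u}"
  proof
    fix v assume v: "v \<in> {v. v \<subseteq># add_mset x u}"
    show "v \<in> {v. v \<subseteq># u} \<union> add_mset x ` {v. v \<subseteq># u}"
    proof (cases "x \<in># v")
      case True
      then obtain w where "v = add_mset x w" by (metis insert_DiffM)
      then show ?thesis using v by auto
    next
      case False
      then have "v \<subseteq># u" using v
        by (metis (no_types, lifting) diff_single_trivial mem_Collect_eq subset_eq_diff_conv add_mset_add_single)
      then show ?thesis by auto
    qed
  qed
  then show ?case using add finite_subset by blast
qed simp

text \<open>Turns a dependent double sum into a single sum over pairs, where it can be reindexed:
  needed for associativity of the polynomial product and for the double sums over faces.\<close>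

lemma (in abelian_monoid) finsum_Sigma:
  assumes "finite A" "\<And>x. x \<in> A \<Longrightarrow> finite (B x)" "\<And>x y. x \<in> A \<Longrightarrow> y \<in> B x \<Longrightarrow> f x y \<in> carrier G"
  shows "(\<Oplus>x\<in>A. \<Oplus>y\<in>B x. f x y) = (\<Oplus>z\<in>Sigma A B. f (fst z) (snd z))"
  using assms
proof (induction A rule: finite_induct)
  case (insert a A)
  have eq: "Sigma (insert a A) B = Pair a ` B a \<union> Sigma A B" by auto
  have 1: "(\<Oplus>z\<in>Sigma (insert a A) B. f (fst z) (snd z)) =
      (\<Oplus>z\<in>Pair a ` B a. f (fst z) (snd z)) \<oplus> (\<Oplus>z\<in>Sigma A B. f (fst z) (snd z))"
    unfolding eq by (rule finsum_Un_disjoint) (use insert in \<open>auto simp: Pi_def\<close>)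
  have 2: "(\<Oplus>z\<in>Pair a ` B a. f (fst z) (snd z)) = (\<Oplus>y\<in>B a. f a y)"
    by (subst finsum_reindex) (use insert in \<open>auto simp: inj_on_def\<close>)
  have 3: "(\<lambda>x. \<Oplus>y\<in>B x. f x y) \<in> A \<rightarrow> carrier G" "(\<Oplus>y\<in>B a. f a y) \<in> carrier G"
    using insert by (auto intro!: finsum_closed)
  show ?case
    using insert 3 by (simp add: 1 2)
qed simp

text \<open>Constants and variables are both monomials with a coefficient, so closure and
  multiplication are treated once for this common form.\<close>

definition mmono :: "'a ring \<Rightarrow> 'a \<Rightarrow> 'v multiset \<Rightarrow> 'v multiset \<Rightarrow> 'a" where
  "mmono S a w = (\<lambda>u. if u = w then a else \<zero>\<^bsub>S\<^esub>)"

lemma mconst_eq_mmono: "mconst S a = mmono S a {#}"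
  by (simp add: mconst_def mmono_def)

lemma mvar_eq_mmono: "mvar S v = mmono S \<one>\<^bsub>S\<^esub> {#v#}"
  by (simp add: mvar_def mmono_def)

lemma mpolys_sel:
  "carrier (mpolys S V) = {f. (\<forall>u. f u \<in> carrier S) \<and> finite {u. f u \<noteq> \<zero>\<^bsub>S\<^esub>} \<and>
                  (\<forall>u. f u \<noteq> \<zero>\<^bsub>S\<^esub> \<longrightarrow> set_mset u \<subseteq> V)}"
  "f \<otimes>\<^bsub>mpolys S V\<^esub> g = (\<lambda>u. \<Oplus>\<^bsub>S\<^esub>v\<in>{v. v \<subseteq># u}. f v \<otimes>\<^bsub>S\<^esub> g (u - v))"
  "\<one>\<^bsub>mpolys S V\<^esub> = mconst S \<one>\<^bsub>S\<^esub>"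
  "\<zero>\<^bsub>mpolys S V\<^esub> = (\<lambda>u. \<zero>\<^bsub>S\<^esub>)"
  "f \<oplus>\<^bsub>mpolys S V\<^esub> g = (\<lambda>u. f u \<oplus>\<^bsub>S\<^esub> g u)"
  by (simp_all add: mpolys_def mconst_def)

lemma mpolys_coeff_closed: "f \<in> carrier (mpolys S V) \<Longrightarrow> f u \<in> carrier S"
  by (simp add: mpolys_sel)

lemma mpolys_finite_supp: "f \<in> carrier (mpolys S V) \<Longrightarrow> finite {u. f u \<noteq> \<zero>\<^bsub>S\<^esub>}"
  by (simp add: mpolys_sel)

lemma mpolys_supp: "f \<in> carrier (mpolys S V) \<Longrightarrow> f u \<noteq> \<zero>\<^bsub>S\<^esub> \<Longrightarrow> set_mset u \<subseteq> V"
  by (simp add: mpolys_sel)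

text \<open>A copy of \<open>cring\<close> that holds the additional lemmas and simplification
  rules, kept apart from the library locale.\<close>

locale base_cring = cring R for R :: "'a ring" (structure)
begin

lemma mmono_closed: "a \<in> carrier R \<Longrightarrow> set_mset w \<subseteq> V \<Longrightarrow> mmono R a w \<in> carrier (mpolys R V)"
  by (auto simp: mpolys_sel mmono_def)

lemma mconst_closed: "a \<in> carrier R \<Longrightarrow> mconst R a \<in> carrier (mpolys R V)"
  by (simp add: mconst_eq_mmono mmono_closed)

lemma mvar_closed: "v \<in> V \<Longrightarrow> mvar R v \<in> carrier (mpolys R V)"
  by (simp add: mvar_eq_mmono mmono_closed)

lemma mpolys_add_closed:
  assumes "f \<in> carrier (mpolys R V)" "g \<in> carrier (mpolys R V)"
  shows "f \<oplus>\<^bsub>mpolys R V\<^esub> g \<in> carrier (mpolys R V)"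
proof -
  have "{u. f u \<oplus> g u \<noteq> \<zero>} \<subseteq> {u. f u \<noteq> \<zero>} \<union> {u. g u \<noteq> \<zero>}"
    by auto
  then have "finite {u. f u \<oplus> g u \<noteq> \<zero>}"
    by (rule finite_subset) (simp add: mpolys_finite_supp[OF assms(1)] mpolys_finite_supp[OF assms(2)])
  moreover have "set_mset u \<subseteq> V" if "f u \<oplus> g u \<noteq> \<zero>" for u
    using that mpolys_supp[OF assms(1), of u] mpolys_supp[OF assms(2), of u]
      mpolys_coeff_closed[OF assms(2), of u] by (cases "f u = \<zero>") auto
  ultimately show ?thesis using assms by (auto simp: mpolys_sel)
qed

text \<open>Without such a pair every summand of the convolution has a zero factor. The resulting
  bound on the support gives closure under products: finiteness and the restriction on the variables
  at once.\<close>

lemma mpolys_mult_nonzero: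
  assumes "f \<in> carrier (mpolys R V)" "g \<in> carrier (mpolys R V)" "(f \<otimes>\<^bsub>mpolys R V\<^esub> g) u \<noteq> \<zero>"
  shows "\<exists>v w. f v \<noteq> \<zero> \<and> g w \<noteq> \<zero> \<and> u = v + w"
proof (rule ccontr)
  assume no: "\<nexists>v w. f v \<noteq> \<zero> \<and> g w \<noteq> \<zero> \<and> u = v + w"
  have "f v \<otimes> g (u - v) = \<zero>" if "v \<subseteq># u" for v
  proof -
    have "f v = \<zero> \<or> g (u - v) = \<zero>" using no that by (metis subset_mset.add_diff_inverse)
    then show ?thesis using assms by (auto simp: mpolys_coeff_closed)
  qed
  then have "(f \<otimes>\<^bsub>mpolys R V\<^esub> g) u = \<zero>"
    unfolding mpolys_sel by (intro add.finprod_one_eqI) auto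
  then show False using assms by simp
qed

lemma mpolys_mult_closed:
  assumes f: "f \<in> carrier (mpolys R V)" and g: "g \<in> carrier (mpolys R V)"
  shows "f \<otimes>\<^bsub>mpolys R V\<^esub> g \<in> carrier (mpolys R V)"
proof -
  let ?h = "f \<otimes>\<^bsub>mpolys R V\<^esub> g"
  have "{u. ?h u \<noteq> \<zero>} \<subseteq> (\<lambda>(v, w). v + w) ` ({u. f u \<noteq> \<zero>} \<times> {u. g u \<noteq> \<zero>})"
    using mpolys_mult_nonzero[OF f g] by fastforce
  then have "finite {u. ?h u \<noteq> \<zero>}"
    by (rule finite_subset) (simp add: mpolys_finite_supp[OF f] mpolys_finite_supp[OF g])
  moreover have "set_mset u \<subseteq> V" if "?h u \<noteq> \<zero>" for u
    using mpolys_mult_nonzero[OF f g that] mpolys_supp[OF f] mpolys_supp[OF g] by fastforce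
  moreover have "?h u \<in> carrier R" for u
    unfolding mpolys_sel using f g by (auto intro!: finsum_closed simp: mpolys_coeff_closed)
  ultimately show ?thesis by (simp add: mpolys_sel(1))
qed

lemma mpolys_mult_comm:
  fixes f g :: "'v multiset \<Rightarrow> 'a"
  assumes f: "f \<in> carrier (mpolys R V)" and g: "g \<in> carrier (mpolys R V)"
  shows "f \<otimes>\<^bsub>mpolys R V\<^esub> g = g \<otimes>\<^bsub>mpolys R V\<^esub> f"
proof
  fix u :: "'v multiset"
  note [simp] = mpolys_coeff_closed[OF f] mpolys_coeff_closed[OF g]
  \<comment> \<open>Complementation \<open>v -> u - v\<close> is an involution of the submultisets
    of \<open>u\<close> and exchanges the two factors.\<close>
  have eq: "{v. v \<subseteq># u} = (\<lambda>v. u - v) ` {v. v \<subseteq># u}"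
    by (auto simp: image_iff) (metis diff_subset_eq_self subset_mset.add_diff_inverse add_diff_cancel_right')
  have inj: "inj_on (\<lambda>v. u - v) {v. v \<subseteq># u}"
    by (rule inj_onI) (metis mem_Collect_eq subset_mset.diff_add add_left_cancel)
  have "(\<Oplus>v\<in>{v. v \<subseteq># u}. f v \<otimes> g (u - v)) = (\<Oplus>v\<in>(\<lambda>v. u - v) ` {v. v \<subseteq># u}. f v \<otimes> g (u - v))"
    using eq by simp
  also have "\<dots> = (\<Oplus>v\<in>{v. v \<subseteq># u}. f (u - v) \<otimes> g (u - (u - v)))"
    by (rule finsum_reindex[OF _ inj]) auto
  also have "\<dots> = (\<Oplus>v\<in>{v. v \<subseteq># u}. g v \<otimes> f (u - v))"
    by (rule finsum_cong') (auto simp: m_comm subset_mset.diff_diff_right subset_mset.add_diff_inverse)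
  finally show "(f \<otimes>\<^bsub>mpolys R V\<^esub> g) u = (g \<otimes>\<^bsub>mpolys R V\<^esub> f) u"
    by (simp add: mpolys_sel)
qed

lemma mpolys_mult_assoc:
  fixes f g h :: "'v multiset \<Rightarrow> 'a"
  assumes f: "f \<in> carrier (mpolys R V)" and g: "g \<in> carrier (mpolys R V)" and h: "h \<in> carrier (mpolys R V)"
  shows "(f \<otimes>\<^bsub>mpolys R V\<^esub> g) \<otimes>\<^bsub>mpolys R V\<^esub> h = f \<otimes>\<^bsub>mpolys R V\<^esub> (g \<otimes>\<^bsub>mpolys R V\<^esub> h)"
proof
  fix u :: "'v multiset"
  note [simp] = mpolys_coeff_closed[OF f] mpolys_coeff_closed[OF g] mpolys_coeff_closed[OF h] finite_submultisets
  let ?D = "Sigma {v. v \<subseteq># u} (\<lambda>v. {w. w \<subseteq># u - v})"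
  \<comment> \<open>Both bracketings sum over decompositions of \<open>u\<close> into three parts.
    The pair \<open>(a, b)\<close> of the first two parts is sent to the partial sum
    \<open>a + b\<close> together with its first part \<open>a\<close>.\<close>
  have im: "(\<lambda>(a, b). (a + b, a)) ` ?D = Sigma {v. v \<subseteq># u} (\<lambda>v. {w. w \<subseteq># v})"
  proof (intro equalityI subsetI)
    fix x assume "x \<in> Sigma {v. v \<subseteq># u} (\<lambda>v. {w. w \<subseteq># v})"
    then obtain v w where x: "x = (v, w)" "v \<subseteq># u" "w \<subseteq># v" by auto
    then have "x = (\<lambda>(a, b). (a + b, a)) (w, v - w)" "(w, v - w) \<in> ?D"
      by (auto intro: subset_mset.order_trans) (simp add: subset_eq_diff_conv)
    then show "x \<in> (\<lambda>(a, b). (a + b, a)) ` ?D" by (rule image_eqI)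
  qed (auto, metis subset_mset.le_diff_conv2 union_commute)
  let ?F = "\<lambda>v w. f w \<otimes> g (v - w) \<otimes> h (u - v)" and ?G = "\<lambda>v w. f v \<otimes> (g w \<otimes> h (u - v - w))"
  have "((f \<otimes>\<^bsub>mpolys R V\<^esub> g) \<otimes>\<^bsub>mpolys R V\<^esub> h) u = (\<Oplus>v\<in>{v. v \<subseteq># u}. \<Oplus>w\<in>{w. w \<subseteq># v}. ?F v w)"
    unfolding mpolys_sel by (intro finsum_cong' finsum_ldistr) (auto intro!: finsum_closed)
  also have "\<dots> = (\<Oplus>z\<in>Sigma {v. v \<subseteq># u} (\<lambda>v. {w. w \<subseteq># v}). ?F (fst z) (snd z))"
    by (rule finsum_Sigma) auto
  also have "\<dots> = (\<Oplus>z\<in>(\<lambda>(a, b). (a + b, a)) ` ?D. ?F (fst z) (snd z))"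
    by (simp only: im)
  also have "\<dots> = (\<Oplus>z\<in>?D. ?G (fst z) (snd z))"
    by (subst finsum_reindex) (auto simp: inj_on_def m_assoc intro!: finsum_cong')
  also have "\<dots> = (\<Oplus>v\<in>{v. v \<subseteq># u}. \<Oplus>w\<in>{w. w \<subseteq># u - v}. ?G v w)"
    by (rule finsum_Sigma[symmetric]) auto
  also have "\<dots> = (f \<otimes>\<^bsub>mpolys R V\<^esub> (g \<otimes>\<^bsub>mpolys R V\<^esub> h)) u"
    unfolding mpolys_sel by (intro finsum_cong' finsum_rdistr[symmetric]) (auto intro!: finsum_closed)
  finally show "((f \<otimes>\<^bsub>mpolys R V\<^esub> g) \<otimes>\<^bsub>mpolys R V\<^esub> h) u = (f \<otimes>\<^bsub>mpolys R V\<^esub> (g \<otimes>\<^bsub>mpolys R V\<^esub> h)) u" .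
qed

text \<open>In the convolution only the summand for \<open>w\<close> itself survives.\<close>

lemma mmono_mult:
  assumes a: "a \<in> carrier R" and f: "f \<in> carrier (mpolys R V)"
  shows "mmono R a w \<otimes>\<^bsub>mpolys R V\<^esub> f = (\<lambda>u. if w \<subseteq># u then a \<otimes> f (u - w) else \<zero>)"
proof
  fix u
  note [simp] = mpolys_coeff_closed[OF f] finite_submultisets a
  have "(mmono R a w \<otimes>\<^bsub>mpolys R V\<^esub> f) u = (\<Oplus>v\<in>{v. v \<subseteq># u}. if w = v then a \<otimes> f (u - v) else \<zero>)"
    unfolding mpolys_sel mmono_def by (rule finsum_cong') auto
  also have "\<dots> = (if w \<subseteq># u then a \<otimes> f (u - w) else \<zero>)"
  proof (cases "w \<subseteq># u")
    case True
    then show ?thesis by (simp add: finsum_singleton[of w "{v. v \<subseteq># u}" "\<lambda>v. a \<otimes> f (u - v)"])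
  qed (auto intro!: add.finprod_one_eqI)
  finally show "(mmono R a w \<otimes>\<^bsub>mpolys R V\<^esub> f) u = (if w \<subseteq># u then a \<otimes> f (u - w) else \<zero>)" .
qed

lemma mconst_mult:
  "a \<in> carrier R \<Longrightarrow> f \<in> carrier (mpolys R V) \<Longrightarrow> mconst R a \<otimes>\<^bsub>mpolys R V\<^esub> f = (\<lambda>u. a \<otimes> f u)"
  by (simp add: mconst_eq_mmono mmono_mult)

lemma mvar_mult:
  "f \<in> carrier (mpolys R V) \<Longrightarrow> mvar R v \<otimes>\<^bsub>mpolys R V\<^esub> f = (\<lambda>u. if v \<in># u then f (u - {#v#}) else \<zero>)"
  by (auto simp add: mvar_eq_mmono mmono_mult fun_eq_iff mpolys_coeff_closed)

lemma cring_mpolys: "cring (mpolys R V)"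
proof (rule cringI)
  let ?P = "mpolys R V"
  show "abelian_group ?P"
  proof (rule abelian_groupI)
    fix f g h assume fgh: "f \<in> carrier ?P" "g \<in> carrier ?P" "h \<in> carrier ?P"
    show "f \<oplus>\<^bsub>?P\<^esub> g \<oplus>\<^bsub>?P\<^esub> h = f \<oplus>\<^bsub>?P\<^esub> (g \<oplus>\<^bsub>?P\<^esub> h)"
      unfolding mpolys_sel(5) by (rule ext, rule a_assoc) (rule fgh[THEN mpolys_coeff_closed])+
  next
    fix f g assume fg: "f \<in> carrier ?P" "g \<in> carrier ?P"
    show "f \<oplus>\<^bsub>?P\<^esub> g = g \<oplus>\<^bsub>?P\<^esub> f"
      unfolding mpolys_sel(5) by (rule ext, rule a_comm) (rule fg[THEN mpolys_coeff_closed])+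
    show "f \<oplus>\<^bsub>?P\<^esub> g \<in> carrier ?P"
      by (rule mpolys_add_closed[OF fg])
  next
    fix f assume f: "f \<in> carrier ?P"
    show "\<zero>\<^bsub>?P\<^esub> \<oplus>\<^bsub>?P\<^esub> f = f"
      unfolding mpolys_sel(4,5) by (rule ext, rule l_zero) (rule mpolys_coeff_closed[OF f])
    have "{u. \<ominus> f u \<noteq> \<zero>} = {u. f u \<noteq> \<zero>}"
      using mpolys_coeff_closed[OF f] by (simp add: local.add.inv_eq_1_iff)
    then have "\<ominus> f u \<noteq> \<zero> \<longleftrightarrow> f u \<noteq> \<zero>" for u by blast
    then have "(\<lambda>u. \<ominus> f u) \<in> carrier ?P"
      using f by (simp add: mpolys_sel)
    moreover have "(\<lambda>u. \<ominus> f u) \<oplus>\<^bsub>?P\<^esub> f = \<zero>\<^bsub>?P\<^esub>"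
      unfolding mpolys_sel(4,5) by (rule ext, rule l_neg) (rule mpolys_coeff_closed[OF f])
    ultimately show "\<exists>g\<in>carrier ?P. g \<oplus>\<^bsub>?P\<^esub> f = \<zero>\<^bsub>?P\<^esub>" by blast
  next
    show "\<zero>\<^bsub>?P\<^esub> \<in> carrier ?P" by (simp add: mpolys_sel)
  qed
  show "comm_monoid ?P"
  proof (rule comm_monoidI)
    fix f assume "f \<in> carrier ?P"
    then show "\<one>\<^bsub>?P\<^esub> \<otimes>\<^bsub>?P\<^esub> f = f"
      by (simp add: mpolys_sel(3) mconst_mult mpolys_coeff_closed)
  next
    show "\<one>\<^bsub>?P\<^esub> \<in> carrier ?P" by (simp add: mpolys_sel(3) mconst_closed)
  qed (fact mpolys_mult_closed mpolys_mult_assoc mpolys_mult_comm)+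
  fix f g h assume f: "f \<in> carrier ?P" and g: "g \<in> carrier ?P" and h: "h \<in> carrier ?P"
  note [simp] = mpolys_coeff_closed[OF f] mpolys_coeff_closed[OF g] mpolys_coeff_closed[OF h]
  show "(f \<oplus>\<^bsub>?P\<^esub> g) \<otimes>\<^bsub>?P\<^esub> h = f \<otimes>\<^bsub>?P\<^esub> h \<oplus>\<^bsub>?P\<^esub> g \<otimes>\<^bsub>?P\<^esub> h"
  proof
    fix u
    have "(\<Oplus>v\<in>{v. v \<subseteq># u}. (f v \<oplus> g v) \<otimes> h (u - v)) =
        (\<Oplus>v\<in>{v. v \<subseteq># u}. f v \<otimes> h (u - v) \<oplus> g v \<otimes> h (u - v))"
      by (rule finsum_cong') (auto simp: l_distr)
    also have "\<dots> = (\<Oplus>v\<in>{v. v \<subseteq># u}. f v \<otimes> h (u - v)) \<oplus> (\<Oplus>v\<in>{v. v \<subseteq># u}. g v \<otimes> h (u - v))"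
      by (rule finsum_addf) auto
    finally show "((f \<oplus>\<^bsub>?P\<^esub> g) \<otimes>\<^bsub>?P\<^esub> h) u = (f \<otimes>\<^bsub>?P\<^esub> h \<oplus>\<^bsub>?P\<^esub> g \<otimes>\<^bsub>?P\<^esub> h) u"
      by (simp add: mpolys_sel(2,5))
  qed
qed

lemma mmono_add_mset:
  assumes "a \<in> carrier R" "set_mset w \<subseteq> V"
  shows "mmono R a (add_mset v w) = mvar R v \<otimes>\<^bsub>mpolys R V\<^esub> mmono R a w"
  unfolding mvar_mult[OF mmono_closed[OF assms]]
  by (auto simp: mmono_def fun_eq_iff)

text \<open>Constants and variables generate \<open>R[V]\<close>. Multiplication by a single
  variable, instead of a general product, also suits statements that are not multiplicative, such as
  \<open>eval_p_const\<close> and \<open>last_face_coeff_empty\<close>.\<close>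

lemma mpolys_induct [consumes 1, case_names const add var]:
  assumes "f \<in> carrier (mpolys R V)"
    and const: "\<And>a. a \<in> carrier R \<Longrightarrow> P (mconst R a)"
    and add: "\<And>f g. f \<in> carrier (mpolys R V) \<Longrightarrow> g \<in> carrier (mpolys R V) \<Longrightarrow> P f \<Longrightarrow> P g \<Longrightarrow>
      P (f \<oplus>\<^bsub>mpolys R V\<^esub> g)"
    and var: "\<And>f v. f \<in> carrier (mpolys R V) \<Longrightarrow> v \<in> V \<Longrightarrow> P f \<Longrightarrow> P (mvar R v \<otimes>\<^bsub>mpolys R V\<^esub> f)"
  shows "P f"
proof -
  have mono: "P (mmono R a w)" if "a \<in> carrier R" "set_mset w \<subseteq> V" for a w
    using that
  proof (induction w)
    case empty
    then show ?case using const by (simp add: mconst_eq_mmono)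
  next
    case (add v w)
    then show ?case using var[of "mmono R a w" v] by (simp add: mmono_add_mset[of a w V] mmono_closed)
  qed
  \<comment> \<open>Induction over a finite set containing the support: \<open>?g\<close> loses one
    coefficient, which is added back as a monomial.\<close>
  have "P f" if "finite U" "{u. f u \<noteq> \<zero>} \<subseteq> U" "f \<in> carrier (mpolys R V)" for U f
    using that
  proof (induction U arbitrary: f rule: finite_induct)
    case empty
    then have "f = mconst R \<zero>" by (auto simp: mconst_def)
    then show ?case using const[of \<zero>] by simp
  next
    case (insert w U)
    note f = insert.prems(2)
    show ?case
    proof (cases "f w = \<zero>")
      case True
      then have "{u. f u \<noteq> \<zero>} \<subseteq> U" using insert.prems(1) by auto
      then show ?thesis using insert.IH f by blast
    next
      case False
      let ?g = "f(w := \<zero>)"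
      have w: "set_mset w \<subseteq> V" using mpolys_supp[OF f False] .
      have "{u. ?g u \<noteq> \<zero>} \<subseteq> {u. f u \<noteq> \<zero>}" by auto
      then have "finite {u. ?g u \<noteq> \<zero>}" using mpolys_finite_supp[OF f] finite_subset by blast
      then have g: "?g \<in> carrier (mpolys R V)" using f by (auto simp: mpolys_sel)
      have "{u. ?g u \<noteq> \<zero>} \<subseteq> U" using insert.prems(1) by auto
      then have "P ?g" using insert.IH g by blast
      moreover have "f = ?g \<oplus>\<^bsub>mpolys R V\<^esub> mmono R (f w) w"
        using f by (auto simp: mpolys_sel mmono_def fun_eq_iff)
      moreover have "mmono R (f w) w \<in> carrier (mpolys R V)"
        using w f by (simp add: mmono_closed mpolys_coeff_closed)
      ultimately show ?thesis
        using add[OF g] mono[OF mpolys_coeff_closed[OF f] w] by metis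
    qed
  qed
  then show ?thesis using assms(1) mpolys_finite_supp by blast
qed

end

section \<open>Evaluation homomorphisms of polynomial rings\<close>

locale meval_setup = S: base_cring S + T: base_cring T
  for S :: "'a ring" and T :: "'b ring" +
  fixes phi :: "'a \<Rightarrow> 'b" and val :: "'v \<Rightarrow> 'b" and V :: "'v set"
  assumes phi: "phi \<in> ring_hom S T" and val: "v \<in> V \<Longrightarrow> val v \<in> carrier T"
begin

sublocale phi: ring_hom_cring S T phi
  by unfold_locales (rule phi)

definition mono_val :: "'v multiset \<Rightarrow> 'b" where
  "mono_val u = (\<Otimes>\<^bsub>T\<^esub>v\<in>set_mset u. val v [^]\<^bsub>T\<^esub> count u v)"

lemma mono_val_closed: "set_mset u \<subseteq> V \<Longrightarrow> mono_val u \<in> carrier T"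
  unfolding mono_val_def by (auto intro!: T.finprod_closed val)

text \<open>Further variables enter with exponent zero. This puts the values of different multisets
  over one common index set.\<close>

lemma mono_val_superset:
  assumes "finite W" "set_mset u \<subseteq> W" "W \<subseteq> V"
  shows "mono_val u = (\<Otimes>\<^bsub>T\<^esub>v\<in>W. val v [^]\<^bsub>T\<^esub> count u v)"
  unfolding mono_val_def
  by (rule T.finprod_mono_neutral_cong_left) (use assms val in \<open>auto simp: not_in_iff subset_iff\<close>)

lemma mono_val_empty: "mono_val {#} = \<one>\<^bsub>T\<^esub>"
  by (simp add: mono_val_def)

lemma mono_val_add_mset:
  assumes "set_mset u \<subseteq> V" "v \<in> V"
  shows "mono_val (add_mset v u) = val v \<otimes>\<^bsub>T\<^esub> mono_val u"
proof -
  let ?W = "insert v (set_mset u)"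
  have W: "?W \<subseteq> V" using assms by simp
  have "mono_val (add_mset v u) = (\<Otimes>\<^bsub>T\<^esub>w\<in>?W. val w [^]\<^bsub>T\<^esub> count (add_mset v u) w)"
    using assms by (intro mono_val_superset) auto
  \<comment> \<open>The multiplicity of \<open>w\<close> in \<open>add_mset v u\<close> is split as
    its multiplicity in \<open>u\<close>, plus one if \<open>w\<close> is \<open>v\<close>.\<close>
  also have "\<dots> = (\<Otimes>\<^bsub>T\<^esub>w\<in>?W. (if v = w then val w else \<one>\<^bsub>T\<^esub>) \<otimes>\<^bsub>T\<^esub> val w [^]\<^bsub>T\<^esub> count u w)"
    using W val by (intro T.finprod_cong') (auto simp: subset_iff T.m_comm)
  also have "\<dots> = (\<Otimes>\<^bsub>T\<^esub>w\<in>?W. if v = w then val w else \<one>\<^bsub>T\<^esub>) \<otimes>\<^bsub>T\<^esub> (\<Otimes>\<^bsub>T\<^esub>w\<in>?W. val w [^]\<^bsub>T\<^esub> count u w)"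
    using W val by (intro T.finprod_multf) (auto simp: subset_iff)
  also have "(\<Otimes>\<^bsub>T\<^esub>w\<in>?W. if v = w then val w else \<one>\<^bsub>T\<^esub>) = val v"
    using W val by (intro T.finprod_singleton) (auto simp: subset_iff)
  also have "(\<Otimes>\<^bsub>T\<^esub>w\<in>?W. val w [^]\<^bsub>T\<^esub> count u w) = mono_val u"
    using W by (intro mono_val_superset[symmetric]) auto
  finally show ?thesis .
qed

abbreviation ev :: "('v multiset \<Rightarrow> 'a) \<Rightarrow> 'b" where
  "ev \<equiv> meval S T phi val"

text \<open>Zero coefficients add nothing, so polynomials with different supports can be evaluated
  over a common set of monomials.\<close>

lemma ev_superset:
  assumes "finite U" "{u. f u \<noteq> \<zero>\<^bsub>S\<^esub>} \<subseteq> U" "\<And>u. u \<in> U \<Longrightarrow> set_mset u \<subseteq> V" "\<And>u. f u \<in> carrier S"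
  shows "ev f = (\<Oplus>\<^bsub>T\<^esub>u\<in>U. phi (f u) \<otimes>\<^bsub>T\<^esub> mono_val u)"
  unfolding meval_def mono_val_def[symmetric]
  by (rule T.add.finprod_mono_neutral_cong_left) (use assms in \<open>auto simp: mono_val_closed\<close>)

lemma ev_supp:
  assumes "f \<in> carrier (mpolys S V)"
  shows "ev f = (\<Oplus>\<^bsub>T\<^esub>u\<in>{u. f u \<noteq> \<zero>\<^bsub>S\<^esub>}. phi (f u) \<otimes>\<^bsub>T\<^esub> mono_val u)"
  by (rule ev_superset) (use assms in \<open>auto simp: mpolys_sel\<close>)

lemma ev_closed: "f \<in> carrier (mpolys S V) \<Longrightarrow> ev f \<in> carrier T"
  by (subst ev_supp) (auto intro!: T.finsum_closed simp: mpolys_coeff_closed mono_val_closed mpolys_supp)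

lemma ev_add:
  assumes f: "f \<in> carrier (mpolys S V)" and g: "g \<in> carrier (mpolys S V)"
  shows "ev (f \<oplus>\<^bsub>mpolys S V\<^esub> g) = ev f \<oplus>\<^bsub>T\<^esub> ev g"
proof -
  note [simp] = mpolys_coeff_closed[OF f] mpolys_coeff_closed[OF g]
  let ?U = "{u. f u \<noteq> \<zero>\<^bsub>S\<^esub>} \<union> {u. g u \<noteq> \<zero>\<^bsub>S\<^esub>}"
  have U: "finite ?U" "\<And>u. u \<in> ?U \<Longrightarrow> set_mset u \<subseteq> V"
    using mpolys_finite_supp[OF f] mpolys_finite_supp[OF g] mpolys_supp[OF f] mpolys_supp[OF g] by auto
  have "ev (f \<oplus>\<^bsub>mpolys S V\<^esub> g) = (\<Oplus>\<^bsub>T\<^esub>u\<in>?U. phi ((f \<oplus>\<^bsub>mpolys S V\<^esub> g) u) \<otimes>\<^bsub>T\<^esub> mono_val u)"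
    by (rule ev_superset) (use U in \<open>auto simp: mpolys_sel(5)\<close>)
  also have "\<dots> = (\<Oplus>\<^bsub>T\<^esub>u\<in>?U. phi (f u) \<otimes>\<^bsub>T\<^esub> mono_val u \<oplus>\<^bsub>T\<^esub> phi (g u) \<otimes>\<^bsub>T\<^esub> mono_val u)"
    by (rule T.finsum_cong') (use U(2) in \<open>auto simp: mpolys_sel(5) T.l_distr mono_val_closed\<close>)
  also have "\<dots> = (\<Oplus>\<^bsub>T\<^esub>u\<in>?U. phi (f u) \<otimes>\<^bsub>T\<^esub> mono_val u) \<oplus>\<^bsub>T\<^esub> (\<Oplus>\<^bsub>T\<^esub>u\<in>?U. phi (g u) \<otimes>\<^bsub>T\<^esub> mono_val u)"
    by (rule T.finsum_addf) (use U(2) in \<open>auto simp: mono_val_closed\<close>)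
  also have "(\<Oplus>\<^bsub>T\<^esub>u\<in>?U. phi (f u) \<otimes>\<^bsub>T\<^esub> mono_val u) = ev f"
    by (rule ev_superset[symmetric]) (use U in auto)
  also have "(\<Oplus>\<^bsub>T\<^esub>u\<in>?U. phi (g u) \<otimes>\<^bsub>T\<^esub> mono_val u) = ev g"
    by (rule ev_superset[symmetric]) (use U in auto)
  finally show ?thesis .
qed

lemma ev_mconst_mult:
  assumes a: "a \<in> carrier S" and f: "f \<in> carrier (mpolys S V)"
  shows "ev (mconst S a \<otimes>\<^bsub>mpolys S V\<^esub> f) = phi a \<otimes>\<^bsub>T\<^esub> ev f"
proof -
  note [simp] = mpolys_coeff_closed[OF f] a
  have "ev (mconst S a \<otimes>\<^bsub>mpolys S V\<^esub> f) =
      (\<Oplus>\<^bsub>T\<^esub>u\<in>{u. f u \<noteq> \<zero>\<^bsub>S\<^esub>}. phi (a \<otimes>\<^bsub>S\<^esub> f u) \<otimes>\<^bsub>T\<^esub> mono_val u)"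
    unfolding S.mconst_mult[OF a f]
    by (rule ev_superset) (use mpolys_finite_supp[OF f] mpolys_supp[OF f] in auto)
  also have "\<dots> = (\<Oplus>\<^bsub>T\<^esub>u\<in>{u. f u \<noteq> \<zero>\<^bsub>S\<^esub>}. phi a \<otimes>\<^bsub>T\<^esub> (phi (f u) \<otimes>\<^bsub>T\<^esub> mono_val u))"
    by (rule T.finsum_cong') (use mpolys_supp[OF f] in \<open>auto simp: T.m_assoc mono_val_closed\<close>)
  also have "\<dots> = phi a \<otimes>\<^bsub>T\<^esub> (\<Oplus>\<^bsub>T\<^esub>u\<in>{u. f u \<noteq> \<zero>\<^bsub>S\<^esub>}. phi (f u) \<otimes>\<^bsub>T\<^esub> mono_val u)"
    by (rule T.finsum_rdistr[symmetric])
      (use mpolys_supp[OF f] mpolys_finite_supp[OF f] in \<open>auto simp: mono_val_closed\<close>)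
  finally show ?thesis by (simp add: ev_supp[OF f])
qed

lemma ev_mvar_mult:
  assumes v: "v \<in> V" and f: "f \<in> carrier (mpolys S V)"
  shows "ev (mvar S v \<otimes>\<^bsub>mpolys S V\<^esub> f) = val v \<otimes>\<^bsub>T\<^esub> ev f"
proof -
  note [simp] = mpolys_coeff_closed[OF f] val[OF v] v
  let ?g = "\<lambda>u. if v \<in># u then f (u - {#v#}) else \<zero>\<^bsub>S\<^esub>" and ?U = "{u. f u \<noteq> \<zero>\<^bsub>S\<^esub>}"
  \<comment> \<open>Multiplication by a variable translates the support by
    \<open>add_mset v\<close>.\<close>
  have "{u. ?g u \<noteq> \<zero>\<^bsub>S\<^esub>} \<subseteq> add_mset v ` ?U"
  proof
    fix u assume "u \<in> {u. ?g u \<noteq> \<zero>\<^bsub>S\<^esub>}"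
    then have "u = add_mset v (u - {#v#})" "f (u - {#v#}) \<noteq> \<zero>\<^bsub>S\<^esub>" by (auto split: if_splits)
    then show "u \<in> add_mset v ` ?U" by blast
  qed
  then have "ev ?g = (\<Oplus>\<^bsub>T\<^esub>u\<in>add_mset v ` ?U. phi (?g u) \<otimes>\<^bsub>T\<^esub> mono_val u)"
    using mpolys_finite_supp[OF f]
    by (intro ev_superset) (auto intro: mpolys_supp[OF f, THEN subsetD])
  also have "\<dots> = (\<Oplus>\<^bsub>T\<^esub>u\<in>?U. phi (f u) \<otimes>\<^bsub>T\<^esub> mono_val (add_mset v u))"
    by (subst T.finsum_reindex) (use mpolys_supp[OF f] in \<open>auto simp: inj_on_def mono_val_closed\<close>)
  also have "\<dots> = (\<Oplus>\<^bsub>T\<^esub>u\<in>?U. val v \<otimes>\<^bsub>T\<^esub> (phi (f u) \<otimes>\<^bsub>T\<^esub> mono_val u))"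
    by (rule T.finsum_cong')
      (use mpolys_supp[OF f] in \<open>auto simp: mono_val_closed mono_val_add_mset T.m_lcomm\<close>)
  also have "\<dots> = val v \<otimes>\<^bsub>T\<^esub> (\<Oplus>\<^bsub>T\<^esub>u\<in>?U. phi (f u) \<otimes>\<^bsub>T\<^esub> mono_val u)"
    by (rule T.finsum_rdistr[symmetric])
      (use mpolys_supp[OF f] mpolys_finite_supp[OF f] in \<open>auto simp: mono_val_closed\<close>)
  finally show ?thesis by (simp add: S.mvar_mult[OF f] ev_supp[OF f])
qed

lemma ev_one: "ev \<one>\<^bsub>mpolys S V\<^esub> = \<one>\<^bsub>T\<^esub>"
proof -
  have "ev \<one>\<^bsub>mpolys S V\<^esub> = (\<Oplus>\<^bsub>T\<^esub>u\<in>{{#}}. phi (mconst S \<one>\<^bsub>S\<^esub> u) \<otimes>\<^bsub>T\<^esub> mono_val u)"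
    unfolding mpolys_sel by (rule ev_superset) (auto simp: mconst_def split: if_splits)
  then show ?thesis by (simp add: mono_val_empty mconst_def)
qed

lemma ev_mconst: "a \<in> carrier S \<Longrightarrow> ev (mconst S a) = phi a"
proof -
  assume a: "a \<in> carrier S"
  interpret P: cring "mpolys S V" by (rule S.cring_mpolys)
  show ?thesis
    using ev_mconst_mult[OF a P.one_closed] a by (simp add: ev_one S.mconst_closed)
qed

lemma ev_mvar: "v \<in> V \<Longrightarrow> ev (mvar S v) = val v"
proof -
  assume v: "v \<in> V"
  interpret P: cring "mpolys S V" by (rule S.cring_mpolys)
  show ?thesis
    using ev_mvar_mult[OF v P.one_closed] v by (simp add: ev_one S.mvar_closed val)
qed

text \<open>Induction over the left factor alone: \<open>ev_mconst_mult\<close> and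
  \<open>ev_mvar_mult\<close> are the generating cases, additivity and associativity do the
  rest.\<close>

lemma ev_mult:
  assumes f: "f \<in> carrier (mpolys S V)" and g: "g \<in> carrier (mpolys S V)"
  shows "ev (f \<otimes>\<^bsub>mpolys S V\<^esub> g) = ev f \<otimes>\<^bsub>T\<^esub> ev g"
proof -
  interpret P: cring "mpolys S V" by (rule S.cring_mpolys)
  show ?thesis
    using f
  proof (induction f rule: S.mpolys_induct)
    case (const a)
    then show ?case using g by (simp add: ev_mconst_mult ev_mconst)
  next
    case (add f h)
    then show ?case using g by (simp add: P.l_distr T.l_distr ev_add ev_closed)
  next
    case (var f v)
    then show ?case using g
      by (simp add: P.m_assoc S.mvar_closed ev_mvar_mult ev_closed val T.m_assoc)
  qed
qed

lemma ev_hom: "ev \<in> ring_hom (mpolys S V) T"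
  by (rule ring_hom_memI) (auto simp: ev_closed ev_mult ev_add ev_one)

end

text \<open>The uniqueness half of the universal property. With the existence half
  \<open>meval_hom\<close> it replaces computations with coefficients by checks on constants and
  variables.\<close>

lemma (in base_cring) mpolys_hom_eqI:
  assumes F: "F \<in> ring_hom (mpolys R V) T" and G: "G \<in> ring_hom (mpolys R V) T"
    and const: "\<And>a. a \<in> carrier R \<Longrightarrow> F (mconst R a) = G (mconst R a)"
    and var: "\<And>v. v \<in> V \<Longrightarrow> F (mvar R v) = G (mvar R v)"
    and f: "f \<in> carrier (mpolys R V)"
  shows "F f = G f"
  using f
proof (induction f rule: mpolys_induct)
  case (const a)
  then show ?case by (rule assms)
next
  case (add f g)
  then show ?case using F G by (simp add: ring_hom_add)
next
  case (var f v)
  then show ?case using F G assms(4) by (simp add: ring_hom_mult mvar_closed)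
qed

lemma meval_hom:
  assumes "cring S" "cring T" "phi \<in> ring_hom S T" "\<And>v. v \<in> V \<Longrightarrow> val v \<in> carrier T"
  shows "meval S T phi val \<in> ring_hom (mpolys S V) T"
    and "\<And>a. a \<in> carrier S \<Longrightarrow> meval S T phi val (mconst S a) = phi a"
    and "\<And>v. v \<in> V \<Longrightarrow> meval S T phi val (mvar S v) = val v"
proof -
  interpret S: cring S by fact
  interpret T: cring T by fact
  interpret meval_setup S T phi val V
    using assms by unfold_locales auto
  show "meval S T phi val \<in> ring_hom (mpolys S V) T"
    "\<And>a. a \<in> carrier S \<Longrightarrow> meval S T phi val (mconst S a) = phi a"
    "\<And>v. v \<in> V \<Longrightarrow> meval S T phi val (mvar S v) = val v"
    by (fact ev_hom ev_mconst ev_mvar)+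
qed

lemma mconst_hom:
  assumes "cring S"
  shows "mconst S \<in> ring_hom S (mpolys S V)"
proof -
  interpret base_cring S using assms by (simp add: base_cring_def)
  show ?thesis
  proof (rule ring_hom_memI)
    fix a b assume "a \<in> carrier S" "b \<in> carrier S"
    then show "mconst S (a \<otimes>\<^bsub>S\<^esub> b) = mconst S a \<otimes>\<^bsub>mpolys S V\<^esub> mconst S b"
      "mconst S (a \<oplus>\<^bsub>S\<^esub> b) = mconst S a \<oplus>\<^bsub>mpolys S V\<^esub> mconst S b"
      by (auto simp: mconst_mult[OF _ mconst_closed] mpolys_sel(5)) (auto simp: mconst_def)
  qed (auto simp: mconst_closed mpolys_sel(3))
qed

section \<open>Generalised bar constructions\<close>

lemma ring_hom_add_pow:
  fixes k :: nat
  assumes "cring S" "cring T" "h \<in> ring_hom S T" "x \<in> carrier S"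
  shows "h ([k] \<cdot>\<^bsub>S\<^esub> x) = [k] \<cdot>\<^bsub>T\<^esub> h x"
proof -
  interpret ring_hom_cring S T h using assms by (simp add: ring_hom_cring_def ring_hom_cring_axioms_def)
  show ?thesis
    by (induction k) (use assms(4) in simp_all)
qed

definition gvars :: "bool \<Rightarrow> nat \<Rightarrow> nat set" where
  "gvars z n = {(if z then 1 else 0)..n}"

lemma gvars_iff: "j \<in> gvars z n \<longleftrightarrow> j \<le> n \<and> (z \<longrightarrow> j \<noteq> 0)"
  by (auto simp: gvars_def)

definition pconst :: "nat \<Rightarrow> 'a ring \<Rightarrow> 'a" where
  "pconst p S = [p] \<cdot>\<^bsub>S\<^esub> \<one>\<^bsub>S\<^esub>"

lemma pconst_closed: "cring S \<Longrightarrow> pconst p S \<in> carrier S"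
proof -
  assume "cring S"
  then interpret cring S .
  show ?thesis by (simp add: pconst_def)
qed

lemma ring_hom_pconst:
  assumes "cring S" "cring T" "h \<in> ring_hom S T"
  shows "h (pconst p S) = pconst p T"
proof -
  interpret S: cring S by fact
  show ?thesis
    using ring_hom_add_pow[OF assms, of "\<one>\<^bsub>S\<^esub>" p] ring_hom_one[OF assms(3)] by (simp add: pconst_def)
qed

text \<open>
  The indices \<open>0\<close> (if \<open>z\<close> holds) and \<open>Suc n\<close> are not variables: they stand for the values \<open>0\<close> and \<open>p\<close>,
  so that faces and degeneracies become reindexings.
\<close>

definition gval :: "bool \<Rightarrow> nat \<Rightarrow> 'a ring \<Rightarrow> nat \<Rightarrow> nat \<Rightarrow> nat multiset \<Rightarrow> 'a" where
  "gval z p S n j = (if z \<and> j = 0 then mconst S \<zero>\<^bsub>S\<^esub> else if j = Suc n then mconst S (pconst p S) else mvar S j)"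

text \<open>Faces, degeneracies, prism operators, evaluation at \<open>p\<close> and the map killing
  \<open>t 0\<close> are all given by maps of this shape, so that identities between them become
  identities between functions \<open>th\<close> on indices.\<close>

definition gmap :: "bool \<Rightarrow> nat \<Rightarrow> 'a ring \<Rightarrow> 'b ring \<Rightarrow> nat \<Rightarrow> ('a \<Rightarrow> 'b) \<Rightarrow> (nat \<Rightarrow> nat) \<Rightarrow>
    (nat multiset \<Rightarrow> 'a) \<Rightarrow> nat multiset \<Rightarrow> 'b" where
  "gmap z p S T n phi th =
    meval S (mpolys T (gvars z n)) (\<lambda>a. mconst T (phi a)) (\<lambda>j. gval z p T n (th j))"

lemma gval_closed:
  assumes "cring S" "j \<le> Suc n"
  shows "gval z p S n j \<in> carrier (mpolys S (gvars z n))"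
proof -
  interpret base_cring S using assms by (simp add: base_cring_def)
  show ?thesis
    using assms by (auto simp: gval_def gvars_iff intro!: mconst_closed mvar_closed pconst_closed)
qed

lemma gval_var: "j \<in> gvars z n \<Longrightarrow> gval z p S n j = mvar S j"
  by (auto simp: gval_def gvars_iff)

lemma gmap_hom:
  assumes "cring S" "cring T" "phi \<in> ring_hom S T" "\<And>v. v \<in> V \<Longrightarrow> th v \<le> Suc n"
  shows "gmap z p S T n phi th \<in> ring_hom (mpolys S V) (mpolys T (gvars z n))"
    and "\<And>a. a \<in> carrier S \<Longrightarrow> gmap z p S T n phi th (mconst S a) = mconst T (phi a)"
    and "\<And>v. v \<in> V \<Longrightarrow> gmap z p S T n phi th (mvar S v) = gval z p T n (th v)"
proof -
  interpret T: base_cring T using assms by (simp add: base_cring_def)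
  have c: "(\<lambda>a. mconst T (phi a)) \<in> ring_hom S (mpolys T (gvars z n))"
    using ring_hom_trans[OF assms(3) mconst_hom[OF assms(2)]] by (simp add: comp_def)
  note * = meval_hom[OF assms(1) T.cring_mpolys c, of V "\<lambda>j. gval z p T n (th j)"]
  show "gmap z p S T n phi th \<in> ring_hom (mpolys S V) (mpolys T (gvars z n))"
    "\<And>a. a \<in> carrier S \<Longrightarrow> gmap z p S T n phi th (mconst S a) = mconst T (phi a)"
    "\<And>v. v \<in> V \<Longrightarrow> gmap z p S T n phi th (mvar S v) = gval z p T n (th v)"
    unfolding gmap_def using * assms(2,4) by (auto simp: gval_closed)
qed

text \<open>The index maps that respect the special values: \<open>p\<close> must stay
  \<open>p\<close>, and if the index \<open>0\<close> stands for zero in the source, it must do so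
  in the target. A free variable \<open>0\<close> may, however, become zero, as in
  \<open>kill_t0\<close>.\<close>

definition gindex :: "bool \<Rightarrow> nat \<Rightarrow> bool \<Rightarrow> nat \<Rightarrow> (nat \<Rightarrow> nat) \<Rightarrow> bool" where
  "gindex z n z' n' th \<longleftrightarrow>
    (\<forall>j \<le> Suc n. th j \<le> Suc n') \<and> th (Suc n) = Suc n' \<and> (z \<longrightarrow> z' \<and> th 0 = 0)"

lemma gmap_gval:
  assumes "cring S" "cring T" "phi \<in> ring_hom S T" "gindex z n z' n' th" "j \<le> Suc n"
  shows "gmap z' p S T n' phi th (gval z p S n j) = gval z' p T n' (th j)"
proof -
  interpret S: cring S by fact
  interpret T: cring T by fact
  have th: "th v \<le> Suc n'" if "v \<in> gvars z n" for v
    using that assms(4) by (auto simp: gindex_def gvars_iff)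
  note g = gmap_hom[OF assms(1-3), where V = "gvars z n" and th = th and n = n' and z = z' and p = p, OF th]
  have "phi \<zero>\<^bsub>S\<^esub> = \<zero>\<^bsub>T\<^esub>"
    using ring_hom_zero[OF assms(3)] S.ring_axioms T.ring_axioms by blast
  then show ?thesis
    using g(2,3) assms(4,5) ring_hom_pconst[OF assms(1-3)]
    by (auto simp: gval_def gindex_def gvars_iff pconst_closed[OF assms(1)])
qed

text \<open>Functoriality, checked on generators. The inner index map is only bounded, as it is
  applied to genuine variables; the outer one has to respect the special values which the inner one
  can produce.\<close>

lemma gmap_comp:
  assumes "cring S" "cring T" "cring U" "phi \<in> ring_hom S T" "psi \<in> ring_hom T U"
    and "\<And>v. v \<in> V \<Longrightarrow> th v \<le> Suc n" "gindex z n z' n' th'" "f \<in> carrier (mpolys S V)"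
  shows "gmap z' p T U n' psi th' (gmap z p S T n phi th f) =
    gmap z' p S U n' (\<lambda>a. psi (phi a)) (\<lambda>v. th' (th v)) f"
proof -
  interpret S: base_cring S using assms by (simp add: base_cring_def)
  have hc: "(\<lambda>a. psi (phi a)) \<in> ring_hom S U"
    using ring_hom_trans[OF assms(4,5)] by (simp add: comp_def)
  have th': "th' v \<le> Suc n'" if "v \<in> gvars z n" for v
    using that assms(7) by (auto simp: gindex_def gvars_iff)
  have tht: "th' (th v) \<le> Suc n'" if "v \<in> V" for v
    using assms(6)[OF that] assms(7) by (auto simp: gindex_def)
  note g1 = gmap_hom[OF assms(1,2,4,6), where z = z and p = p]
  note g2 = gmap_hom[OF assms(2,3,5) th', where z = z' and p = p]
  note g3 = gmap_hom[OF assms(1,3) hc tht, where z = z' and p = p]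
  have "(gmap z' p T U n' psi th' \<circ> gmap z p S T n phi th) f =
      gmap z' p S U n' (\<lambda>a. psi (phi a)) (\<lambda>v. th' (th v)) f"
  proof (rule S.mpolys_hom_eqI[OF ring_hom_trans[OF g1(1) g2(1)] g3(1)])
    fix a assume "a \<in> carrier S"
    then show "(gmap z' p T U n' psi th' \<circ> gmap z p S T n phi th) (mconst S a) =
        gmap z' p S U n' (\<lambda>a. psi (phi a)) (\<lambda>v. th' (th v)) (mconst S a)"
      using g1(2) g2(2) g3(2) ring_hom_closed[OF assms(4)] by simp
  next
    fix v assume "v \<in> V"
    then show "(gmap z' p T U n' psi th' \<circ> gmap z p S T n phi th) (mvar S v) =
        gmap z' p S U n' (\<lambda>a. psi (phi a)) (\<lambda>v. th' (th v)) (mvar S v)"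
      using g1(3) g3(3) gmap_gval[OF assms(2,3,5,7) assms(6)] by simp
  qed (use assms in auto)
  then show ?thesis by simp
qed

lemma gmap_cong:
  assumes "cring S" "cring T" "phi \<in> ring_hom S T" "\<And>v. v \<in> V \<Longrightarrow> th v \<le> Suc n"
    and "\<And>a. a \<in> carrier S \<Longrightarrow> phi a = phi' a" "\<And>v. v \<in> V \<Longrightarrow> th v = th' v" "f \<in> carrier (mpolys S V)"
  shows "gmap z p S T n phi th f = gmap z p S T n phi' th' f"
proof -
  interpret S: base_cring S using assms by (simp add: base_cring_def)
  have h: "phi' \<in> ring_hom S T"
  proof (rule ring_hom_memI)
    fix a b assume ab: "a \<in> carrier S" "b \<in> carrier S"
    then show "phi' (a \<otimes>\<^bsub>S\<^esub> b) = phi' a \<otimes>\<^bsub>T\<^esub> phi' b" "phi' (a \<oplus>\<^bsub>S\<^esub> b) = phi' a \<oplus>\<^bsub>T\<^esub> phi' b"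
      using assms(5)[of a] assms(5)[of b] assms(5)[of "a \<otimes>\<^bsub>S\<^esub> b"] assms(5)[of "a \<oplus>\<^bsub>S\<^esub> b"]
        ring_hom_mult[OF assms(3) ab] ring_hom_add[OF assms(3) ab] by simp_all
    show "phi' a \<in> carrier T"
      using assms(5)[OF ab(1)] ring_hom_closed[OF assms(3) ab(1)] by simp
  qed (use assms(5)[of "\<one>\<^bsub>S\<^esub>"] ring_hom_one[OF assms(3)] in simp)
  have th': "\<And>v. v \<in> V \<Longrightarrow> th' v \<le> Suc n" using assms by simp
  note g1 = gmap_hom[OF assms(1-4), where z = z and p = p]
  note g2 = gmap_hom[OF assms(1,2) h th', where z = z and p = p]
  show ?thesis
    by (rule S.mpolys_hom_eqI[OF g1(1) g2(1)]) (use g1(2,3) g2(2,3) assms in auto)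
qed

text \<open>The form in which most simplicial identities are used: one commuting square of
  coefficient rings and one of index maps.\<close>

lemma gmap_commute:
  assumes "cring S" "cring T" "cring T'" "cring U"
    and "phi \<in> ring_hom S T" "psi \<in> ring_hom T U" "phi' \<in> ring_hom S T'" "psi' \<in> ring_hom T' U"
    and "\<And>v. v \<in> V \<Longrightarrow> th v \<le> Suc n" "gindex z n z0 n0 eta"
    and "\<And>v. v \<in> V \<Longrightarrow> th' v \<le> Suc n'" "gindex z' n' z0 n0 eta'"
    and "\<And>a. a \<in> carrier S \<Longrightarrow> psi (phi a) = psi' (phi' a)" "\<And>v. v \<in> V \<Longrightarrow> eta (th v) = eta' (th' v)"
    and f: "f \<in> carrier (mpolys S V)"
  shows "gmap z0 p T U n0 psi eta (gmap z p S T n phi th f) = gmap z0 p T' U n0 psi' eta' (gmap z' p S T' n' phi' th' f)"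
proof -
  have "(\<lambda>a. psi (phi a)) \<in> ring_hom S U"
    using ring_hom_trans[OF assms(5,6)] by (simp add: comp_def)
  moreover have "\<And>v. v \<in> V \<Longrightarrow> eta (th v) \<le> Suc n0"
    using assms(9,10) by (auto simp: gindex_def)
  ultimately have "gmap z0 p S U n0 (\<lambda>a. psi (phi a)) (\<lambda>v. eta (th v)) f =
      gmap z0 p S U n0 (\<lambda>a. psi' (phi' a)) (\<lambda>v. eta' (th' v)) f"
    using assms(1,4,13,14) f by (intro gmap_cong[where V = V]) auto
  then show ?thesis
    using gmap_comp[OF assms(1,2,4,5,6,9,10) f] gmap_comp[OF assms(1,3,4,7,8,11,12) f] by simp
qed

text \<open>All variables are fixed, so only coefficients change. This matches \<open>gmap\<close>
  with the coefficientwise \<open>bar_map\<close>, and with the identity.\<close>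

lemma gmap_pointwise:
  assumes "cring S" "cring T" "phi \<in> ring_hom S T" "f \<in> carrier (mpolys S (gvars z n))"
  shows "gmap z p S T n phi (\<lambda>j. j) f = (\<lambda>u. phi (f u))"
proof -
  interpret S: base_cring S using assms by (simp add: base_cring_def)
  interpret T: base_cring T using assms by (simp add: base_cring_def)
  interpret phi: ring_hom_cring S T phi using assms by unfold_locales
  have "v \<le> Suc n" if "v \<in> gvars z n" for v using that by (simp add: gvars_iff)
  note g = gmap_hom[OF assms(1-3), where V = "gvars z n" and th = "\<lambda>j. j" and z = z and p = p, OF this]
  interpret g: ring_hom_cring "mpolys S (gvars z n)" "mpolys T (gvars z n)" "gmap z p S T n phi (\<lambda>j. j)"
    by (intro ring_hom_cring.intro ring_hom_cring_axioms.intro S.cring_mpolys T.cring_mpolys g(1))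
  show ?thesis
    using assms(4)
  proof (induction f rule: S.mpolys_induct)
    case (const a)
    then show ?case using g(2) by (auto simp: mconst_def)
  next
    case (add f h)
    then have "gmap z p S T n phi (\<lambda>j. j) (f \<oplus>\<^bsub>mpolys S (gvars z n)\<^esub> h) =
        (\<lambda>u. phi (f u)) \<oplus>\<^bsub>mpolys T (gvars z n)\<^esub> (\<lambda>u. phi (h u))" by simp
    then show ?case using add(1,2) by (simp add: mpolys_sel(5) mpolys_coeff_closed)
  next
    case (var f v)
    have "gmap z p S T n phi (\<lambda>j. j) f \<in> carrier (mpolys T (gvars z n))"
      using var(1) by (rule g.hom_closed)
    then have "mvar T v \<otimes>\<^bsub>mpolys T (gvars z n)\<^esub> gmap z p S T n phi (\<lambda>j. j) f =
        (\<lambda>u. if v \<in># u then phi (f (u - {#v#})) else \<zero>\<^bsub>T\<^esub>)"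
      using var(3) by (simp add: T.mvar_mult)
    moreover have "gmap z p S T n phi (\<lambda>j. j) (mvar S v \<otimes>\<^bsub>mpolys S (gvars z n)\<^esub> f) =
        mvar T v \<otimes>\<^bsub>mpolys T (gvars z n)\<^esub> gmap z p S T n phi (\<lambda>j. j) f"
      using var(1,2) g(3) by (simp add: gval_var S.mvar_closed)
    ultimately show ?case
      using S.mvar_mult[OF var(1), of v] by auto
  qed
qed

section \<open>The bar construction as a simplicial ring\<close>

definition dgn_index :: "nat \<Rightarrow> nat \<Rightarrow> nat" where
  "dgn_index k j = (if j \<le> k then j else Suc j)"

text \<open>
  For \<open>z = False\<close> there is an additional variable with index \<open>0\<close>. The result is the bar construction
  computing the tensor product of \<open>A[t]\<close> and \<open>A\<close> over \<open>A[t]\<close>, where \<open>t \<mapsto> p\<close> on the right.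
\<close>

definition gbar :: "bool \<Rightarrow> nat \<Rightarrow> 'a sring \<Rightarrow> (nat multiset \<Rightarrow> 'a) sring" where
  "gbar z p A =
    \<lparr>lev = (\<lambda>n. mpolys (lev A n) (gvars z n)),
     face = (\<lambda>n k. gmap z p (lev A (Suc n)) (lev A n) n (face A n k) (face_index k)),
     dgn = (\<lambda>n k. meval (lev A n) (mpolys (lev A (Suc n)) (gvars z (Suc n)))
        (\<lambda>a. mconst (lev A (Suc n)) (dgn A n k a)) (\<lambda>j. mvar (lev A (Suc n)) (dgn_index k j)))\<rparr>"

lemma gbar_sel:
  "lev (gbar z p A) n = mpolys (lev A n) (gvars z n)"
  "face (gbar z p A) n k = gmap z p (lev A (Suc n)) (lev A n) n (face A n k) (face_index k)"
  by (simp_all add: gbar_def)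

text \<open>An equality of records, not only on carriers, because the two value functions agree at
  every index: the multiple \<open>p\<close> of the unit polynomial is the constant polynomial
  \<open>p\<close>.\<close>

lemma bar_eq_gbar:
  assumes "simplicial_cring A"
  shows "bar p A = gbar True p A"
proof -
  interpret A: simplicial_cring A by fact
  have "bar_value p (lev A n) n = gval True p (lev A n) n" for n
  proof
    fix j
    interpret base_cring "lev A n" using A.lev_cring by (simp add: base_cring_def)
    have "[p] \<cdot>\<^bsub>mpolys (lev A n) {1..n}\<^esub> \<one>\<^bsub>mpolys (lev A n) {1..n}\<^esub> = mconst (lev A n) (pconst p (lev A n))"
      using ring_hom_add_pow[OF A.lev_cring cring_mpolys
          mconst_hom[OF A.lev_cring, where V = "{1..n}"] one_closed, of p]
      by (simp add: mpolys_sel(3) pconst_def del: One_nat_def)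
    then show "bar_value p (lev A n) n j = gval True p (lev A n) n j"
      by (simp add: bar_value_def gval_def mpolys_sel(4) mconst_def)
  qed
  then show ?thesis
    by (simp add: bar_def gbar_def gmap_def gvars_def dgn_index_def)
qed

context simplicial_cring
begin

lemma base_lev: "base_cring (lev X n)"
  by (simp add: base_cring_def lev_cring)

text \<open>\<open>dgn_index\<close> takes variables to variables, never to a special index, so
  \<open>mvar\<close> and \<open>gval\<close> agree on its values; degeneracies thereby join the
  calculus of \<open>gmap\<close>.\<close>

lemma gbar_dgn:
  assumes "k \<le> n" "f \<in> carrier (mpolys (lev X n) (gvars z n))"
  shows "dgn (gbar z p X) n k f = gmap z p (lev X n) (lev X (Suc n)) (Suc n) (dgn X n k) (dgn_index k) f"
proof -
  interpret L: base_cring "lev X n" by (rule base_lev)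
  interpret L': base_cring "lev X (Suc n)" by (rule base_lev)
  have V: "dgn_index k v \<in> gvars z (Suc n)" if "v \<in> gvars z n" for v
    using that by (auto simp: gvars_iff dgn_index_def)
  have hc: "(\<lambda>a. mconst (lev X (Suc n)) (dgn X n k a)) \<in> ring_hom (lev X n) (mpolys (lev X (Suc n)) (gvars z (Suc n)))"
    using ring_hom_trans[OF dgn_hom[OF assms(1)] mconst_hom[OF lev_cring]] by (simp add: comp_def)
  have V': "dgn_index k v \<le> Suc (Suc n)" if "v \<in> gvars z n" for v
    using V[OF that] by (auto simp: gvars_iff)
  have V'': "mvar (lev X (Suc n)) (dgn_index k v) \<in> carrier (mpolys (lev X (Suc n)) (gvars z (Suc n)))"
    if "v \<in> gvars z n" for v using V[OF that] by (rule L'.mvar_closed)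
  note g1 = meval_hom[OF lev_cring L'.cring_mpolys hc,
      where val = "\<lambda>j. mvar (lev X (Suc n)) (dgn_index k j)", OF V'']
  note g2 = gmap_hom[OF lev_cring lev_cring dgn_hom[OF assms(1)] V', where z = z and p = p]
  show ?thesis
    unfolding gbar_def by simp (rule L.mpolys_hom_eqI[OF g1(1) g2(1) _ _ assms(2)],
      use g1(2,3) g2(2,3) V in \<open>auto simp: gval_var\<close>)
qed

lemma face_index_gindex: "k \<le> Suc n \<Longrightarrow> gindex z (Suc n) z n (face_index k)"
  by (auto simp: gindex_def face_index_def)

lemma dgn_index_gindex: "k \<le> n \<Longrightarrow> gindex z n z (Suc n) (dgn_index k)"
  by (auto simp: gindex_def dgn_index_def)

lemma gbar_face_hom:
  assumes "i \<le> Suc n"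
  shows "face (gbar z p X) n i \<in> ring_hom (lev (gbar z p X) (Suc n)) (lev (gbar z p X) n)"
  unfolding gbar_sel
  by (rule gmap_hom(1)[OF lev_cring lev_cring face_hom[OF assms]])
    (use assms in \<open>auto simp: face_index_def gvars_iff\<close>)

lemma gbar_dgn_hom:
  assumes "i \<le> n"
  shows "dgn (gbar z p X) n i \<in> ring_hom (lev (gbar z p X) n) (lev (gbar z p X) (Suc n))"
proof -
  interpret L: cring "mpolys (lev X n) (gvars z n)" by (rule base_cring.cring_mpolys[OF base_lev])
  have "gmap z p (lev X n) (lev X (Suc n)) (Suc n) (dgn X n i) (dgn_index i) \<in>
      ring_hom (mpolys (lev X n) (gvars z n)) (mpolys (lev X (Suc n)) (gvars z (Suc n)))"
    by (rule gmap_hom(1)[OF lev_cring lev_cring dgn_hom[OF assms]])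
      (auto simp: dgn_index_def gvars_iff)
  then show ?thesis
    unfolding gbar_sel using assms
    by (intro ring_hom_memI) (simp_all add: gbar_dgn ring_hom_closed ring_hom_mult ring_hom_add ring_hom_one)
qed

text \<open>Identify the index \<open>j\<close> with the n-simplex of the interval that has
  \<open>j\<close> vertices at the first end: then \<open>face_index\<close> and
  \<open>dgn_index\<close> are the faces and degeneracies of the interval. Each identity combines
  the one in \<open>X\<close> with the one in the interval.\<close>

lemma simplicial_gbar: "simplicial_cring (gbar z p X)"
proof (rule simplicial_cring.intro)
  fix n :: nat
  show "cring (lev (gbar z p X) n)"
    by (simp add: gbar_sel base_cring.cring_mpolys[OF base_lev])
next
  fix n i :: nat assume "i \<le> Suc n"
  then show "face (gbar z p X) n i \<in> ring_hom (lev (gbar z p X) (Suc n)) (lev (gbar z p X) n)"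
    by (rule gbar_face_hom)
next
  fix n i :: nat assume "i \<le> n"
  then show "dgn (gbar z p X) n i \<in> ring_hom (lev (gbar z p X) n) (lev (gbar z p X) (Suc n))"
    by (rule gbar_dgn_hom)
next
  fix n i j :: nat and x assume *: "i < j" "j \<le> Suc (Suc n)" "x \<in> carrier (lev (gbar z p X) (Suc (Suc n)))"
  then show "face (gbar z p X) n i (face (gbar z p X) (Suc n) j x) = face (gbar z p X) n (j - 1) (face (gbar z p X) (Suc n) i x)"
    unfolding gbar_sel
    by (intro gmap_commute[where V = "gvars z (Suc (Suc n))"] lev_cring face_hom face_index_gindex)
      (auto simp: face_face, auto simp: face_index_def gvars_iff)
next
  fix n i j :: nat and x assume *: "i \<le> j" "j \<le> n" "x \<in> carrier (lev (gbar z p X) n)"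
  then have c: "dgn (gbar z p X) n k x \<in> carrier (mpolys (lev X (Suc n)) (gvars z (Suc n)))" if "k \<le> n" for k
    using ring_hom_closed[OF gbar_dgn_hom[OF that]] by (simp add: gbar_sel)
  show "dgn (gbar z p X) (Suc n) i (dgn (gbar z p X) n j x) = dgn (gbar z p X) (Suc n) (Suc j) (dgn (gbar z p X) n i x)"
    using * c[of j] c[of i] unfolding gbar_sel
    apply (simp add: gbar_dgn)
    by (intro gmap_commute[where V = "gvars z n"] lev_cring dgn_hom dgn_index_gindex)
      (auto simp: dgn_dgn, auto simp: dgn_index_def gvars_iff)
next
  fix n i j :: nat and x assume *: "i < j" "j \<le> Suc n" "x \<in> carrier (lev (gbar z p X) (Suc n))"
  then have c: "face (gbar z p X) n k x \<in> carrier (mpolys (lev X n) (gvars z n))" if "k \<le> Suc n" for k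
    using ring_hom_closed[OF gbar_face_hom[OF that]] by (simp add: gbar_sel)
  show "face (gbar z p X) (Suc n) i (dgn (gbar z p X) (Suc n) j x) = dgn (gbar z p X) n (j - 1) (face (gbar z p X) n i x)"
    using * c[of i] unfolding gbar_sel(1)
    apply (simp add: gbar_dgn)
    unfolding gbar_sel
    by (intro gmap_commute[where V = "gvars z (Suc n)"] lev_cring dgn_hom face_hom dgn_index_gindex face_index_gindex)
      (auto simp: face_dgn_less, auto simp: dgn_index_def face_index_def gvars_iff)
next
  fix n i j :: nat and x assume *: "Suc j < i" "i \<le> Suc (Suc n)" "x \<in> carrier (lev (gbar z p X) (Suc n))"
  then have c: "face (gbar z p X) n k x \<in> carrier (mpolys (lev X n) (gvars z n))" if "k \<le> Suc n" for k
    using ring_hom_closed[OF gbar_face_hom[OF that]] by (simp add: gbar_sel)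
  show "face (gbar z p X) (Suc n) i (dgn (gbar z p X) (Suc n) j x) = dgn (gbar z p X) n j (face (gbar z p X) n (i - 1) x)"
    using * c[of "i - 1"] unfolding gbar_sel(1)
    apply (simp add: gbar_dgn)
    unfolding gbar_sel
    by (intro gmap_commute[where V = "gvars z (Suc n)"] lev_cring dgn_hom face_hom dgn_index_gindex face_index_gindex)
      (auto simp: face_dgn_greater, auto simp: dgn_index_def face_index_def gvars_iff)
next
  \<comment> \<open>One side is the identity here, so the composite is computed by
    \<open>gmap_comp\<close> and then recognised by \<open>gmap_pointwise\<close>.\<close>
  have id: "face (gbar z p X) n k (dgn (gbar z p X) n i x) = x"
    if "i \<le> n" "k = i \<or> k = Suc i" "x \<in> carrier (lev (gbar z p X) n)" for n i k x
  proof -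
    have k: "k \<le> Suc n" using that by auto
    have "face (gbar z p X) n k (dgn (gbar z p X) n i x) =
        gmap z p (lev X n) (lev X n) n (\<lambda>a. face X n k (dgn X n i a)) (\<lambda>v. face_index k (dgn_index i v)) x"
      using that unfolding gbar_sel(1)
      apply (simp add: gbar_dgn)
      unfolding gbar_sel
      by (intro gmap_comp[where V = "gvars z n"] lev_cring dgn_hom face_hom face_index_gindex)
        (auto simp: dgn_index_def gvars_iff)
    also have "\<dots> = gmap z p (lev X n) (lev X n) n (\<lambda>a. a) (\<lambda>v. v) x"
      using that k ring_hom_trans[OF dgn_hom[OF that(1)] face_hom[OF k]] unfolding gbar_sel(1)
      by (intro gmap_cong[where V = "gvars z n"] lev_cring)
        (auto simp: dgn_index_def face_index_def gvars_iff comp_def face_dgn_same face_dgn_Suc)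
    also have "\<dots> = x"
      using that gmap_pointwise[OF lev_cring lev_cring, where phi = "\<lambda>a. a" and f = x and p = p] id_ring_hom[of "lev X n"]
      by (simp add: gbar_sel id_def)
    finally show ?thesis .
  qed
  fix n i :: nat and x assume "i \<le> n" "x \<in> carrier (lev (gbar z p X) n)"
  then show "face (gbar z p X) n i (dgn (gbar z p X) n i x) = x"
    "face (gbar z p X) n (Suc i) (dgn (gbar z p X) n i x) = x"
    by (auto intro: id)
qed

end

section \<open>Chains of simplicial rings\<close>

definition alt :: "'a ring \<Rightarrow> nat \<Rightarrow> 'a \<Rightarrow> 'a" where
  "alt S i x = (if even i then x else \<ominus>\<^bsub>S\<^esub> x)"

lemma alt_hom:
  assumes "cring S" "cring T" "f \<in> ring_hom S T" "x \<in> carrier S"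
  shows "f (alt S i x) = alt T i (f x)"
proof -
  interpret ring_hom_cring S T f using assms by (simp add: ring_hom_cring_def ring_hom_cring_axioms_def)
  show ?thesis using assms by (simp add: alt_def)
qed

context base_cring
begin

lemma minus_self [simp]: "x \<in> carrier R \<Longrightarrow> x \<ominus> x = \<zero>"
  by (simp add: a_minus_def r_neg)

lemma minus_zero_right [simp]: "x \<in> carrier R \<Longrightarrow> x \<ominus> \<zero> = x"
  by (simp add: a_minus_def)

lemma minus_eq_zeroD:
  assumes "x \<in> carrier R" "y \<in> carrier R" "x \<ominus> y = \<zero>"
  shows "x = y"
  using assms minus_equality[of x "\<ominus> y"] by (simp add: a_minus_def)

lemma minus_add_cancel [simp]: "x \<in> carrier R \<Longrightarrow> y \<in> carrier R \<Longrightarrow> x \<ominus> y \<oplus> y = x"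
  by (simp add: a_minus_def a_assoc l_neg)

lemma add_minus_cancel_left [simp]: "x \<in> carrier R \<Longrightarrow> y \<in> carrier R \<Longrightarrow> x \<oplus> y \<ominus> x = y"
  by (simp add: a_minus_def a_comm[of x y] a_assoc r_neg)

lemma alt_closed [simp]: "x \<in> carrier R \<Longrightarrow> alt R i x \<in> carrier R"
  by (simp add: alt_def)

lemma alt_alt: "x \<in> carrier R \<Longrightarrow> alt R i (alt R j x) = alt R (i + j) x"
  by (simp add: alt_def)

lemma alt_Suc: "x \<in> carrier R \<Longrightarrow> alt R (Suc i) x = \<ominus> alt R i x"
  by (simp add: alt_def)

lemma alt_zero [simp]: "alt R i \<zero> = \<zero>"
  by (simp add: alt_def)

lemma alt_add: "x \<in> carrier R \<Longrightarrow> y \<in> carrier R \<Longrightarrow> alt R i (x \<oplus> y) = alt R i x \<oplus> alt R i y"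
  by (simp add: alt_def minus_add)

lemma alt_mult: "x \<in> carrier R \<Longrightarrow> y \<in> carrier R \<Longrightarrow> alt R i (x \<otimes> y) = x \<otimes> alt R i y"
  by (simp add: alt_def r_minus)

lemma alt_finsum:
  assumes "finite A" "\<And>j. j \<in> A \<Longrightarrow> f j \<in> carrier R"
  shows "alt R i (\<Oplus>j\<in>A. f j) = (\<Oplus>j\<in>A. alt R i (f j))"
  using assms
proof (induction A rule: finite_induct)
  case (insert a A)
  then show ?case
    by (subst (1 2) finsum_insert) (auto simp: alt_add finsum_closed)
qed simp

text \<open>The pairing \<open>g\<close> matches each summand with its negative; this is how terms
  cancel in \<open>bd_bd\<close> and next to the diagonal in \<open>prism_boundary\<close>.\<close>

lemma finsum_sign_reversing:
  assumes "finite A" "bij_betw g A B" "A \<inter> B = {}" "\<And>a. a \<in> A \<Longrightarrow> f a \<in> carrier R"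
    and "\<And>a. a \<in> A \<Longrightarrow> f (g a) = \<ominus> f a"
  shows "(\<Oplus>x\<in>A \<union> B. f x) = \<zero>"
proof -
  have B: "B = g ` A" "inj_on g A" using assms(2) by (auto simp: bij_betw_def)
  have "(\<Oplus>x\<in>A \<union> B. f x) = (\<Oplus>x\<in>A. f x) \<oplus> (\<Oplus>x\<in>B. f x)"
    by (rule finsum_Un_disjoint) (use assms B in auto)
  also have "(\<Oplus>x\<in>B. f x) = (\<Oplus>x\<in>A. f (g x))"
    unfolding B(1) by (rule finsum_reindex) (use assms B in auto)
  also have "(\<Oplus>x\<in>A. f x) \<oplus> (\<Oplus>x\<in>A. f (g x)) = (\<Oplus>x\<in>A. f x \<oplus> f (g x))"
    by (rule finsum_addf[symmetric]) (use assms in auto)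
  also have "\<dots> = \<zero>"
    by (rule add.finprod_one_eqI) (use assms in \<open>auto simp: r_neg\<close>)
  finally show ?thesis .
qed

end

lemma chains_sel [simp]: "grp (chains X) = lev X"
  by (simp add: chains_def)

lemma bnd_chains: "bnd (chains X) n x = (\<Oplus>\<^bsub>lev X n\<^esub>i\<in>{0..Suc n}. alt (lev X n) i (face X n i x))"
  by (simp add: chains_def alt_def)

context simplicial_cring
begin

lemma face_closed [simp]: "i \<le> Suc n \<Longrightarrow> x \<in> carrier (lev X (Suc n)) \<Longrightarrow> face X n i x \<in> carrier (lev X n)"
  using ring_hom_closed[OF face_hom] .

lemma dgn_closed [simp]: "i \<le> n \<Longrightarrow> x \<in> carrier (lev X n) \<Longrightarrow> dgn X n i x \<in> carrier (lev X (Suc n))"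
  using ring_hom_closed[OF dgn_hom] .

abbreviation bd :: "nat \<Rightarrow> 'a \<Rightarrow> 'a" where
  "bd \<equiv> bnd (chains X)"

lemma bd_closed [simp]: "x \<in> carrier (lev X (Suc n)) \<Longrightarrow> bd n x \<in> carrier (lev X n)"
proof -
  interpret base_cring "lev X n" by (rule base_lev)
  show "x \<in> carrier (lev X (Suc n)) \<Longrightarrow> ?thesis"
    unfolding bnd_chains by (auto intro!: finsum_closed)
qed

lemma bd_add:
  assumes "x \<in> carrier (lev X (Suc n))" "y \<in> carrier (lev X (Suc n))"
  shows "bd n (x \<oplus>\<^bsub>lev X (Suc n)\<^esub> y) = bd n x \<oplus>\<^bsub>lev X n\<^esub> bd n y"
proof -
  interpret base_cring "lev X n" by (rule base_lev)
  have "bd n (x \<oplus>\<^bsub>lev X (Suc n)\<^esub> y) =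
      (\<Oplus>\<^bsub>lev X n\<^esub>i\<in>{0..Suc n}. alt (lev X n) i (face X n i x) \<oplus>\<^bsub>lev X n\<^esub> alt (lev X n) i (face X n i y))"
    unfolding bnd_chains
    by (rule finsum_cong') (use assms ring_hom_add[OF face_hom] in \<open>auto simp: alt_add\<close>)
  also have "\<dots> = bd n x \<oplus>\<^bsub>lev X n\<^esub> bd n y"
    unfolding bnd_chains by (rule finsum_addf) (use assms in auto)
  finally show ?thesis .
qed

lemma bd_zero [simp]: "bd n \<zero>\<^bsub>lev X (Suc n)\<^esub> = \<zero>\<^bsub>lev X n\<^esub>"
proof -
  interpret base_cring "lev X n" by (rule base_lev)
  interpret S: base_cring "lev X (Suc n)" by (rule base_lev)
  have "bd n \<zero>\<^bsub>lev X (Suc n)\<^esub> \<oplus>\<^bsub>lev X n\<^esub> bd n \<zero>\<^bsub>lev X (Suc n)\<^esub> = bd n \<zero>\<^bsub>lev X (Suc n)\<^esub>"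
    using bd_add[of "\<zero>\<^bsub>lev X (Suc n)\<^esub>" n "\<zero>\<^bsub>lev X (Suc n)\<^esub>"] by simp
  then show ?thesis by simp
qed

lemma bd_uminus:
  assumes "x \<in> carrier (lev X (Suc n))"
  shows "bd n (\<ominus>\<^bsub>lev X (Suc n)\<^esub> x) = \<ominus>\<^bsub>lev X n\<^esub> bd n x"
proof -
  interpret base_cring "lev X n" by (rule base_lev)
  interpret S: base_cring "lev X (Suc n)" by (rule base_lev)
  have "bd n (\<ominus>\<^bsub>lev X (Suc n)\<^esub> x) \<oplus>\<^bsub>lev X n\<^esub> bd n x = \<zero>\<^bsub>lev X n\<^esub>"
    using bd_add[of "\<ominus>\<^bsub>lev X (Suc n)\<^esub> x" n x] assms by (simp add: S.l_neg)
  then show ?thesis using assms by (simp add: minus_equality)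
qed

lemma bd_minus:
  assumes "x \<in> carrier (lev X (Suc n))" "y \<in> carrier (lev X (Suc n))"
  shows "bd n (x \<ominus>\<^bsub>lev X (Suc n)\<^esub> y) = bd n x \<ominus>\<^bsub>lev X n\<^esub> bd n y"
proof -
  interpret S: base_cring "lev X (Suc n)" by (rule base_lev)
  show ?thesis using assms by (simp add: a_minus_def bd_add bd_uminus)
qed

lemma bd_bd:
  assumes x: "x \<in> carrier (lev X (Suc (Suc n)))"
  shows "bd n (bd (Suc n) x) = \<zero>\<^bsub>lev X n\<^esub>"
proof -
  interpret L: base_cring "lev X n" by (rule base_lev)
  interpret S: base_cring "lev X (Suc n)" by (rule base_lev)
  let ?f = "\<lambda>i j. alt (lev X n) (i + j) (face X n i (face X (Suc n) j x))"
  let ?F = "\<lambda>z. ?f (fst z) (snd z)"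
  have 1: "alt (lev X n) i (face X n i (bd (Suc n) x)) = (\<Oplus>\<^bsub>lev X n\<^esub>j\<in>{0..Suc (Suc n)}. ?f i j)"
    if i: "i \<le> Suc n" for i
  proof -
    interpret d: ring_hom_cring "lev X (Suc n)" "lev X n" "face X n i"
      by (intro ring_hom_cring.intro ring_hom_cring_axioms.intro lev_cring face_hom i)
    have "alt (lev X n) i (face X n i (bd (Suc n) x)) = alt (lev X n) i
        (\<Oplus>\<^bsub>lev X n\<^esub>j\<in>{0..Suc (Suc n)}. alt (lev X n) j (face X n i (face X (Suc n) j x)))"
      unfolding bnd_chains using x
      by (subst d.hom_finsum) (auto intro!: arg_cong[where f = "alt (lev X n) i"] L.finsum_cong' simp: alt_hom[OF lev_cring lev_cring d.homh])
    also have "\<dots> = (\<Oplus>\<^bsub>lev X n\<^esub>j\<in>{0..Suc (Suc n)}. ?f i j)"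
      using x i by (subst L.alt_finsum) (auto intro!: L.finsum_cong' simp: L.alt_alt)
    finally show ?thesis .
  qed
  have "bd n (bd (Suc n) x) = (\<Oplus>\<^bsub>lev X n\<^esub>i\<in>{0..Suc n}. \<Oplus>\<^bsub>lev X n\<^esub>j\<in>{0..Suc (Suc n)}. ?f i j)"
    unfolding bnd_chains[of X n] using x
    by (intro L.finsum_cong') (auto simp: 1 intro!: L.finsum_closed)
  also have "\<dots> = (\<Oplus>\<^bsub>lev X n\<^esub>z\<in>{0..Suc n} \<times> {0..Suc (Suc n)}. ?F z)"
    using x by (intro L.finsum_Sigma) auto
  also have "{0..Suc n} \<times> {0..Suc (Suc n)} =
      {(i, j). i < j \<and> j \<le> Suc (Suc n)} \<union> {(i, j). j \<le> i \<and> i \<le> Suc n}" (is "_ = ?A \<union> ?B")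
    by auto
  also have "(\<Oplus>\<^bsub>lev X n\<^esub>z\<in>?A \<union> ?B. ?F z) = \<zero>\<^bsub>lev X n\<^esub>"
  proof (rule L.finsum_sign_reversing)
    have "?A \<subseteq> {..Suc (Suc n)} \<times> {..Suc (Suc n)}" by auto
    then show "finite ?A" by (rule finite_subset) simp
    \<comment> \<open>\<open>face_face\<close> equates the composites for \<open>(i, j)\<close> and
      \<open>(j - 1, i)\<close>, and the index sum drops by one, so the signs are opposite.\<close>
    show "bij_betw (\<lambda>(i, j). (j - 1, i)) ?A ?B"
      by (rule bij_betwI[where g = "\<lambda>(i, j). (j, Suc i)"]) auto
    show "?A \<inter> ?B = {}" by auto
    fix a assume "a \<in> ?A"
    then obtain i j where a: "a = (i, Suc j)" "i \<le> j" "j \<le> Suc n"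
      by (cases a, cases "snd a") auto
    show "?F a \<in> carrier (lev X n)" using a x by simp
    show "?F (case a of (i, j) \<Rightarrow> (j - 1, i)) = \<ominus>\<^bsub>lev X n\<^esub> ?F a"
      using a x face_face[of i "Suc j" n x] by (simp add: L.alt_Suc add.commute)
  qed
  finally show ?thesis .
qed

lemma cycles_iff:
  "c \<in> cycles (chains X) n \<longleftrightarrow> c \<in> carrier (lev X n) \<and> (\<forall>k. n = Suc k \<longrightarrow> bd k c = \<zero>\<^bsub>lev X k\<^esub>)"
  by (simp add: cycles_def)

lemma bd_cycle: "x \<in> carrier (lev X (Suc n)) \<Longrightarrow> bd n x \<in> cycles (chains X) n"
  by (auto simp: cycles_iff bd_bd)

lemma cycles_minus:
  assumes "x \<in> cycles (chains X) n" "y \<in> cycles (chains X) n"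
  shows "x \<ominus>\<^bsub>lev X n\<^esub> y \<in> cycles (chains X) n"
proof -
  interpret L: base_cring "lev X n" by (rule base_lev)
  have "bd k (x \<ominus>\<^bsub>lev X n\<^esub> y) = \<zero>\<^bsub>lev X k\<^esub>" if "n = Suc k" for k
  proof -
    interpret K: base_cring "lev X k" by (rule base_lev)
    show ?thesis using assms that by (auto simp: cycles_iff bd_minus)
  qed
  then show ?thesis using assms by (auto simp: cycles_iff)
qed

end

section \<open>Simplicial homotopies and the prism formula\<close>

locale simplicial_homotopy = simplicial_cring +
  fixes h :: "nat \<Rightarrow> nat \<Rightarrow> 'a \<Rightarrow> 'a"
  assumes h_hom: "i \<le> n \<Longrightarrow> h n i \<in> ring_hom (lev X n) (lev X (Suc n))"
    and face_h_less: "i < j \<Longrightarrow> j \<le> Suc n \<Longrightarrow> x \<in> carrier (lev X (Suc n)) \<Longrightarrow>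
      face X (Suc n) i (h (Suc n) j x) = h n (j - 1) (face X n i x)"
    and face_h_same: "0 < i \<Longrightarrow> i \<le> n \<Longrightarrow> x \<in> carrier (lev X n) \<Longrightarrow>
      face X n i (h n i x) = face X n i (h n (i - 1) x)"
    and face_h_greater: "Suc j < i \<Longrightarrow> i \<le> Suc (Suc n) \<Longrightarrow> x \<in> carrier (lev X (Suc n)) \<Longrightarrow>
      face X (Suc n) i (h (Suc n) j x) = h n j (face X n (i - 1) x)"
begin

lemma h_closed [simp]: "i \<le> n \<Longrightarrow> x \<in> carrier (lev X n) \<Longrightarrow> h n i x \<in> carrier (lev X (Suc n))"
  using ring_hom_closed[OF h_hom] .

definition prism :: "nat \<Rightarrow> 'a \<Rightarrow> 'a" where
  "prism n x = (\<Oplus>\<^bsub>lev X (Suc n)\<^esub>i\<in>{0..n}. alt (lev X (Suc n)) i (h n i x))"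

lemma prism_closed: "x \<in> carrier (lev X n) \<Longrightarrow> prism n x \<in> carrier (lev X (Suc n))"
proof -
  interpret base_cring "lev X (Suc n)" by (rule base_lev)
  show "x \<in> carrier (lev X n) \<Longrightarrow> ?thesis"
    unfolding prism_def by (auto intro!: finsum_closed)
qed

text \<open>In the double sum over faces \<open>i\<close> and prism operators \<open>j\<close> the
  two extreme terms survive; they are the ends of the homotopy. The terms next to the diagonal
  (\<open>A\<close> and \<open>B\<close>) cancel by \<open>face_h_same\<close>. The others
  (\<open>C\<close>) make up, with signs, the images under \<open>h\<close> of the boundary of
  \<open>x\<close>, which vanishes for a cycle.\<close>

lemma prism_boundary:
  assumes c: "x \<in> cycles (chains X) n"
  shows "bd n (prism n x) = face X n 0 (h n 0 x) \<ominus>\<^bsub>lev X n\<^esub> face X n (Suc n) (h n n x)"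
proof -
  interpret L: base_cring "lev X n" by (rule base_lev)
  interpret S: base_cring "lev X (Suc n)" by (rule base_lev)
  have x: "x \<in> carrier (lev X n)" using c by (simp add: cycles_iff)
  let ?f = "\<lambda>i j. alt (lev X n) (i + j) (face X n i (h n j x))"
  let ?F = "\<lambda>z. ?f (fst z) (snd z)"
  have 1: "alt (lev X n) i (face X n i (prism n x)) = (\<Oplus>\<^bsub>lev X n\<^esub>j\<in>{0..n}. ?f i j)"
    if i: "i \<le> Suc n" for i
  proof -
    interpret d: ring_hom_cring "lev X (Suc n)" "lev X n" "face X n i"
      by (intro ring_hom_cring.intro ring_hom_cring_axioms.intro lev_cring face_hom i)
    have "alt (lev X n) i (face X n i (prism n x)) = alt (lev X n) i
        (\<Oplus>\<^bsub>lev X n\<^esub>j\<in>{0..n}. alt (lev X n) j (face X n i (h n j x)))"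
      unfolding prism_def using x
      by (subst d.hom_finsum) (auto intro!: arg_cong[where f = "alt (lev X n) i"] L.finsum_cong' simp: alt_hom[OF lev_cring lev_cring d.homh])
    also have "\<dots> = (\<Oplus>\<^bsub>lev X n\<^esub>j\<in>{0..n}. ?f i j)"
      using x i by (subst L.alt_finsum) (auto intro!: L.finsum_cong' simp: L.alt_alt)
    finally show ?thesis .
  qed
  define A where "A = (\<lambda>j. (j, j)) ` {1..n}"
  define B where "B = (\<lambda>j. (j, j - 1)) ` {1..n}"
  define C where "C = {(i, j). i < j \<and> j \<le> n} \<union> {(i, j). Suc j < i \<and> i \<le> Suc n}"
  have fin: "finite A" "finite B" "finite C"
  proof -
    have "C \<subseteq> {..Suc n} \<times> {..n}" by (auto simp: C_def)
    then show "finite C" by (rule finite_subset) simp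
  qed (auto simp: A_def B_def)
  have cl: "?F z \<in> carrier (lev X n)" if "z \<in> {0..Suc n} \<times> {0..n}" for z
    using that x by auto
  have dec: "{0..Suc n} \<times> {0..n} = {(0, 0)} \<union> ({(Suc n, n)} \<union> ((A \<union> B) \<union> C))"
  proof (intro equalityI subsetI)
    fix z assume "z \<in> {0..Suc n} \<times> {0..n}"
    then obtain i j where z: "z = (i, j)" "i \<le> Suc n" "j \<le> n" by auto
    consider "i < j" | "i = j" "i = 0" | "i = j" "0 < i" | "i = Suc j" "j = n" | "i = Suc j" "j < n" | "Suc j < i"
      using z by linarith
    then show "z \<in> {(0, 0)} \<union> ({(Suc n, n)} \<union> ((A \<union> B) \<union> C))"
      using z by cases (auto simp: A_def B_def C_def image_iff)
  qed (auto simp: A_def B_def C_def)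
  have sumAB: "(\<Oplus>\<^bsub>lev X n\<^esub>z\<in>A \<union> B. ?F z) = \<zero>\<^bsub>lev X n\<^esub>"
  proof (rule L.finsum_sign_reversing)
    show "bij_betw (\<lambda>(i, j). (i, j - 1)) A B"
      by (rule bij_betwI[where g = "\<lambda>(i, j). (i, Suc j)"]) (auto simp: A_def B_def image_iff)
    show "A \<inter> B = {}" by (auto simp: A_def B_def)
    fix a assume "a \<in> A"
    then obtain i where a: "a = (Suc i, Suc i)" "Suc i \<le> n"
      unfolding A_def by (metis (no_types, lifting) Suc_le_D atLeastAtMost_iff imageE One_nat_def)
    show "?F a \<in> carrier (lev X n)" using a x by simp
    show "?F (case a of (i, j) \<Rightarrow> (i, j - 1)) = \<ominus>\<^bsub>lev X n\<^esub> ?F a"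
      using a x face_h_same[of "Suc i" n x] by (simp add: L.alt_Suc)
  qed (use fin in auto)
  have sumC: "(\<Oplus>\<^bsub>lev X n\<^esub>z\<in>C. ?F z) = \<zero>\<^bsub>lev X n\<^esub>"
  proof (cases n)
    case 0
    then have "C = {}" by (auto simp: C_def)
    then show ?thesis by simp
  next
    case (Suc m)
    interpret M: base_cring "lev X m" by (rule base_lev)
    \<comment> \<open>Each \<open>h m j (face X m i x)\<close> comes from exactly one term of
      \<open>C\<close>: from \<open>(i, j + 1)\<close> by \<open>face_h_less\<close> if
      \<open>i \<le> j\<close>, and from \<open>(i + 1, j)\<close> by \<open>face_h_greater\<close>
      otherwise. Both have index sum \<open>i + j + 1\<close>, so the sign is uniform.\<close>
    let ?g = "\<lambda>(j, i). if i \<le> j then (i, Suc j) else (Suc i, j)"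
    let ?T = "{0..m} \<times> {0..Suc m}"
    let ?G = "\<lambda>j i. alt (lev X n) (Suc (i + j)) (h m j (face X m i x))"
    have x': "x \<in> carrier (lev X (Suc m))" using x Suc by simp
    have C: "C = ?g ` ?T"
    proof (intro equalityI subsetI)
      fix z assume "z \<in> C"
      then obtain i j where z: "z = (i, j)" "i < j \<and> j \<le> n \<or> Suc j < i \<and> i \<le> Suc n"
        by (auto simp: C_def)
      then have "z = ?g (if i < j then (j - 1, i) else (j, i - 1))" "(if i < j then (j - 1, i) else (j, i - 1)) \<in> ?T"
        using Suc by auto
      then show "z \<in> ?g ` ?T" by (rule image_eqI)
    qed (auto simp: C_def Suc split: if_splits)
    have inj: "inj_on ?g ?T"
      by (rule inj_onI) (auto split: if_splits)
    have Gcl: "?G j i \<in> carrier (lev X n)" if "j \<le> m" "i \<le> Suc m" for i j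
      using that x' Suc by (intro L.alt_closed) (auto simp: Suc intro: h_closed)
    have FG: "?F (?g z) = ?G (fst z) (snd z)" if zT: "z \<in> ?T" for z
    proof -
      obtain j i where z: "z = (j, i)" "j \<le> m" "i \<le> Suc m" using zT by (cases z) auto
      show ?thesis
      proof (cases "i \<le> j")
        case True
        then have "face X (Suc m) i (h (Suc m) (Suc j) x) = h m j (face X m i x)"
          using face_h_less[of i "Suc j" m x] z x' by simp
        then show ?thesis using True z Suc by simp
      next
        case False
        then have "face X (Suc m) (Suc i) (h (Suc m) j x) = h m j (face X m i x)"
          using face_h_greater[of j "Suc i" m x] z x' by simp
        then show ?thesis using False z Suc by simp
      qed
    qed
    have inner: "(\<Oplus>\<^bsub>lev X n\<^esub>i\<in>{0..Suc m}. ?G j i) = \<zero>\<^bsub>lev X n\<^esub>" if j: "j \<le> m" for j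
    proof -
      interpret d: ring_hom_cring "lev X m" "lev X n" "h m j"
        unfolding Suc by (intro ring_hom_cring.intro ring_hom_cring_axioms.intro lev_cring h_hom j)
      have "(\<Oplus>\<^bsub>lev X n\<^esub>i\<in>{0..Suc m}. ?G j i) =
          alt (lev X n) (Suc j) (\<Oplus>\<^bsub>lev X n\<^esub>i\<in>{0..Suc m}. alt (lev X n) i (h m j (face X m i x)))"
        using x' by (subst L.alt_finsum) (auto intro!: L.finsum_cong' simp: L.alt_alt add.commute)
      also have "(\<Oplus>\<^bsub>lev X n\<^esub>i\<in>{0..Suc m}. alt (lev X n) i (h m j (face X m i x))) = h m j (bd m x)"
        unfolding bnd_chains using x'
        by (subst d.hom_finsum) (auto intro!: L.finsum_cong' simp: alt_hom[OF lev_cring lev_cring d.homh])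
      also have "bd m x = \<zero>\<^bsub>lev X m\<^esub>" using c Suc by (simp add: cycles_iff)
      finally show ?thesis by simp
    qed
    have "(\<Oplus>\<^bsub>lev X n\<^esub>z\<in>C. ?F z) = (\<Oplus>\<^bsub>lev X n\<^esub>z\<in>?T. ?F (?g z))"
      unfolding C by (rule L.finsum_reindex[OF _ inj]) (use FG Gcl in auto)
    also have "\<dots> = (\<Oplus>\<^bsub>lev X n\<^esub>z\<in>?T. ?G (fst z) (snd z))"
      by (rule L.finsum_cong') (use FG Gcl in auto)
    also have "\<dots> = (\<Oplus>\<^bsub>lev X n\<^esub>j\<in>{0..m}. \<Oplus>\<^bsub>lev X n\<^esub>i\<in>{0..Suc m}. ?G j i)"
      by (rule L.finsum_Sigma[symmetric]) (use Gcl in auto)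
    also have "\<dots> = \<zero>\<^bsub>lev X n\<^esub>"
      by (rule L.add.finprod_one_eqI) (use inner in auto)
    finally show ?thesis .
  qed
  have "bd n (prism n x) = (\<Oplus>\<^bsub>lev X n\<^esub>i\<in>{0..Suc n}. \<Oplus>\<^bsub>lev X n\<^esub>j\<in>{0..n}. ?f i j)"
    unfolding bnd_chains using x
    by (intro L.finsum_cong') (auto simp: 1 intro!: L.finsum_closed)
  also have "\<dots> = (\<Oplus>\<^bsub>lev X n\<^esub>z\<in>{0..Suc n} \<times> {0..n}. ?F z)"
    using x by (intro L.finsum_Sigma) auto
  also have "\<dots> = ?F (0, 0) \<oplus>\<^bsub>lev X n\<^esub> (\<Oplus>\<^bsub>lev X n\<^esub>z\<in>{(Suc n, n)} \<union> ((A \<union> B) \<union> C). ?F z)"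
    unfolding dec by (subst L.finsum_Un_disjoint)
      (use fin x cl dec in \<open>auto simp: A_def B_def C_def\<close>)
  also have "(\<Oplus>\<^bsub>lev X n\<^esub>z\<in>{(Suc n, n)} \<union> ((A \<union> B) \<union> C). ?F z) =
      ?F (Suc n, n) \<oplus>\<^bsub>lev X n\<^esub> (\<Oplus>\<^bsub>lev X n\<^esub>z\<in>(A \<union> B) \<union> C. ?F z)"
    by (subst L.finsum_Un_disjoint) (use fin x cl dec in \<open>auto simp: A_def B_def C_def\<close>)
  also have "(\<Oplus>\<^bsub>lev X n\<^esub>z\<in>(A \<union> B) \<union> C. ?F z) = (\<Oplus>\<^bsub>lev X n\<^esub>z\<in>A \<union> B. ?F z) \<oplus>\<^bsub>lev X n\<^esub> (\<Oplus>\<^bsub>lev X n\<^esub>z\<in>C. ?F z)"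
    by (subst L.finsum_Un_disjoint) (use fin x cl dec in \<open>auto simp: A_def B_def C_def\<close>)
  finally show ?thesis
    using x unfolding sumAB sumC by (simp add: alt_def a_minus_def)
qed

end

context simplicial_cring
begin

lemma lev_simps [simp]:
  "\<zero>\<^bsub>lev X n\<^esub> \<in> carrier (lev X n)" "\<one>\<^bsub>lev X n\<^esub> \<in> carrier (lev X n)"
  "x \<in> carrier (lev X n) \<Longrightarrow> \<zero>\<^bsub>lev X n\<^esub> \<oplus>\<^bsub>lev X n\<^esub> x = x"
  "x \<in> carrier (lev X n) \<Longrightarrow> x \<oplus>\<^bsub>lev X n\<^esub> \<zero>\<^bsub>lev X n\<^esub> = x"
  "x \<in> carrier (lev X n) \<Longrightarrow> \<ominus>\<^bsub>lev X n\<^esub> x \<in> carrier (lev X n)"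
  "x \<in> carrier (lev X n) \<Longrightarrow> y \<in> carrier (lev X n) \<Longrightarrow> x \<oplus>\<^bsub>lev X n\<^esub> y \<in> carrier (lev X n)"
  "x \<in> carrier (lev X n) \<Longrightarrow> y \<in> carrier (lev X n) \<Longrightarrow> x \<ominus>\<^bsub>lev X n\<^esub> y \<in> carrier (lev X n)"
  "x \<in> carrier (lev X n) \<Longrightarrow> y \<in> carrier (lev X n) \<Longrightarrow> x \<otimes>\<^bsub>lev X n\<^esub> y \<in> carrier (lev X n)"
  "x \<in> carrier (lev X n) \<Longrightarrow> x \<ominus>\<^bsub>lev X n\<^esub> \<zero>\<^bsub>lev X n\<^esub> = x"
  "x \<in> carrier (lev X n) \<Longrightarrow> x \<ominus>\<^bsub>lev X n\<^esub> x = \<zero>\<^bsub>lev X n\<^esub>"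
  "\<ominus>\<^bsub>lev X n\<^esub> \<zero>\<^bsub>lev X n\<^esub> = \<zero>\<^bsub>lev X n\<^esub>"
proof -
  interpret base_cring "lev X n" by (rule base_lev)
  show "\<zero>\<^bsub>lev X n\<^esub> \<in> carrier (lev X n)" "\<one>\<^bsub>lev X n\<^esub> \<in> carrier (lev X n)"
    "x \<in> carrier (lev X n) \<Longrightarrow> \<zero>\<^bsub>lev X n\<^esub> \<oplus>\<^bsub>lev X n\<^esub> x = x"
    "x \<in> carrier (lev X n) \<Longrightarrow> x \<oplus>\<^bsub>lev X n\<^esub> \<zero>\<^bsub>lev X n\<^esub> = x"
    "x \<in> carrier (lev X n) \<Longrightarrow> \<ominus>\<^bsub>lev X n\<^esub> x \<in> carrier (lev X n)"
    "x \<in> carrier (lev X n) \<Longrightarrow> y \<in> carrier (lev X n) \<Longrightarrow> x \<oplus>\<^bsub>lev X n\<^esub> y \<in> carrier (lev X n)"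
    "x \<in> carrier (lev X n) \<Longrightarrow> y \<in> carrier (lev X n) \<Longrightarrow> x \<ominus>\<^bsub>lev X n\<^esub> y \<in> carrier (lev X n)"
    "x \<in> carrier (lev X n) \<Longrightarrow> y \<in> carrier (lev X n) \<Longrightarrow> x \<otimes>\<^bsub>lev X n\<^esub> y \<in> carrier (lev X n)"
    "x \<in> carrier (lev X n) \<Longrightarrow> x \<ominus>\<^bsub>lev X n\<^esub> \<zero>\<^bsub>lev X n\<^esub> = x"
    "x \<in> carrier (lev X n) \<Longrightarrow> x \<ominus>\<^bsub>lev X n\<^esub> x = \<zero>\<^bsub>lev X n\<^esub>"
    "\<ominus>\<^bsub>lev X n\<^esub> \<zero>\<^bsub>lev X n\<^esub> = \<zero>\<^bsub>lev X n\<^esub>"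
    by simp_all
qed

lemma zero_boundary: "\<zero>\<^bsub>lev X n\<^esub> \<in> boundaries (chains X) n"
  unfolding boundaries_def chains_sel by (rule image_eqI[where x = "\<zero>\<^bsub>lev X (Suc n)\<^esub>"]) simp_all

end

section \<open>Simplicial maps and quasi-isomorphisms\<close>

lemma shomD:
  assumes "shom X Y f"
  shows "f n \<in> ring_hom (lev X n) (lev Y n)"
    and "i \<le> Suc n \<Longrightarrow> x \<in> carrier (lev X (Suc n)) \<Longrightarrow> f n (face X n i x) = face Y n i (f (Suc n) x)"
    and "i \<le> n \<Longrightarrow> x \<in> carrier (lev X n) \<Longrightarrow> f (Suc n) (dgn X n i x) = dgn Y n i (f n x)"
  using assms by (auto simp: shom_def)

locale simplicial_hom = X: simplicial_cring X + Y: simplicial_cring Y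
  for X :: "'a sring" and Y :: "'b sring" +
  fixes f :: "nat \<Rightarrow> 'a \<Rightarrow> 'b"
  assumes shom: "shom X Y f"
begin

lemma lev_hom: "ring_hom_cring (lev X n) (lev Y n) (f n)"
  by (intro ring_hom_cring.intro ring_hom_cring_axioms.intro X.lev_cring Y.lev_cring shomD(1)[OF shom])

lemma f_closed [simp]: "x \<in> carrier (lev X n) \<Longrightarrow> f n x \<in> carrier (lev Y n)"
  using ring_hom_closed[OF shomD(1)[OF shom]] .

lemma f_zero [simp]: "f n \<zero>\<^bsub>lev X n\<^esub> = \<zero>\<^bsub>lev Y n\<^esub>"
  using ring_hom_cring.hom_zero[OF lev_hom] .

lemma f_add: "x \<in> carrier (lev X n) \<Longrightarrow> y \<in> carrier (lev X n) \<Longrightarrow>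
    f n (x \<oplus>\<^bsub>lev X n\<^esub> y) = f n x \<oplus>\<^bsub>lev Y n\<^esub> f n y"
  using ring_hom_add[OF shomD(1)[OF shom]] .

lemma f_minus: 
  assumes "x \<in> carrier (lev X n)" "y \<in> carrier (lev X n)"
  shows "f n (x \<ominus>\<^bsub>lev X n\<^esub> y) = f n x \<ominus>\<^bsub>lev Y n\<^esub> f n y"
proof -
  interpret ring_hom_cring "lev X n" "lev Y n" "f n" by (rule lev_hom)
  show ?thesis using assms by (simp add: a_minus_def)
qed

lemma bd_hom:
  assumes "x \<in> carrier (lev X (Suc n))"
  shows "f n (X.bd n x) = Y.bd n (f (Suc n) x)"
proof -
  interpret XL: base_cring "lev X n" by (rule X.base_lev)
  interpret YL: base_cring "lev Y n" by (rule Y.base_lev)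
  interpret ring_hom_cring "lev X n" "lev Y n" "f n" by (rule lev_hom)
  have "f n (X.bd n x) = (\<Oplus>\<^bsub>lev Y n\<^esub>i\<in>{0..Suc n}. f n (alt (lev X n) i (face X n i x)))"
    unfolding bnd_chains using assms by (subst hom_finsum) (auto simp: comp_def)
  also have "\<dots> = Y.bd n (f (Suc n) x)"
    unfolding bnd_chains using assms
    by (intro YL.finsum_cong')
      (auto simp: alt_hom[OF X.lev_cring Y.lev_cring homh] shomD(2)[OF shom])
  finally show ?thesis .
qed

lemma f_cycles: "c \<in> cycles (chains X) n \<Longrightarrow> f n c \<in> cycles (chains Y) n"
  by (auto simp: X.cycles_iff Y.cycles_iff simp flip: bd_hom)

lemma f_boundaries: "c \<in> boundaries (chains X) n \<Longrightarrow> f n c \<in> boundaries (chains Y) n"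
  by (auto simp: boundaries_def bd_hom)

text \<open>The long exact sequence of the kernel in elementary terms: lift along \<open>f\<close>,
  then correct the lift by an element of the acyclic kernel.\<close>

lemma quasi_iso_surj:
  assumes surj: "\<And>n y. y \<in> carrier (lev Y n) \<Longrightarrow> \<exists>x\<in>carrier (lev X n). f n x = y"
    and acyclic: "\<And>n x. x \<in> cycles (chains X) n \<Longrightarrow> f n x = \<zero>\<^bsub>lev Y n\<^esub> \<Longrightarrow>
      \<exists>x'\<in>carrier (lev X (Suc n)). f (Suc n) x' = \<zero>\<^bsub>lev Y (Suc n)\<^esub> \<and> X.bd n x' = x"
  shows "quasi_iso (chains X) (chains Y) f"
  unfolding quasi_iso_def
proof (intro conjI allI ballI impI)
  fix n c assume c: "c \<in> cycles (chains X) n" "f n c \<in> boundaries (chains Y) n"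
  interpret XL: base_cring "lev X n" by (rule X.base_lev)
  interpret XS: base_cring "lev X (Suc n)" by (rule X.base_lev)
  interpret YL: base_cring "lev Y n" by (rule Y.base_lev)
  from c(2) obtain y where y: "y \<in> carrier (lev Y (Suc n))" "f n c = Y.bd n y"
    by (auto simp: boundaries_def)
  obtain x where x: "x \<in> carrier (lev X (Suc n))" "f (Suc n) x = y" using surj[OF y(1)] by auto
  have cc: "c \<in> carrier (lev X n)" using c by (simp add: X.cycles_iff)
  have "f n (c \<ominus>\<^bsub>lev X n\<^esub> X.bd n x) = \<zero>\<^bsub>lev Y n\<^esub>"
    using x y cc by (simp add: f_minus bd_hom)
  moreover have "c \<ominus>\<^bsub>lev X n\<^esub> X.bd n x \<in> cycles (chains X) n"
    using c x by (simp add: X.cycles_minus X.bd_cycle)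
  ultimately obtain x' where x': "x' \<in> carrier (lev X (Suc n))" "X.bd n x' = c \<ominus>\<^bsub>lev X n\<^esub> X.bd n x"
    using acyclic by blast
  have "c = X.bd n (x' \<oplus>\<^bsub>lev X (Suc n)\<^esub> x)"
    using x x' cc by (simp add: X.bd_add)
  then show "c \<in> boundaries (chains X) n"
    using x x' by (auto simp: boundaries_def)
next
  fix n d assume d: "d \<in> cycles (chains Y) n"
  interpret XL: base_cring "lev X n" by (rule X.base_lev)
  interpret YL: base_cring "lev Y n" by (rule Y.base_lev)
  have dc: "d \<in> carrier (lev Y n)" using d by (simp add: Y.cycles_iff)
  then obtain x where x: "x \<in> carrier (lev X n)" "f n x = d" using surj by blast
  have "\<exists>c\<in>cycles (chains X) n. f n c = d"
  proof (cases n)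
    case 0
    then show ?thesis using x by (auto simp: X.cycles_iff)
  next
    case (Suc k)
    have x': "x \<in> carrier (lev X (Suc k))" using x Suc by simp
    \<comment> \<open>The boundary of a lift of a cycle is a cycle in the kernel; a kernel element
      \<open>z\<close> with the same boundary is subtracted from the lift.\<close>
    have "X.bd k x \<in> cycles (chains X) k" using x' by (rule X.bd_cycle)
    moreover have "f k (X.bd k x) = \<zero>\<^bsub>lev Y k\<^esub>"
      using x x' d Suc by (simp add: bd_hom Y.cycles_iff)
    ultimately obtain z where z: "z \<in> carrier (lev X n)" "f n z = \<zero>\<^bsub>lev Y n\<^esub>" "X.bd k z = X.bd k x"
      using acyclic Suc by blast
    interpret K: base_cring "lev X k" by (rule X.base_lev)
    have "X.bd k (x \<ominus>\<^bsub>lev X n\<^esub> z) = \<zero>\<^bsub>lev X k\<^esub>"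
      using x' z Suc by (simp add: X.bd_minus)
    then have "x \<ominus>\<^bsub>lev X n\<^esub> z \<in> cycles (chains X) n"
      using x z Suc by (auto simp: X.cycles_iff)
    moreover have "f n (x \<ominus>\<^bsub>lev X n\<^esub> z) = d" using x z dc by (simp add: f_minus)
    ultimately show ?thesis by blast
  qed
  then obtain c where c: "c \<in> cycles (chains X) n" "f n c = d" by blast
  have "d \<ominus>\<^bsub>grp (chains Y) n\<^esub> f n c \<in> boundaries (chains Y) n"
    using c dc by (simp add: Y.zero_boundary)
  then show "\<exists>c\<in>cycles (chains X) n. d \<ominus>\<^bsub>grp (chains Y) n\<^esub> f n c \<in> boundaries (chains Y) n"
    using c by blast
qed

end

lemma simplicial_hom_of_weak_equiv: "weak_equiv X Y f \<Longrightarrow> simplicial_hom X Y f"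
  by (simp add: weak_equiv_def simplicial_hom_def simplicial_hom_axioms_def)

lemma shom_comp:
  assumes "shom X Y f" "shom Y Z g"
  shows "shom X Z (\<lambda>n x. g n (f n x))"
  unfolding shom_def
proof (intro conjI allI impI ballI)
  fix n
  show "(\<lambda>x. g n (f n x)) \<in> ring_hom (lev X n) (lev Z n)"
    using ring_hom_trans[OF shomD(1)[OF assms(1)] shomD(1)[OF assms(2)]] by (simp add: comp_def)
qed (use assms ring_hom_closed[OF shomD(1)[OF assms(1)]] in \<open>auto simp: shom_def\<close>)

lemma weak_equiv_comp:
  assumes "weak_equiv X Y f" "weak_equiv Y Z g"
  shows "weak_equiv X Z (\<lambda>n x. g n (f n x))"
proof -
  interpret f: simplicial_hom X Y f using assms(1) by (rule simplicial_hom_of_weak_equiv)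
  interpret g: simplicial_hom Y Z g using assms(2) by (rule simplicial_hom_of_weak_equiv)
  have f: "quasi_iso (chains X) (chains Y) f" and g: "quasi_iso (chains Y) (chains Z) g"
    using assms by (auto simp: weak_equiv_def)
  have "quasi_iso (chains X) (chains Z) (\<lambda>n x. g n (f n x))"
    unfolding quasi_iso_def
  proof (intro conjI allI ballI impI)
    fix n c assume "c \<in> cycles (chains X) n" "g n (f n c) \<in> boundaries (chains Z) n"
    then show "c \<in> boundaries (chains X) n"
      using f g f.f_cycles unfolding quasi_iso_def by blast
  next
    fix n e assume e: "e \<in> cycles (chains Z) n"
    interpret Z: base_cring "lev Z n" by (rule g.Y.base_lev)
    obtain d where d: "d \<in> cycles (chains Y) n" "e \<ominus>\<^bsub>lev Z n\<^esub> g n d \<in> boundaries (chains Z) n"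
      using g e unfolding quasi_iso_def chains_sel by meson
    obtain c where c: "c \<in> cycles (chains X) n" "d \<ominus>\<^bsub>lev Y n\<^esub> f n c \<in> boundaries (chains Y) n"
      using f d(1) unfolding quasi_iso_def chains_sel by meson
    have cl: "c \<in> carrier (lev X n)" "d \<in> carrier (lev Y n)" "e \<in> carrier (lev Z n)"
      using c d e by (auto simp: f.X.cycles_iff f.Y.cycles_iff g.Y.cycles_iff)
    obtain a where a: "a \<in> carrier (lev Z (Suc n))" "e \<ominus>\<^bsub>lev Z n\<^esub> g n d = g.Y.bd n a"
      using d(2) by (auto simp: boundaries_def)
    obtain b where b: "b \<in> carrier (lev Z (Suc n))" "g n (d \<ominus>\<^bsub>lev Y n\<^esub> f n c) = g.Y.bd n b"
      using g.f_boundaries[OF c(2)] by (auto simp: boundaries_def)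
    have "e \<ominus>\<^bsub>lev Z n\<^esub> g n (f n c) = (e \<ominus>\<^bsub>lev Z n\<^esub> g n d) \<oplus>\<^bsub>lev Z n\<^esub> (g n d \<ominus>\<^bsub>lev Z n\<^esub> g n (f n c))"
      using cl by (simp add: a_minus_def Z.a_assoc Z.r_neg1)
    also have "\<dots> = g.Y.bd n (a \<oplus>\<^bsub>lev Z (Suc n)\<^esub> b)"
      using a b cl by (simp add: g.f_minus g.Y.bd_add)
    finally have "e \<ominus>\<^bsub>lev Z n\<^esub> g n (f n c) \<in> boundaries (chains Z) n"
      using a b cring.cring_simprules(1)[OF g.Y.lev_cring] by (auto simp: boundaries_def)
    then show "\<exists>c\<in>cycles (chains X) n. e \<ominus>\<^bsub>grp (chains Z) n\<^esub> g n (f n c) \<in> boundaries (chains Z) n"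
      using c by auto
  qed
  then show ?thesis
    using assms shom_comp[of X Y f Z g] by (auto simp: weak_equiv_def)
qed

section \<open>Fibre products\<close>

lemma sfibprod_sel:
  "carrier (lev (sfibprod X Y f g) n) = {(x, y). x \<in> carrier (lev X n) \<and> y \<in> carrier (lev Y n) \<and> f n x = g n y}"
  "(x, y) \<otimes>\<^bsub>lev (sfibprod X Y f g) n\<^esub> (x', y') = (x \<otimes>\<^bsub>lev X n\<^esub> x', y \<otimes>\<^bsub>lev Y n\<^esub> y')"
  "(x, y) \<oplus>\<^bsub>lev (sfibprod X Y f g) n\<^esub> (x', y') = (x \<oplus>\<^bsub>lev X n\<^esub> x', y \<oplus>\<^bsub>lev Y n\<^esub> y')"
  "\<one>\<^bsub>lev (sfibprod X Y f g) n\<^esub> = (\<one>\<^bsub>lev X n\<^esub>, \<one>\<^bsub>lev Y n\<^esub>)"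
  "\<zero>\<^bsub>lev (sfibprod X Y f g) n\<^esub> = (\<zero>\<^bsub>lev X n\<^esub>, \<zero>\<^bsub>lev Y n\<^esub>)"
  "face (sfibprod X Y f g) n i (x, y) = (face X n i x, face Y n i y)"
  "dgn (sfibprod X Y f g) n i (x, y) = (dgn X n i x, dgn Y n i y)"
  by (simp_all add: sfibprod_def)

locale fibre_square = f: simplicial_hom X Z f + g: simplicial_hom Y Z g
  for X :: "'a sring" and Y :: "'b sring" and Z :: "'c sring" and f g
begin

abbreviation "E \<equiv> sfibprod X Y f g"

lemma cring_fibprod: "cring (lev E n)"
proof -
  interpret X: base_cring "lev X n" by (rule f.X.base_lev)
  interpret Y: base_cring "lev Y n" by (rule g.X.base_lev)
  interpret Z: base_cring "lev Z n" by (rule f.Y.base_lev)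
  interpret fh: ring_hom_cring "lev X n" "lev Z n" "f n" by (rule f.lev_hom)
  interpret gh: ring_hom_cring "lev Y n" "lev Z n" "g n" by (rule g.lev_hom)
  show ?thesis
  proof (rule cringI)
    show "abelian_group (lev E n)"
    proof (rule abelian_groupI)
      fix x assume "x \<in> carrier (lev E n)"
      then obtain a b where ab: "x = (a, b)" "(a, b) \<in> carrier (lev E n)" by (cases x) auto
      then have "(\<ominus>\<^bsub>lev X n\<^esub> a, \<ominus>\<^bsub>lev Y n\<^esub> b) \<in> carrier (lev E n)"
        "(\<ominus>\<^bsub>lev X n\<^esub> a, \<ominus>\<^bsub>lev Y n\<^esub> b) \<oplus>\<^bsub>lev E n\<^esub> x = \<zero>\<^bsub>lev E n\<^esub>"
        by (auto simp: sfibprod_sel X.l_neg Y.l_neg)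
      then show "\<exists>y\<in>carrier (lev E n). y \<oplus>\<^bsub>lev E n\<^esub> x = \<zero>\<^bsub>lev E n\<^esub>" by blast
    qed (auto simp: sfibprod_sel X.a_ac Y.a_ac)
    show "comm_monoid (lev E n)"
      by (rule comm_monoidI) (auto simp: sfibprod_sel X.m_ac Y.m_ac)
  qed (auto simp: sfibprod_sel X.l_distr Y.l_distr)
qed

lemma simplicial_fibprod: "simplicial_cring E"
proof (rule simplicial_cring.intro)
  fix n i :: nat assume i: "i \<le> Suc n"
  show "face E n i \<in> ring_hom (lev E (Suc n)) (lev E n)"
  proof (rule ring_hom_memI)
    fix x y assume "x \<in> carrier (lev E (Suc n))" "y \<in> carrier (lev E (Suc n))"
    then show "face E n i (x \<otimes>\<^bsub>lev E (Suc n)\<^esub> y) = face E n i x \<otimes>\<^bsub>lev E n\<^esub> face E n i y"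
      "face E n i (x \<oplus>\<^bsub>lev E (Suc n)\<^esub> y) = face E n i x \<oplus>\<^bsub>lev E n\<^esub> face E n i y"
      using ring_hom_mult[OF f.X.face_hom[OF i]] ring_hom_mult[OF g.X.face_hom[OF i]]
        ring_hom_add[OF f.X.face_hom[OF i]] ring_hom_add[OF g.X.face_hom[OF i]]
      by (auto simp: sfibprod_sel)
  qed (use i ring_hom_one[OF f.X.face_hom[OF i]] ring_hom_one[OF g.X.face_hom[OF i]] in
      \<open>auto simp: sfibprod_sel shomD(2)[OF f.shom] shomD(2)[OF g.shom]\<close>)
next
  fix n i :: nat assume i: "i \<le> n"
  show "dgn E n i \<in> ring_hom (lev E n) (lev E (Suc n))"
  proof (rule ring_hom_memI)
    fix x y assume "x \<in> carrier (lev E n)" "y \<in> carrier (lev E n)"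
    then show "dgn E n i (x \<otimes>\<^bsub>lev E n\<^esub> y) = dgn E n i x \<otimes>\<^bsub>lev E (Suc n)\<^esub> dgn E n i y"
      "dgn E n i (x \<oplus>\<^bsub>lev E n\<^esub> y) = dgn E n i x \<oplus>\<^bsub>lev E (Suc n)\<^esub> dgn E n i y"
      using ring_hom_mult[OF f.X.dgn_hom[OF i]] ring_hom_mult[OF g.X.dgn_hom[OF i]]
        ring_hom_add[OF f.X.dgn_hom[OF i]] ring_hom_add[OF g.X.dgn_hom[OF i]]
      by (auto simp: sfibprod_sel)
  qed (use i ring_hom_one[OF f.X.dgn_hom[OF i]] ring_hom_one[OF g.X.dgn_hom[OF i]] in
      \<open>auto simp: sfibprod_sel shomD(3)[OF f.shom] shomD(3)[OF g.shom]\<close>)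
next
  fix n i j :: nat and x assume "i < j" "j \<le> Suc (Suc n)" "x \<in> carrier (lev E (Suc (Suc n)))"
  then show "face E n i (face E (Suc n) j x) = face E n (j - 1) (face E (Suc n) i x)"
    using f.X.face_face[of i j n] g.X.face_face[of i j n] by (auto simp: sfibprod_sel)
next
  fix n i j :: nat and x assume "i \<le> j" "j \<le> n" "x \<in> carrier (lev E n)"
  then show "dgn E (Suc n) i (dgn E n j x) = dgn E (Suc n) (Suc j) (dgn E n i x)"
    using f.X.dgn_dgn[of i j n] g.X.dgn_dgn[of i j n] by (auto simp: sfibprod_sel)
next
  fix n i j :: nat and x assume "i < j" "j \<le> Suc n" "x \<in> carrier (lev E (Suc n))"
  then show "face E (Suc n) i (dgn E (Suc n) j x) = dgn E n (j - 1) (face E n i x)"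
    using f.X.face_dgn_less[of i j n] g.X.face_dgn_less[of i j n] by (auto simp: sfibprod_sel)
next
  fix n i j :: nat and x assume "Suc j < i" "i \<le> Suc (Suc n)" "x \<in> carrier (lev E (Suc n))"
  then show "face E (Suc n) i (dgn E (Suc n) j x) = dgn E n j (face E n (i - 1) x)"
    using f.X.face_dgn_greater[of j i n] g.X.face_dgn_greater[of j i n] by (auto simp: sfibprod_sel)
next
  fix n i :: nat and x assume "i \<le> n" "x \<in> carrier (lev E n)"
  then show "face E n i (dgn E n i x) = x" "face E n (Suc i) (dgn E n i x) = x"
    using f.X.face_dgn_same[of i n] g.X.face_dgn_same[of i n] f.X.face_dgn_Suc[of i n] g.X.face_dgn_Suc[of i n]
    by (auto simp: sfibprod_sel)
qed (rule cring_fibprod)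

lemma shom_fst: "shom E X (\<lambda>n. fst)"
  unfolding shom_def by (auto simp: sfibprod_sel intro!: ring_hom_memI)

lemma shom_snd: "shom E Y (\<lambda>n. snd)"
  unfolding shom_def by (auto simp: sfibprod_sel intro!: ring_hom_memI)

sublocale fst: simplicial_hom E X "\<lambda>n. fst"
  by (intro simplicial_hom.intro simplicial_hom_axioms.intro simplicial_fibprod f.X.simplicial_cring_axioms shom_fst)

sublocale snd: simplicial_hom E Y "\<lambda>n. snd"
  by (intro simplicial_hom.intro simplicial_hom_axioms.intro simplicial_fibprod g.X.simplicial_cring_axioms shom_snd)

lemma bd_fibprod: "x \<in> carrier (lev E (Suc n)) \<Longrightarrow> fst.X.bd n x = (f.X.bd n (fst x), g.X.bd n (snd x))"
  using fst.bd_hom[of x n] snd.bd_hom[of x n] by (simp add: prod_eq_iff)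

text \<open>Base change of a surjection with acyclic kernel: the kernel of the first projection is
  that of \<open>g\<close>, placed in the second component.\<close>

lemma weak_equiv_fst:
  assumes surj: "\<And>n z. z \<in> carrier (lev Z n) \<Longrightarrow> \<exists>y\<in>carrier (lev Y n). g n y = z"
    and acyclic: "\<And>n y. y \<in> cycles (chains Y) n \<Longrightarrow> g n y = \<zero>\<^bsub>lev Z n\<^esub> \<Longrightarrow>
      \<exists>y'\<in>carrier (lev Y (Suc n)). g (Suc n) y' = \<zero>\<^bsub>lev Z (Suc n)\<^esub> \<and> g.X.bd n y' = y"
  shows "weak_equiv E X (\<lambda>n. fst)"
proof -
  have "quasi_iso (chains E) (chains X) (\<lambda>n. fst)"
  proof (rule fst.quasi_iso_surj)
    fix n x assume x: "x \<in> carrier (lev X n)"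
    then obtain y where "y \<in> carrier (lev Y n)" "g n y = f n x" using surj[of "f n x" n] by auto
    then have "(x, y) \<in> carrier (lev E n)" using x by (simp add: sfibprod_sel)
    then show "\<exists>e\<in>carrier (lev E n). fst e = x" by force
  next
    fix n e assume e: "e \<in> cycles (chains E) n" "fst e = \<zero>\<^bsub>lev X n\<^esub>"
    then have ec: "e \<in> carrier (lev E n)" by (simp add: fst.X.cycles_iff)
    have "snd e \<in> cycles (chains Y) n" using snd.f_cycles[OF e(1)] .
    moreover have "g n (snd e) = \<zero>\<^bsub>lev Z n\<^esub>" using ec e(2) by (auto simp: sfibprod_sel)
    ultimately obtain y where y: "y \<in> carrier (lev Y (Suc n))" "g (Suc n) y = \<zero>\<^bsub>lev Z (Suc n)\<^esub>" "g.X.bd n y = snd e"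
      using acyclic by blast
    interpret X: base_cring "lev X (Suc n)" by (rule f.X.base_lev)
    have c: "(\<zero>\<^bsub>lev X (Suc n)\<^esub>, y) \<in> carrier (lev E (Suc n))"
      using y by (simp add: sfibprod_sel)
    moreover have "fst.X.bd n (\<zero>\<^bsub>lev X (Suc n)\<^esub>, y) = e"
      using bd_fibprod[OF c] y(3) e(2) by (simp add: prod_eq_iff)
    ultimately show "\<exists>x'\<in>carrier (lev E (Suc n)). fst x' = \<zero>\<^bsub>lev X (Suc n)\<^esub> \<and> fst.X.bd n x' = e"
      by force
  qed
  then show ?thesis
    by (simp add: weak_equiv_def shom_fst fst.X.simplicial_cring_axioms f.X.simplicial_cring_axioms)
qed

end

section \<open>Mapping cones of strict fibre products\<close>

lemma mcone_sel:
  "carrier (grp (mcone C D f) n) =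
    carrier (grp D n) \<times> (if n = 0 then {\<zero>\<^bsub>grp C 0\<^esub>} else carrier (grp C (n - 1)))"
  "\<zero>\<^bsub>grp (mcone C D f) n\<^esub> = (\<zero>\<^bsub>grp D n\<^esub>, \<zero>\<^bsub>grp C (n - 1)\<^esub>)"
  "(d, c) \<oplus>\<^bsub>grp (mcone C D f) n\<^esub> (d', c') = (d \<oplus>\<^bsub>grp D n\<^esub> d', c \<oplus>\<^bsub>grp C (n - 1)\<^esub> c')"
  "bnd (mcone C D f) n (d, c) = (bnd D n d \<oplus>\<^bsub>grp D n\<^esub> f n c,
     if n = 0 then \<zero>\<^bsub>grp C 0\<^esub> else \<ominus>\<^bsub>grp C (n - 1)\<^esub> bnd C (n - 1) c)"
  by (simp_all add: mcone_def)

text \<open>Negatives are determined by uniqueness inside the carrier, so the cone has first to be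
  recognised as an abelian group; the last hypothesis expresses that the second component is trivial
  in degree \<open>0\<close>.\<close>

lemma mcone_minus:
  assumes "\<And>n. cring (grp C n)" "\<And>n. cring (grp D n)"
    and "d \<in> carrier (grp D n)" "d' \<in> carrier (grp D n)" "c \<in> carrier (grp C (n - 1))" "c' \<in> carrier (grp C (n - 1))"
    and "n = 0 \<Longrightarrow> c = \<zero>\<^bsub>grp C 0\<^esub> \<and> c' = \<zero>\<^bsub>grp C 0\<^esub>"
  shows "(d, c) \<ominus>\<^bsub>grp (mcone C D f) n\<^esub> (d', c') = (d \<ominus>\<^bsub>grp D n\<^esub> d', c \<ominus>\<^bsub>grp C (n - 1)\<^esub> c')"
proof -
  interpret C: base_cring "grp C (n - 1)" using assms by (simp add: base_cring_def)
  interpret D: base_cring "grp D n" using assms by (simp add: base_cring_def)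
  have C0: "n = 0 \<Longrightarrow> \<ominus>\<^bsub>grp C 0\<^esub> \<zero>\<^bsub>grp C 0\<^esub> = \<zero>\<^bsub>grp C 0\<^esub>" "n = 0 \<Longrightarrow> \<zero>\<^bsub>grp C 0\<^esub> \<oplus>\<^bsub>grp C 0\<^esub> \<zero>\<^bsub>grp C 0\<^esub> = \<zero>\<^bsub>grp C 0\<^esub>"
    using C.minus_zero C.l_zero[OF C.zero_closed] by simp_all
  have mem: "(a, b) \<in> carrier (grp (mcone C D f) n) \<longleftrightarrow>
      a \<in> carrier (grp D n) \<and> b \<in> carrier (grp C (n - 1)) \<and> (n = 0 \<longrightarrow> b = \<zero>\<^bsub>grp C 0\<^esub>)" for a b
    using C.zero_closed by (auto simp: mcone_sel)
  interpret M: abelian_group "grp (mcone C D f) n"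
  proof (rule abelian_groupI)
    fix x assume "x \<in> carrier (grp (mcone C D f) n)"
    then obtain a b where ab: "x = (a, b)" "a \<in> carrier (grp D n)" "b \<in> carrier (grp C (n - 1))" "n = 0 \<Longrightarrow> b = \<zero>\<^bsub>grp C 0\<^esub>"
      using mem by (cases x) auto
    then have "(\<ominus>\<^bsub>grp D n\<^esub> a, \<ominus>\<^bsub>grp C (n - 1)\<^esub> b) \<in> carrier (grp (mcone C D f) n)"
      using C0 C.a_inv_closed unfolding mem by auto
    moreover have "(\<ominus>\<^bsub>grp D n\<^esub> a, \<ominus>\<^bsub>grp C (n - 1)\<^esub> b) \<oplus>\<^bsub>grp (mcone C D f) n\<^esub> x = \<zero>\<^bsub>grp (mcone C D f) n\<^esub>"
      using ab C.l_neg D.l_neg by (simp add: mcone_sel)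
    ultimately show "\<exists>y\<in>carrier (grp (mcone C D f) n). y \<oplus>\<^bsub>grp (mcone C D f) n\<^esub> x = \<zero>\<^bsub>grp (mcone C D f) n\<^esub>" by blast
  next
    show "\<zero>\<^bsub>grp (mcone C D f) n\<^esub> \<in> carrier (grp (mcone C D f) n)"
      using C.zero_closed by (simp add: mcone_sel)
  next
    fix x y assume "x \<in> carrier (grp (mcone C D f) n)" "y \<in> carrier (grp (mcone C D f) n)"
    then show "x \<oplus>\<^bsub>grp (mcone C D f) n\<^esub> y \<in> carrier (grp (mcone C D f) n)"
      "x \<oplus>\<^bsub>grp (mcone C D f) n\<^esub> y = y \<oplus>\<^bsub>grp (mcone C D f) n\<^esub> x"
      "\<zero>\<^bsub>grp (mcone C D f) n\<^esub> \<oplus>\<^bsub>grp (mcone C D f) n\<^esub> x = x"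
      using C.a_closed C.a_comm D.a_comm C.l_zero C0
      by (cases x, cases y, simp add: mem mcone_sel(2,3))+
  next
    fix x y z assume "x \<in> carrier (grp (mcone C D f) n)" "y \<in> carrier (grp (mcone C D f) n)"
      "z \<in> carrier (grp (mcone C D f) n)"
    then show "x \<oplus>\<^bsub>grp (mcone C D f) n\<^esub> y \<oplus>\<^bsub>grp (mcone C D f) n\<^esub> z =
        x \<oplus>\<^bsub>grp (mcone C D f) n\<^esub> (y \<oplus>\<^bsub>grp (mcone C D f) n\<^esub> z)"
      using C.a_assoc D.a_assoc by (cases x, cases y, cases z) (simp add: mem mcone_sel(3))
  qed
  have cl: "(d', c') \<in> carrier (grp (mcone C D f) n)" "(\<ominus>\<^bsub>grp D n\<^esub> d', \<ominus>\<^bsub>grp C (n - 1)\<^esub> c') \<in> carrier (grp (mcone C D f) n)"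
    using assms(3-7) C0 C.a_inv_closed unfolding mem by auto
  have "(\<ominus>\<^bsub>grp D n\<^esub> d', \<ominus>\<^bsub>grp C (n - 1)\<^esub> c') \<oplus>\<^bsub>grp (mcone C D f) n\<^esub> (d', c') = \<zero>\<^bsub>grp (mcone C D f) n\<^esub>"
    using assms C.l_neg D.l_neg by (simp add: mcone_sel)
  then have "\<ominus>\<^bsub>grp (mcone C D f) n\<^esub> (d', c') = (\<ominus>\<^bsub>grp D n\<^esub> d', \<ominus>\<^bsub>grp C (n - 1)\<^esub> c')"
    using M.minus_equality cl by blast
  then show ?thesis by (simp add: a_minus_def mcone_sel)
qed

text \<open>Lifting along \<open>g\<close> moves the component in \<open>Z\<close> of a cone element
  into \<open>Y\<close>, up to a boundary. This is why a strict fibre product along a levelwise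
  surjection is a homotopy fibre product.\<close>

lemma (in fibre_square) derived_pullback_fibprod:
  assumes surj: "\<And>n z. z \<in> carrier (lev Z n) \<Longrightarrow> \<exists>y\<in>carrier (lev Y n). g n y = z"
  shows "derived_pullback_square E X Y Z (\<lambda>n. fst) (\<lambda>n. snd) f g"
proof -
  let ?C = "mcone (chains E) (chains X) (\<lambda>n. fst)" and ?D = "mcone (chains Y) (chains Z) g"
  have "quasi_iso ?C ?D (\<lambda>n (x, e). (f n x, snd e))"
    unfolding quasi_iso_def
  proof (intro conjI allI ballI impI)
    fix n c assume c: "c \<in> cycles ?C n" and bc: "(case c of (x, e) \<Rightarrow> (f n x, snd e)) \<in> boundaries ?D n"
    obtain x e where xe: "c = (x, e)" by (cases c)
    interpret X: base_cring "lev X n" by (rule f.X.base_lev)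
    interpret Y: base_cring "lev Y n" by (rule g.X.base_lev)
    interpret Z: base_cring "lev Z n" by (rule f.Y.base_lev)
    interpret Xs: base_cring "lev X (Suc n)" by (rule f.X.base_lev)
    have x: "x \<in> carrier (lev X n)" and e: "if n = 0 then e = \<zero>\<^bsub>lev E 0\<^esub> else e \<in> carrier (lev E (n - 1))"
      using c xe by (auto simp: cycles_def mcone_sel split: if_splits)
    obtain z y where zy: "z \<in> carrier (lev Z (Suc n))" "y \<in> carrier (lev Y n)"
        "f n x = f.Y.bd n z \<oplus>\<^bsub>lev Z n\<^esub> g n y"
        "snd e = (if n = 0 then \<zero>\<^bsub>lev Y 0\<^esub> else \<ominus>\<^bsub>lev Y (n - 1)\<^esub> g.X.bd (n - 1) y)"
      using bc unfolding xe boundaries_def by (auto simp: mcone_sel)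
    obtain y' where y': "y' \<in> carrier (lev Y (Suc n))" "g (Suc n) y' = z" using surj[OF zy(1)] by auto
    \<comment> \<open>Adding the boundary of a lift of \<open>z\<close> makes \<open>w\<close> match
      \<open>x\<close> over \<open>Z\<close>. The cone element \<open>(0, (x, w))\<close> then has
      boundary \<open>(x, e)\<close>.\<close>
    define w where "w = g.X.bd n y' \<oplus>\<^bsub>lev Y n\<^esub> y"
    have w: "w \<in> carrier (lev Y n)" using zy y' by (simp add: w_def)
    have "g n w = f n x" using zy y' by (simp add: w_def g.f_add g.bd_hom)
    then have xw: "(x, w) \<in> carrier (lev E n)" using x w by (simp add: sfibprod_sel)
    have "c = bnd ?C n (\<zero>\<^bsub>lev X (Suc n)\<^esub>, (x, w))"
    proof (cases n)
      case 0
      then show ?thesis using e x xe by (simp add: mcone_sel)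
    next
      case (Suc k)
      interpret Xk: base_cring "lev X k" by (rule f.X.base_lev)
      interpret Yk: base_cring "lev Y k" by (rule g.X.base_lev)
      interpret Ek: cring "lev E k" by (rule cring_fibprod)
      have ec: "e \<in> carrier (lev E k)" using e Suc by simp
      then have ec': "fst e \<in> carrier (lev X k)" "snd e \<in> carrier (lev Y k)" by simp_all
      have "bnd ?C k c = \<zero>\<^bsub>grp ?C k\<^esub>" using c Suc by (simp add: cycles_def)
      then have 0: "f.X.bd k x \<oplus>\<^bsub>lev X k\<^esub> fst e = \<zero>\<^bsub>lev X k\<^esub>"
        by (simp add: xe mcone_sel)
      have x': "x \<in> carrier (lev X (Suc k))" and y0: "y \<in> carrier (lev Y (Suc k))" using x zy Suc by simp_all
      have xw': "(x, w) \<in> carrier (lev E (Suc k))" using xw Suc by simp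
      have "g.X.bd k w = g.X.bd k y"
        using y' y0 Suc by (simp add: w_def g.X.bd_add g.X.bd_bd)
      then have "\<ominus>\<^bsub>lev Y k\<^esub> g.X.bd k w = snd e"
        using zy Suc by simp
      then have "g.X.bd k w \<oplus>\<^bsub>lev Y k\<^esub> snd e = \<zero>\<^bsub>lev Y k\<^esub>"
        using w Suc by (metis Yk.r_neg g.X.bd_closed)
      then have "e \<oplus>\<^bsub>lev E k\<^esub> fst.X.bd k (x, w) = \<zero>\<^bsub>lev E k\<^esub>"
        using 0 ec' x' w Suc unfolding bd_fibprod[OF xw'] 
        by (cases e) (simp add: sfibprod_sel Xk.a_comm Yk.a_comm)
      then have "e = \<ominus>\<^bsub>lev E k\<^esub> fst.X.bd k (x, w)"
        using ec xw' Ek.minus_equality by (metis fst.X.bd_closed)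
      then show ?thesis using Suc x xe by (simp add: mcone_sel)
    qed
    moreover have "(\<zero>\<^bsub>lev X (Suc n)\<^esub>, (x, w)) \<in> carrier (grp ?C (Suc n))"
      using xw by (simp add: mcone_sel)
    ultimately show "c \<in> boundaries ?C n" unfolding boundaries_def by blast
  next
    fix n d assume d: "d \<in> cycles ?D n"
    obtain z y where zy: "d = (z, y)" by (cases d)
    interpret X: base_cring "lev X n" by (rule f.X.base_lev)
    interpret Y: base_cring "lev Y n" by (rule g.X.base_lev)
    interpret Z: base_cring "lev Z n" by (rule f.Y.base_lev)
    interpret Zs: base_cring "lev Z (Suc n)" by (rule f.Y.base_lev)
    have z: "z \<in> carrier (lev Z n)" and y: "if n = 0 then y = \<zero>\<^bsub>lev Y 0\<^esub> else y \<in> carrier (lev Y (n - 1))"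
      using d zy by (auto simp: cycles_def mcone_sel split: if_splits)
    obtain y' where y': "y' \<in> carrier (lev Y n)" "g n y' = z" using surj[OF z] by auto
    have b: "bnd ?D n (\<zero>\<^bsub>lev Z (Suc n)\<^esub>, y') \<in> boundaries ?D n"
      unfolding boundaries_def by (rule imageI) (use y' in \<open>simp add: mcone_sel\<close>)
    have "\<exists>e. (\<zero>\<^bsub>lev X n\<^esub>, e) \<in> cycles ?C n \<and>
        d \<ominus>\<^bsub>grp ?D n\<^esub> (f n \<zero>\<^bsub>lev X n\<^esub>, snd e) = bnd ?D n (\<zero>\<^bsub>lev Z (Suc n)\<^esub>, y')"
    proof (cases n)
      case 0
      interpret Y0: base_cring "lev Y 0" by (rule g.X.base_lev)
      have "(\<zero>\<^bsub>lev X n\<^esub>, \<zero>\<^bsub>lev E 0\<^esub>) \<in> cycles ?C n"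
        using 0 by (simp add: cycles_def mcone_sel X.zero_closed[unfolded 0])
      moreover have "d \<ominus>\<^bsub>grp ?D n\<^esub> (f n \<zero>\<^bsub>lev X n\<^esub>, snd \<zero>\<^bsub>lev E 0\<^esub>) = bnd ?D n (\<zero>\<^bsub>lev Z (Suc n)\<^esub>, y')"
        unfolding zy using 0 y y' z
        by (subst mcone_minus) (simp_all add: g.X.lev_cring f.Y.lev_cring mcone_sel sfibprod_sel Z.zero_closed[unfolded 0]
            Z.minus_zero_right[unfolded 0] Z.l_zero[unfolded 0])
      ultimately show ?thesis by blast
    next
      case (Suc k)
      interpret Xk: base_cring "lev X k" by (rule f.X.base_lev)
      interpret Yk: base_cring "lev Y k" by (rule g.X.base_lev)
      interpret Zk: base_cring "lev Z k" by (rule f.Y.base_lev)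
      interpret Xk: base_cring "lev X k" by (rule f.X.base_lev)
      have yc: "y \<in> carrier (lev Y k)" using y Suc by simp
      have y'': "y' \<in> carrier (lev Y (Suc k))" "g (Suc k) y' = z" using y' Suc by simp_all
      have "bnd ?D k d = \<zero>\<^bsub>grp ?D k\<^esub>" using d Suc by (simp add: cycles_def)
      then have 0: "f.Y.bd k z \<oplus>\<^bsub>lev Z k\<^esub> g k y = \<zero>\<^bsub>lev Z k\<^esub>"
          "k \<noteq> 0 \<Longrightarrow> \<ominus>\<^bsub>lev Y (k - 1)\<^esub> g.X.bd (k - 1) y = \<zero>\<^bsub>lev Y (k - 1)\<^esub>"
        by (simp_all add: zy mcone_sel)
      \<comment> \<open>The cycle condition puts \<open>w\<close> into the kernel of
        \<open>g\<close>, so that \<open>(0, w)\<close> lies in the fibre product; \<open>w\<close>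
        differs from \<open>y\<close> only by the boundary of \<open>y'\<close>.\<close>
      define w where "w = y \<oplus>\<^bsub>lev Y k\<^esub> g.X.bd k y'"
      have w: "w \<in> carrier (lev Y k)" using yc y'' by (simp add: w_def)
      have "g k w = g k y \<oplus>\<^bsub>lev Z k\<^esub> f.Y.bd k z"
        using yc y'' by (simp add: w_def g.f_add g.bd_hom)
      also have "\<dots> = f.Y.bd k z \<oplus>\<^bsub>lev Z k\<^esub> g k y"
        by (rule Zk.a_comm) (use yc z Suc in auto)
      finally have "g k w = \<zero>\<^bsub>lev Z k\<^esub>" using 0(1) by simp
      then have ew: "(\<zero>\<^bsub>lev X k\<^esub>, w) \<in> carrier (lev E k)" using w by (simp add: sfibprod_sel)
      have bw: "fst.X.bd j (\<zero>\<^bsub>lev X k\<^esub>, w) = \<zero>\<^bsub>lev E j\<^esub>" if j: "k = Suc j" for j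
      proof -
        interpret Yj: base_cring "lev Y j" by (rule g.X.base_lev)
        have "g.X.bd j y = \<zero>\<^bsub>lev Y j\<^esub>"
          using 0(2) yc j Yj.minus_minus[of "g.X.bd j y"] by simp
        then have "g.X.bd j w = \<zero>\<^bsub>lev Y j\<^esub>"
          using yc y'' j by (simp add: w_def g.X.bd_add g.X.bd_bd)
        then show ?thesis
          using ew j by (simp add: bd_fibprod sfibprod_sel)
      qed
      have "(\<zero>\<^bsub>lev X n\<^esub>, (\<zero>\<^bsub>lev X k\<^esub>, w)) \<in> cycles ?C n"
      proof -
        have "\<ominus>\<^bsub>lev E j\<^esub> \<zero>\<^bsub>lev E j\<^esub> = \<zero>\<^bsub>lev E j\<^esub>" for j
        proof -
          interpret Ej: cring "lev E j" by (rule cring_fibprod)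
          show ?thesis by simp
        qed
        then show ?thesis
          using ew Suc bw X.zero_closed by (cases k) (auto simp: cycles_def mcone_sel)
      qed
      moreover have "d \<ominus>\<^bsub>grp ?D n\<^esub> (f n \<zero>\<^bsub>lev X n\<^esub>, w) = bnd ?D n (\<zero>\<^bsub>lev Z (Suc n)\<^esub>, y')"
      proof -
        have "y \<ominus>\<^bsub>lev Y k\<^esub> w = \<ominus>\<^bsub>lev Y k\<^esub> g.X.bd k y'"
          using yc y'' by (simp add: w_def a_minus_def Yk.minus_add Yk.r_neg2)
        then show ?thesis
          unfolding zy using Suc yc w y' z Z.zero_closed Z.minus_zero_right[OF z] Z.l_zero[OF z]
          by (subst mcone_minus) (simp_all add: g.X.lev_cring f.Y.lev_cring mcone_sel)
      qed
      ultimately show ?thesis by force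
    qed
    then obtain e where e: "(\<zero>\<^bsub>lev X n\<^esub>, e) \<in> cycles ?C n"
        "d \<ominus>\<^bsub>grp ?D n\<^esub> (f n \<zero>\<^bsub>lev X n\<^esub>, snd e) \<in> boundaries ?D n"
      using b by auto
    then show "\<exists>c\<in>cycles ?C n. d \<ominus>\<^bsub>grp ?D n\<^esub> (case c of (x, e) \<Rightarrow> (f n x, snd e)) \<in> boundaries ?D n"
      by (intro bexI[of _ "(\<zero>\<^bsub>lev X n\<^esub>, e)"]) auto
  qed
  then show ?thesis
    unfolding derived_pullback_square_def
    using fst.X.simplicial_cring_axioms f.X.simplicial_cring_axioms g.X.simplicial_cring_axioms
      f.Y.simplicial_cring_axioms shom_fst shom_snd f.shom g.shom
    by (auto simp: sfibprod_sel)
qed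

section \<open>Reduction modulo p\<close>

context base_cring
begin

lemma pideal_ideal: "ideal (pideal p R) R"
  unfolding pideal_def by (rule cgenideal_ideal) simp

lemma pconst_in [simp]: "pconst p R \<in> carrier R"
  by (simp add: pconst_def)

lemma pconst_mult: "x \<in> carrier R \<Longrightarrow> pconst p R \<otimes> x = [p] \<cdot> x"
  by (simp add: pconst_def add_pow_ldistr)

lemma mem_pideal: "x \<in> pideal p R \<longleftrightarrow> (\<exists>a\<in>carrier R. x = pconst p R \<otimes> a)"
  unfolding pideal_def cgenideal_def pconst_def[symmetric] by (auto simp: m_comm)

lemma pcls_eq_rcos: "pcls p R = (+>) (pideal p R)"
  by (simp add: pcls_def fun_eq_iff)

lemma cring_modp: "cring (modp p R)"
  using ideal.quotient_is_cring[OF pideal_ideal is_cring] .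

lemma pcls_hom: "pcls p R \<in> ring_hom R (modp p R)"
  unfolding pcls_eq_rcos by (rule ideal.rcos_ring_hom[OF pideal_ideal])

lemma carrier_modp: "carrier (modp p R) = pcls p R ` carrier R"
  unfolding pcls_eq_rcos FactRing_def A_RCOSETS_def' by auto

lemma pcls_eq_iff:
  assumes "x \<in> carrier R" "y \<in> carrier R"
  shows "pcls p R x = pcls p R y \<longleftrightarrow> (\<exists>a\<in>carrier R. x = y \<oplus> pconst p R \<otimes> a)"
proof -
  have "pcls p R x = pcls p R y \<longleftrightarrow> x \<ominus> y \<in> pideal p R"
    unfolding pcls_def using quotient_eq_iff_same_a_r_cos[OF pideal_ideal assms] by simp
  also have "\<dots> \<longleftrightarrow> (\<exists>a\<in>carrier R. x = y \<oplus> pconst p R \<otimes> a)"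
    unfolding mem_pideal
  proof (intro bex_cong refl iffI)
    fix a assume "a \<in> carrier R" "x \<ominus> y = pconst p R \<otimes> a"
    then show "x = y \<oplus> pconst p R \<otimes> a"
      using assms minus_add_cancel[of x y] by (simp add: a_comm)
  next
    fix a assume "a \<in> carrier R" "x = y \<oplus> pconst p R \<otimes> a"
    then show "x \<ominus> y = pconst p R \<otimes> a" using assms by simp
  qed
  finally show ?thesis .
qed

lemma zero_modp: "\<zero>\<^bsub>modp p R\<^esub> = pcls p R \<zero>"
  using ring_hom_cring.hom_zero[of R "modp p R" "pcls p R"] cring_modp pcls_hom is_cring
  by (simp add: ring_hom_cring_def ring_hom_cring_axioms_def)

lemma pcls_zero_iff:
  "x \<in> carrier R \<Longrightarrow> pcls p R x = \<zero>\<^bsub>modp p R\<^esub> \<longleftrightarrow> (\<exists>a\<in>carrier R. x = pconst p R \<otimes> a)"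
  by (simp add: zero_modp pcls_eq_iff)

lemma pcls_pconst: "pcls p R (pconst p R) = \<zero>\<^bsub>modp p R\<^esub>"
  by (subst pcls_zero_iff) (auto intro!: bexI[of _ \<one>])

lemma pconst_modp: "pconst p (modp p R) = \<zero>\<^bsub>modp p R\<^esub>"
  using ring_hom_pconst[OF is_cring cring_modp pcls_hom, of p p] by (simp add: pcls_pconst)

lemma pcls_self: "x \<in> carrier R \<Longrightarrow> x \<in> pcls p R x"
proof -
  interpret I: ideal "pideal p R" R by (rule pideal_ideal)
  show "x \<in> carrier R \<Longrightarrow> ?thesis" unfolding pcls_def by (rule I.a_rcos_self)
qed

lemma pcls_memD:
  assumes "y \<in> pcls p R x" "x \<in> carrier R"
  shows "y \<in> carrier R" "pcls p R y = pcls p R x"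
proof -
  interpret I: ideal "pideal p R" R by (rule pideal_ideal)
  show "y \<in> carrier R" using I.a_elemrcos_carrier[OF assms(2) assms(1)[unfolded pcls_def]] .
  show "pcls p R y = pcls p R x" unfolding pcls_def using I.a_repr_independence'[OF assms(1)[unfolded pcls_def] assms(2)] by (rule sym)
qed

end

text \<open>The union in \<open>modp_map\<close> is over one and the same class: representatives
  differ by multiples of \<open>p\<close>, and \<open>f\<close> preserves these.\<close>

lemma modp_map_pcls:
  assumes "cring S" "cring T" "f \<in> ring_hom S T" "x \<in> carrier S"
  shows "modp_map p T f (pcls p S x) = pcls p T (f x)"
proof -
  interpret S: base_cring S using assms by (simp add: base_cring_def)
  interpret T: base_cring T using assms by (simp add: base_cring_def)
  have "pcls p T (f y) = pcls p T (f x)" if y: "y \<in> pcls p S x" for y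
  proof -
    have yc: "y \<in> carrier S" "pcls p S y = pcls p S x" using S.pcls_memD[OF y assms(4)] .
    then obtain a where a: "a \<in> carrier S" "y = x \<oplus>\<^bsub>S\<^esub> pconst p S \<otimes>\<^bsub>S\<^esub> a"
      using S.pcls_eq_iff[OF yc(1) assms(4), of p] by auto
    have "f y = f x \<oplus>\<^bsub>T\<^esub> pconst p T \<otimes>\<^bsub>T\<^esub> f a"
      unfolding a(2) using a(1) assms(4) ring_hom_pconst[OF assms(1-3)]
      by (simp add: ring_hom_add[OF assms(3)] ring_hom_mult[OF assms(3)])
    moreover have "f x \<in> carrier T" "f y \<in> carrier T" "f a \<in> carrier T"
      using a(1) yc(1) assms(4) ring_hom_closed[OF assms(3)] by auto
    ultimately show ?thesis
      using T.pcls_eq_iff[of "f y" "f x" p] by blast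
  qed
  then show ?thesis
    unfolding modp_map_def using S.pcls_self[OF assms(4), of p] by blast
qed

lemma modp_map_hom:
  assumes "cring S" "cring T" "f \<in> ring_hom S T"
  shows "modp_map p T f \<in> ring_hom (modp p S) (modp p T)"
proof -
  interpret S: base_cring S using assms by (simp add: base_cring_def)
  interpret T: base_cring T using assms by (simp add: base_cring_def)
  note m = modp_map_pcls[OF assms, where p = p]
  show ?thesis
  proof (rule ring_hom_memI)
    fix x assume "x \<in> carrier (modp p S)"
    then show "modp_map p T f x \<in> carrier (modp p T)"
      using m ring_hom_closed[OF assms(3)] by (auto simp: S.carrier_modp T.carrier_modp)
  next
    fix x y assume "x \<in> carrier (modp p S)" "y \<in> carrier (modp p S)"
    then obtain a b where ab: "a \<in> carrier S" "b \<in> carrier S" "x = pcls p S a" "y = pcls p S b"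
      by (auto simp: S.carrier_modp)
    have f: "f a \<in> carrier T" "f b \<in> carrier T" using ab ring_hom_closed[OF assms(3)] by auto
    have "modp_map p T f (pcls p S (a \<otimes>\<^bsub>S\<^esub> b)) = pcls p T (f a) \<otimes>\<^bsub>modp p T\<^esub> pcls p T (f b)"
      "modp_map p T f (pcls p S (a \<oplus>\<^bsub>S\<^esub> b)) = pcls p T (f a) \<oplus>\<^bsub>modp p T\<^esub> pcls p T (f b)"
      using ab m[of "a \<otimes>\<^bsub>S\<^esub> b"] m[of "a \<oplus>\<^bsub>S\<^esub> b"] f
      by (simp_all add: ring_hom_mult[OF assms(3)] ring_hom_add[OF assms(3)]
          ring_hom_mult[OF T.pcls_hom] ring_hom_add[OF T.pcls_hom])
    then show "modp_map p T f (x \<otimes>\<^bsub>modp p S\<^esub> y) = modp_map p T f x \<otimes>\<^bsub>modp p T\<^esub> modp_map p T f y"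
      "modp_map p T f (x \<oplus>\<^bsub>modp p S\<^esub> y) = modp_map p T f x \<oplus>\<^bsub>modp p T\<^esub> modp_map p T f y"
      using ab m[of a] m[of b] by (simp_all add: ring_hom_mult[OF S.pcls_hom] ring_hom_add[OF S.pcls_hom])
  next
    show "modp_map p T f \<one>\<^bsub>modp p S\<^esub> = \<one>\<^bsub>modp p T\<^esub>"
      using m[of "\<one>\<^bsub>S\<^esub>"] ring_hom_one[OF assms(3)] ring_hom_one[OF S.pcls_hom, of p] ring_hom_one[OF T.pcls_hom, of p]
      by simp
  qed
qed

text \<open>Each ring axiom for \<open>T\<close> is the image of the axiom for \<open>S\<close>.
  Nothing is assumed about \<open>T\<close> beyond its carrier and operations, so that
  \<open>W2\<close> can be seen to be a ring in this way.\<close>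

lemma cring_image:
  assumes "cring S" and im: "carrier T = q ` carrier S"
    and mult: "\<And>x y. x \<in> carrier S \<Longrightarrow> y \<in> carrier S \<Longrightarrow> q (x \<otimes>\<^bsub>S\<^esub> y) = q x \<otimes>\<^bsub>T\<^esub> q y"
    and add: "\<And>x y. x \<in> carrier S \<Longrightarrow> y \<in> carrier S \<Longrightarrow> q (x \<oplus>\<^bsub>S\<^esub> y) = q x \<oplus>\<^bsub>T\<^esub> q y"
    and one: "q \<one>\<^bsub>S\<^esub> = \<one>\<^bsub>T\<^esub>" and zero: "q \<zero>\<^bsub>S\<^esub> = \<zero>\<^bsub>T\<^esub>"
  shows "cring T"
proof -
  interpret S: cring S by fact
  have [simp]: "x \<in> carrier S \<Longrightarrow> q x \<in> carrier T" for x using im by auto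
  show ?thesis
  proof (rule cringI)
    show "abelian_group T"
    proof (rule abelian_groupI)
      fix x assume "x \<in> carrier T"
      then obtain a where a: "a \<in> carrier S" "x = q a" using im by auto
      then have "q (\<ominus>\<^bsub>S\<^esub> a) \<oplus>\<^bsub>T\<^esub> x = \<zero>\<^bsub>T\<^esub>"
        by (simp add: add[symmetric] S.l_neg zero)
      then show "\<exists>y\<in>carrier T. y \<oplus>\<^bsub>T\<^esub> x = \<zero>\<^bsub>T\<^esub>" using a by (intro bexI[of _ "q (\<ominus>\<^bsub>S\<^esub> a)"]) auto
    qed (auto simp: im add[symmetric] zero[symmetric] S.a_ac)
    show "comm_monoid T"
      by (rule comm_monoidI) (auto simp: im mult[symmetric] one[symmetric] S.m_ac)
  qed (auto simp: im mult[symmetric] add[symmetric] S.l_distr)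
qed

text \<open>The simplicial version of \<open>cring_image\<close>, used twice: for the reduction
  modulo \<open>p\<close> and for the constant object on \<open>W2\<close>.\<close>

lemma simplicial_image:
  assumes X: "simplicial_cring X" and im: "\<And>n. carrier (lev Y n) = q n ` carrier (lev X n)"
    and mult: "\<And>n x y. x \<in> carrier (lev X n) \<Longrightarrow> y \<in> carrier (lev X n) \<Longrightarrow>
      q n (x \<otimes>\<^bsub>lev X n\<^esub> y) = q n x \<otimes>\<^bsub>lev Y n\<^esub> q n y"
    and add: "\<And>n x y. x \<in> carrier (lev X n) \<Longrightarrow> y \<in> carrier (lev X n) \<Longrightarrow>
      q n (x \<oplus>\<^bsub>lev X n\<^esub> y) = q n x \<oplus>\<^bsub>lev Y n\<^esub> q n y"
    and one: "\<And>n. q n \<one>\<^bsub>lev X n\<^esub> = \<one>\<^bsub>lev Y n\<^esub>" and zero: "\<And>n. q n \<zero>\<^bsub>lev X n\<^esub> = \<zero>\<^bsub>lev Y n\<^esub>"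
    and face: "\<And>n i x. i \<le> Suc n \<Longrightarrow> x \<in> carrier (lev X (Suc n)) \<Longrightarrow> face Y n i (q (Suc n) x) = q n (face X n i x)"
    and dgn: "\<And>n i x. i \<le> n \<Longrightarrow> x \<in> carrier (lev X n) \<Longrightarrow> dgn Y n i (q n x) = q (Suc n) (dgn X n i x)"
  shows "simplicial_cring Y" and "shom X Y q"
proof -
  interpret X: simplicial_cring X by (rule X)
  have cr: "cring (lev Y n)" for n
    by (rule cring_image[where S = "lev X n" and q = "q n"]) (simp_all add: X.lev_cring im mult add one zero)
  show "simplicial_cring Y"
  proof (rule simplicial_cring.intro)
    fix n i :: nat assume i: "i \<le> Suc n"
    show "face Y n i \<in> ring_hom (lev Y (Suc n)) (lev Y n)"
      by (rule ring_hom_memI)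
        (auto simp: im mult[symmetric] add[symmetric] one[symmetric] face i
          ring_hom_mult[OF X.face_hom[OF i]] ring_hom_add[OF X.face_hom[OF i]] ring_hom_one[OF X.face_hom[OF i]])
  next
    fix n i :: nat assume i: "i \<le> n"
    show "dgn Y n i \<in> ring_hom (lev Y n) (lev Y (Suc n))"
      by (rule ring_hom_memI)
        (auto simp: im mult[symmetric] add[symmetric] one[symmetric] dgn i
          ring_hom_mult[OF X.dgn_hom[OF i]] ring_hom_add[OF X.dgn_hom[OF i]] ring_hom_one[OF X.dgn_hom[OF i]])
  next
    fix n i j :: nat and x assume ij: "i < j" "j \<le> Suc (Suc n)" and "x \<in> carrier (lev Y (Suc (Suc n)))"
    then obtain a where "a \<in> carrier (lev X (Suc (Suc n)))" "x = q (Suc (Suc n)) a" by (auto simp: im)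
    then show "face Y n i (face Y (Suc n) j x) = face Y n (j - 1) (face Y (Suc n) i x)"
      using ij X.face_face[OF ij] by (simp add: face)
  next
    fix n i j :: nat and x assume ij: "i \<le> j" "j \<le> n" and "x \<in> carrier (lev Y n)"
    then obtain a where "a \<in> carrier (lev X n)" "x = q n a" by (auto simp: im)
    then show "dgn Y (Suc n) i (dgn Y n j x) = dgn Y (Suc n) (Suc j) (dgn Y n i x)"
      using ij X.dgn_dgn[OF ij] by (simp add: dgn)
  next
    fix n i j :: nat and x assume ij: "i < j" "j \<le> Suc n" and "x \<in> carrier (lev Y (Suc n))"
    then obtain a where "a \<in> carrier (lev X (Suc n))" "x = q (Suc n) a" by (auto simp: im)
    then show "face Y (Suc n) i (dgn Y (Suc n) j x) = dgn Y n (j - 1) (face Y n i x)"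
      using ij X.face_dgn_less[OF ij] by (simp add: face dgn)
  next
    fix n i j :: nat and x assume ij: "Suc j < i" "i \<le> Suc (Suc n)" and "x \<in> carrier (lev Y (Suc n))"
    then obtain a where "a \<in> carrier (lev X (Suc n))" "x = q (Suc n) a" by (auto simp: im)
    then show "face Y (Suc n) i (dgn Y (Suc n) j x) = dgn Y n j (face Y n (i - 1) x)"
      using ij X.face_dgn_greater[OF ij] by (simp add: face dgn)
  next
    fix n i :: nat and x assume i: "i \<le> n" and "x \<in> carrier (lev Y n)"
    then obtain a where "a \<in> carrier (lev X n)" "x = q n a" by (auto simp: im)
    then show "face Y n i (dgn Y n i x) = x" "face Y n (Suc i) (dgn Y n i x) = x"
      using i X.face_dgn_same[OF i] X.face_dgn_Suc[OF i] by (simp_all add: face dgn)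
  qed (rule cr)
  show "shom X Y q"
    unfolding shom_def
  proof (intro conjI allI impI ballI)
    fix n show "q n \<in> ring_hom (lev X n) (lev Y n)"
      by (rule ring_hom_memI) (simp_all add: im mult add one)
  qed (simp_all add: face dgn)
qed

context simplicial_cring
begin

lemma smodp_sel:
  "lev (smodp p X) n = modp p (lev X n)"
  "face (smodp p X) n i = modp_map p (lev X n) (face X n i)"
  "dgn (smodp p X) n i = modp_map p (lev X (Suc n)) (dgn X n i)"
  by (simp_all add: smodp_def)

lemma simplicial_smodp: "simplicial_cring (smodp p X)"
  and shom_pcls: "shom X (smodp p X) (\<lambda>n. pcls p (lev X n))"
proof -
  let ?q = "\<lambda>n. pcls p (lev X n)"
  have h: "?q n \<in> ring_hom (lev X n) (lev (smodp p X) n)" for n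
    unfolding smodp_sel by (rule base_cring.pcls_hom[OF base_lev])
  have im: "carrier (lev (smodp p X) n) = ?q n ` carrier (lev X n)" for n
    unfolding smodp_sel by (rule base_cring.carrier_modp[OF base_lev])
  have zero: "?q n \<zero>\<^bsub>lev X n\<^esub> = \<zero>\<^bsub>lev (smodp p X) n\<^esub>" for n
    unfolding smodp_sel by (rule base_cring.zero_modp[OF base_lev, symmetric])
  have fc: "face (smodp p X) n i (?q (Suc n) x) = ?q n (face X n i x)"
    if "i \<le> Suc n" "x \<in> carrier (lev X (Suc n))" for n i x
    unfolding smodp_sel by (rule modp_map_pcls[OF lev_cring lev_cring face_hom[OF that(1)] that(2)])
  have dg: "dgn (smodp p X) n i (?q n x) = ?q (Suc n) (dgn X n i x)"
    if "i \<le> n" "x \<in> carrier (lev X n)" for n i x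
    unfolding smodp_sel by (rule modp_map_pcls[OF lev_cring lev_cring dgn_hom[OF that(1)] that(2)])
  show "simplicial_cring (smodp p X)"
    by (rule simplicial_image(1)[where X = X and q = ?q])
      (rule simplicial_cring_axioms im ring_hom_mult[OF h] ring_hom_add[OF h] ring_hom_one[OF h] zero fc dg; assumption?)+
  show "shom X (smodp p X) ?q"
    by (rule simplicial_image(2)[where X = X and q = ?q])
      (rule simplicial_cring_axioms im ring_hom_mult[OF h] ring_hom_add[OF h] ring_hom_one[OF h] zero fc dg; assumption?)+
qed

end

section \<open>The augmentation of the bar construction\<close>

lemma coeff_empty_mult:
  assumes "cring S" "f \<in> carrier (mpolys S V)" "g \<in> carrier (mpolys S V)"
  shows "(f \<otimes>\<^bsub>mpolys S V\<^esub> g) {#} = f {#} \<otimes>\<^bsub>S\<^esub> g {#}"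
proof -
  interpret S: base_cring S using assms by (simp add: base_cring_def)
  have "{v :: 'b multiset. v = {#}} = {{#}}" by auto
  then show ?thesis
    using assms by (simp add: mpolys_sel(2) mpolys_coeff_closed)
qed

lemma coeff_empty_hom:
  assumes "cring S"
  shows "(\<lambda>f. f {#}) \<in> ring_hom (mpolys S V) S"
  by (rule ring_hom_memI)
    (simp_all add: coeff_empty_mult[OF assms] mpolys_coeff_closed mpolys_sel(3,5) mconst_def)

text \<open>Compatibility is again checked separately on coefficients and on indices. Instances are
  a change of coefficients, the evaluation at \<open>p\<close> and the map killing
  \<open>t 0\<close>.\<close>

lemma shom_gmap:
  assumes X: "simplicial_cring X" and Y: "simplicial_cring Y" and r: "shom X Y r"
    and th: "\<And>n. gindex z n z' n (th n)"
    and "\<And>n k v. k \<le> Suc n \<Longrightarrow> v \<in> gvars z (Suc n) \<Longrightarrow> face_index k (th (Suc n) v) = th n (face_index k v)"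
    and "\<And>n k v. k \<le> n \<Longrightarrow> v \<in> gvars z n \<Longrightarrow> dgn_index k (th n v) = th (Suc n) (dgn_index k v)"
  shows "shom (gbar z p X) (gbar z' p Y) (\<lambda>n. gmap z' p (lev X n) (lev Y n) n (r n) (th n))"
  unfolding shom_def
proof (intro conjI allI impI ballI)
  interpret X: simplicial_cring X by (rule X)
  interpret Y: simplicial_cring Y by (rule Y)
  note rh = shomD(1)[OF r]
  have th_le: "th n v \<le> Suc n" if "v \<in> gvars z n" for n v
    using th[of n] that by (auto simp: gindex_def gvars_iff)
  fix n :: nat
  show hom: "gmap z' p (lev X n) (lev Y n) n (r n) (th n) \<in> ring_hom (lev (gbar z p X) n) (lev (gbar z' p Y) n)" for n
    unfolding gbar_sel by (rule gmap_hom(1)[OF X.lev_cring Y.lev_cring rh th_le])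
  fix i :: nat and x
  {
    assume "i \<le> Suc n" "x \<in> carrier (lev (gbar z p X) (Suc n))"
    then show "gmap z' p (lev X n) (lev Y n) n (r n) (th n) (face (gbar z p X) n i x) =
        face (gbar z' p Y) n i (gmap z' p (lev X (Suc n)) (lev Y (Suc n)) (Suc n) (r (Suc n)) (th (Suc n)) x)"
      unfolding gbar_sel using assms(5) th_le
      by (intro gmap_commute[where V = "gvars z (Suc n)"] X.lev_cring Y.lev_cring X.face_hom Y.face_hom rh
          th Y.face_index_gindex)
        (auto simp: shomD(2)[OF r], auto simp: face_index_def gvars_iff)
  next
    assume *: "i \<le> n" "x \<in> carrier (lev (gbar z p X) n)"
    have c: "gmap z' p (lev X n) (lev Y n) n (r n) (th n) x \<in> carrier (mpolys (lev Y n) (gvars z' n))"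
      using ring_hom_closed[OF hom *(2)] by (simp add: gbar_sel)
    show "gmap z' p (lev X (Suc n)) (lev Y (Suc n)) (Suc n) (r (Suc n)) (th (Suc n)) (dgn (gbar z p X) n i x) =
        dgn (gbar z' p Y) n i (gmap z' p (lev X n) (lev Y n) n (r n) (th n) x)"
      using * assms(6) th_le unfolding gbar_sel(1) X.gbar_dgn[OF *(1) *(2)[unfolded gbar_sel(1)]] Y.gbar_dgn[OF *(1) c]
      by (intro gmap_commute[where V = "gvars z n"] X.lev_cring Y.lev_cring X.dgn_hom Y.dgn_hom rh
          th Y.dgn_index_gindex)
        (auto simp: shomD(3)[OF r], auto simp: dgn_index_def gvars_iff)
  }
qed

lemma shom_id: "shom X X (\<lambda>n x. x)"
  using id_ring_hom by (auto simp: shom_def id_def)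

lemma shom_bar_map:
  assumes X: "simplicial_cring X" and Y: "simplicial_cring Y" and r: "shom X Y r"
  shows "shom (gbar True p X) (gbar True p Y) (bar_map r)"
proof -
  interpret X: simplicial_cring X by (rule X)
  interpret Y: simplicial_cring Y by (rule Y)
  interpret B: simplicial_cring "gbar True p X" by (rule X.simplicial_gbar)
  have s: "shom (gbar True p X) (gbar True p Y) (\<lambda>n. gmap True p (lev X n) (lev Y n) n (r n) (\<lambda>j. j))"
    by (rule shom_gmap[OF assms]) (auto simp: gindex_def)
  have eq: "gmap True p (lev X n) (lev Y n) n (r n) (\<lambda>j. j) f = bar_map r n f"
    if "f \<in> carrier (lev (gbar True p X) n)" for n f
    using gmap_pointwise[OF X.lev_cring Y.lev_cring shomD(1)[OF r]] that by (simp add: bar_map_def gbar_sel)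
  interpret L: cring "lev (gbar True p X) n" for n by (rule B.lev_cring)
  show ?thesis
    unfolding shom_def
  proof (intro conjI allI impI ballI)
    fix n
    have "\<And>f. f \<in> carrier (lev (gbar True p X) n) \<Longrightarrow> bar_map r n f = gmap True p (lev X n) (lev Y n) n (r n) (\<lambda>j. j) f"
      using eq by simp
    then show "bar_map r n \<in> ring_hom (lev (gbar True p X) n) (lev (gbar True p Y) n)"
      using shomD(1)[OF s, of n]
      by (intro ring_hom_memI) (simp_all add: ring_hom_closed ring_hom_mult ring_hom_add ring_hom_one)
  next
    fix n i x assume "i \<le> Suc n" "x \<in> carrier (lev (gbar True p X) (Suc n))"
    then show "bar_map r n (face (gbar True p X) n i x) = face (gbar True p Y) n i (bar_map r (Suc n) x)"
      using shomD(2)[OF s, of i n x] by (simp add: eq)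
  next
    fix n i x assume "i \<le> n" "x \<in> carrier (lev (gbar True p X) n)"
    then show "bar_map r (Suc n) (dgn (gbar True p X) n i x) = dgn (gbar True p Y) n i (bar_map r n x)"
      using shomD(3)[OF s, of i n x] by (simp add: eq)
  qed
qed

context simplicial_cring
begin

lemma shom_bar_aug: "shom (gbar True p X) (smodp p X) (bar_aug p X)"
proof -
  have h: "bar_aug p X n \<in> ring_hom (mpolys (lev X n) V) (modp p (lev X n))" for n V
  proof -
    interpret L: base_cring "lev X n" by (rule base_lev)
    have "bar_aug p X n = pcls p (lev X n) \<circ> (\<lambda>f. f {#})" by (simp add: bar_aug_def fun_eq_iff)
    then show ?thesis using ring_hom_trans[OF coeff_empty_hom[OF lev_cring] L.pcls_hom] by simp
  qed
  have const: "bar_aug p X n (mconst (lev X n) a) = pcls p (lev X n) a" for n a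
    by (simp add: bar_aug_def mconst_def)
  have var: "bar_aug p X n (mvar (lev X n) j) = pcls p (lev X n) \<zero>\<^bsub>lev X n\<^esub>" for n j
    by (simp add: bar_aug_def mvar_def)
  \<comment> \<open>Whatever a face makes of a variable (another variable, \<open>0\<close> or
    \<open>p\<close>) dies in the target. For \<open>p\<close> this holds because the target is
    reduced modulo \<open>p\<close>.\<close>
  have val: "bar_aug p X n (gval True p (lev X n) n j) = pcls p (lev X n) \<zero>\<^bsub>lev X n\<^esub>" for n j
  proof -
    interpret L: base_cring "lev X n" by (rule base_lev)
    show ?thesis by (simp add: gval_def const var L.pcls_pconst L.zero_modp)
  qed
  show ?thesis
    unfolding shom_def
  proof (intro conjI allI impI ballI)
    fix n show "bar_aug p X n \<in> ring_hom (lev (gbar True p X) n) (lev (smodp p X) n)"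
      unfolding gbar_sel smodp_sel by (rule h)
  next
    fix n i f assume i: "i \<le> Suc n" and f: "f \<in> carrier (lev (gbar True p X) (Suc n))"
    have fi: "v \<in> gvars True (Suc n) \<Longrightarrow> face_index i v \<le> Suc n" for v
      using i by (auto simp: face_index_def gvars_iff)
    note g = gmap_hom[OF lev_cring lev_cring face_hom[OF i] fi, where z = True and p = p]
    have z: "face X n i \<zero>\<^bsub>lev X (Suc n)\<^esub> = \<zero>\<^bsub>lev X n\<^esub>"
      using ring_hom_zero[OF face_hom[OF i]] lev_cring by (simp add: cring_def)
    have "(bar_aug p X n \<circ> face (gbar True p X) n i) f = (face (smodp p X) n i \<circ> bar_aug p X (Suc n)) f"
      unfolding gbar_sel smodp_sel
      by (rule base_cring.mpolys_hom_eqI[OF base_lev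
            ring_hom_trans[OF g(1) h] ring_hom_trans[OF h modp_map_hom[OF lev_cring lev_cring face_hom[OF i]]] _ _ f[unfolded gbar_sel]])
        (auto simp: g(2,3) const var val modp_map_pcls[OF lev_cring lev_cring face_hom[OF i]] z)
    then show "bar_aug p X n (face (gbar True p X) n i f) = face (smodp p X) n i (bar_aug p X (Suc n) f)"
      by simp
  next
    fix n i f assume i: "i \<le> n" and f: "f \<in> carrier (lev (gbar True p X) n)"
    have fi: "v \<in> gvars True n \<Longrightarrow> dgn_index i v \<le> Suc (Suc n)" for v
      by (auto simp: dgn_index_def gvars_iff)
    note g = gmap_hom[OF lev_cring lev_cring dgn_hom[OF i] fi, where z = True and p = p]
    have z: "dgn X n i \<zero>\<^bsub>lev X n\<^esub> = \<zero>\<^bsub>lev X (Suc n)\<^esub>"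
      using ring_hom_zero[OF dgn_hom[OF i]] lev_cring by (simp add: cring_def)
    have "(bar_aug p X (Suc n) \<circ> gmap True p (lev X n) (lev X (Suc n)) (Suc n) (dgn X n i) (dgn_index i)) f =
        (dgn (smodp p X) n i \<circ> bar_aug p X n) f"
      unfolding gbar_sel smodp_sel
      by (rule base_cring.mpolys_hom_eqI[OF base_lev
            ring_hom_trans[OF g(1) h] ring_hom_trans[OF h modp_map_hom[OF lev_cring lev_cring dgn_hom[OF i]]] _ _ f[unfolded gbar_sel]])
        (auto simp: g(2,3) const var val modp_map_pcls[OF lev_cring lev_cring dgn_hom[OF i]] z)
    then show "bar_aug p X (Suc n) (dgn (gbar True p X) n i f) = dgn (smodp p X) n i (bar_aug p X n f)"
      using gbar_dgn[OF i f[unfolded gbar_sel]] by simp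
  qed
qed

lemma bar_aug_surj:
  assumes "y \<in> carrier (lev (smodp p X) n)"
  shows "\<exists>f\<in>carrier (lev (gbar True p X) n). bar_aug p X n f = y"
proof -
  interpret L: base_cring "lev X n" by (rule base_lev)
  obtain a where "a \<in> carrier (lev X n)" "y = pcls p (lev X n) a"
    using assms by (auto simp: smodp_sel L.carrier_modp)
  then show ?thesis
    by (intro bexI[of _ "mconst (lev X n) a"]) (auto simp: bar_aug_def mconst_def gbar_sel L.mconst_closed[unfolded mconst_def])
qed

end

text \<open>
  The kernel of the augmentation is acyclic: with \<open>C = gbar False p A\<close> it is the quotient
  \<open>I/(t 0) I\<close>, where \<open>I\<close> is the kernel of the evaluation \<open>t i \<mapsto> p\<close> on \<open>C\<close>. The ideal \<open>I\<close> is acyclic by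
  the contraction of the simplicial interval, and multiplication by \<open>t 0\<close> is injective on it.
\<close>

lemma coeff_empty_simps [simp]: "mconst S a {#} = a" "mvar S v {#} = \<zero>\<^bsub>S\<^esub>"
  by (simp_all add: mconst_def mvar_def)

context simplicial_cring
begin

lemma gmap_id:
  assumes "f \<in> carrier (mpolys (lev X n) (gvars z n))"
  shows "gmap z p (lev X n) (lev X n) n (\<lambda>a. a) (\<lambda>j. j) f = f"
  using gmap_pointwise[OF lev_cring lev_cring _ assms, where phi = "\<lambda>a. a" and p = p] id_ring_hom[of "lev X n"]
  by (simp add: id_def)

text \<open>On indices this contracts the interval onto the end where \<open>t\<close> becomes
  \<open>p\<close>. The ends of the homotopy are the identity and \<open>eval_p\<close>. It moves
  the index \<open>0\<close>, which is possible because \<open>t 0\<close> is a free variable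
  here.\<close>

definition bar_prism :: "nat \<Rightarrow> nat \<Rightarrow> nat \<Rightarrow> (nat multiset \<Rightarrow> 'a) \<Rightarrow> nat multiset \<Rightarrow> 'a" where
  "bar_prism p n i = gmap False p (lev X n) (lev X (Suc n)) (Suc n) (dgn X n i) (\<lambda>j. Suc (max i j))"

lemma prism_gindex: "i \<le> n \<Longrightarrow> gindex False n False (Suc n) (\<lambda>j. Suc (max i j))"
  by (auto simp: gindex_def)

lemma bar_prism_homotopy: "simplicial_homotopy (gbar False p X) (bar_prism p)"
proof (intro simplicial_homotopy.intro simplicial_homotopy_axioms.intro simplicial_gbar)
  fix n i :: nat assume i: "i \<le> n"
  show "bar_prism p n i \<in> ring_hom (lev (gbar False p X) n) (lev (gbar False p X) (Suc n))"
    unfolding bar_prism_def gbar_sel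
    by (rule gmap_hom(1)[OF lev_cring lev_cring dgn_hom[OF i]]) (use i in \<open>auto simp: gvars_iff\<close>)
next
  fix n i j :: nat and x assume *: "i < j" "j \<le> Suc n" "x \<in> carrier (lev (gbar False p X) (Suc n))"
  then show "face (gbar False p X) (Suc n) i (bar_prism p (Suc n) j x) = bar_prism p n (j - 1) (face (gbar False p X) n i x)"
    unfolding gbar_sel bar_prism_def
    by (intro gmap_commute[where V = "gvars False (Suc n)"] lev_cring dgn_hom face_hom prism_gindex face_index_gindex)
      (auto simp: face_dgn_less, auto simp: face_index_def gvars_iff)
next
  fix n i j :: nat and x assume *: "Suc j < i" "i \<le> Suc (Suc n)" "x \<in> carrier (lev (gbar False p X) (Suc n))"
  then show "face (gbar False p X) (Suc n) i (bar_prism p (Suc n) j x) = bar_prism p n j (face (gbar False p X) n (i - 1) x)"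
    unfolding gbar_sel bar_prism_def
    by (intro gmap_commute[where V = "gvars False (Suc n)"] lev_cring dgn_hom face_hom prism_gindex face_index_gindex)
      (auto simp: face_dgn_greater, auto simp: face_index_def gvars_iff)
next
  fix n i :: nat and x assume *: "0 < i" "i \<le> n" "x \<in> carrier (lev (gbar False p X) n)"
  then have "face X n i (dgn X n i a) = face X n i (dgn X n (i - 1) a)" if "a \<in> carrier (lev X n)" for a
    using that face_dgn_same[of i n a] face_dgn_Suc[of "i - 1" n a] by simp
  then show "face (gbar False p X) n i (bar_prism p n i x) = face (gbar False p X) n i (bar_prism p n (i - 1) x)"
    using * unfolding gbar_sel bar_prism_def
    by (intro gmap_commute[where V = "gvars False n"] lev_cring dgn_hom face_hom prism_gindex face_index_gindex)
      (auto simp: face_index_def gvars_iff)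
qed

text \<open>Written as an endomorphism of \<open>gbar False p X\<close> with a constant index map,
  instead of as a map to \<open>X\<close>, so that it too belongs to the calculus of
  \<open>gmap\<close>.\<close>

definition eval_p :: "nat \<Rightarrow> nat \<Rightarrow> (nat multiset \<Rightarrow> 'a) \<Rightarrow> nat multiset \<Rightarrow> 'a" where
  "eval_p p n = gmap False p (lev X n) (lev X n) n (\<lambda>a. a) (\<lambda>_. Suc n)"

lemma shom_eval_p: "shom (gbar False p X) (gbar False p X) (eval_p p)"
  unfolding eval_p_def[abs_def]
  by (rule shom_gmap[OF simplicial_cring_axioms simplicial_cring_axioms shom_id])
    (auto simp: gindex_def face_index_def dgn_index_def)

lemma eval_p_gindex: "gindex False n False n (\<lambda>_. Suc n)"
  by (simp add: gindex_def)

lemma id_lev_hom: "(\<lambda>a. a) \<in> ring_hom (lev X n) (lev X n)"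
  using id_ring_hom[of "lev X n"] by (simp add: id_def)

text \<open>Each variable contributes a factor \<open>p\<close>, so modulo \<open>p\<close> only the
  constant coefficient remains. This relates the kernel of the evaluation to that of
  \<open>bar_aug\<close>.\<close>

lemma eval_p_const:
  assumes "f \<in> carrier (mpolys (lev X n) (gvars False n))"
  shows "\<exists>b\<in>carrier (lev X n). eval_p p n f =
    mconst (lev X n) (f {#} \<oplus>\<^bsub>lev X n\<^esub> pconst p (lev X n) \<otimes>\<^bsub>lev X n\<^esub> b)"
proof -
  interpret L: base_cring "lev X n" by (rule base_lev)
  let ?P = "pconst p (lev X n)" and ?M = "mpolys (lev X n) (gvars False n)"
  note g = gmap_hom[OF lev_cring lev_cring id_lev_hom, where V = "gvars False n" and th = "\<lambda>_. Suc n" and n1 = n and z = False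
      and p = p and n = n, folded eval_p_def, simplified]
  note mc = mconst_hom[OF lev_cring, where V = "gvars False n" and n1 = n]
  show ?thesis
    using assms
  proof (induction f rule: L.mpolys_induct)
    case (const a)
    then show ?case by (intro bexI[of _ "\<zero>\<^bsub>lev X n\<^esub>"]) (auto simp: g(2))
  next
    case (add f h)
    then obtain b c where b: "b \<in> carrier (lev X n)" "eval_p p n f = mconst (lev X n) (f {#} \<oplus>\<^bsub>lev X n\<^esub> ?P \<otimes>\<^bsub>lev X n\<^esub> b)"
      and c: "c \<in> carrier (lev X n)" "eval_p p n h = mconst (lev X n) (h {#} \<oplus>\<^bsub>lev X n\<^esub> ?P \<otimes>\<^bsub>lev X n\<^esub> c)" by auto
    have cl: "f {#} \<in> carrier (lev X n)" "h {#} \<in> carrier (lev X n)" using add by (auto simp: mpolys_coeff_closed)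
    have "eval_p p n (f \<oplus>\<^bsub>?M\<^esub> h) = mconst (lev X n) ((f {#} \<oplus>\<^bsub>lev X n\<^esub> ?P \<otimes>\<^bsub>lev X n\<^esub> b) \<oplus>\<^bsub>lev X n\<^esub>
        (h {#} \<oplus>\<^bsub>lev X n\<^esub> ?P \<otimes>\<^bsub>lev X n\<^esub> c))"
      using ring_hom_add[OF g(1) add(1,2)] b c cl ring_hom_add[OF mc] by simp
    also have "(f {#} \<oplus>\<^bsub>lev X n\<^esub> ?P \<otimes>\<^bsub>lev X n\<^esub> b) \<oplus>\<^bsub>lev X n\<^esub> (h {#} \<oplus>\<^bsub>lev X n\<^esub> ?P \<otimes>\<^bsub>lev X n\<^esub> c) =
        (f \<oplus>\<^bsub>?M\<^esub> h) {#} \<oplus>\<^bsub>lev X n\<^esub> ?P \<otimes>\<^bsub>lev X n\<^esub> (b \<oplus>\<^bsub>lev X n\<^esub> c)"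
      using b(1) c(1) cl by (simp add: mpolys_sel(5) L.a_ac L.r_distr)
    finally show ?case using b(1) c(1) by (intro bexI[where x = "b \<oplus>\<^bsub>lev X n\<^esub> c"]) simp_all
  next
    case (var f v)
    then obtain b where b: "b \<in> carrier (lev X n)" "eval_p p n f = mconst (lev X n) (f {#} \<oplus>\<^bsub>lev X n\<^esub> ?P \<otimes>\<^bsub>lev X n\<^esub> b)"
      by auto
    have cl: "f {#} \<in> carrier (lev X n)" using var by (simp add: mpolys_coeff_closed)
    have "eval_p p n (mvar (lev X n) v \<otimes>\<^bsub>?M\<^esub> f) = mconst (lev X n) (?P \<otimes>\<^bsub>lev X n\<^esub> (f {#} \<oplus>\<^bsub>lev X n\<^esub> ?P \<otimes>\<^bsub>lev X n\<^esub> b))"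
      using ring_hom_mult[OF g(1) L.mvar_closed[OF var(2)] var(1)] g(3)[OF var(2)] b cl ring_hom_mult[OF mc]
      by (simp add: gval_def)
    also have "?P \<otimes>\<^bsub>lev X n\<^esub> (f {#} \<oplus>\<^bsub>lev X n\<^esub> ?P \<otimes>\<^bsub>lev X n\<^esub> b) =
        (mvar (lev X n) v \<otimes>\<^bsub>?M\<^esub> f) {#} \<oplus>\<^bsub>lev X n\<^esub> ?P \<otimes>\<^bsub>lev X n\<^esub> (f {#} \<oplus>\<^bsub>lev X n\<^esub> ?P \<otimes>\<^bsub>lev X n\<^esub> b)"
      using cl b(1) by (simp add: L.mvar_mult[OF var(1)])
    finally show ?case
      using b(1) cl by (intro bexI[where x = "f {#} \<oplus>\<^bsub>lev X n\<^esub> ?P \<otimes>\<^bsub>lev X n\<^esub> b"]) simp_all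
  qed
qed

lemma mconst_inj: "mconst S a = mconst S b \<Longrightarrow> a = b"
  by (metis mconst_def)

end

section \<open>Acyclicity of the kernel of the augmentation\<close>

locale ptf_simplicial = simplicial_cring +
  fixes p :: nat
  assumes ptf: "x \<in> carrier (lev X n) \<Longrightarrow> pconst p (lev X n) \<otimes>\<^bsub>lev X n\<^esub> x = \<zero>\<^bsub>lev X n\<^esub> \<Longrightarrow> x = \<zero>\<^bsub>lev X n\<^esub>"
begin

abbreviation "C \<equiv> gbar False p X"
abbreviation "B \<equiv> gbar True p X"

sublocale C: simplicial_homotopy C "bar_prism p" by (rule bar_prism_homotopy)
sublocale B: simplicial_cring B by (rule simplicial_gbar)
sublocale e: simplicial_hom C C "eval_p p"
  by (intro simplicial_hom.intro simplicial_hom_axioms.intro simplicial_gbar shom_eval_p)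

lemma ptf_mpolys:
  assumes "f \<in> carrier (mpolys (lev X n) V)"
    and "mconst (lev X n) (pconst p (lev X n)) \<otimes>\<^bsub>mpolys (lev X n) V\<^esub> f = \<zero>\<^bsub>mpolys (lev X n) V\<^esub>"
  shows "f = \<zero>\<^bsub>mpolys (lev X n) V\<^esub>"
proof -
  interpret L: base_cring "lev X n" by (rule base_lev)
  have "pconst p (lev X n) \<otimes>\<^bsub>lev X n\<^esub> f u = \<zero>\<^bsub>lev X n\<^esub>" for u
    using assms L.mconst_mult[OF L.pconst_in assms(1), of p] by (simp add: mpolys_sel(4) fun_eq_iff)
  then have "f u = \<zero>\<^bsub>lev X n\<^esub>" for u
    by (rule ptf[OF mpolys_coeff_closed[OF assms(1)]])
  then show ?thesis by (simp add: mpolys_sel(4) fun_eq_iff)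
qed

text \<open>The prism joins the identity to \<open>eval_p\<close>, so on the kernel of
  \<open>eval_p\<close> its boundary is \<open>c\<close> itself. It stays in the kernel, because
  evaluation commutes with the prism operators.\<close>

lemma ker_eval_acyclic:
  assumes c: "c \<in> cycles (chains C) n" "eval_p p n c = \<zero>\<^bsub>lev C n\<^esub>"
  shows "\<exists>c'\<in>carrier (lev C (Suc n)). eval_p p (Suc n) c' = \<zero>\<^bsub>lev C (Suc n)\<^esub> \<and> C.bd n c' = c"
proof (intro bexI[of _ "C.prism n c"] conjI)
  have cc: "c \<in> carrier (lev C n)" using c by (simp add: C.cycles_iff)
  then have cc': "c \<in> carrier (mpolys (lev X n) (gvars False n))" by (simp add: gbar_sel)
  show "C.prism n c \<in> carrier (lev C (Suc n))" using cc by (rule C.prism_closed)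
  interpret L: base_cring "lev C (Suc n)" by (rule C.base_lev)
  interpret eh: ring_hom_cring "lev C (Suc n)" "lev C (Suc n)" "eval_p p (Suc n)" by (rule e.lev_hom)
  have 1: "eval_p p (Suc n) (bar_prism p n i c) = \<zero>\<^bsub>lev C (Suc n)\<^esub>" if i: "i \<le> n" for i
  proof -
    have "eval_p p (Suc n) (bar_prism p n i c) = bar_prism p n i (eval_p p n c)"
      unfolding eval_p_def bar_prism_def using i
      by (intro gmap_commute[OF _ _ _ _ _ _ _ _ _ _ _ _ _ _ cc'] lev_cring dgn_hom id_lev_hom prism_gindex eval_p_gindex)
        (auto simp: gvars_iff)
    also have "\<dots> = \<zero>\<^bsub>lev C (Suc n)\<^esub>"
      unfolding c(2) using ring_hom_zero[OF C.h_hom[OF i]] C.lev_cring by (simp add: cring_def)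
    finally show ?thesis .
  qed
  show "eval_p p (Suc n) (C.prism n c) = \<zero>\<^bsub>lev C (Suc n)\<^esub>"
    unfolding C.prism_def using cc
    by (subst eh.hom_finsum)
      (auto simp: alt_hom[OF C.lev_cring C.lev_cring eh.homh] 1 intro!: L.add.finprod_one_eqI)
  have "face C n 0 (bar_prism p n 0 c) =
      gmap False p (lev X n) (lev X n) n (\<lambda>a. face X n 0 (dgn X n 0 a)) (\<lambda>v. face_index 0 (Suc (max 0 v))) c"
    unfolding gbar_sel bar_prism_def
    by (intro gmap_comp[OF _ _ _ _ _ _ _ cc'] lev_cring dgn_hom face_hom face_index_gindex) (auto simp: gvars_iff)
  also have "\<dots> = gmap False p (lev X n) (lev X n) n (\<lambda>a. a) (\<lambda>j. j) c"
    using ring_hom_trans[OF dgn_hom[of 0 n] face_hom[of 0 n]]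
    by (intro gmap_cong[OF _ _ _ _ _ _ cc'] lev_cring)
      (auto simp: face_index_def comp_def gvars_iff face_dgn_same)
  finally have 2: "face C n 0 (bar_prism p n 0 c) = c" by (simp add: gmap_id[OF cc'])
  have "face C n (Suc n) (bar_prism p n n c) =
      gmap False p (lev X n) (lev X n) n (\<lambda>a. face X n (Suc n) (dgn X n n a)) (\<lambda>v. face_index (Suc n) (Suc (max n v))) c"
    unfolding gbar_sel bar_prism_def
    by (intro gmap_comp[OF _ _ _ _ _ _ _ cc'] lev_cring dgn_hom face_hom face_index_gindex) (auto simp: gvars_iff)
  also have "\<dots> = eval_p p n c"
    using ring_hom_trans[OF dgn_hom[of n n] face_hom[of "Suc n" n]] unfolding eval_p_def
    by (intro gmap_cong[OF _ _ _ _ _ _ cc'] lev_cring)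
      (auto simp: face_index_def comp_def gvars_iff face_dgn_Suc max_def)
  finally have 3: "face C n (Suc n) (bar_prism p n n c) = \<zero>\<^bsub>lev C n\<^esub>" by (simp add: c(2))
  show "C.bd n (C.prism n c) = c"
    unfolding C.prism_boundary[OF c(1)] 2 3 using cc by simp
qed

abbreviation t0 :: "nat \<Rightarrow> nat multiset \<Rightarrow> 'a" where
  "t0 n \<equiv> mvar (lev X n) 0"

lemma t0_closed [simp]: "t0 n \<in> carrier (lev C n)"
  unfolding gbar_sel by (rule base_cring.mvar_closed[OF base_lev]) (simp add: gvars_iff)

text \<open>All faces fix \<open>t 0\<close>, since \<open>face_index\<close> fixes the index
  \<open>0\<close>, which is a variable here. Hence multiplication by \<open>t 0\<close> commutes
  with the boundary, although the boundary is only additive.\<close>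

lemma bd_t0:
  assumes x: "x \<in> carrier (lev C (Suc n))"
  shows "C.bd n (t0 (Suc n) \<otimes>\<^bsub>lev C (Suc n)\<^esub> x) = t0 n \<otimes>\<^bsub>lev C n\<^esub> C.bd n x"
proof -
  interpret L: base_cring "lev C n" by (rule C.base_lev)
  have t: "face C n i (t0 (Suc n)) = t0 n" if i: "i \<le> Suc n" for i
  proof -
    have "\<And>v. v \<in> gvars False (Suc n) \<Longrightarrow> face_index i v \<le> Suc n"
      using i by (auto simp: face_index_def gvars_iff)
    from gmap_hom(3)[OF lev_cring lev_cring face_hom[OF i], where V = "gvars False (Suc n)" and th = "face_index i"
        and z = False and p = p and v = 0, OF this]
    have "face C n i (t0 (Suc n)) = gval False p (lev X n) n (face_index i 0)"
      by (simp add: gbar_sel gvars_iff)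
    then show ?thesis by (simp add: face_index_def gval_def)
  qed
  have "C.bd n (t0 (Suc n) \<otimes>\<^bsub>lev C (Suc n)\<^esub> x) =
      (\<Oplus>\<^bsub>lev C n\<^esub>i\<in>{0..Suc n}. t0 n \<otimes>\<^bsub>lev C n\<^esub> alt (lev C n) i (face C n i x))"
    unfolding bnd_chains using x
    by (intro L.finsum_cong') (auto simp: ring_hom_mult[OF C.face_hom] t L.alt_mult)
  also have "\<dots> = t0 n \<otimes>\<^bsub>lev C n\<^esub> C.bd n x"
    unfolding bnd_chains using x by (intro L.finsum_rdistr[symmetric]) auto
  finally show ?thesis .
qed

lemma t0_cancel:
  assumes "x \<in> carrier (lev C n)" "t0 n \<otimes>\<^bsub>lev C n\<^esub> x = \<zero>\<^bsub>lev C n\<^esub>"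
  shows "x = \<zero>\<^bsub>lev C n\<^esub>"
proof -
  interpret L: base_cring "lev X n" by (rule base_lev)
  have x: "x \<in> carrier (mpolys (lev X n) (gvars False n))" using assms by (simp add: gbar_sel)
  have "(\<lambda>u. if 0 \<in># u then x (u - {#0#}) else \<zero>\<^bsub>lev X n\<^esub>) = (\<lambda>u. \<zero>\<^bsub>lev X n\<^esub>)"
    using assms(2) L.mvar_mult[OF x] by (simp add: gbar_sel mpolys_sel(4))
  then have "x u = \<zero>\<^bsub>lev X n\<^esub>" for u
    by (auto dest!: fun_cong[where x = "add_mset 0 u"])
  then show ?thesis by (simp add: gbar_sel mpolys_sel(4) fun_eq_iff)
qed

lemma eval_t0:
  assumes "x \<in> carrier (lev C n)"
  shows "eval_p p n (t0 n \<otimes>\<^bsub>lev C n\<^esub> x) = mconst (lev X n) (pconst p (lev X n)) \<otimes>\<^bsub>lev C n\<^esub> eval_p p n x"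
proof -
  interpret eh: ring_hom_cring "lev C n" "lev C n" "eval_p p n" by (rule e.lev_hom)
  have "eval_p p n (t0 n) = gval False p (lev X n) n (Suc n)"
    unfolding eval_p_def
    by (rule gmap_hom(3)[OF lev_cring lev_cring id_lev_hom, where V = "gvars False n"]) (auto simp: gvars_iff)
  then show ?thesis using assms by (simp add: gval_def)
qed

definition kill_t0 :: "nat \<Rightarrow> (nat multiset \<Rightarrow> 'a) \<Rightarrow> nat multiset \<Rightarrow> 'a" where
  "kill_t0 n = gmap True p (lev X n) (lev X n) n (\<lambda>a. a) (\<lambda>j. j)"

lemma shom_kill_t0: "shom C B kill_t0"
  unfolding kill_t0_def[abs_def]
  by (rule shom_gmap[OF simplicial_cring_axioms simplicial_cring_axioms shom_id]) (auto simp: gindex_def)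

sublocale q: simplicial_hom C B kill_t0
  by (intro simplicial_hom.intro simplicial_hom_axioms.intro simplicial_gbar shom_kill_t0)

lemma B_subset_C: "f \<in> carrier (lev B n) \<Longrightarrow> f \<in> carrier (lev C n)"
  unfolding gbar_sel mpolys_sel gvars_def by fastforce

lemma kill_t0_B: "f \<in> carrier (lev B n) \<Longrightarrow> kill_t0 n f = f"
  unfolding kill_t0_def gbar_sel by (rule gmap_id)

lemma kill_t0_t0:
  assumes "x \<in> carrier (lev C n)"
  shows "kill_t0 n (t0 n \<otimes>\<^bsub>lev C n\<^esub> x) = \<zero>\<^bsub>lev B n\<^esub>"
proof -
  interpret qh: ring_hom_cring "lev C n" "lev B n" "kill_t0 n" by (rule q.lev_hom)
  have "kill_t0 n (t0 n) = gval True p (lev X n) n 0"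
    unfolding kill_t0_def
    by (rule gmap_hom(3)[OF lev_cring lev_cring id_lev_hom, where V = "gvars False n"]) (auto simp: gvars_iff)
  then have "kill_t0 n (t0 n) = \<zero>\<^bsub>lev B n\<^esub>" by (simp add: gval_def gbar_sel mpolys_sel(4) mconst_def)
  then show ?thesis using assms by simp
qed

lemma kill_t0_const:
  assumes "f \<in> carrier (lev C n)"
  shows "kill_t0 n f {#} = f {#}"
proof -
  have th: "\<And>v. v \<in> gvars False n \<Longrightarrow> v \<le> Suc n" by (auto simp: gvars_iff)
  note g = gmap_hom[OF lev_cring lev_cring id_lev_hom, where V = "gvars False n" and th = "\<lambda>j. j" and n1 = n and z = True and p = p and n = n, OF th,
      folded kill_t0_def]
  have "((\<lambda>f. f {#}) \<circ> kill_t0 n) (mconst (lev X n) a) = mconst (lev X n) a {#}" if "a \<in> carrier (lev X n)" for a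
    using that by (simp add: g(2))
  moreover have "((\<lambda>f. f {#}) \<circ> kill_t0 n) (mvar (lev X n) v) = mvar (lev X n) v {#}" if "v \<in> gvars False n" for v
    using g(3)[OF _ that] that by (auto simp: gval_def gvars_iff)
  ultimately have "((\<lambda>f. f {#}) \<circ> kill_t0 n) f = f {#}"
    using base_cring.mpolys_hom_eqI[where F = "(\<lambda>f. f {#}) \<circ> kill_t0 n" and G = "\<lambda>f. f {#}",
        OF base_lev ring_hom_trans[OF g(1) coeff_empty_hom[OF lev_cring]] coeff_empty_hom[OF lev_cring]]
      assms by (simp add: gbar_sel)
  then show ?thesis by simp
qed

lemma kill_t0_kernel:
  assumes c: "c \<in> carrier (lev C n)" and q: "kill_t0 n c = \<zero>\<^bsub>lev B n\<^esub>"
  shows "\<exists>d\<in>carrier (lev C n). c = t0 n \<otimes>\<^bsub>lev C n\<^esub> d"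
proof -
  interpret L: base_cring "lev X n" by (rule base_lev)
  interpret CL: base_cring "lev C n" by (rule C.base_lev)
  interpret qh: ring_hom_cring "lev C n" "lev B n" "kill_t0 n" by (rule q.lev_hom)
  have c': "c \<in> carrier (mpolys (lev X n) (gvars False n))" using c by (simp add: gbar_sel)
  let ?z = "\<zero>\<^bsub>lev X n\<^esub>"
  \<comment> \<open>Division with remainder by \<open>t 0\<close>: \<open>?r\<close> gathers the
    monomials free of \<open>t 0\<close>, and \<open>?d\<close> is the quotient of the others. The
    map \<open>kill_t0\<close> returns \<open>?r\<close>.\<close>
  let ?d = "\<lambda>u. c (add_mset 0 u)" and ?r = "\<lambda>u. if 0 \<in># u then ?z else c u"
  have "{u. ?d u \<noteq> ?z} = add_mset 0 -` {u. c u \<noteq> ?z}" by auto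
  moreover have "finite (add_mset 0 -` {u. c u \<noteq> ?z})"
    by (rule finite_vimageI[OF mpolys_finite_supp[OF c']]) (simp add: inj_def)
  ultimately have "finite {u. ?d u \<noteq> ?z}" by simp
  moreover have "set_mset u \<subseteq> gvars False n" if "?d u \<noteq> ?z" for u
    using mpolys_supp[OF c' that] by simp
  ultimately have d: "?d \<in> carrier (mpolys (lev X n) (gvars False n))"
    using c' by (simp add: mpolys_sel)
  have "{u. ?r u \<noteq> ?z} \<subseteq> {u. c u \<noteq> ?z}" by auto
  then have "finite {u. ?r u \<noteq> ?z}" using mpolys_finite_supp[OF c'] finite_subset by blast
  moreover have "set_mset u \<subseteq> gvars True n" if "?r u \<noteq> ?z" for u
    using mpolys_supp[OF c', of u] that by (auto simp: gvars_iff subset_iff split: if_splits) (metis gr_zeroI)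
  ultimately have r: "?r \<in> carrier (lev B n)"
    using c' by (auto simp: gbar_sel mpolys_sel)
  have "c u = (?r \<oplus>\<^bsub>lev C n\<^esub> t0 n \<otimes>\<^bsub>lev C n\<^esub> ?d) u" for u
    using L.mvar_mult[OF d, of 0] mpolys_coeff_closed[OF c', of u] by (simp add: gbar_sel mpolys_sel(5))
  then have eq: "c = ?r \<oplus>\<^bsub>lev C n\<^esub> t0 n \<otimes>\<^bsub>lev C n\<^esub> ?d" by blast
  have dC: "?d \<in> carrier (lev C n)" using d by (simp add: gbar_sel)
  have "kill_t0 n c = kill_t0 n ?r \<oplus>\<^bsub>lev B n\<^esub> kill_t0 n (t0 n \<otimes>\<^bsub>lev C n\<^esub> ?d)"
    by (subst eq) (use B_subset_C[OF r] dC in simp)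
  also have "\<dots> = ?r" using r dC by (simp add: kill_t0_t0 kill_t0_B)
  finally have "?r = \<zero>\<^bsub>lev B n\<^esub>" using q by simp
  moreover have "\<zero>\<^bsub>lev B n\<^esub> = \<zero>\<^bsub>lev C n\<^esub>" by (simp add: gbar_sel mpolys_sel(4))
  ultimately have "c = t0 n \<otimes>\<^bsub>lev C n\<^esub> ?d"
    using dC by (subst eq) simp
  then show ?thesis using dC by blast
qed

text \<open>As the constant coefficient of \<open>f\<close> is \<open>p a\<close>, the value of
  \<open>f\<close> is \<open>p (a + b)\<close> by \<open>eval_p_const\<close>. The polynomial
  \<open>t 0 (a + b)\<close> has the same value and is removed by \<open>kill_t0\<close>; the
  difference is the required lift.\<close>

lemma ker_eval_lift:
  assumes f: "f \<in> carrier (lev B n)" "bar_aug p X n f = \<zero>\<^bsub>lev (smodp p X) n\<^esub>"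
  shows "\<exists>g\<in>carrier (lev C n). eval_p p n g = \<zero>\<^bsub>lev C n\<^esub> \<and> kill_t0 n g = f"
proof -
  interpret L: base_cring "lev X n" by (rule base_lev)
  interpret CL: base_cring "lev C n" by (rule C.base_lev)
  interpret BL: base_cring "lev B n" by (rule B.base_lev)
  let ?P = "pconst p (lev X n)"
  have fC: "f \<in> carrier (lev C n)" using f(1) by (rule B_subset_C)
  have f0: "f {#} \<in> carrier (lev X n)" using f(1) by (simp add: gbar_sel mpolys_coeff_closed)
  then obtain a where a: "a \<in> carrier (lev X n)" "f {#} = ?P \<otimes>\<^bsub>lev X n\<^esub> a"
    using f(2) L.pcls_zero_iff by (auto simp: bar_aug_def smodp_sel)
  obtain b where b: "b \<in> carrier (lev X n)"
    "eval_p p n f = mconst (lev X n) (f {#} \<oplus>\<^bsub>lev X n\<^esub> ?P \<otimes>\<^bsub>lev X n\<^esub> b)"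
    using eval_p_const[of f n p] fC by (auto simp: gbar_sel)
  define d :: "nat multiset \<Rightarrow> 'a" where "d = mconst (lev X n) (a \<oplus>\<^bsub>lev X n\<^esub> b)"
  have ab: "a \<oplus>\<^bsub>lev X n\<^esub> b \<in> carrier (lev X n)" using a b by simp
  have d: "d \<in> carrier (lev C n)" using ab by (simp add: d_def gbar_sel L.mconst_closed)
  have ed: "eval_p p n d = d"
    unfolding d_def eval_p_def
    by (rule gmap_hom(2)[OF lev_cring lev_cring id_lev_hom _ ab, where V = "gvars False n"]) (auto simp: gvars_iff)
  have "mconst (lev X n) ?P \<otimes>\<^bsub>lev C n\<^esub> d = mconst (lev X n) (?P \<otimes>\<^bsub>lev X n\<^esub> (a \<oplus>\<^bsub>lev X n\<^esub> b))"
    unfolding d_def gbar_sel by (rule ring_hom_mult[OF mconst_hom[OF lev_cring], symmetric]) (use ab in auto)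
  then have "mconst (lev X n) ?P \<otimes>\<^bsub>lev C n\<^esub> d = eval_p p n f"
    using a b by (simp add: L.r_distr)
  then have "eval_p p n (f \<ominus>\<^bsub>lev C n\<^esub> t0 n \<otimes>\<^bsub>lev C n\<^esub> d) = \<zero>\<^bsub>lev C n\<^esub>"
    using fC d by (simp add: e.f_minus eval_t0 ed)
  moreover have "kill_t0 n (f \<ominus>\<^bsub>lev C n\<^esub> t0 n \<otimes>\<^bsub>lev C n\<^esub> d) = f"
    using fC d f(1) by (simp add: q.f_minus kill_t0_t0 kill_t0_B)
  ultimately show ?thesis using fC d by (intro bexI[of _ "f \<ominus>\<^bsub>lev C n\<^esub> t0 n \<otimes>\<^bsub>lev C n\<^esub> d"]) auto
qed

text \<open>The long exact sequence of multiplication by \<open>t 0\<close> on the acyclic ideal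
  \<open>I\<close>. A lift \<open>g\<close> of \<open>f\<close> to \<open>I\<close> has a boundary
  of the form \<open>t 0 c\<close>; once \<open>c\<close> is known to be a cycle in
  \<open>I\<close>, it bounds some \<open>c'\<close> in \<open>I\<close>, and
  \<open>g - t 0 c'\<close> is a cycle in \<open>I\<close> that still lifts
  \<open>f\<close>.\<close>

lemma bar_aug_kernel_acyclic:
  assumes f: "f \<in> cycles (chains B) n" "bar_aug p X n f = \<zero>\<^bsub>lev (smodp p X) n\<^esub>"
  shows "\<exists>f'\<in>carrier (lev B (Suc n)). bar_aug p X (Suc n) f' = \<zero>\<^bsub>lev (smodp p X) (Suc n)\<^esub> \<and> B.bd n f' = f"
proof -
  interpret CL: base_cring "lev C n" by (rule C.base_lev)
  interpret BL: base_cring "lev B n" by (rule B.base_lev)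
  have fB: "f \<in> carrier (lev B n)" using f(1) by (simp add: B.cycles_iff)
  obtain g where g: "g \<in> carrier (lev C n)" "eval_p p n g = \<zero>\<^bsub>lev C n\<^esub>" "kill_t0 n g = f"
    using ker_eval_lift[OF fB f(2)] by blast
  have "\<exists>g\<in>cycles (chains C) n. eval_p p n g = \<zero>\<^bsub>lev C n\<^esub> \<and> kill_t0 n g = f"
  proof (cases n)
    case 0
    then show ?thesis using g by (auto simp: C.cycles_iff)
  next
    case (Suc k)
    interpret Ck: base_cring "lev C k" by (rule C.base_lev)
    have g': "g \<in> carrier (lev C (Suc k))" using g Suc by simp
    have "kill_t0 k (C.bd k g) = \<zero>\<^bsub>lev B k\<^esub>"
      using q.bd_hom[OF g'] g f(1) Suc by (simp add: B.cycles_iff)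
    then obtain c where c: "c \<in> carrier (lev C k)" "C.bd k g = t0 k \<otimes>\<^bsub>lev C k\<^esub> c"
      using kill_t0_kernel[of "C.bd k g" k] g' by auto
    \<comment> \<open>Evaluation turns \<open>t 0\<close> into \<open>p\<close>, so the absence of
      \<open>p\<close>-torsion puts \<open>c\<close> into \<open>I\<close>.\<close>
    have "mconst (lev X k) (pconst p (lev X k)) \<otimes>\<^bsub>lev C k\<^esub> eval_p p k c = \<zero>\<^bsub>lev C k\<^esub>"
      using eval_t0[OF c(1)] c(2) e.bd_hom[OF g'] g(2) Suc by simp
    then have ec: "eval_p p k c = \<zero>\<^bsub>lev C k\<^esub>"
      using ptf_mpolys[of "eval_p p k c" k "gvars False k"] e.f_closed[OF c(1)] by (simp add: gbar_sel)
    have "c \<in> cycles (chains C) k"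
      unfolding C.cycles_iff
    proof (intro conjI allI impI)
      fix j assume k: "k = Suc j"
      have "t0 j \<otimes>\<^bsub>lev C j\<^esub> C.bd j c = C.bd j (C.bd k g)"
        using bd_t0[of c j] c k by simp
      also have "\<dots> = \<zero>\<^bsub>lev C j\<^esub>" using C.bd_bd[of g j] g' k by simp
      finally show "C.bd j c = \<zero>\<^bsub>lev C j\<^esub>"
        using t0_cancel[of "C.bd j c" j] c k by simp
    qed (rule c(1))
    then obtain c' where c': "c' \<in> carrier (lev C n)" "eval_p p n c' = \<zero>\<^bsub>lev C n\<^esub>" "C.bd k c' = c"
      using ker_eval_acyclic ec Suc by blast
    let ?g = "g \<ominus>\<^bsub>lev C n\<^esub> t0 n \<otimes>\<^bsub>lev C n\<^esub> c'"
    have "C.bd k ?g = \<zero>\<^bsub>lev C k\<^esub>"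
      using c c' g' Suc by (simp add: C.bd_minus bd_t0)
    then have "?g \<in> cycles (chains C) n" using g c' Suc by (auto simp: C.cycles_iff)
    moreover have "eval_p p n ?g = \<zero>\<^bsub>lev C n\<^esub>"
    proof -
      interpret L: base_cring "lev X n" by (rule base_lev)
      have "mconst (lev X n) (pconst p (lev X n)) \<in> carrier (lev C n)"
        by (simp add: gbar_sel L.mconst_closed)
      then have "eval_p p n (t0 n \<otimes>\<^bsub>lev C n\<^esub> c') = \<zero>\<^bsub>lev C n\<^esub>"
        using c' by (simp add: eval_t0)
      then show ?thesis using g c' by (simp add: e.f_minus)
    qed
    moreover have "kill_t0 n ?g = f"
      using g c' fB by (simp add: q.f_minus kill_t0_t0)
    ultimately show ?thesis by blast
  qed
  then obtain g where g: "g \<in> cycles (chains C) n" "eval_p p n g = \<zero>\<^bsub>lev C n\<^esub>" "kill_t0 n g = f" by blast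
  then obtain h where h: "h \<in> carrier (lev C (Suc n))" "eval_p p (Suc n) h = \<zero>\<^bsub>lev C (Suc n)\<^esub>" "C.bd n h = g"
    using ker_eval_acyclic by blast
  interpret L: base_cring "lev X (Suc n)" by (rule base_lev)
  \<comment> \<open>As \<open>h\<close> evaluates to zero, its constant coefficient is a multiple of
    \<open>p\<close>, so the image of \<open>h\<close> in \<open>B\<close> lies in the kernel of the
    augmentation.\<close>
  obtain b where b: "b \<in> carrier (lev X (Suc n))"
    "h {#} \<oplus>\<^bsub>lev X (Suc n)\<^esub> pconst p (lev X (Suc n)) \<otimes>\<^bsub>lev X (Suc n)\<^esub> b = \<zero>\<^bsub>lev X (Suc n)\<^esub>"
  proof -
    have z: "\<zero>\<^bsub>lev C (Suc n)\<^esub> = mconst (lev X (Suc n)) \<zero>\<^bsub>lev X (Suc n)\<^esub>"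
      by (simp add: gbar_sel mpolys_sel(4) mconst_def)
    obtain b where b: "b \<in> carrier (lev X (Suc n))" "eval_p p (Suc n) h =
        mconst (lev X (Suc n)) (h {#} \<oplus>\<^bsub>lev X (Suc n)\<^esub> pconst p (lev X (Suc n)) \<otimes>\<^bsub>lev X (Suc n)\<^esub> b)"
      using eval_p_const[of h "Suc n" p] h(1) by (auto simp: gbar_sel)
    show ?thesis
      by (rule that[OF b(1)]) (rule mconst_inj[OF trans[OF trans[OF b(2)[symmetric] h(2)] z]])
  qed
  have h0: "h {#} \<in> carrier (lev X (Suc n))" using h by (simp add: gbar_sel mpolys_coeff_closed)
  have "h {#} = pconst p (lev X (Suc n)) \<otimes>\<^bsub>lev X (Suc n)\<^esub> (\<ominus>\<^bsub>lev X (Suc n)\<^esub> b)"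
    using h0 b by (simp add: L.r_minus L.sum_zero_eq_neg)
  then have "bar_aug p X (Suc n) (kill_t0 (Suc n) h) = \<zero>\<^bsub>lev (smodp p X) (Suc n)\<^esub>"
    using h(1) h0 b(1) L.pcls_zero_iff[OF h0, of p] by (auto simp: bar_aug_def kill_t0_const smodp_sel)
  moreover have "B.bd n (kill_t0 (Suc n) h) = f"
    using q.bd_hom[OF h(1)] h(3) g(3) by simp
  ultimately show ?thesis using h(1) by (intro bexI[of _ "kill_t0 (Suc n) h"]) auto
qed

end

section \<open>Simplicial modules\<close>

text \<open>Faces and degeneracies are semilinear over those of \<open>A\<close>, which is what
  makes them multiplicative on \<open>sqzero A N\<close>.\<close>

locale simplicial_module = simplicial_cring A
  for A :: "'a sring" and N :: "('a, 'm) smodule" +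
  assumes module_lev: "module (lev A n) (mlev N n)"
    and mface_closed: "i \<le> Suc n \<Longrightarrow> x \<in> carrier (mlev N (Suc n)) \<Longrightarrow> mface N n i x \<in> carrier (mlev N n)"
    and mface_add: "i \<le> Suc n \<Longrightarrow> x \<in> carrier (mlev N (Suc n)) \<Longrightarrow> y \<in> carrier (mlev N (Suc n)) \<Longrightarrow>
      mface N n i (x \<oplus>\<^bsub>mlev N (Suc n)\<^esub> y) = mface N n i x \<oplus>\<^bsub>mlev N n\<^esub> mface N n i y"
    and mface_smult: "i \<le> Suc n \<Longrightarrow> a \<in> carrier (lev A (Suc n)) \<Longrightarrow> x \<in> carrier (mlev N (Suc n)) \<Longrightarrow>
      mface N n i (a \<odot>\<^bsub>mlev N (Suc n)\<^esub> x) = face A n i a \<odot>\<^bsub>mlev N n\<^esub> mface N n i x"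
    and mdgn_closed: "i \<le> n \<Longrightarrow> x \<in> carrier (mlev N n) \<Longrightarrow> mdgn N n i x \<in> carrier (mlev N (Suc n))"
    and mdgn_add: "i \<le> n \<Longrightarrow> x \<in> carrier (mlev N n) \<Longrightarrow> y \<in> carrier (mlev N n) \<Longrightarrow>
      mdgn N n i (x \<oplus>\<^bsub>mlev N n\<^esub> y) = mdgn N n i x \<oplus>\<^bsub>mlev N (Suc n)\<^esub> mdgn N n i y"
    and mdgn_smult: "i \<le> n \<Longrightarrow> a \<in> carrier (lev A n) \<Longrightarrow> x \<in> carrier (mlev N n) \<Longrightarrow>
      mdgn N n i (a \<odot>\<^bsub>mlev N n\<^esub> x) = dgn A n i a \<odot>\<^bsub>mlev N (Suc n)\<^esub> mdgn N n i x"
    and mface_mface: "i < j \<Longrightarrow> j \<le> Suc (Suc n) \<Longrightarrow> x \<in> carrier (mlev N (Suc (Suc n))) \<Longrightarrow>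
      mface N n i (mface N (Suc n) j x) = mface N n (j - 1) (mface N (Suc n) i x)"
    and mdgn_mdgn: "i \<le> j \<Longrightarrow> j \<le> n \<Longrightarrow> x \<in> carrier (mlev N n) \<Longrightarrow>
      mdgn N (Suc n) i (mdgn N n j x) = mdgn N (Suc n) (Suc j) (mdgn N n i x)"
    and mface_mdgn_less: "i < j \<Longrightarrow> j \<le> Suc n \<Longrightarrow> x \<in> carrier (mlev N (Suc n)) \<Longrightarrow>
      mface N (Suc n) i (mdgn N (Suc n) j x) = mdgn N n (j - 1) (mface N n i x)"
    and mface_mdgn_same: "i \<le> n \<Longrightarrow> x \<in> carrier (mlev N n) \<Longrightarrow> mface N n i (mdgn N n i x) = x"
    and mface_mdgn_Suc: "i \<le> n \<Longrightarrow> x \<in> carrier (mlev N n) \<Longrightarrow> mface N n (Suc i) (mdgn N n i x) = x"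
    and mface_mdgn_greater: "Suc j < i \<Longrightarrow> i \<le> Suc (Suc n) \<Longrightarrow> x \<in> carrier (mlev N (Suc n)) \<Longrightarrow>
      mface N (Suc n) i (mdgn N (Suc n) j x) = mdgn N n j (mface N n (i - 1) x)"

lemma sqzero_sel:
  "carrier (lev (sqzero A N) n) = carrier (lev A n) \<times> carrier (mlev N n)"
  "(a, x) \<otimes>\<^bsub>lev (sqzero A N) n\<^esub> (b, y) =
    (a \<otimes>\<^bsub>lev A n\<^esub> b, (a \<odot>\<^bsub>mlev N n\<^esub> y) \<oplus>\<^bsub>mlev N n\<^esub> (b \<odot>\<^bsub>mlev N n\<^esub> x))"
  "(a, x) \<oplus>\<^bsub>lev (sqzero A N) n\<^esub> (b, y) = (a \<oplus>\<^bsub>lev A n\<^esub> b, x \<oplus>\<^bsub>mlev N n\<^esub> y)"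
  "\<one>\<^bsub>lev (sqzero A N) n\<^esub> = (\<one>\<^bsub>lev A n\<^esub>, \<zero>\<^bsub>mlev N n\<^esub>)"
  "\<zero>\<^bsub>lev (sqzero A N) n\<^esub> = (\<zero>\<^bsub>lev A n\<^esub>, \<zero>\<^bsub>mlev N n\<^esub>)"
  "face (sqzero A N) n i (a, x) = (face A n i a, mface N n i x)"
  "dgn (sqzero A N) n i (a, x) = (dgn A n i a, mdgn N n i x)"
  by (simp_all add: sqzero_def)

context simplicial_module
begin

lemma add_zero_fixed:
  assumes "abelian_group G" "x \<in> carrier G" "x \<oplus>\<^bsub>G\<^esub> x = x"
  shows "x = \<zero>\<^bsub>G\<^esub>"
proof -
  interpret abelian_group G by fact
  show ?thesis using assms by simp
qed

lemma abelian_mlev: "abelian_group (mlev N n)"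
  using module_lev by (simp add: module_def)

lemma mzero_closed: "\<zero>\<^bsub>mlev N n\<^esub> \<in> carrier (mlev N n)"
proof -
  interpret abelian_group "mlev N n" by (rule abelian_mlev)
  show ?thesis by simp
qed

lemma mface_zero: "i \<le> Suc n \<Longrightarrow> mface N n i \<zero>\<^bsub>mlev N (Suc n)\<^esub> = \<zero>\<^bsub>mlev N n\<^esub>"
proof -
  assume i: "i \<le> Suc n"
  interpret S: abelian_group "mlev N (Suc n)" by (rule abelian_mlev)
  show ?thesis
    using mface_add[OF i S.zero_closed S.zero_closed] mface_closed[OF i S.zero_closed]
    by (intro add_zero_fixed[OF abelian_mlev]) simp_all
qed

lemma mdgn_zero: "i \<le> n \<Longrightarrow> mdgn N n i \<zero>\<^bsub>mlev N n\<^esub> = \<zero>\<^bsub>mlev N (Suc n)\<^esub>"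
proof -
  assume i: "i \<le> n"
  interpret S: abelian_group "mlev N n" by (rule abelian_mlev)
  show ?thesis
    using mdgn_add[OF i S.zero_closed S.zero_closed] mdgn_closed[OF i S.zero_closed]
    by (intro add_zero_fixed[OF abelian_mlev]) simp_all
qed

lemma cring_sqzero: "cring (lev (sqzero A N) n)"
proof -
  interpret M: module "lev A n" "mlev N n" by (rule module_lev)
  show ?thesis
  proof (rule cringI)
    show "abelian_group (lev (sqzero A N) n)"
    proof (rule abelian_groupI)
      fix x assume "x \<in> carrier (lev (sqzero A N) n)"
      then obtain a y where x: "x = (a, y)" "a \<in> carrier (lev A n)" "y \<in> carrier (mlev N n)" by (auto simp: sqzero_sel)
      then show "\<exists>z\<in>carrier (lev (sqzero A N) n). z \<oplus>\<^bsub>lev (sqzero A N) n\<^esub> x = \<zero>\<^bsub>lev (sqzero A N) n\<^esub>"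
        by (intro bexI[where x = "(\<ominus>\<^bsub>lev A n\<^esub> a, \<ominus>\<^bsub>mlev N n\<^esub> y)"])
          (auto simp: sqzero_sel M.R.l_neg M.l_neg)
    qed (auto simp: sqzero_sel M.R.a_ac M.a_ac)
    show "comm_monoid (lev (sqzero A N) n)"
    proof (rule comm_monoidI)
      fix x y z assume "x \<in> carrier (lev (sqzero A N) n)" "y \<in> carrier (lev (sqzero A N) n)"
        "z \<in> carrier (lev (sqzero A N) n)"
      then show "x \<otimes>\<^bsub>lev (sqzero A N) n\<^esub> y \<otimes>\<^bsub>lev (sqzero A N) n\<^esub> z =
          x \<otimes>\<^bsub>lev (sqzero A N) n\<^esub> (y \<otimes>\<^bsub>lev (sqzero A N) n\<^esub> z)"
        by (auto simp: sqzero_sel M.R.m_assoc M.smult_r_distr M.smult_assoc1[symmetric] M.a_assoc M.R.m_comm)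
          (simp add: M.R.m_comm M.R.m_lcomm)?
    qed (auto simp: sqzero_sel M.R.m_comm M.a_comm)
  next
    fix x y z assume "x \<in> carrier (lev (sqzero A N) n)" "y \<in> carrier (lev (sqzero A N) n)"
      "z \<in> carrier (lev (sqzero A N) n)"
    then show "(x \<oplus>\<^bsub>lev (sqzero A N) n\<^esub> y) \<otimes>\<^bsub>lev (sqzero A N) n\<^esub> z =
        x \<otimes>\<^bsub>lev (sqzero A N) n\<^esub> z \<oplus>\<^bsub>lev (sqzero A N) n\<^esub> y \<otimes>\<^bsub>lev (sqzero A N) n\<^esub> z"
      by (auto simp: sqzero_sel M.R.l_distr M.smult_r_distr M.smult_l_distr M.a_ac)
  qed
qed

lemma simplicial_sqzero: "simplicial_cring (sqzero A N)"
proof (rule simplicial_cring.intro)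
  fix n i :: nat assume i: "i \<le> Suc n"
  interpret S: module "lev A (Suc n)" "mlev N (Suc n)" by (rule module_lev)
  show "face (sqzero A N) n i \<in> ring_hom (lev (sqzero A N) (Suc n)) (lev (sqzero A N) n)"
    by (rule ring_hom_memI)
      (use i in \<open>auto simp: sqzero_sel mface_closed mface_add mface_smult mface_zero ring_hom_mult[OF face_hom]
        ring_hom_add[OF face_hom] ring_hom_one[OF face_hom]\<close>)
next
  fix n i :: nat assume i: "i \<le> n"
  interpret S: module "lev A n" "mlev N n" by (rule module_lev)
  show "dgn (sqzero A N) n i \<in> ring_hom (lev (sqzero A N) n) (lev (sqzero A N) (Suc n))"
    by (rule ring_hom_memI)
      (use i in \<open>auto simp: sqzero_sel mdgn_closed mdgn_add mdgn_smult mdgn_zero ring_hom_mult[OF dgn_hom]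
        ring_hom_add[OF dgn_hom] ring_hom_one[OF dgn_hom]\<close>)
next
  fix n i j :: nat and x assume "i < j" "j \<le> Suc (Suc n)" "x \<in> carrier (lev (sqzero A N) (Suc (Suc n)))"
  then show "face (sqzero A N) n i (face (sqzero A N) (Suc n) j x) = face (sqzero A N) n (j - 1) (face (sqzero A N) (Suc n) i x)"
    using face_face[of i j n] mface_mface[of i j n] by (auto simp: sqzero_sel)
next
  fix n i j :: nat and x assume "i \<le> j" "j \<le> n" "x \<in> carrier (lev (sqzero A N) n)"
  then show "dgn (sqzero A N) (Suc n) i (dgn (sqzero A N) n j x) = dgn (sqzero A N) (Suc n) (Suc j) (dgn (sqzero A N) n i x)"
    using dgn_dgn[of i j n] mdgn_mdgn[of i j n] by (auto simp: sqzero_sel)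
next
  fix n i j :: nat and x assume "i < j" "j \<le> Suc n" "x \<in> carrier (lev (sqzero A N) (Suc n))"
  then show "face (sqzero A N) (Suc n) i (dgn (sqzero A N) (Suc n) j x) = dgn (sqzero A N) n (j - 1) (face (sqzero A N) n i x)"
    using face_dgn_less[of i j n] mface_mdgn_less[of i j n] by (auto simp: sqzero_sel)
next
  fix n i j :: nat and x assume "Suc j < i" "i \<le> Suc (Suc n)" "x \<in> carrier (lev (sqzero A N) (Suc n))"
  then show "face (sqzero A N) (Suc n) i (dgn (sqzero A N) (Suc n) j x) = dgn (sqzero A N) n j (face (sqzero A N) n (i - 1) x)"
    using face_dgn_greater[of j i n] mface_mdgn_greater[of j i n] by (auto simp: sqzero_sel)
next
  fix n i :: nat and x assume "i \<le> n" "x \<in> carrier (lev (sqzero A N) n)"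
  then show "face (sqzero A N) n i (dgn (sqzero A N) n i x) = x" "face (sqzero A N) n (Suc i) (dgn (sqzero A N) n i x) = x"
    using face_dgn_same[of i n] mface_mdgn_same[of i n] face_dgn_Suc[of i n] mface_mdgn_Suc[of i n]
    by (auto simp: sqzero_sel)
qed (rule cring_sqzero)

end

section \<open>The ring as a module, constant modules, shifts and cofibres\<close>

lemma sself_sel:
  "carrier (mlev (sself A) n) = carrier (lev A n)" "\<zero>\<^bsub>mlev (sself A) n\<^esub> = \<zero>\<^bsub>lev A n\<^esub>"
  "x \<oplus>\<^bsub>mlev (sself A) n\<^esub> y = x \<oplus>\<^bsub>lev A n\<^esub> y" "a \<odot>\<^bsub>mlev (sself A) n\<^esub> x = a \<otimes>\<^bsub>lev A n\<^esub> x"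
  "mface (sself A) = face A" "mdgn (sself A) = dgn A"
  by (simp_all add: sself_def)

lemma simplicial_sself:
  assumes "simplicial_cring A"
  shows "simplicial_module A (sself A)"
proof -
  interpret A: simplicial_cring A by fact
  have m: "module (lev A n) (mlev (sself A) n)" for n
  proof -
    interpret L: base_cring "lev A n" by (rule A.base_lev)
    have "abelian_group (mlev (sself A) n)"
      by (rule abelian_groupI) (auto simp: sself_sel L.a_ac intro: bexI[where x = "\<ominus>\<^bsub>lev A n\<^esub> x" for x] L.l_neg)
    then show ?thesis
      by (rule moduleI[OF A.lev_cring]) (auto simp: sself_sel L.l_distr L.r_distr L.m_assoc)
  qed
  show ?thesis
    by (rule simplicial_module.intro[OF assms], rule simplicial_module_axioms.intro, rule m)
      (auto simp: sself_sel ring_hom_add[OF A.face_hom] ring_hom_mult[OF A.face_hom] ring_hom_add[OF A.dgn_hom]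
        ring_hom_mult[OF A.dgn_hom] A.face_face A.dgn_dgn A.face_dgn_less A.face_dgn_same A.face_dgn_Suc A.face_dgn_greater)
qed

lemma sconst_module_sel:
  "carrier (mlev (sconst_module pi M) n) = carrier M" "\<zero>\<^bsub>mlev (sconst_module pi M) n\<^esub> = \<zero>\<^bsub>M\<^esub>"
  "x \<oplus>\<^bsub>mlev (sconst_module pi M) n\<^esub> y = x \<oplus>\<^bsub>M\<^esub> y" "a \<odot>\<^bsub>mlev (sconst_module pi M) n\<^esub> x = pi n a \<odot>\<^bsub>M\<^esub> x"
  "mface (sconst_module pi M) n i x = x" "mdgn (sconst_module pi M) n i x = x"
  by (simp_all add: sconst_module_def)

lemma simplicial_sconst_module:
  fixes M :: "('s, 'm) module"
  assumes "simplicial_cring A" "module S M" "shom A (sconst S) pi"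
  shows "simplicial_module A (sconst_module pi M)"
proof -
  interpret A: simplicial_cring A by fact
  interpret M: module S M by fact
  have h: "pi n \<in> ring_hom (lev A n) S" for n
    using shomD(1)[OF assms(3), of n] by (simp add: sconst_def)
  have m: "module (lev A n) (mlev (sconst_module pi M) n)" for n
  proof -
    have "abelian_group (mlev (sconst_module pi M) n)"
      by (rule abelian_groupI) (auto simp: sconst_module_sel M.a_ac intro: bexI[where x = "\<ominus>\<^bsub>M\<^esub> x" for x] M.l_neg)
    then show ?thesis
      by (rule moduleI[OF A.lev_cring])
        (auto simp: sconst_module_sel M.smult_l_distr M.smult_r_distr M.smult_assoc1 ring_hom_add[OF h]
          ring_hom_mult[OF h] ring_hom_one[OF h] ring_hom_closed[OF h])
  qed
  show ?thesis
    by (rule simplicial_module.intro[OF assms(1)], rule simplicial_module_axioms.intro, rule m)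
      (use shomD(2,3)[OF assms(3)] in \<open>auto simp: sconst_module_sel sconst_def\<close>)
qed

lemma sshift_sel:
  "carrier (mlev (sshift L) n) = {1..n} \<rightarrow>\<^sub>E carrier (mlev L n)"
  "\<zero>\<^bsub>mlev (sshift L) n\<^esub> = (\<lambda>j\<in>{1..n}. \<zero>\<^bsub>mlev L n\<^esub>)"
  "x \<oplus>\<^bsub>mlev (sshift L) n\<^esub> y = (\<lambda>j\<in>{1..n}. x j \<oplus>\<^bsub>mlev L n\<^esub> y j)"
  "a \<odot>\<^bsub>mlev (sshift L) n\<^esub> x = (\<lambda>j\<in>{1..n}. a \<odot>\<^bsub>mlev L n\<^esub> x j)"
  "mface (sshift L) = tuple_face L" "mdgn (sshift L) = tuple_dgn L"
  by (simp_all add: sshift_def)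

lemma PiE_memD: "x \<in> {1..n} \<rightarrow>\<^sub>E T \<Longrightarrow> Suc 0 \<le> j \<Longrightarrow> j \<le> n \<Longrightarrow> x j \<in> T"
  by (auto simp: PiE_iff)

text \<open>Extensionality reduces equality of tuples to their entries. Both \<open>1\<close> and
  \<open>Suc 0\<close> are covered as lower bounds, since simplification turns the first into the
  second.\<close>

lemma tuple_ext:
  "tuple_face L n k x \<in> extensional {1..n}" "tuple_dgn L n k x \<in> extensional {1..Suc n}"
  "x \<in> {1..n} \<rightarrow>\<^sub>E T \<Longrightarrow> x \<in> extensional {1..n}" "restrict u {1..n} \<in> extensional {1..n}"
  "tuple_face L n k x \<in> extensional {Suc 0..n}" "tuple_dgn L n k x \<in> extensional {Suc 0..Suc n}"
  by (auto simp: tuple_face_def tuple_dgn_def PiE_iff)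

lemma tuple_eqI:
  fixes y z :: "nat \<Rightarrow> 'm"
  assumes "y \<in> extensional {1..n}" "z \<in> extensional {1..n}" "\<And>l. Suc 0 \<le> l \<Longrightarrow> l \<le> n \<Longrightarrow> y l = z l"
  shows "y = z"
  using assms by (intro extensionalityI[where A = "{1..n}"]) auto

lemma tuple_face_apply:
  "Suc 0 \<le> j \<Longrightarrow> j \<le> n \<Longrightarrow> tuple_face L n k x j =
    (if j < k then mface L n k (x j)
     else if j = k then mface L n k (x j) \<oplus>\<^bsub>mlev L n\<^esub> mface L n k (x (Suc j))
     else mface L n k (x (Suc j)))"
  by (simp add: tuple_face_def)

lemma tuple_dgn_apply:
  "Suc 0 \<le> j \<Longrightarrow> j \<le> Suc n \<Longrightarrow> tuple_dgn L n k x j =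
    (if j \<le> k then mdgn L n k (x j)
     else if j = Suc k then \<zero>\<^bsub>mlev L (Suc n)\<^esub>
     else mdgn L n k (x (j - 1)))"
  by (simp add: tuple_dgn_def)

context simplicial_module
begin

lemma module_sshift: "module (lev A n) (mlev (sshift N) n)"
proof -
  interpret M: module "lev A n" "mlev N n" by (rule module_lev)
  note [simp] = PiE_memD[where T = "carrier (mlev N n)" for n] tuple_ext
  have "abelian_group (mlev (sshift N) n)"
  proof (rule abelian_groupI)
    fix x assume x: "x \<in> carrier (mlev (sshift N) n)"
    then have "(\<lambda>j\<in>{1..n}. \<ominus>\<^bsub>mlev N n\<^esub> x j) \<in> carrier (mlev (sshift N) n)"
      by (auto simp: sshift_sel PiE_iff)
    moreover have "(\<lambda>j\<in>{1..n}. \<ominus>\<^bsub>mlev N n\<^esub> x j) \<oplus>\<^bsub>mlev (sshift N) n\<^esub> x = \<zero>\<^bsub>mlev (sshift N) n\<^esub>"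
      unfolding sshift_sel using x by (intro tuple_eqI) (auto simp: sshift_sel M.l_neg)
    ultimately show "\<exists>y\<in>carrier (mlev (sshift N) n). y \<oplus>\<^bsub>mlev (sshift N) n\<^esub> x = \<zero>\<^bsub>mlev (sshift N) n\<^esub>" by blast
    show "\<zero>\<^bsub>mlev (sshift N) n\<^esub> \<oplus>\<^bsub>mlev (sshift N) n\<^esub> x = x"
      using x unfolding sshift_sel by (intro tuple_eqI[where n = n]) (auto simp: PiE_iff)
    fix y assume y: "y \<in> carrier (mlev (sshift N) n)"
    then show "x \<oplus>\<^bsub>mlev (sshift N) n\<^esub> y \<in> carrier (mlev (sshift N) n)"
      using x by (auto simp: sshift_sel PiE_iff)
    show "x \<oplus>\<^bsub>mlev (sshift N) n\<^esub> y = y \<oplus>\<^bsub>mlev (sshift N) n\<^esub> x"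
      using x y unfolding sshift_sel by (intro tuple_eqI) (auto simp: M.a_comm)
    fix z assume z: "z \<in> carrier (mlev (sshift N) n)"
    show "x \<oplus>\<^bsub>mlev (sshift N) n\<^esub> y \<oplus>\<^bsub>mlev (sshift N) n\<^esub> z =
        x \<oplus>\<^bsub>mlev (sshift N) n\<^esub> (y \<oplus>\<^bsub>mlev (sshift N) n\<^esub> z)"
      using x y z unfolding sshift_sel by (intro tuple_eqI) (auto simp: M.a_assoc)
  next
    show "\<zero>\<^bsub>mlev (sshift N) n\<^esub> \<in> carrier (mlev (sshift N) n)" by (auto simp: sshift_sel PiE_iff)
  qed
  then show ?thesis
  proof (rule moduleI[OF lev_cring])
    fix a x assume a: "a \<in> carrier (lev A n)" and x: "x \<in> carrier (mlev (sshift N) n)"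
    then show "a \<odot>\<^bsub>mlev (sshift N) n\<^esub> x \<in> carrier (mlev (sshift N) n)" by (auto simp: sshift_sel PiE_iff)
    fix b assume b: "b \<in> carrier (lev A n)"
    show "(a \<oplus>\<^bsub>lev A n\<^esub> b) \<odot>\<^bsub>mlev (sshift N) n\<^esub> x =
        a \<odot>\<^bsub>mlev (sshift N) n\<^esub> x \<oplus>\<^bsub>mlev (sshift N) n\<^esub> b \<odot>\<^bsub>mlev (sshift N) n\<^esub> x"
      using a b x unfolding sshift_sel by (intro tuple_eqI) (auto simp: M.smult_l_distr)
    show "(a \<otimes>\<^bsub>lev A n\<^esub> b) \<odot>\<^bsub>mlev (sshift N) n\<^esub> x = a \<odot>\<^bsub>mlev (sshift N) n\<^esub> (b \<odot>\<^bsub>mlev (sshift N) n\<^esub> x)"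
      using a b x unfolding sshift_sel by (intro tuple_eqI) (auto simp: M.smult_assoc1)
  next
    fix a x y assume "a \<in> carrier (lev A n)" "x \<in> carrier (mlev (sshift N) n)" "y \<in> carrier (mlev (sshift N) n)"
    then show "a \<odot>\<^bsub>mlev (sshift N) n\<^esub> (x \<oplus>\<^bsub>mlev (sshift N) n\<^esub> y) =
        a \<odot>\<^bsub>mlev (sshift N) n\<^esub> x \<oplus>\<^bsub>mlev (sshift N) n\<^esub> a \<odot>\<^bsub>mlev (sshift N) n\<^esub> y"
      unfolding sshift_sel by (intro tuple_eqI) (auto simp: M.smult_r_distr)
  next
    fix x assume "x \<in> carrier (mlev (sshift N) n)"
    then show "\<one>\<^bsub>lev A n\<^esub> \<odot>\<^bsub>mlev (sshift N) n\<^esub> x = x"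
      unfolding sshift_sel by (intro tuple_eqI[where n = n]) (auto simp: PiE_iff)
  qed
qed

text \<open>The identities hold entry by entry. Those between faces use associativity, since two
  neighbouring inner faces add up three consecutive entries.\<close>

lemma simplicial_sshift: "simplicial_module A (sshift N)"
proof (rule simplicial_module.intro[OF simplicial_cring_axioms], rule simplicial_module_axioms.intro)
  note [simp] = PiE_memD[where T = "carrier (mlev N n)" for n] mface_closed mdgn_closed mzero_closed tuple_ext tuple_face_apply tuple_dgn_apply
  interpret M: abelian_group "mlev N n" for n by (rule abelian_mlev)
  fix n i j :: nat and x y :: "nat \<Rightarrow> 'm" and a
  show "module (lev A n) (mlev (sshift N) n)" by (rule module_sshift)
  {
    assume i: "i \<le> Suc n" and x: "x \<in> carrier (mlev (sshift N) (Suc n))"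
    then show "mface (sshift N) n i x \<in> carrier (mlev (sshift N) n)"
      by (auto simp: sshift_sel PiE_iff)
    {
      assume "y \<in> carrier (mlev (sshift N) (Suc n))"
      then show "mface (sshift N) n i (x \<oplus>\<^bsub>mlev (sshift N) (Suc n)\<^esub> y) =
          mface (sshift N) n i x \<oplus>\<^bsub>mlev (sshift N) n\<^esub> mface (sshift N) n i y"
        unfolding sshift_sel using i x by (intro tuple_eqI) (auto simp: sshift_sel mface_add M.a_ac)
    }
    {
      assume a: "a \<in> carrier (lev A (Suc n))"
      interpret Mn: module "lev A n" "mlev N n" by (rule module_lev)
      show "mface (sshift N) n i (a \<odot>\<^bsub>mlev (sshift N) (Suc n)\<^esub> x) =
          face A n i a \<odot>\<^bsub>mlev (sshift N) n\<^esub> mface (sshift N) n i x"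
        unfolding sshift_sel using i x a
        by (intro tuple_eqI) (auto simp: sshift_sel mface_smult Mn.smult_r_distr)
    }
  }
  {
    assume i: "i \<le> n" and x: "x \<in> carrier (mlev (sshift N) n)"
    show "mdgn (sshift N) n i x \<in> carrier (mlev (sshift N) (Suc n))"
      using i x by (auto simp: sshift_sel PiE_iff)
    {
      assume "y \<in> carrier (mlev (sshift N) n)"
      then show "mdgn (sshift N) n i (x \<oplus>\<^bsub>mlev (sshift N) n\<^esub> y) =
          mdgn (sshift N) n i x \<oplus>\<^bsub>mlev (sshift N) (Suc n)\<^esub> mdgn (sshift N) n i y"
        unfolding sshift_sel using i x by (intro tuple_eqI) (auto simp: sshift_sel mdgn_add)
    }
    {
      assume a: "a \<in> carrier (lev A n)"
      interpret Mn: module "lev A (Suc n)" "mlev N (Suc n)" by (rule module_lev)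
      show "mdgn (sshift N) n i (a \<odot>\<^bsub>mlev (sshift N) n\<^esub> x) =
          dgn A n i a \<odot>\<^bsub>mlev (sshift N) (Suc n)\<^esub> mdgn (sshift N) n i x"
        unfolding sshift_sel using i x a by (intro tuple_eqI) (auto simp: sshift_sel mdgn_smult)
    }
    have x': "x \<in> extensional {Suc 0..n}" using x by (auto simp: sshift_sel PiE_iff)
    show "mface (sshift N) n i (mdgn (sshift N) n i x) = x"
      unfolding sshift_sel using i x x'
      by (intro tuple_eqI[where n = n]) (auto simp: sshift_sel mface_mdgn_same mface_mdgn_Suc mface_zero)
    show "mface (sshift N) n (Suc i) (mdgn (sshift N) n i x) = x"
      unfolding sshift_sel using i x x'
      by (intro tuple_eqI[where n = n]) (auto simp: sshift_sel mface_mdgn_same mface_mdgn_Suc mface_zero)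
  }
  {
    assume ij: "i < j" "j \<le> Suc (Suc n)" and x: "x \<in> carrier (mlev (sshift N) (Suc (Suc n)))"
    show "mface (sshift N) n i (mface (sshift N) (Suc n) j x) = mface (sshift N) n (j - 1) (mface (sshift N) (Suc n) i x)"
      unfolding sshift_sel using ij x mface_mface[OF ij]
      by (intro tuple_eqI[where n = n]) (auto simp: sshift_sel mface_add M.a_assoc)
  }
  {
    assume ij: "i \<le> j" "j \<le> n" and x: "x \<in> carrier (mlev (sshift N) n)"
    show "mdgn (sshift N) (Suc n) i (mdgn (sshift N) n j x) = mdgn (sshift N) (Suc n) (Suc j) (mdgn (sshift N) n i x)"
      unfolding sshift_sel using ij x mdgn_mdgn[OF ij]
      by (intro tuple_eqI[where n = "Suc (Suc n)"]) (auto simp: sshift_sel mdgn_zero)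
  }
  {
    assume ij: "i < j" "j \<le> Suc n" and x: "x \<in> carrier (mlev (sshift N) (Suc n))"
    show "mface (sshift N) (Suc n) i (mdgn (sshift N) (Suc n) j x) = mdgn (sshift N) n (j - 1) (mface (sshift N) n i x)"
      unfolding sshift_sel using ij x mface_mdgn_less[OF ij]
      by (intro tuple_eqI[where n = "Suc n"]) (auto simp: sshift_sel mface_zero mdgn_add)
  }
  {
    assume ij: "Suc j < i" "i \<le> Suc (Suc n)" and x: "x \<in> carrier (mlev (sshift N) (Suc n))"
    show "mface (sshift N) (Suc n) i (mdgn (sshift N) (Suc n) j x) = mdgn (sshift N) n j (mface (sshift N) n (i - 1) x)"
      unfolding sshift_sel using ij x mface_mdgn_greater[OF ij]
      by (intro tuple_eqI[where n = "Suc n"]) (auto simp: sshift_sel mface_zero mdgn_add)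
  }
qed

end

lemma scofib_sel:
  "carrier (mlev (scofib L N g) n) = carrier (mlev N n) \<times> carrier (mlev (sshift L) n)"
  "\<zero>\<^bsub>mlev (scofib L N g) n\<^esub> = (\<zero>\<^bsub>mlev N n\<^esub>, \<zero>\<^bsub>mlev (sshift L) n\<^esub>)"
  "(y, x) \<oplus>\<^bsub>mlev (scofib L N g) n\<^esub> (y', x') = (y \<oplus>\<^bsub>mlev N n\<^esub> y', x \<oplus>\<^bsub>mlev (sshift L) n\<^esub> x')"
  "a \<odot>\<^bsub>mlev (scofib L N g) n\<^esub> (y, x) = (a \<odot>\<^bsub>mlev N n\<^esub> y, a \<odot>\<^bsub>mlev (sshift L) n\<^esub> x)"
  "mface (scofib L N g) n k (y, x) =
    (if k = 0 then mface N n k y \<oplus>\<^bsub>mlev N n\<^esub> g n (mface L n k (x 1)) else mface N n k y, mface (sshift L) n k x)"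
  "mdgn (scofib L N g) n k (y, x) = (mdgn N n k y, mdgn (sshift L) n k x)"
  by (simp_all add: scofib_def sshift_def)

locale simplicial_module_map = L: simplicial_module A L + N: simplicial_module A N
  for A :: "'a sring" and L :: "('a, 'l) smodule" and N :: "('a, 'm) smodule" +
  fixes g :: "nat \<Rightarrow> 'l \<Rightarrow> 'm"
  assumes g_closed: "x \<in> carrier (mlev L n) \<Longrightarrow> g n x \<in> carrier (mlev N n)"
    and g_add: "x \<in> carrier (mlev L n) \<Longrightarrow> y \<in> carrier (mlev L n) \<Longrightarrow>
      g n (x \<oplus>\<^bsub>mlev L n\<^esub> y) = g n x \<oplus>\<^bsub>mlev N n\<^esub> g n y"
    and g_smult: "a \<in> carrier (lev A n) \<Longrightarrow> x \<in> carrier (mlev L n) \<Longrightarrow>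
      g n (a \<odot>\<^bsub>mlev L n\<^esub> x) = a \<odot>\<^bsub>mlev N n\<^esub> g n x"
    and g_face: "i \<le> Suc n \<Longrightarrow> x \<in> carrier (mlev L (Suc n)) \<Longrightarrow> g n (mface L n i x) = mface N n i (g (Suc n) x)"
    and g_dgn: "i \<le> n \<Longrightarrow> x \<in> carrier (mlev L n) \<Longrightarrow> g (Suc n) (mdgn L n i x) = mdgn N n i (g n x)"
begin

lemma g_zero: "g n \<zero>\<^bsub>mlev L n\<^esub> = \<zero>\<^bsub>mlev N n\<^esub>"
proof -
  interpret L': abelian_group "mlev L n" by (rule L.abelian_mlev)
  show ?thesis
    using g_add[OF L'.zero_closed L'.zero_closed] g_closed[OF L'.zero_closed]
    by (intro N.add_zero_fixed[OF N.abelian_mlev]) simp_all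
qed

lemma module_scofib: "module (lev A n) (mlev (scofib L N g) n)"
proof -
  interpret S: module "lev A n" "mlev (sshift L) n" by (rule L.module_sshift)
  interpret N': module "lev A n" "mlev N n" by (rule N.module_lev)
  have "abelian_group (mlev (scofib L N g) n)"
  proof (rule abelian_groupI)
    fix x assume "x \<in> carrier (mlev (scofib L N g) n)"
    then show "\<exists>z\<in>carrier (mlev (scofib L N g) n). z \<oplus>\<^bsub>mlev (scofib L N g) n\<^esub> x = \<zero>\<^bsub>mlev (scofib L N g) n\<^esub>"
      by (intro bexI[where x = "(\<ominus>\<^bsub>mlev N n\<^esub> fst x, \<ominus>\<^bsub>mlev (sshift L) n\<^esub> snd x)"])
        (auto simp: scofib_sel S.l_neg N'.l_neg)
  qed (auto simp: scofib_sel S.a_ac N'.a_ac)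
  then show ?thesis
    by (rule moduleI[OF L.lev_cring])
      (auto simp: scofib_sel S.smult_l_distr N'.smult_l_distr S.smult_r_distr N'.smult_r_distr
        S.smult_assoc1 N'.smult_assoc1)
qed

text \<open>Only face \<open>0\<close> mixes the two components. It reads the first entry of the
  tuple, so the identities not inherited from \<open>N\<close> and the shift concern what happens to
  that entry (\<open>face1\<close> and \<open>dgn1\<close>).\<close>

lemma simplicial_scofib: "simplicial_module A (scofib L N g)"
proof (rule simplicial_module.intro[OF L.simplicial_cring_axioms], rule simplicial_module_axioms.intro)
  interpret S: simplicial_module A "sshift L" by (rule L.simplicial_sshift)
  interpret N': abelian_group "mlev N n" for n by (rule N.abelian_mlev)
  have x1: "x 1 \<in> carrier (mlev L n)" if "x \<in> carrier (mlev (sshift L) n)" "1 \<le> n" for x n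
    using that by (auto simp: sshift_sel PiE_iff)
  note [simp] = x1[simplified] g_closed N.mface_closed N.mdgn_closed L.mface_closed L.mdgn_closed
    S.mface_closed S.mdgn_closed
  have face1: "mface (sshift L) n k x 1 = (if k = 0 then mface L n k (x 2) else if k = 1 then
      mface L n k (x 1) \<oplus>\<^bsub>mlev L n\<^esub> mface L n k (x 2) else mface L n k (x 1))" if "1 \<le> n" for n k x
    using that by (simp add: sshift_sel tuple_face_apply numeral_2_eq_2)
  have dgn1: "mdgn (sshift L) n k x 1 = (if k = 0 then \<zero>\<^bsub>mlev L (Suc n)\<^esub> else mdgn L n k (x 1))" for n k x
    by (simp add: sshift_sel tuple_dgn_apply)
  have x2: "x 2 \<in> carrier (mlev L n)" if "x \<in> carrier (mlev (sshift L) n)" "2 \<le> n" for x n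
    using that by (auto simp: sshift_sel PiE_iff)
  fix n i j :: nat and x y and a
  show "module (lev A n) (mlev (scofib L N g) n)" by (rule module_scofib)
  {
    assume i: "i \<le> Suc n" and x: "x \<in> carrier (mlev (scofib L N g) (Suc n))"
    then show "mface (scofib L N g) n i x \<in> carrier (mlev (scofib L N g) n)"
      by (auto simp: scofib_sel)
    {
      assume "y \<in> carrier (mlev (scofib L N g) (Suc n))"
      then show "mface (scofib L N g) n i (x \<oplus>\<^bsub>mlev (scofib L N g) (Suc n)\<^esub> y) =
          mface (scofib L N g) n i x \<oplus>\<^bsub>mlev (scofib L N g) n\<^esub> mface (scofib L N g) n i y"
        using i x by (auto simp: scofib_sel S.mface_add N.mface_add)
          (auto simp: sshift_sel(3) L.mface_add g_add N'.a_ac)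
    }
    {
      assume a: "a \<in> carrier (lev A (Suc n))"
      interpret Nn: module "lev A n" "mlev N n" by (rule N.module_lev)
      show "mface (scofib L N g) n i (a \<odot>\<^bsub>mlev (scofib L N g) (Suc n)\<^esub> x) =
          face A n i a \<odot>\<^bsub>mlev (scofib L N g) n\<^esub> mface (scofib L N g) n i x"
        using i x a by (auto simp: scofib_sel S.mface_smult N.mface_smult)
          (auto simp: sshift_sel(4) L.mface_smult g_smult Nn.smult_r_distr)
    }
  }
  {
    assume i: "i \<le> n" and x: "x \<in> carrier (mlev (scofib L N g) n)"
    show "mdgn (scofib L N g) n i x \<in> carrier (mlev (scofib L N g) (Suc n))"
      using i x by (auto simp: scofib_sel)
    {
      assume "y \<in> carrier (mlev (scofib L N g) n)"
      then show "mdgn (scofib L N g) n i (x \<oplus>\<^bsub>mlev (scofib L N g) n\<^esub> y) =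
          mdgn (scofib L N g) n i x \<oplus>\<^bsub>mlev (scofib L N g) (Suc n)\<^esub> mdgn (scofib L N g) n i y"
        using i x by (auto simp: scofib_sel S.mdgn_add N.mdgn_add)
    }
    {
      assume a: "a \<in> carrier (lev A n)"
      show "mdgn (scofib L N g) n i (a \<odot>\<^bsub>mlev (scofib L N g) n\<^esub> x) =
          dgn A n i a \<odot>\<^bsub>mlev (scofib L N g) (Suc n)\<^esub> mdgn (scofib L N g) n i x"
        using i x a by (auto simp: scofib_sel S.mdgn_smult N.mdgn_smult)
    }
    show "mface (scofib L N g) n i (mdgn (scofib L N g) n i x) = x"
      using i x
      by (auto simp: scofib_sel S.mface_mdgn_same N.mface_mdgn_same dgn1[simplified] L.mface_zero g_zero)
    show "mface (scofib L N g) n (Suc i) (mdgn (scofib L N g) n i x) = x"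
      using i x by (auto simp: scofib_sel S.mface_mdgn_Suc N.mface_mdgn_Suc)
  }
  {
    assume ij: "i < j" "j \<le> Suc (Suc n)" and x: "x \<in> carrier (mlev (scofib L N g) (Suc (Suc n)))"
    obtain u v where uv: "x = (u, v)" "u \<in> carrier (mlev N (Suc (Suc n)))" "v \<in> carrier (mlev (sshift L) (Suc (Suc n)))"
      using x by (auto simp: scofib_sel)
    have v: "v 1 \<in> carrier (mlev L (Suc (Suc n)))" "v 2 \<in> carrier (mlev L (Suc (Suc n)))"
      using x1[OF uv(3)] x2[OF uv(3)] by auto
    consider "i = 0" "j = 1" | "i = 0" "1 < j" | "0 < i" using ij by linarith
    then show "mface (scofib L N g) n i (mface (scofib L N g) (Suc n) j x) =
        mface (scofib L N g) n (j - 1) (mface (scofib L N g) (Suc n) i x)"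
    proof cases
      \<comment> \<open>One side applies \<open>g\<close> to the sum of the first two entries, the
        other adds their images one after the other.\<close>
      case 1
      have "mface L n 0 (mface L (Suc n) 1 (v l)) = mface L n 0 (mface L (Suc n) 0 (v l))" if "l = 1 \<or> l = 2" for l
        using L.mface_mface[of 0 1 n "v l"] v that by auto
      then show ?thesis
        using 1 ij uv v S.mface_mface[of 0 1 n v] N.mface_mface[of 0 1 n u]
        by (simp add: scofib_sel face1[simplified] L.mface_add g_add N.mface_add g_face[symmetric] N'.a_assoc)
    next
      case 2
      then show ?thesis
        using ij uv v S.mface_mface[of 0 j n v] N.mface_mface[of 0 j n u] L.mface_mface[of 0 j n "v 1"]
        by (simp add: scofib_sel face1[simplified] N.mface_add g_face[symmetric])
    next
      case 3
      then show ?thesis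
        using ij uv S.mface_mface[of i j n v] N.mface_mface[of i j n u] by (simp add: scofib_sel)
    qed
  }
  {
    assume ij: "i \<le> j" "j \<le> n" and x: "x \<in> carrier (mlev (scofib L N g) n)"
    then show "mdgn (scofib L N g) (Suc n) i (mdgn (scofib L N g) n j x) =
        mdgn (scofib L N g) (Suc n) (Suc j) (mdgn (scofib L N g) n i x)"
      by (auto simp: scofib_sel S.mdgn_mdgn N.mdgn_mdgn)
  }
  {
    assume ij: "i < j" "j \<le> Suc n" and x: "x \<in> carrier (mlev (scofib L N g) (Suc n))"
    then show "mface (scofib L N g) (Suc n) i (mdgn (scofib L N g) (Suc n) j x) =
        mdgn (scofib L N g) n (j - 1) (mface (scofib L N g) n i x)"
      by (auto simp: scofib_sel S.mface_mdgn_less N.mface_mdgn_less dgn1[simplified] N.mdgn_add g_dgn[symmetric]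
          L.mface_mdgn_less)
  }
  {
    assume ij: "Suc j < i" "i \<le> Suc (Suc n)" and x: "x \<in> carrier (mlev (scofib L N g) (Suc n))"
    then show "mface (scofib L N g) (Suc n) i (mdgn (scofib L N g) (Suc n) j x) =
        mdgn (scofib L N g) n j (mface (scofib L N g) n (i - 1) x)"
      by (auto simp: scofib_sel S.mface_mdgn_greater N.mface_mdgn_greater)
  }
qed

end

text \<open>The Leibniz rule for linear coefficients. It is the multiplication of a square-zero
  extension, and it also governs the linear part of \<open>lam\<close>.\<close>

lemma coeff_single_mult:
  assumes "cring S" "f \<in> carrier (mpolys S V)" "g \<in> carrier (mpolys S V)"
  shows "(f \<otimes>\<^bsub>mpolys S V\<^esub> g) {#j#} = f {#} \<otimes>\<^bsub>S\<^esub> g {#j#} \<oplus>\<^bsub>S\<^esub> g {#} \<otimes>\<^bsub>S\<^esub> f {#j#}"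
proof -
  interpret S: base_cring S using assms by (simp add: base_cring_def)
  have "v = {#} \<or> v = {#j#}" if "v \<subseteq># {#j#}" for v
    using that by (cases v) (auto simp: insert_subset_eq_iff)
  then have "{v. v \<subseteq># {#j#}} = {{#}, {#j#}}" by auto
  then show ?thesis
    using assms by (simp add: mpolys_sel(2) mpolys_coeff_closed S.m_comm)
qed

text \<open>The maps are compared on constants and variables. The last face gives the last variable
  the constant term \<open>p\<close>, which the square-zero extension can match only because
  \<open>p = 0\<close>.\<close>

lemma shom_bar_to_sqzero:
  assumes "simplicial_cring A" and char: "\<And>n. pconst p (lev A n) = \<zero>\<^bsub>lev A n\<^esub>"
  shows "shom (gbar True p A) (sqzero A (sshift (sself A))) bar_to_sqzero"
proof -
  interpret A: simplicial_cring A by fact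
  interpret S: simplicial_module A "sself A" by (rule simplicial_sself[OF assms(1)])
  interpret N: simplicial_module A "sshift (sself A)" by (rule S.simplicial_sshift)
  let ?Z = "sqzero A (sshift (sself A))"
  interpret Z: simplicial_cring ?Z by (rule N.simplicial_sqzero)
  let ?b = "bar_to_sqzero :: nat \<Rightarrow> (nat multiset \<Rightarrow> 'a) \<Rightarrow> 'a \<times> (nat \<Rightarrow> 'a)"
  have hom: "?b n \<in> ring_hom (mpolys (lev A n) (gvars True n)) (lev ?Z n)" for n
  proof (rule ring_hom_memI)
    interpret L: base_cring "lev A n" by (rule A.base_lev)
    fix f g assume f: "f \<in> carrier (mpolys (lev A n) (gvars True n))" and g: "g \<in> carrier (mpolys (lev A n) (gvars True n))"
    note [simp] = mpolys_coeff_closed[OF f] mpolys_coeff_closed[OF g]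
    show "?b n f \<in> carrier (lev ?Z n)"
      by (auto simp: bar_to_sqzero_def sqzero_sel sshift_sel sself_sel)
    show "?b n (f \<otimes>\<^bsub>mpolys (lev A n) (gvars True n)\<^esub> g) = ?b n f \<otimes>\<^bsub>lev ?Z n\<^esub> ?b n g"
      by (simp add: bar_to_sqzero_def sqzero_sel sshift_sel sself_sel coeff_single_mult[OF A.lev_cring f g]
          coeff_empty_mult[OF A.lev_cring f g] cong: restrict_cong)
    show "?b n (f \<oplus>\<^bsub>mpolys (lev A n) (gvars True n)\<^esub> g) = ?b n f \<oplus>\<^bsub>lev ?Z n\<^esub> ?b n g"
      by (simp add: bar_to_sqzero_def sqzero_sel sshift_sel sself_sel mpolys_sel(5) cong: restrict_cong)
  next
    show "?b n \<one>\<^bsub>mpolys (lev A n) (gvars True n)\<^esub> = \<one>\<^bsub>lev ?Z n\<^esub>"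
      by (simp add: bar_to_sqzero_def sqzero_sel sshift_sel sself_sel mpolys_sel(3) mconst_def)
  qed
  have const: "?b n (mconst (lev A n) a) = (a, \<lambda>j\<in>{1..n}. \<zero>\<^bsub>lev A n\<^esub>)" for n a
    by (simp add: bar_to_sqzero_def mconst_def)
  have var: "?b n (mvar (lev A n) v) = (\<zero>\<^bsub>lev A n\<^esub>, \<lambda>j\<in>{1..n}. if j = v then \<one>\<^bsub>lev A n\<^esub> else \<zero>\<^bsub>lev A n\<^esub>)" for n v
    by (auto simp: bar_to_sqzero_def mvar_def fun_eq_iff)
  \<comment> \<open>At the special indices \<open>0\<close> and \<open>n + 1\<close> the tuple on
    the right is zero, in agreement with the values \<open>0\<close> and
    \<open>p = 0\<close>.\<close>
  have val: "?b n (gval True p (lev A n) n v) =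
      (\<zero>\<^bsub>lev A n\<^esub>, \<lambda>j\<in>{1..n}. if j = v then \<one>\<^bsub>lev A n\<^esub> else \<zero>\<^bsub>lev A n\<^esub>)" for n v
    by (auto simp: gval_def char const var fun_eq_iff restrict_def)
  show ?thesis
    unfolding shom_def
  proof (intro conjI allI impI ballI)
    fix n show "?b n \<in> ring_hom (lev (gbar True p A) n) (lev ?Z n)"
      using hom by (simp add: gbar_sel)
  next
    fix n i f assume i: "i \<le> Suc n" and f: "f \<in> carrier (lev (gbar True p A) (Suc n))"
    have fi: "v \<in> gvars True (Suc n) \<Longrightarrow> face_index i v \<le> Suc n" for v
      using i by (auto simp: face_index_def gvars_iff)
    note g = gmap_hom[OF A.lev_cring A.lev_cring A.face_hom[OF i], where V = "gvars True (Suc n)" and th = "face_index i"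
        and z = True and p = p, OF fi]
    interpret d: ring_hom_cring "lev A (Suc n)" "lev A n" "face A n i"
      by (intro ring_hom_cring.intro ring_hom_cring_axioms.intro A.lev_cring A.face_hom i)
    have "(?b n \<circ> face (gbar True p A) n i) f = (face ?Z n i \<circ> ?b (Suc n)) f"
      unfolding gbar_sel
    proof (rule base_cring.mpolys_hom_eqI[OF A.base_lev ring_hom_trans[OF g(1) hom]
          ring_hom_trans[OF hom Z.face_hom[OF i]] _ _ f[unfolded gbar_sel]])
      fix a assume "a \<in> carrier (lev A (Suc n))"
      then show "(?b n \<circ> gmap True p (lev A (Suc n)) (lev A n) n (face A n i) (face_index i)) (mconst (lev A (Suc n)) a) =
          (face ?Z n i \<circ> ?b (Suc n)) (mconst (lev A (Suc n)) a)"
        using N.mface_zero[OF i] by (simp add: g(2) const sqzero_sel sshift_sel sself_sel)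
    next
      fix v assume v: "v \<in> gvars True (Suc n)"
      have "tuple_face (sself A) n i (\<lambda>j\<in>{1..Suc n}. if j = v then \<one>\<^bsub>lev A (Suc n)\<^esub> else \<zero>\<^bsub>lev A (Suc n)\<^esub>) =
          (\<lambda>j\<in>{1..n}. if j = face_index i v then \<one>\<^bsub>lev A n\<^esub> else \<zero>\<^bsub>lev A n\<^esub>)"
        using v d.hom_one d.hom_zero
        by (intro tuple_eqI[where n = n])
          (auto simp: tuple_ext tuple_face_apply sself_sel face_index_def gvars_iff simp del: d.hom_one d.hom_zero)
      then show "(?b n \<circ> gmap True p (lev A (Suc n)) (lev A n) n (face A n i) (face_index i)) (mvar (lev A (Suc n)) v) =
          (face ?Z n i \<circ> ?b (Suc n)) (mvar (lev A (Suc n)) v)"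
        using g(3)[OF _ v] by (simp add: val var sqzero_sel sshift_sel)
    qed
    then show "?b n (face (gbar True p A) n i f) = face ?Z n i (?b (Suc n) f)" by simp
  next
    fix n i f assume i: "i \<le> n" and f: "f \<in> carrier (lev (gbar True p A) n)"
    have fi: "v \<in> gvars True n \<Longrightarrow> dgn_index i v \<le> Suc (Suc n)" for v
      by (auto simp: dgn_index_def gvars_iff)
    note g = gmap_hom[OF A.lev_cring A.lev_cring A.dgn_hom[OF i], where V = "gvars True n" and th = "dgn_index i"
        and z = True and p = p, OF fi]
    interpret d: ring_hom_cring "lev A n" "lev A (Suc n)" "dgn A n i"
      by (intro ring_hom_cring.intro ring_hom_cring_axioms.intro A.lev_cring A.dgn_hom i)
    have "(?b (Suc n) \<circ> gmap True p (lev A n) (lev A (Suc n)) (Suc n) (dgn A n i) (dgn_index i)) f = (dgn ?Z n i \<circ> ?b n) f"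
    proof (rule base_cring.mpolys_hom_eqI[OF A.base_lev ring_hom_trans[OF g(1) hom]
          ring_hom_trans[OF hom Z.dgn_hom[OF i]] _ _ f[unfolded gbar_sel]])
      fix a assume "a \<in> carrier (lev A n)"
      then show "(?b (Suc n) \<circ> gmap True p (lev A n) (lev A (Suc n)) (Suc n) (dgn A n i) (dgn_index i)) (mconst (lev A n) a) =
          (dgn ?Z n i \<circ> ?b n) (mconst (lev A n) a)"
        using N.mdgn_zero[OF i] by (simp add: g(2) const sqzero_sel sshift_sel sself_sel)
    next
      fix v assume v: "v \<in> gvars True n"
      have "tuple_dgn (sself A) n i (\<lambda>j\<in>{1..n}. if j = v then \<one>\<^bsub>lev A n\<^esub> else \<zero>\<^bsub>lev A n\<^esub>) =
          (\<lambda>j\<in>{1..Suc n}. if j = dgn_index i v then \<one>\<^bsub>lev A (Suc n)\<^esub> else \<zero>\<^bsub>lev A (Suc n)\<^esub>)"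
        using v i by (intro tuple_eqI[where n = "Suc n"])
          (auto simp: tuple_ext tuple_dgn_apply sself_sel dgn_index_def gvars_iff)
      then show "(?b (Suc n) \<circ> gmap True p (lev A n) (lev A (Suc n)) (Suc n) (dgn A n i) (dgn_index i)) (mvar (lev A n) v) =
          (dgn ?Z n i \<circ> ?b n) (mvar (lev A n) v)"
        using g(3)[OF _ v] by (simp add: val var sqzero_sel sshift_sel)
    qed
    then show "?b (Suc n) (dgn (gbar True p A) n i f) = dgn ?Z n i (?b n f)"
      using A.gbar_dgn[OF i f[unfolded gbar_sel]] by simp
  qed
qed

section \<open>Binomial expansion and Frobenius\<close>

context base_cring
begin

lemma binomial_expansion:
  assumes x: "x \<in> carrier R" and y: "y \<in> carrier R"
  shows "(x \<oplus> y) [^] (n::nat) = (\<Oplus>k\<in>{..n}. [(n choose k)] \<cdot> (x [^] (n - k) \<otimes> y [^] k))"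
proof (induction n)
  case 0
  then show ?case using x y by simp
next
  case (Suc n)
  note [simp] = x y
  let ?t = "\<lambda>k. x [^] (n - k) \<otimes> y [^] Suc k"
  have "(x \<oplus> y) [^] Suc n = (\<Oplus>k\<in>{..n}. [(n choose k)] \<cdot> (x [^] (n - k) \<otimes> y [^] k)) \<otimes> x
      \<oplus> (\<Oplus>k\<in>{..n}. [(n choose k)] \<cdot> (x [^] (n - k) \<otimes> y [^] k)) \<otimes> y"
    by (simp only: nat_pow_Suc Suc) (simp add: r_distr)
  also have "(\<Oplus>k\<in>{..n}. [(n choose k)] \<cdot> (x [^] (n - k) \<otimes> y [^] k)) \<otimes> y = (\<Oplus>k\<in>{..n}. [(n choose k)] \<cdot> ?t k)"
    by (subst finsum_ldistr) (auto intro!: finsum_cong' simp: add_pow_ldistr m_assoc)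
  also have "(\<Oplus>k\<in>{..n}. [(n choose k)] \<cdot> (x [^] (n - k) \<otimes> y [^] k)) \<otimes> x =
      (\<Oplus>k\<in>{..n}. [(n choose k)] \<cdot> (x [^] (Suc n - k) \<otimes> y [^] k))"
    by (subst finsum_ldistr) (auto intro!: finsum_cong' simp: add_pow_ldistr add_pow_rdistr Suc_diff_le m_ac)
  \<comment> \<open>The added summand has binomial coefficient zero; it aligns the range so that the
    summand for \<open>k = 0\<close> can be split off.\<close>
  also have "\<dots> = (\<Oplus>k\<in>{..Suc n}. [(n choose k)] \<cdot> (x [^] (Suc n - k) \<otimes> y [^] k))"
    by (subst finsum_Suc) (auto intro!: finsum_closed simp: binomial_eq_0)
  also have "\<dots> = (\<Oplus>k\<in>{..n}. [(n choose Suc k)] \<cdot> ?t k) \<oplus> x [^] Suc n"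
    by (subst finsum_Suc2) auto
  also have "(\<Oplus>k\<in>{..n}. [(n choose Suc k)] \<cdot> ?t k) \<oplus> x [^] Suc n \<oplus> (\<Oplus>k\<in>{..n}. [(n choose k)] \<cdot> ?t k) =
      ((\<Oplus>k\<in>{..n}. [(n choose k)] \<cdot> ?t k) \<oplus> (\<Oplus>k\<in>{..n}. [(n choose Suc k)] \<cdot> ?t k)) \<oplus> x [^] Suc n"
  proof -
    have rot: "b \<oplus> c \<oplus> a = (a \<oplus> b) \<oplus> c" if "a \<in> carrier R" "b \<in> carrier R" "c \<in> carrier R" for a b c
      using that by (simp add: a_ac)
    show ?thesis by (rule rot) (auto intro!: finsum_closed)
  qed
  also have "(\<Oplus>k\<in>{..n}. [(n choose k)] \<cdot> ?t k) \<oplus> (\<Oplus>k\<in>{..n}. [(n choose Suc k)] \<cdot> ?t k) =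
      (\<Oplus>k\<in>{..n}. [(Suc n choose Suc k)] \<cdot> ?t k)"
    by (subst finsum_addf[symmetric]) (auto intro!: finsum_cong' simp: add.nat_pow_mult)
  also have "(\<Oplus>k\<in>{..n}. [(Suc n choose Suc k)] \<cdot> ?t k) \<oplus> x [^] Suc n =
      (\<Oplus>k\<in>{..Suc n}. [(Suc n choose k)] \<cdot> (x [^] (Suc n - k) \<otimes> y [^] k))"
    by (subst finsum_Suc2) auto
  finally show ?case .
qed

text \<open>For prime \<open>p\<close> this is the integral polynomial
  \<open>((x + y) ^ p - x ^ p - y ^ p) / p\<close>, with the quotients taken among the integers so
  that it makes sense in the presence of \<open>p\<close>-torsion. Up to sign it is the cocycle in
  the addition of \<open>W2\<close>.\<close>

definition binom_rest :: "nat \<Rightarrow> 'a \<Rightarrow> 'a \<Rightarrow> 'a" where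
  "binom_rest p x y = (\<Oplus>j\<in>{1..p - 1}. [((p choose j) div p)] \<cdot> (x [^] (p - j) \<otimes> y [^] j))"

lemma binom_rest_closed: "x \<in> carrier R \<Longrightarrow> y \<in> carrier R \<Longrightarrow> binom_rest p x y \<in> carrier R"
  by (auto simp: binom_rest_def intro!: finsum_closed)

text \<open>For prime \<open>p\<close> all inner binomial coefficients are divisible by
  \<open>p\<close>, so the integer quotients in \<open>binom_rest\<close> are exact.\<close>

lemma frobenius_add:
  assumes p: "prime p" and x: "x \<in> carrier R" and y: "y \<in> carrier R"
  shows "(x \<oplus> y) [^] p = x [^] p \<oplus> y [^] p \<oplus> pconst p R \<otimes> binom_rest p x y"
proof -
  note [simp] = x y
  let ?f = "\<lambda>k. [(p choose k)] \<cdot> (x [^] (p - k) \<otimes> y [^] k)"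
  have p2: "2 \<le> p" using p by (rule prime_ge_2_nat)
  have cl: "?f k \<in> carrier R" for k by simp
  have set: "{..p} = {0} \<union> ({p} \<union> {1..p - 1})" using p2 by auto
  have "(x \<oplus> y) [^] p = (\<Oplus>k\<in>{..p}. ?f k)" by (rule binomial_expansion[OF x y])
  also have "\<dots> = (\<Oplus>k\<in>{0}. ?f k) \<oplus> (\<Oplus>k\<in>{p} \<union> {1..p - 1}. ?f k)"
    unfolding set by (rule finsum_Un_disjoint) (use p2 in auto)
  also have "(\<Oplus>k\<in>{p} \<union> {1..p - 1}. ?f k) = (\<Oplus>k\<in>{p}. ?f k) \<oplus> (\<Oplus>k\<in>{1..p - 1}. ?f k)"
    by (rule finsum_Un_disjoint) (use p2 in auto)
  also have "(\<Oplus>k\<in>{1..p - 1}. ?f k) =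
      (\<Oplus>k\<in>{1..p - 1}. pconst p R \<otimes> ([((p choose k) div p)] \<cdot> (x [^] (p - k) \<otimes> y [^] k)))"
  proof (rule finsum_cong')
    fix k assume "k \<in> {1..p - 1}"
    then have "p dvd (p choose k)" using p p2 by (intro dvd_choose_prime) auto
    then have "[(p choose k)] \<cdot> z = pconst p R \<otimes> ([((p choose k) div p)] \<cdot> z)" if "z \<in> carrier R" for z
      using that by (simp add: pconst_mult add.nat_pow_pow)
    then show "?f k = pconst p R \<otimes> ([((p choose k) div p)] \<cdot> (x [^] (p - k) \<otimes> y [^] k))" by simp
  qed auto
  also have "\<dots> = pconst p R \<otimes> binom_rest p x y"
    unfolding binom_rest_def by (rule finsum_rdistr[symmetric]) auto
  finally show ?thesis
    using p2 by (simp add: a_assoc binom_rest_closed)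
qed

end

lemma nat_pow_hom:
  fixes n :: nat
  assumes "cring S" "cring T" "f \<in> ring_hom S T" "x \<in> carrier S"
  shows "f (x [^]\<^bsub>S\<^esub> n) = f x [^]\<^bsub>T\<^esub> n"
proof -
  interpret ring_hom_cring S T f using assms by (simp add: ring_hom_cring_def ring_hom_cring_axioms_def)
  show ?thesis by (induction n) (use assms(4) in simp_all)
qed

lemma shom_sfrob:
  assumes "simplicial_cring A" "prime p" and char: "\<And>n. pconst p (lev A n) = \<zero>\<^bsub>lev A n\<^esub>"
  shows "shom A A (sfrob p A)"
proof -
  interpret A: simplicial_cring A by fact
  show ?thesis
    unfolding shom_def
  proof (intro conjI allI impI ballI)
    fix n
    interpret L: base_cring "lev A n" by (rule A.base_lev)
    show "sfrob p A n \<in> ring_hom (lev A n) (lev A n)"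
      by (rule ring_hom_memI)
        (auto simp: sfrob_def L.frobenius_add[OF assms(2)] char L.binom_rest_closed L.nat_pow_distrib)
  next
    fix n i x assume "i \<le> Suc n" "x \<in> carrier (lev A (Suc n))"
    then show "sfrob p A n (face A n i x) = face A n i (sfrob p A (Suc n) x)"
      by (simp add: sfrob_def nat_pow_hom[OF A.lev_cring A.lev_cring A.face_hom])
  next
    fix n i x assume "i \<le> n" "x \<in> carrier (lev A n)"
    then show "sfrob p A (Suc n) (dgn A n i x) = dgn A n i (sfrob p A n x)"
      by (simp add: sfrob_def nat_pow_hom[OF A.lev_cring A.lev_cring A.dgn_hom])
  qed
qed

section \<open>Coefficients of faces in the bar construction\<close>

context simplicial_cring
begin

lemma gbar_const:
  "i \<le> Suc n \<Longrightarrow> a \<in> carrier (lev X (Suc n)) \<Longrightarrow>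
    face (gbar z p X) n i (mconst (lev X (Suc n)) a) = mconst (lev X n) (face X n i a)"
  "i \<le> n \<Longrightarrow> a \<in> carrier (lev X n) \<Longrightarrow>
    dgn (gbar z p X) n i (mconst (lev X n) a) = mconst (lev X (Suc n)) (dgn X n i a)"
proof -
  show "face (gbar z p X) n i (mconst (lev X (Suc n)) a) = mconst (lev X n) (face X n i a)"
    if i: "i \<le> Suc n" and a: "a \<in> carrier (lev X (Suc n))"
    unfolding gbar_sel
    by (rule gmap_hom(2)[OF lev_cring lev_cring face_hom[OF i], where V = "gvars z (Suc n)"])
      (use i a in \<open>auto simp: face_index_def gvars_iff\<close>)
  assume i: "i \<le> n" and a: "a \<in> carrier (lev X n)"
  interpret L: base_cring "lev X n" by (rule base_lev)
  show "dgn (gbar z p X) n i (mconst (lev X n) a) = mconst (lev X (Suc n)) (dgn X n i a)"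
    unfolding gbar_dgn[OF i L.mconst_closed[OF a]]
    by (rule gmap_hom(2)[OF lev_cring lev_cring dgn_hom[OF i], where V = "gvars z n"])
      (use i a in \<open>auto simp: dgn_index_def gvars_iff\<close>)
qed

lemma shom_bar_unit: "shom X (gbar z p X) (bar_unit X)"
  unfolding shom_def bar_unit_def gbar_sel(1)
  using mconst_hom[OF lev_cring] by (auto simp: gbar_const)

lemma gbar_var:
  assumes "i \<le> Suc n" "v \<in> gvars z (Suc n)"
  shows "face (gbar z p X) n i (mvar (lev X (Suc n)) v) = gval z p (lev X n) n (face_index i v)"
  unfolding gbar_sel
  by (rule gmap_hom(3)[OF lev_cring lev_cring face_hom[OF assms(1)], where V = "gvars z (Suc n)"])
    (use assms in \<open>auto simp: face_index_def gvars_iff\<close>)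

text \<open>The last face is exceptional, because it sends a variable to \<open>p\<close>:\<close>

lemma face_coeff_empty:
  assumes i: "i \<le> n" and f: "f \<in> carrier (lev (gbar True p X) (Suc n))"
  shows "face (gbar True p X) n i f {#} = face X n i (f {#})"
proof -
  interpret B: simplicial_cring "gbar True p X" by (rule simplicial_gbar)
  interpret d: ring_hom_cring "lev X (Suc n)" "lev X n" "face X n i"
    using i by (intro ring_hom_cring.intro ring_hom_cring_axioms.intro lev_cring face_hom) auto
  have i': "i \<le> Suc n" using i by simp
  have F: "(\<lambda>g. g {#}) \<circ> face (gbar True p X) n i \<in> ring_hom (mpolys (lev X (Suc n)) (gvars True (Suc n))) (lev X n)"
    using ring_hom_trans[OF B.face_hom[OF i', unfolded gbar_sel(1)] coeff_empty_hom[OF lev_cring]] .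
  have G: "face X n i \<circ> (\<lambda>g. g {#}) \<in> ring_hom (mpolys (lev X (Suc n)) (gvars True (Suc n))) (lev X n)"
    using ring_hom_trans[OF coeff_empty_hom[OF lev_cring] face_hom[OF i']] .
  have "((\<lambda>g. g {#}) \<circ> face (gbar True p X) n i) f = (face X n i \<circ> (\<lambda>g. g {#})) f"
    by (rule base_cring.mpolys_hom_eqI[OF base_lev F G _ _ f[unfolded gbar_sel(1)]])
      (use i in \<open>auto simp: gbar_const gbar_var gval_def, auto simp: face_index_def gvars_iff split: if_splits\<close>)
  then show ?thesis by simp
qed

text \<open>Degeneracies send variables to variables, so nothing flows into the constant
  coefficient.\<close>

lemma dgn_coeff_empty:
  assumes i: "i \<le> n" and f: "f \<in> carrier (lev (gbar True p X) n)"
  shows "dgn (gbar True p X) n i f {#} = dgn X n i (f {#})"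
proof -
  interpret B: simplicial_cring "gbar True p X" by (rule simplicial_gbar)
  interpret L: base_cring "lev X n" by (rule base_lev)
  interpret d: ring_hom_cring "lev X n" "lev X (Suc n)" "dgn X n i"
    using i by (intro ring_hom_cring.intro ring_hom_cring_axioms.intro lev_cring dgn_hom) auto
  have F: "(\<lambda>g. g {#}) \<circ> dgn (gbar True p X) n i \<in> ring_hom (mpolys (lev X n) (gvars True n)) (lev X (Suc n))"
    using ring_hom_trans[OF B.dgn_hom[OF i, unfolded gbar_sel(1)] coeff_empty_hom[OF lev_cring]] .
  have G: "dgn X n i \<circ> (\<lambda>g. g {#}) \<in> ring_hom (mpolys (lev X n) (gvars True n)) (lev X (Suc n))"
    using ring_hom_trans[OF coeff_empty_hom[OF lev_cring] dgn_hom[OF i]] .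
  have var: "dgn (gbar True p X) n i (mvar (lev X n) v) = gval True p (lev X (Suc n)) (Suc n) (dgn_index i v)"
    if v: "v \<in> gvars True n" for v
    unfolding gbar_dgn[OF i L.mvar_closed[OF v]]
    by (rule gmap_hom(3)[OF lev_cring lev_cring dgn_hom[OF i] _ v]) (auto simp: dgn_index_def gvars_iff)
  have "((\<lambda>g. g {#}) \<circ> dgn (gbar True p X) n i) f = (dgn X n i \<circ> (\<lambda>g. g {#})) f"
    by (rule base_cring.mpolys_hom_eqI[OF base_lev F G _ _ f[unfolded gbar_sel(1)]])
      (use i in \<open>auto simp: gbar_const var gval_def, auto simp: dgn_index_def gvars_iff split: if_splits\<close>)
  then show ?thesis by simp
qed

text \<open>Setting the last variable to \<open>p\<close> moves its powers into the constant
  coefficient: the first power with a factor \<open>p\<close>, the higher ones with a factor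
  \<open>p ^ 2\<close>, collected in \<open>b\<close>. After division by \<open>p\<close> and
  reduction modulo \<open>p\<close> only the linear coefficient remains.\<close>

lemma last_face_coeff_empty:
  assumes f: "f \<in> carrier (lev (gbar True p X) (Suc n))"
  shows "\<exists>b\<in>carrier (lev X n). face (gbar True p X) n (Suc n) f {#} =
    face X n (Suc n) (f {#}) \<oplus>\<^bsub>lev X n\<^esub> pconst p (lev X n) \<otimes>\<^bsub>lev X n\<^esub>
      (face X n (Suc n) (f {#Suc n#}) \<oplus>\<^bsub>lev X n\<^esub> pconst p (lev X n) \<otimes>\<^bsub>lev X n\<^esub> b)"
proof -
  interpret B: simplicial_cring "gbar True p X" by (rule simplicial_gbar)
  interpret L: base_cring "lev X n" by (rule base_lev)
  interpret S: base_cring "lev X (Suc n)" by (rule base_lev)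
  let ?M = "mpolys (lev X (Suc n)) (gvars True (Suc n))" and ?P = "pconst p (lev X n)"
  let ?d = "face X n (Suc n)" and ?D = "face (gbar True p X) n (Suc n)"
  interpret d: ring_hom_cring "lev X (Suc n)" "lev X n" ?d
    by (intro ring_hom_cring.intro ring_hom_cring_axioms.intro lev_cring face_hom) auto
  have D: "?D \<in> ring_hom ?M (mpolys (lev X n) (gvars True n))"
    using B.face_hom[of "Suc n" n] by (simp add: gbar_sel(1))
  show ?thesis
    using f unfolding gbar_sel(1)
  proof (induction f rule: S.mpolys_induct)
    case (const a)
    then show ?case
      by (intro bexI[where x = "\<zero>\<^bsub>lev X n\<^esub>"]) (auto simp: gbar_const, simp add: mconst_def)
  next
    case (add f h)
    then obtain b c where b: "b \<in> carrier (lev X n)" "?D f {#} = ?d (f {#}) \<oplus>\<^bsub>lev X n\<^esub> ?P \<otimes>\<^bsub>lev X n\<^esub> (?d (f {#Suc n#}) \<oplus>\<^bsub>lev X n\<^esub> ?P \<otimes>\<^bsub>lev X n\<^esub> b)"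
      and c: "c \<in> carrier (lev X n)" "?D h {#} = ?d (h {#}) \<oplus>\<^bsub>lev X n\<^esub> ?P \<otimes>\<^bsub>lev X n\<^esub> (?d (h {#Suc n#}) \<oplus>\<^bsub>lev X n\<^esub> ?P \<otimes>\<^bsub>lev X n\<^esub> c)"
      by blast
    have [simp]: "f u \<in> carrier (lev X (Suc n))" "h u \<in> carrier (lev X (Suc n))" for u
      using add by (auto simp: mpolys_coeff_closed)
    have "?D (f \<oplus>\<^bsub>?M\<^esub> h) {#} = ?D f {#} \<oplus>\<^bsub>lev X n\<^esub> ?D h {#}"
      using ring_hom_add[OF D add(1,2)] by (simp add: mpolys_sel(5))
    also have "\<dots> = ?d ((f \<oplus>\<^bsub>?M\<^esub> h) {#}) \<oplus>\<^bsub>lev X n\<^esub> ?P \<otimes>\<^bsub>lev X n\<^esub>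
        (?d ((f \<oplus>\<^bsub>?M\<^esub> h) {#Suc n#}) \<oplus>\<^bsub>lev X n\<^esub> ?P \<otimes>\<^bsub>lev X n\<^esub> (b \<oplus>\<^bsub>lev X n\<^esub> c))"
      unfolding b(2) c(2) using b(1) c(1) by (simp add: mpolys_sel(5) L.r_distr L.a_ac)
    finally show ?case using b(1) c(1) by (intro bexI[where x = "b \<oplus>\<^bsub>lev X n\<^esub> c"]) auto
  next
    case (var f v)
    then obtain b where b: "b \<in> carrier (lev X n)" "?D f {#} = ?d (f {#}) \<oplus>\<^bsub>lev X n\<^esub> ?P \<otimes>\<^bsub>lev X n\<^esub> (?d (f {#Suc n#}) \<oplus>\<^bsub>lev X n\<^esub> ?P \<otimes>\<^bsub>lev X n\<^esub> b)"
      by blast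
    have [simp]: "f u \<in> carrier (lev X (Suc n))" for u
      using var by (auto simp: mpolys_coeff_closed)
    have Df: "?D f \<in> carrier (mpolys (lev X n) (gvars True n))" using ring_hom_closed[OF D var(1)] .
    have "?D (mvar (lev X (Suc n)) v \<otimes>\<^bsub>?M\<^esub> f) {#} = gval True p (lev X n) n (face_index (Suc n) v) {#} \<otimes>\<^bsub>lev X n\<^esub> ?D f {#}"
      using var(1,2) ring_hom_mult[OF D S.mvar_closed[OF var(2)] var(1)] gbar_var[OF _ var(2), where i = "Suc n" and p = p]
        coeff_empty_mult[OF lev_cring gval_closed[OF lev_cring] Df, of "face_index (Suc n) v"]
      by (simp add: face_index_def gvars_iff)
    also have "gval True p (lev X n) n (face_index (Suc n) v) {#} = (if v = Suc n then ?P else \<zero>\<^bsub>lev X n\<^esub>)"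
      using var(2) by (auto simp: gval_def face_index_def gvars_iff)
    finally have eq: "?D (mvar (lev X (Suc n)) v \<otimes>\<^bsub>?M\<^esub> f) {#} = (if v = Suc n then ?P else \<zero>\<^bsub>lev X n\<^esub>) \<otimes>\<^bsub>lev X n\<^esub> ?D f {#}" .
    have cf: "(mvar (lev X (Suc n)) v \<otimes>\<^bsub>?M\<^esub> f) {#} = \<zero>\<^bsub>lev X (Suc n)\<^esub>"
      "(mvar (lev X (Suc n)) v \<otimes>\<^bsub>?M\<^esub> f) {#Suc n#} = (if v = Suc n then f {#} else \<zero>\<^bsub>lev X (Suc n)\<^esub>)"
      by (auto simp: S.mvar_mult[OF var(1)])
    show ?case
    proof (cases "v = Suc n")
      case True
      \<comment> \<open>Multiplication by the last variable makes the old constant coefficient the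
        linear one, and the old bracket becomes the new \<open>b\<close>.\<close>
      have c: "?d (f {#Suc n#}) \<oplus>\<^bsub>lev X n\<^esub> ?P \<otimes>\<^bsub>lev X n\<^esub> b \<in> carrier (lev X n)" using b(1) by simp
      then have "?D (mvar (lev X (Suc n)) v \<otimes>\<^bsub>?M\<^esub> f) {#} = ?d \<zero>\<^bsub>lev X (Suc n)\<^esub> \<oplus>\<^bsub>lev X n\<^esub> ?P \<otimes>\<^bsub>lev X n\<^esub>
          (?d (f {#}) \<oplus>\<^bsub>lev X n\<^esub> ?P \<otimes>\<^bsub>lev X n\<^esub> (?d (f {#Suc n#}) \<oplus>\<^bsub>lev X n\<^esub> ?P \<otimes>\<^bsub>lev X n\<^esub> b))"
        unfolding eq b(2) using True by simp
      then show ?thesis using c True unfolding cf by auto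
    next
      case False
      have "?D f {#} \<in> carrier (lev X n)" using Df by (rule mpolys_coeff_closed)
      then have "?D (mvar (lev X (Suc n)) v \<otimes>\<^bsub>?M\<^esub> f) {#} = \<zero>\<^bsub>lev X n\<^esub>"
        unfolding eq using False by simp
      then show ?thesis using False unfolding cf by (intro bexI[where x = "\<zero>\<^bsub>lev X n\<^esub>"]) auto
    qed
  qed
qed

end

text \<open>Adding neighbours does not change a total, while the outer faces drop an end entry. The
  two losses are made up for in \<open>lam_face\<close>: the first through face \<open>0\<close> of
  the cofibre, the last through the constant coefficient.\<close>

lemma (in abelian_monoid) tuple_face_sum:
  assumes "\<And>j. u j \<in> carrier G"
  defines "t \<equiv> \<lambda>k j. if j < k then u j else if j = k then u j \<oplus> u (Suc j) else u (Suc j)"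
  shows "u (Suc 0) \<oplus> (\<Oplus>j\<in>{Suc 0..n}. t 0 j) = (\<Oplus>j\<in>{Suc 0..Suc n}. u j)"
    and "0 < k \<Longrightarrow> k \<le> n \<Longrightarrow> (\<Oplus>j\<in>{Suc 0..n}. t k j) = (\<Oplus>j\<in>{Suc 0..Suc n}. u j)"
    and "(\<Oplus>j\<in>{Suc 0..n}. t (Suc n) j) \<oplus> u (Suc n) = (\<Oplus>j\<in>{Suc 0..Suc n}. u j)"
proof -
  note [simp] = assms(1)
  have tc [simp]: "t k j \<in> carrier G" for k j by (simp add: t_def)
  have S: "(\<Oplus>j\<in>{Suc 0..Suc n}. f j) = f (Suc n) \<oplus> (\<Oplus>j\<in>{Suc 0..n}. f j)" if "\<And>j. f j \<in> carrier G" for f n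
    using that by (simp add: atLeastAtMostSuc_conv)
  have c: "(\<Oplus>j\<in>{Suc 0..n}. f j) \<in> carrier G" if "\<And>j. f j \<in> carrier G" for f n
    using that by simp
  have low: "n < k \<Longrightarrow> (\<Oplus>j\<in>{Suc 0..n}. t k j) = (\<Oplus>j\<in>{Suc 0..n}. u j)" for n k
    by (induction n) (simp_all add: S, simp add: t_def)
  show "(\<Oplus>j\<in>{Suc 0..n}. t (Suc n) j) \<oplus> u (Suc n) = (\<Oplus>j\<in>{Suc 0..Suc n}. u j)"
    by (simp only: low S assms(1) lessI) (simp add: a_comm c)
  show "u (Suc 0) \<oplus> (\<Oplus>j\<in>{Suc 0..n}. t 0 j) = (\<Oplus>j\<in>{Suc 0..Suc n}. u j)"
  proof (induction n)
    case (Suc n)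
    have "t 0 (Suc n) = u (Suc (Suc n))" by (simp add: t_def)
    then have "u (Suc 0) \<oplus> (\<Oplus>j\<in>{Suc 0..Suc n}. t 0 j) = u (Suc (Suc n)) \<oplus> (u (Suc 0) \<oplus> (\<Oplus>j\<in>{Suc 0..n}. t 0 j))"
      by (subst S) (simp_all add: a_lcomm)
    then show ?case unfolding Suc by (simp only: S[of u "Suc n"] assms(1))
  qed simp
  show "0 < k \<Longrightarrow> k \<le> n \<Longrightarrow> (\<Oplus>j\<in>{Suc 0..n}. t k j) = (\<Oplus>j\<in>{Suc 0..Suc n}. u j)"
  proof (induction n)
    case (Suc n)
    show ?case
    proof (cases "k = Suc n")
      case True
      then have "t k (Suc n) = u (Suc n) \<oplus> u (Suc (Suc n))" by (simp add: t_def)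
      then show ?thesis using True by (simp add: S low a_ac)
    next
      case False
      then have "t k (Suc n) = u (Suc (Suc n))" "k \<le> n" using Suc.prems by (auto simp: t_def)
      then show ?thesis using Suc by (simp add: S)
    qed
  qed simp
qed

lemma (in abelian_monoid) tuple_dgn_sum:
  assumes "\<And>j. u j \<in> carrier G" "k \<le> n"
  shows "(\<Oplus>j\<in>{Suc 0..Suc n}. if j \<le> k then u j else if j = Suc k then \<zero> else u (j - 1)) = (\<Oplus>j\<in>{Suc 0..n}. u j)"
proof -
  note [simp] = assms(1)
  define t where "t = (\<lambda>j. if j \<le> k then u j else if j = Suc k then \<zero> else u (j - 1))"
  have tc [simp]: "t j \<in> carrier G" for j by (simp add: t_def)
  have S: "(\<Oplus>j\<in>{Suc 0..Suc n}. f j) = f (Suc n) \<oplus> (\<Oplus>j\<in>{Suc 0..n}. f j)" if "\<And>j. f j \<in> carrier G" for f n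
    using that by (simp add: atLeastAtMostSuc_conv)
  have low: "n \<le> k \<Longrightarrow> (\<Oplus>j\<in>{Suc 0..n}. t j) = (\<Oplus>j\<in>{Suc 0..n}. u j)" for n
    by (induction n) (simp_all add: S, simp add: t_def)
  have "k \<le> n \<Longrightarrow> (\<Oplus>j\<in>{Suc 0..Suc n}. t j) = (\<Oplus>j\<in>{Suc 0..n}. u j)" for n
  proof (induction n)
    case 0
    then show ?case by (simp add: t_def)
  next
    case (Suc n)
    show ?case
    proof (cases "k = Suc n")
      case True
      then have "t (Suc (Suc n)) = \<zero>" by (simp add: t_def)
      then show ?thesis using True by (subst S) (simp_all add: low)
    next
      case False
      then have "t (Suc (Suc n)) = u (Suc n)" "k \<le> n" using Suc.prems by (auto simp: t_def)
      then show ?thesis using Suc by (subst S) (simp_all add: S[of u])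
    qed
  qed
  then show ?thesis using assms(2) by (simp add: t_def)
qed

section \<open>The pullback square\<close>

text \<open>Torsion is tested coefficientwise. This carries the hypothesis from \<open>Q\<close> to
  \<open>bar p Q\<close>, where quotients by \<open>p\<close> are formed and whose own bar
  construction is augmented.\<close>

lemma (in ptf_simplicial) ptf_gbar: "ptf_simplicial B p"
proof (intro ptf_simplicial.intro ptf_simplicial_axioms.intro simplicial_gbar)
  fix n f assume f: "f \<in> carrier (lev B n)" "pconst p (lev B n) \<otimes>\<^bsub>lev B n\<^esub> f = \<zero>\<^bsub>lev B n\<^esub>"
  interpret L: base_cring "lev X n" by (rule base_lev)
  have "mconst (lev X n) \<in> ring_hom (lev X n) (lev B n)"
    unfolding gbar_sel by (rule mconst_hom[OF lev_cring])
  note ring_hom_pconst[OF lev_cring B.lev_cring this, symmetric]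
  then show "f = \<zero>\<^bsub>lev B n\<^esub>"
    using f ptf_mpolys by (simp add: gbar_sel)
qed

lemma W2_sel:
  "carrier (W2 p R M m) = carrier R \<times> carrier M"
  "(a, x) \<otimes>\<^bsub>W2 p R M m\<^esub> (b, y) = (a \<otimes>\<^bsub>R\<^esub> b,
     (pcls p R (a [^]\<^bsub>R\<^esub> p) \<odot>\<^bsub>M\<^esub> y) \<oplus>\<^bsub>M\<^esub> (pcls p R (b [^]\<^bsub>R\<^esub> p) \<odot>\<^bsub>M\<^esub> x))"
  "\<one>\<^bsub>W2 p R M m\<^esub> = (\<one>\<^bsub>R\<^esub>, \<zero>\<^bsub>M\<^esub>)"
  "\<zero>\<^bsub>W2 p R M m\<^esub> = (\<zero>\<^bsub>R\<^esub>, \<zero>\<^bsub>M\<^esub>)"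
  "(a, x) \<oplus>\<^bsub>W2 p R M m\<^esub> (b, y) = (a \<oplus>\<^bsub>R\<^esub> b, (x \<oplus>\<^bsub>M\<^esub> y) \<ominus>\<^bsub>M\<^esub>
     (\<Oplus>\<^bsub>M\<^esub>j\<in>{1..p - 1}.
        pcls p R ([((p choose j) div p)] \<cdot>\<^bsub>R\<^esub> (a [^]\<^bsub>R\<^esub> (p - j) \<otimes>\<^bsub>R\<^esub> b [^]\<^bsub>R\<^esub> j)) \<odot>\<^bsub>M\<^esub> m))"
  by (simp_all add: W2_def)

lemma sconst_sel [simp]: "lev (sconst S) n = S" "face (sconst S) n i x = x" "dgn (sconst S) n i x = x"
  by (simp_all add: sconst_def)

lemma (in base_cring) alt_sum_const:
  "x \<in> carrier R \<Longrightarrow> (\<Oplus>i\<in>{0..n}. alt R i x) = (if even n then x else \<zero>)"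
  by (induction n) (auto simp: atLeast0_atMost_Suc alt_def r_neg l_neg)

text \<open>There are \<open>n + 2\<close> equal summands with alternating signs. So the
  differentials of a constant object are alternately zero and the identity, and its homology sits in
  degree \<open>0\<close>.\<close>

lemma bnd_sconst:
  assumes "cring S" "x \<in> carrier S"
  shows "bnd (chains (sconst S)) n x = (if even n then \<zero>\<^bsub>S\<^esub> else x)"
proof -
  interpret base_cring S using assms by (simp add: base_cring_def)
  show ?thesis
    unfolding bnd_chains sconst_sel using alt_sum_const[OF assms(2), of "Suc n"] by simp
qed

lemma simplicial_sconst: "cring S \<Longrightarrow> simplicial_cring (sconst S)"
  using id_ring_hom[of S] by (intro simplicial_cring.intro) (auto simp: id_def sconst_def)

lemma sconst_boundaries:
  assumes "cring S"
  shows "boundaries (chains (sconst S)) n = (if even n then {\<zero>\<^bsub>S\<^esub>} else carrier S)"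
proof -
  interpret cring S by fact
  show ?thesis
    unfolding boundaries_def chains_sel sconst_sel
    using bnd_sconst[OF assms] zero_closed by (auto simp: image_iff)
qed

lemma sconst_cycles:
  assumes "cring S"
  shows "cycles (chains (sconst S)) n = (if even n \<and> n \<noteq> 0 then {\<zero>\<^bsub>S\<^esub>} else carrier S)"
proof -
  interpret cring S by fact
  show ?thesis
    by (cases n) (auto simp: cycles_def bnd_sconst[OF assms])
qed

text \<open>In degree \<open>0\<close> a constant object has no nonzero boundaries, so surjectivity
  on homology is surjectivity on elements; degeneracies carry it to the higher levels.\<close>

lemma weak_equiv_sconst_surj:
  assumes "weak_equiv X (sconst S) eps" "r \<in> carrier S"
  shows "\<exists>x\<in>carrier (lev X n). eps n x = r"
proof -
  interpret eps: simplicial_hom X "sconst S" eps using assms(1) by (rule simplicial_hom_of_weak_equiv)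
  have S: "cring S" using eps.Y.lev_cring[of 0] by simp
  interpret S: base_cring S using S by (simp add: base_cring_def)
  show ?thesis
  proof (induction n)
    case 0
    have "r \<in> cycles (chains (sconst S)) 0" using assms(2) by (simp add: sconst_cycles[OF S])
    then obtain c where c: "c \<in> cycles (chains X) 0" "r \<ominus>\<^bsub>S\<^esub> eps 0 c \<in> boundaries (chains (sconst S)) 0"
      using assms(1) unfolding weak_equiv_def quasi_iso_def chains_sel sconst_sel by blast
    then have "c \<in> carrier (lev X 0)" by (simp add: eps.X.cycles_iff)
    moreover from this have "r = eps 0 c"
      using c(2) assms(2) eps.f_closed[of c 0] S.minus_eq_zeroD[of r "eps 0 c"] by (simp add: sconst_boundaries[OF S])
    ultimately show ?case by blast
  next
    case (Suc n)
    then obtain x where "x \<in> carrier (lev X n)" "eps n x = r" by blast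
    then show ?case
      using shomD(3)[OF eps.shom, of 0 n x] by (intro bexI[where x = "dgn X n 0 x"]) auto
  qed
qed

section \<open>The corners of the square and their strict fibre product\<close>

locale frobenius_square =
  fixes p :: nat and R :: "'r ring" and M :: "('r set, 'm) module" and m :: 'm
    and Q :: "'q sring" and eps :: "nat \<Rightarrow> 'q \<Rightarrow> 'r"
  assumes prime: "prime p" and cring_R: "cring R" and module_M: "module (modp p R) M" and m: "m \<in> carrier M"
    and res: "ptf_resolution p Q (sconst R) eps"
begin

lemma we_eps: "weak_equiv Q (sconst R) eps"
  using res by (simp add: ptf_resolution_def)

sublocale eps: simplicial_hom Q "sconst R" eps
  using we_eps by (rule simplicial_hom_of_weak_equiv)

sublocale R: base_cring R
  using cring_R by (simp add: base_cring_def)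

abbreviation "k \<equiv> modp p R"

sublocale k: base_cring k
  using R.cring_modp by (simp add: base_cring_def)

sublocale M: module k M
  by (rule module_M)

sublocale Q: ptf_simplicial Q p
proof (intro ptf_simplicial.intro ptf_simplicial_axioms.intro eps.X.simplicial_cring_axioms)
  fix n x assume x: "x \<in> carrier (lev Q n)" "pconst p (lev Q n) \<otimes>\<^bsub>lev Q n\<^esub> x = \<zero>\<^bsub>lev Q n\<^esub>"
  interpret L: base_cring "lev Q n" by (rule eps.X.base_lev)
  show "x = \<zero>\<^bsub>lev Q n\<^esub>"
    using res x by (simp add: ptf_resolution_def L.pconst_mult)
qed

abbreviation "A \<equiv> gbar True p Q"
abbreviation "AA \<equiv> gbar True p A"
abbreviation "Qp \<equiv> smodp p Q"

sublocale A: ptf_simplicial A p by (rule Q.ptf_gbar)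
sublocale Qp: simplicial_cring Qp by (rule eps.X.simplicial_smodp)
sublocale Ap: simplicial_cring "smodp p A" by (rule Q.B.simplicial_smodp)

lemma bar_eq: "bar p Q = A" "bar p A = AA"
  using bar_eq_gbar[OF eps.X.simplicial_cring_axioms] bar_eq_gbar[OF Q.B.simplicial_cring_axioms] by simp_all

lemma char_smodp: "simplicial_cring Y \<Longrightarrow> pconst p (lev (smodp p Y) n) = \<zero>\<^bsub>lev (smodp p Y) n\<^esub>"
  unfolding simplicial_cring.smodp_sel(1) using base_cring.pconst_modp[OF simplicial_cring.base_lev] .

lemma shom_frob_can: "shom Q (smodp p A) (frob_can p Q)"
proof -
  have "frob_can p Q = (\<lambda>n x. sfrob p (smodp p A) n (pcls p (lev A n) (bar_unit Q n x)))"
    by (simp add: frob_can_def bar_eq fun_eq_iff)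
  then show ?thesis
    using shom_comp[OF shom_comp[OF eps.X.shom_bar_unit Q.B.shom_pcls]
        shom_sfrob[OF Ap.simplicial_cring_axioms prime char_smodp[OF Q.B.simplicial_cring_axioms]]]
    by simp
qed

sublocale P: fibre_square Q AA "smodp p A" "frob_can p Q" "bar_aug p A"
  by (intro fibre_square.intro simplicial_hom.intro simplicial_hom_axioms.intro eps.X.simplicial_cring_axioms
      A.B.simplicial_cring_axioms Ap.simplicial_cring_axioms shom_frob_can Q.B.shom_bar_aug)

abbreviation "P \<equiv> frob_source p Q"

lemma P_eq: "P = P.E"
  by (simp add: frob_source_def bar_eq)

text \<open>A base change of the augmentation of \<open>bar p (bar p Q)\<close>, followed by
  \<open>eps\<close>. The acyclicity invoked is that for the torsion-free simplicial ring
  \<open>bar p Q\<close>.\<close>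

lemma we_P: "weak_equiv P (sconst R) (\<lambda>n (x, f). eps n x)"
proof -
  have "weak_equiv P.E Q (\<lambda>n. fst)"
    by (rule P.weak_equiv_fst) (auto intro: Q.B.bar_aug_surj A.bar_aug_kernel_acyclic)
  from weak_equiv_comp[OF this we_eps] show ?thesis
    by (simp add: P_eq case_prod_beta')
qed

abbreviation "Z \<equiv> sqzero Qp (sshift (sself Qp))"

lemma simplicial_Z: "simplicial_cring Z"
  by (intro simplicial_module.simplicial_sqzero simplicial_module.simplicial_sshift simplicial_sself
      Qp.simplicial_cring_axioms)

lemma shom_frob_map: "shom P Z (frob_map p Q)"
proof -
  have "frob_map p Q = (\<lambda>n e. bar_to_sqzero n (bar_map (bar_aug p Q) n (snd e)))"
    by (simp add: frob_map_def fun_eq_iff case_prod_beta')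
  then show ?thesis
    using shom_comp[OF shom_comp[OF P.shom_snd shom_bar_map[OF Q.B.simplicial_cring_axioms Qp.simplicial_cring_axioms
            eps.X.shom_bar_aug]] shom_bar_to_sqzero[OF Qp.simplicial_cring_axioms char_smodp[OF eps.X.simplicial_cring_axioms]]]
    by (simp add: P_eq)
qed

abbreviation "aug \<equiv> aug_modp p R eps"

lemma aug_pcls: "x \<in> carrier (lev Q n) \<Longrightarrow> aug n (pcls p (lev Q n) x) = pcls p R (eps n x)"
  unfolding aug_modp_def
  using modp_map_pcls[OF eps.X.lev_cring cring_R] shomD(1)[OF eps.shom, of n] by simp

lemma shom_aug: "shom Qp (sconst k) aug"
  unfolding shom_def
proof (intro conjI allI impI ballI)
  fix n show "aug n \<in> ring_hom (lev Qp n) (lev (sconst k) n)"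
    unfolding aug_modp_def eps.X.smodp_sel sconst_sel
    using modp_map_hom[OF eps.X.lev_cring cring_R] shomD(1)[OF eps.shom, of n] by simp
next
  fix n i c assume i: "i \<le> Suc n" and "c \<in> carrier (lev Qp (Suc n))"
  then obtain x where x: "x \<in> carrier (lev Q (Suc n))" "c = pcls p (lev Q (Suc n)) x"
    using base_cring.carrier_modp[OF eps.X.base_lev] by (auto simp: eps.X.smodp_sel)
  have "face Qp n i c = pcls p (lev Q n) (face Q n i x)"
    unfolding eps.X.smodp_sel x(2)
    by (rule modp_map_pcls[OF eps.X.lev_cring eps.X.lev_cring eps.X.face_hom[OF i] x(1)])
  then show "aug n (face Qp n i c) = face (sconst k) n i (aug (Suc n) c)"
    using x i shomD(2)[OF eps.shom i x(1)] by (simp add: aug_pcls)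
next
  fix n i c assume i: "i \<le> n" and "c \<in> carrier (lev Qp n)"
  then obtain x where x: "x \<in> carrier (lev Q n)" "c = pcls p (lev Q n) x"
    using base_cring.carrier_modp[OF eps.X.base_lev] by (auto simp: eps.X.smodp_sel)
  have "dgn Qp n i c = pcls p (lev Q (Suc n)) (dgn Q n i x)"
    unfolding eps.X.smodp_sel x(2)
    by (rule modp_map_pcls[OF eps.X.lev_cring eps.X.lev_cring eps.X.dgn_hom[OF i] x(1)])
  then show "aug (Suc n) (dgn Qp n i c) = dgn (sconst k) n i (aug n c)"
    using x i shomD(3)[OF eps.shom i x(1)] by (simp add: aug_pcls)
qed

sublocale aug: simplicial_hom Qp "sconst k" aug
  by (intro simplicial_hom.intro simplicial_hom_axioms.intro Qp.simplicial_cring_axioms simplicial_sconst k.is_cring shom_aug)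

lemma aug_face: "i \<le> Suc n \<Longrightarrow> c \<in> carrier (lev Qp (Suc n)) \<Longrightarrow> aug n (face Qp n i c) = aug (Suc n) c"
  using shomD(2)[OF shom_aug] by simp

lemma aug_dgn: "i \<le> n \<Longrightarrow> c \<in> carrier (lev Qp n) \<Longrightarrow> aug (Suc n) (dgn Qp n i c) = aug n c"
  using shomD(3)[OF shom_aug] by simp

abbreviation "N \<equiv> sconst_module aug M"
abbreviation "em \<equiv> elt_map p R eps M m"
abbreviation "Y \<equiv> sqzero Qp (cofib_elt p R Q eps M m)"

lemma aug_closed [simp]: "c \<in> carrier (lev Qp n) \<Longrightarrow> aug n c \<in> carrier k"
  using aug.f_closed by simp

sublocale em: simplicial_module_map Qp "sself Qp" N em
proof (intro simplicial_module_map.intro simplicial_module_map_axioms.intro simplicial_sself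
    Qp.simplicial_cring_axioms simplicial_sconst_module[OF _ module_M shom_aug])
  fix n x assume x: "x \<in> carrier (mlev (sself Qp) n)"
  then show "em n x \<in> carrier (mlev N n)"
    by (simp add: elt_map_def sself_sel sconst_module_sel m)
  fix y assume "y \<in> carrier (mlev (sself Qp) n)"
  then show "em n (x \<oplus>\<^bsub>mlev (sself Qp) n\<^esub> y) = em n x \<oplus>\<^bsub>mlev N n\<^esub> em n y"
    using x by (simp add: elt_map_def sself_sel sconst_module_sel m aug.f_add M.smult_l_distr)
next
  fix n a x assume "a \<in> carrier (lev Qp n)" "x \<in> carrier (mlev (sself Qp) n)"
  then show "em n (a \<odot>\<^bsub>mlev (sself Qp) n\<^esub> x) = a \<odot>\<^bsub>mlev N n\<^esub> em n x"
    using ring_hom_mult[OF shomD(1)[OF shom_aug]]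
    by (simp add: elt_map_def sself_sel sconst_module_sel m M.smult_assoc1)
qed (simp_all add: elt_map_def sself_sel sconst_module_sel aug_face aug_dgn)

sublocale Y: simplicial_cring Y
  unfolding cofib_elt_def by (rule simplicial_module.simplicial_sqzero[OF em.simplicial_scofib])

lemma Y_sel:
  "carrier (lev Y n) = carrier (lev Qp n) \<times> (carrier M \<times> carrier (mlev (sshift (sself Qp)) n))"
  "(a, (y, z)) \<otimes>\<^bsub>lev Y n\<^esub> (a', (y', z')) = (a \<otimes>\<^bsub>lev Qp n\<^esub> a', (aug n a \<odot>\<^bsub>M\<^esub> y' \<oplus>\<^bsub>M\<^esub> aug n a' \<odot>\<^bsub>M\<^esub> y,
     a \<odot>\<^bsub>mlev (sshift (sself Qp)) n\<^esub> z' \<oplus>\<^bsub>mlev (sshift (sself Qp)) n\<^esub> a' \<odot>\<^bsub>mlev (sshift (sself Qp)) n\<^esub> z))"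
  "(a, (y, z)) \<oplus>\<^bsub>lev Y n\<^esub> (a', (y', z')) = (a \<oplus>\<^bsub>lev Qp n\<^esub> a', (y \<oplus>\<^bsub>M\<^esub> y', z \<oplus>\<^bsub>mlev (sshift (sself Qp)) n\<^esub> z'))"
  "\<one>\<^bsub>lev Y n\<^esub> = (\<one>\<^bsub>lev Qp n\<^esub>, (\<zero>\<^bsub>M\<^esub>, \<zero>\<^bsub>mlev (sshift (sself Qp)) n\<^esub>))"
  "\<zero>\<^bsub>lev Y n\<^esub> = (\<zero>\<^bsub>lev Qp n\<^esub>, (\<zero>\<^bsub>M\<^esub>, \<zero>\<^bsub>mlev (sshift (sself Qp)) n\<^esub>))"
  "face Y n i (a, (y, z)) = (face Qp n i a,
     (if i = 0 then y \<oplus>\<^bsub>M\<^esub> aug n (face Qp n 0 (z 1)) \<odot>\<^bsub>M\<^esub> m else y, tuple_face (sself Qp) n i z))"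
  "dgn Y n i (a, (y, z)) = (dgn Qp n i a, (y, tuple_dgn (sself Qp) n i z))"
  by (simp_all add: cofib_elt_def sqzero_sel scofib_sel sconst_module_sel elt_map_def sself_sel sshift_sel(5,6))

lemma shom_snd_Y: "shom Y Z (sqzero_map (\<lambda>n. snd))"
  unfolding shom_def
proof (intro conjI allI impI ballI)
  fix n show "sqzero_map (\<lambda>n. snd) n \<in> ring_hom (lev Y n) (lev Z n)"
    by (rule ring_hom_memI) (auto simp: sqzero_map_def Y_sel sqzero_sel[of Qp "sshift (sself Qp)"])
qed (auto simp: sqzero_map_def Y_sel sqzero_sel[of Qp "sshift (sself Qp)"] sshift_sel(5,6))

sublocale E: fibre_square P Y Z "frob_map p Q" "sqzero_map (\<lambda>n. snd)"
  by (intro fibre_square.intro simplicial_hom.intro simplicial_hom_axioms.intro simplicial_Z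
      Y.simplicial_cring_axioms shom_frob_map shom_snd_Y P.simplicial_fibprod[folded P_eq])

lemma pullback: "derived_pullback_square E.E P Y Z (\<lambda>n. fst) (\<lambda>n. snd) (frob_map p Q) (sqzero_map (\<lambda>n. snd))"
proof (rule E.derived_pullback_fibprod)
  fix n z assume "z \<in> carrier (lev Z n)"
  then show "\<exists>y\<in>carrier (lev Y n). sqzero_map (\<lambda>n. snd) n y = z"
    by (intro bexI[where x = "(fst z, (\<zero>\<^bsub>M\<^esub>, snd z))"]) (auto simp: sqzero_map_def Y_sel sqzero_sel[of Qp "sshift (sself Qp)"])
qed

end

section \<open>The comparison with the arithmetic extension\<close>

lemma binom_rest_hom:
  assumes "cring S" "cring T" "h \<in> ring_hom S T" "x \<in> carrier S" "y \<in> carrier S"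
  shows "h (base_cring.binom_rest S p x y) = base_cring.binom_rest T p (h x) (h y)"
proof -
  interpret S: base_cring S using assms by (simp add: base_cring_def)
  interpret T: base_cring T using assms by (simp add: base_cring_def)
  interpret h: ring_hom_cring S T h
    using assms by (intro ring_hom_cring.intro ring_hom_cring_axioms.intro)
  show ?thesis
    unfolding S.binom_rest_def T.binom_rest_def
    by (subst h.hom_finsum)
      (use assms in \<open>auto intro!: T.finsum_cong' simp: ring_hom_add_pow[OF assms(1-3)] nat_pow_hom[OF assms(1-3)]\<close>)
qed

context frobenius_square
begin

abbreviation "u \<equiv> bar_unit Q"
abbreviation "pA n \<equiv> pconst p (lev A n)"

definition rho :: "nat \<Rightarrow> (nat multiset \<Rightarrow> 'q) \<Rightarrow> 'r set" where
  "rho n c = aug n (bar_aug p Q n c)"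

text \<open>As a map to a constant ring, \<open>rho\<close> is unchanged by faces and degeneracies.
  This makes corrections computed at different levels comparable in \<open>R/p\<close>.\<close>

lemma shom_rho: "shom A (sconst k) rho"
  using shom_comp[OF eps.X.shom_bar_aug shom_aug] by (simp add: rho_def[abs_def])

sublocale rho: simplicial_hom A "sconst k" rho
  by (intro simplicial_hom.intro simplicial_hom_axioms.intro Q.B.simplicial_cring_axioms simplicial_sconst k.is_cring shom_rho)

lemma rho_hom: "rho n \<in> ring_hom (lev A n) k"
  using shomD(1)[OF shom_rho, of n] by simp

lemma rho_closed [simp]: "c \<in> carrier (lev A n) \<Longrightarrow> rho n c \<in> carrier k"
  using rho.f_closed by simp

lemma rho_face: "i \<le> Suc n \<Longrightarrow> c \<in> carrier (lev A (Suc n)) \<Longrightarrow> rho n (face A n i c) = rho (Suc n) c"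
  using shomD(2)[OF shom_rho] by simp

lemma rho_dgn: "i \<le> n \<Longrightarrow> c \<in> carrier (lev A n) \<Longrightarrow> rho (Suc n) (dgn A n i c) = rho n c"
  using shomD(3)[OF shom_rho] by simp

lemma rho_pA [simp]: "rho n (pA n) = \<zero>\<^bsub>k\<^esub>"
  using ring_hom_pconst[OF Q.B.lev_cring k.is_cring rho_hom] by (simp add: R.pconst_modp)

lemma u_closed [simp]: "x \<in> carrier (lev Q n) \<Longrightarrow> u n x \<in> carrier (lev A n)"
  using ring_hom_closed[OF shomD(1)[OF eps.X.shom_bar_unit]] .

lemma rho_u: "x \<in> carrier (lev Q n) \<Longrightarrow> rho n (u n x) = pcls p R (eps n x)"
  by (simp add: rho_def bar_aug_def bar_unit_def aug_pcls)

lemma eps_closed [simp]: "x \<in> carrier (lev Q n) \<Longrightarrow> eps n x \<in> carrier R"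
  using eps.f_closed by simp

lemma frob_can_eq: "x \<in> carrier (lev Q n) \<Longrightarrow> frob_can p Q n x = pcls p (lev A n) (u n x [^]\<^bsub>lev A n\<^esub> p)"
proof -
  interpret L: base_cring "lev A n" by (rule Q.B.base_lev)
  show "x \<in> carrier (lev Q n) \<Longrightarrow> ?thesis"
    unfolding frob_can_def bar_eq sfrob_def Q.B.smodp_sel
    by (rule nat_pow_hom[OF Q.B.lev_cring L.cring_modp L.pcls_hom, symmetric]) simp
qed

text \<open>The fibre product condition equates two classes modulo \<open>p\<close>; unfolding the
  congruence exhibits the quotient that \<open>gam\<close> selects.\<close>

lemma P_iff:
  "(x, f) \<in> carrier (lev P n) \<longleftrightarrow> x \<in> carrier (lev Q n) \<and> f \<in> carrier (lev AA n) \<and>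
    (\<exists>c\<in>carrier (lev A n). f {#} = u n x [^]\<^bsub>lev A n\<^esub> p \<oplus>\<^bsub>lev A n\<^esub> pA n \<otimes>\<^bsub>lev A n\<^esub> c)"
proof -
  interpret L: base_cring "lev A n" by (rule Q.B.base_lev)
  have "frob_can p Q n x = bar_aug p A n f \<longleftrightarrow>
    (\<exists>c\<in>carrier (lev A n). f {#} = u n x [^]\<^bsub>lev A n\<^esub> p \<oplus>\<^bsub>lev A n\<^esub> pA n \<otimes>\<^bsub>lev A n\<^esub> c)"
    if x: "x \<in> carrier (lev Q n)" and f: "f \<in> carrier (lev AA n)"
  proof -
    have "f {#} \<in> carrier (lev A n)" using f by (simp add: gbar_sel(1)[of True p A] mpolys_coeff_closed)
    then have "pcls p (lev A n) (f {#}) = pcls p (lev A n) (u n x [^]\<^bsub>lev A n\<^esub> p) \<longleftrightarrow>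
      (\<exists>c\<in>carrier (lev A n). f {#} = u n x [^]\<^bsub>lev A n\<^esub> p \<oplus>\<^bsub>lev A n\<^esub> pA n \<otimes>\<^bsub>lev A n\<^esub> c)"
      using x by (intro L.pcls_eq_iff) auto
    then show ?thesis unfolding frob_can_eq[OF x] bar_aug_def by metis
  qed
  then show ?thesis
    unfolding P_eq sfibprod_sel by auto
qed

text \<open>The quotient of \<open>f {#} - x ^ p\<close> by \<open>p\<close> exists (and is unique) only if \<open>(x, f)\<close> lies in \<open>frob_source\<close>.\<close>

definition gam :: "nat \<Rightarrow> 'q \<Rightarrow> (nat multiset \<Rightarrow> nat multiset \<Rightarrow> 'q) \<Rightarrow> nat multiset \<Rightarrow> 'q" where
  "gam n x f = (SOME c. c \<in> carrier (lev A n) \<and>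
    f {#} = u n x [^]\<^bsub>lev A n\<^esub> p \<oplus>\<^bsub>lev A n\<^esub> pA n \<otimes>\<^bsub>lev A n\<^esub> c)"

lemma gam_spec:
  assumes "(x, f) \<in> carrier (lev P n)"
  shows "gam n x f \<in> carrier (lev A n)"
    and "f {#} = u n x [^]\<^bsub>lev A n\<^esub> p \<oplus>\<^bsub>lev A n\<^esub> pA n \<otimes>\<^bsub>lev A n\<^esub> gam n x f"
proof -
  have "\<exists>c. c \<in> carrier (lev A n) \<and> f {#} = u n x [^]\<^bsub>lev A n\<^esub> p \<oplus>\<^bsub>lev A n\<^esub> pA n \<otimes>\<^bsub>lev A n\<^esub> c"
    using assms P_iff by blast
  from someI_ex[OF this] show "gam n x f \<in> carrier (lev A n)"
    "f {#} = u n x [^]\<^bsub>lev A n\<^esub> p \<oplus>\<^bsub>lev A n\<^esub> pA n \<otimes>\<^bsub>lev A n\<^esub> gam n x f"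
    by (simp_all add: gam_def)
qed

text \<open>Cancellation of \<open>p\<close> in \<open>bar p Q\<close>. Later formulas for
  \<open>gam\<close> are obtained by proposing a quotient and verifying its defining
  equation.\<close>

lemma gam_eq:
  assumes P: "(x, f) \<in> carrier (lev P n)" and c: "c \<in> carrier (lev A n)"
    and f: "f {#} = u n x [^]\<^bsub>lev A n\<^esub> p \<oplus>\<^bsub>lev A n\<^esub> pA n \<otimes>\<^bsub>lev A n\<^esub> c"
  shows "gam n x f = c"
proof -
  interpret L: base_cring "lev A n" by (rule Q.B.base_lev)
  have x: "u n x [^]\<^bsub>lev A n\<^esub> p \<in> carrier (lev A n)" using P P_iff by auto
  note g = gam_spec[OF P]
  have "pA n \<otimes>\<^bsub>lev A n\<^esub> gam n x f = f {#} \<ominus>\<^bsub>lev A n\<^esub> u n x [^]\<^bsub>lev A n\<^esub> p"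
    using g x by (subst g(2)) simp
  also have "\<dots> = pA n \<otimes>\<^bsub>lev A n\<^esub> c"
    using c x by (subst f) simp
  finally have "pA n \<otimes>\<^bsub>lev A n\<^esub> gam n x f = pA n \<otimes>\<^bsub>lev A n\<^esub> c" .
  then have "pA n \<otimes>\<^bsub>lev A n\<^esub> (gam n x f \<ominus>\<^bsub>lev A n\<^esub> c) = \<zero>\<^bsub>lev A n\<^esub>"
    using g(1) c by (simp add: a_minus_def L.r_distr L.r_minus L.r_neg)
  then have "gam n x f \<ominus>\<^bsub>lev A n\<^esub> c = \<zero>\<^bsub>lev A n\<^esub>"
    by (rule A.ptf[rotated]) (use g(1) c in simp)
  then show ?thesis using L.minus_eq_zeroD g(1) c by blast
qed

text \<open>
  The last face adds \<open>p\<close> times the last linear coefficient to the constant one; the sum of the linear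
  coefficients makes \<open>lam\<close> invariant under it.
\<close>

definition lam :: "nat \<Rightarrow> 'q \<Rightarrow> (nat multiset \<Rightarrow> nat multiset \<Rightarrow> 'q) \<Rightarrow> 'r set" where
  "lam n x f = rho n (gam n x f) \<oplus>\<^bsub>k\<^esub> (\<Oplus>\<^bsub>k\<^esub>j\<in>{Suc 0..n}. rho n (f {#j#}))"

lemma coeff_closed [simp]: "f \<in> carrier (lev AA n) \<Longrightarrow> f v \<in> carrier (lev A n)"
  by (simp add: gbar_sel(1)[of True p A] mpolys_coeff_closed)

lemma P_closed: "(x, f) \<in> carrier (lev P n) \<Longrightarrow> x \<in> carrier (lev Q n)" "(x, f) \<in> carrier (lev P n) \<Longrightarrow> f \<in> carrier (lev AA n)"
  by (auto simp: P_iff)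

lemma lam_closed [simp]: "(x, f) \<in> carrier (lev P n) \<Longrightarrow> lam n x f \<in> carrier k"
  unfolding lam_def using gam_spec P_closed by (auto intro!: k.finsum_closed k.a_closed)

section \<open>The correction \<open>lam\<close> and the ring operations\<close>

lemma P_sel:
  "(x, f) \<otimes>\<^bsub>lev P n\<^esub> (x', f') = (x \<otimes>\<^bsub>lev Q n\<^esub> x', f \<otimes>\<^bsub>lev AA n\<^esub> f')"
  "(x, f) \<oplus>\<^bsub>lev P n\<^esub> (x', f') = (x \<oplus>\<^bsub>lev Q n\<^esub> x', f \<oplus>\<^bsub>lev AA n\<^esub> f')"
  "\<one>\<^bsub>lev P n\<^esub> = (\<one>\<^bsub>lev Q n\<^esub>, \<one>\<^bsub>lev AA n\<^esub>)" "\<zero>\<^bsub>lev P n\<^esub> = (\<zero>\<^bsub>lev Q n\<^esub>, \<zero>\<^bsub>lev AA n\<^esub>)"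
  "face P n i (x, f) = (face Q n i x, face AA n i f)" "dgn P n i (x, f) = (dgn Q n i x, dgn AA n i f)"
  unfolding P_eq sfibprod_sel by simp_all

lemma AA_sel:
  "(f \<oplus>\<^bsub>lev AA n\<^esub> g) v = f v \<oplus>\<^bsub>lev A n\<^esub> g v"
  "\<zero>\<^bsub>lev AA n\<^esub> v = \<zero>\<^bsub>lev A n\<^esub>" "\<one>\<^bsub>lev AA n\<^esub> = mconst (lev A n) \<one>\<^bsub>lev A n\<^esub>"
  by (simp_all add: gbar_sel(1)[of True p A] mpolys_sel)

lemma AA_mult:
  assumes "f \<in> carrier (lev AA n)" "g \<in> carrier (lev AA n)"
  shows "(f \<otimes>\<^bsub>lev AA n\<^esub> g) {#} = f {#} \<otimes>\<^bsub>lev A n\<^esub> g {#}"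
    "(f \<otimes>\<^bsub>lev AA n\<^esub> g) {#j#} = f {#} \<otimes>\<^bsub>lev A n\<^esub> g {#j#} \<oplus>\<^bsub>lev A n\<^esub> g {#} \<otimes>\<^bsub>lev A n\<^esub> f {#j#}"
  using coeff_empty_mult[OF Q.B.lev_cring] coeff_single_mult[OF Q.B.lev_cring] assms
  by (simp_all add: gbar_sel(1)[of True p A])

lemma u_hom: "u n \<in> ring_hom (lev Q n) (lev A n)"
  using shomD(1)[OF eps.X.shom_bar_unit] .

lemma simplicial_P: "simplicial_cring P"
  using P.simplicial_fibprod by (simp add: P_eq)

lemma pcls_eps_pow:
  fixes j :: nat
  assumes "x \<in> carrier (lev Q n)"
  shows "rho n (u n x [^]\<^bsub>lev A n\<^esub> j) = pcls p R (eps n x [^]\<^bsub>R\<^esub> j)"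
  using nat_pow_hom[OF Q.B.lev_cring k.is_cring rho_hom u_closed[OF assms], of j]
    nat_pow_hom[OF cring_R k.is_cring R.pcls_hom[of p] eps_closed[OF assms], of j] assms by (simp add: rho_u)

text \<open>The summand with factor \<open>p\<close> dies. Hence the constant coefficient of
  \<open>f\<close> acts on \<open>M\<close> as the \<open>p\<close>-th power of the image of
  \<open>x\<close>: this is the source of the Frobenius twist in the multiplication of
  \<open>W2\<close>.\<close>

lemma rho_coeff_empty:
  assumes "(x, f) \<in> carrier (lev P n)"
  shows "rho n (f {#}) = pcls p R (eps n x [^]\<^bsub>R\<^esub> p)"
proof -
  interpret L: base_cring "lev A n" by (rule Q.B.base_lev)
  interpret r: ring_hom_cring "lev A n" k "rho n"
    by (intro ring_hom_cring.intro ring_hom_cring_axioms.intro Q.B.lev_cring k.is_cring rho_hom)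
  have "pcls p R (eps n x [^]\<^bsub>R\<^esub> p) \<in> carrier k"
    using P_closed[OF assms] ring_hom_closed[OF R.pcls_hom] by simp
  then show ?thesis
    using P_closed[OF assms] gam_spec(1)[OF assms]
    by (subst gam_spec(2)[OF assms]) (simp add: pcls_eps_pow)
qed

text \<open>The power \<open>(x + x') ^ p\<close> exceeds the sum of the powers by \<open>p\<close>
  times \<open>binom_rest\<close>, so that term has to be subtracted from the sum of the quotients;
  linear coefficients are additive.\<close>

lemma lam_add:
  assumes e: "(x, f) \<in> carrier (lev P n)" "(x', f') \<in> carrier (lev P n)"
  shows "lam n (x \<oplus>\<^bsub>lev Q n\<^esub> x') (f \<oplus>\<^bsub>lev AA n\<^esub> f') =
    lam n x f \<oplus>\<^bsub>k\<^esub> lam n x' f' \<ominus>\<^bsub>k\<^esub> pcls p R (R.binom_rest p (eps n x) (eps n x'))"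
proof -
  interpret L: base_cring "lev A n" by (rule Q.B.base_lev)
  interpret r: ring_hom_cring "lev A n" k "rho n"
    by (intro ring_hom_cring.intro ring_hom_cring_axioms.intro Q.B.lev_cring k.is_cring rho_hom)
  note c = P_closed[OF e(1)] P_closed[OF e(2)] and g = gam_spec[OF e(1)] gam_spec[OF e(2)]
  note [simp] = c g(1,3)
  have sum: "(x \<oplus>\<^bsub>lev Q n\<^esub> x', f \<oplus>\<^bsub>lev AA n\<^esub> f') \<in> carrier (lev P n)"
    using cring.cring_simprules(1)[OF simplicial_cring.lev_cring[OF simplicial_P] e] by (simp add: P_sel)
  let ?S = "L.binom_rest p (u n x) (u n x')"
  have S [simp]: "?S \<in> carrier (lev A n)" by (rule L.binom_rest_closed) simp_all
  have ua: "u n (x \<oplus>\<^bsub>lev Q n\<^esub> x') = u n x \<oplus>\<^bsub>lev A n\<^esub> u n x'"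
    using ring_hom_add[OF u_hom] by simp
  \<comment> \<open>An identity valid in every commutative ring: \<open>s\<close> is moved from the
    quotient into the power, where it completes the expansion of
    \<open>(x + x') ^ p\<close>.\<close>
  have rearr: "(a \<oplus>\<^bsub>lev A n\<^esub> q \<otimes>\<^bsub>lev A n\<^esub> b) \<oplus>\<^bsub>lev A n\<^esub> (a' \<oplus>\<^bsub>lev A n\<^esub> q \<otimes>\<^bsub>lev A n\<^esub> b') =
      (a \<oplus>\<^bsub>lev A n\<^esub> a' \<oplus>\<^bsub>lev A n\<^esub> q \<otimes>\<^bsub>lev A n\<^esub> s) \<oplus>\<^bsub>lev A n\<^esub> q \<otimes>\<^bsub>lev A n\<^esub> (b \<oplus>\<^bsub>lev A n\<^esub> b' \<ominus>\<^bsub>lev A n\<^esub> s)"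
    if "a \<in> carrier (lev A n)" "a' \<in> carrier (lev A n)" "b \<in> carrier (lev A n)" "b' \<in> carrier (lev A n)"
      "q \<in> carrier (lev A n)" "s \<in> carrier (lev A n)" for a a' b b' q s
    using that by algebra
  have "gam n (x \<oplus>\<^bsub>lev Q n\<^esub> x') (f \<oplus>\<^bsub>lev AA n\<^esub> f') = gam n x f \<oplus>\<^bsub>lev A n\<^esub> gam n x' f' \<ominus>\<^bsub>lev A n\<^esub> ?S"
  proof (rule gam_eq[OF sum])
    show "gam n x f \<oplus>\<^bsub>lev A n\<^esub> gam n x' f' \<ominus>\<^bsub>lev A n\<^esub> ?S \<in> carrier (lev A n)" by simp
    show "(f \<oplus>\<^bsub>lev AA n\<^esub> f') {#} = u n (x \<oplus>\<^bsub>lev Q n\<^esub> x') [^]\<^bsub>lev A n\<^esub> p \<oplus>\<^bsub>lev A n\<^esub>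
        pA n \<otimes>\<^bsub>lev A n\<^esub> (gam n x f \<oplus>\<^bsub>lev A n\<^esub> gam n x' f' \<ominus>\<^bsub>lev A n\<^esub> ?S)"
      unfolding ua AA_sel g(2,4)
      by (subst L.frobenius_add[OF prime]; (subst rearr[where s = ?S])?) simp_all
  qed
  moreover have "rho n ?S = pcls p R (R.binom_rest p (eps n x) (eps n x'))"
    using binom_rest_hom[OF Q.B.lev_cring k.is_cring rho_hom u_closed[OF c(1)] u_closed[OF c(3)], of p]
      binom_rest_hom[OF cring_R k.is_cring R.pcls_hom[of p] eps_closed[OF c(1)] eps_closed[OF c(3)], of p]
    by (simp add: rho_u)
  ultimately have 1: "rho n (gam n (x \<oplus>\<^bsub>lev Q n\<^esub> x') (f \<oplus>\<^bsub>lev AA n\<^esub> f')) =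
      rho n (gam n x f) \<oplus>\<^bsub>k\<^esub> rho n (gam n x' f') \<ominus>\<^bsub>k\<^esub> pcls p R (R.binom_rest p (eps n x) (eps n x'))"
    by (simp add: a_minus_def)
  have 2: "(\<Oplus>\<^bsub>k\<^esub>j\<in>{Suc 0..n}. rho n ((f \<oplus>\<^bsub>lev AA n\<^esub> f') {#j#})) =
      (\<Oplus>\<^bsub>k\<^esub>j\<in>{Suc 0..n}. rho n (f {#j#})) \<oplus>\<^bsub>k\<^esub> (\<Oplus>\<^bsub>k\<^esub>j\<in>{Suc 0..n}. rho n (f' {#j#}))"
    by (subst k.finsum_addf[symmetric]) (auto intro!: k.finsum_cong' simp: AA_sel)
  have cl: "(\<Oplus>\<^bsub>k\<^esub>j\<in>{Suc 0..n}. rho n (f {#j#})) \<in> carrier k" "(\<Oplus>\<^bsub>k\<^esub>j\<in>{Suc 0..n}. rho n (f' {#j#})) \<in> carrier k"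
    "pcls p R (R.binom_rest p (eps n x) (eps n x')) \<in> carrier k"
    using ring_hom_closed[OF R.pcls_hom] R.binom_rest_closed by (auto intro!: k.finsum_closed)
  have "a \<oplus>\<^bsub>k\<^esub> b \<ominus>\<^bsub>k\<^esub> s \<oplus>\<^bsub>k\<^esub> (c \<oplus>\<^bsub>k\<^esub> d) = (a \<oplus>\<^bsub>k\<^esub> c) \<oplus>\<^bsub>k\<^esub> (b \<oplus>\<^bsub>k\<^esub> d) \<ominus>\<^bsub>k\<^esub> s"
    if "a \<in> carrier k" "b \<in> carrier k" "c \<in> carrier k" "d \<in> carrier k" "s \<in> carrier k" for a b c d s
    using that by (simp add: a_minus_def k.a_ac)
  then show ?thesis
    unfolding lam_def 1 2 using cl by simp
qed

text \<open>In \<open>(a + p b) (a' + p b')\<close> the part divided by \<open>p\<close> is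
  \<open>a b' + a' b\<close> up to a multiple of \<open>p\<close>, which \<open>rho\<close> kills.
  Linear coefficients obey the same rule by Leibniz, since constant coefficients act as
  \<open>p\<close>-th powers.\<close>

lemma lam_mult:
  assumes e: "(x, f) \<in> carrier (lev P n)" "(x', f') \<in> carrier (lev P n)"
  shows "lam n (x \<otimes>\<^bsub>lev Q n\<^esub> x') (f \<otimes>\<^bsub>lev AA n\<^esub> f') =
    pcls p R (eps n x [^]\<^bsub>R\<^esub> p) \<otimes>\<^bsub>k\<^esub> lam n x' f' \<oplus>\<^bsub>k\<^esub> pcls p R (eps n x' [^]\<^bsub>R\<^esub> p) \<otimes>\<^bsub>k\<^esub> lam n x f"
proof -
  interpret L: base_cring "lev A n" by (rule Q.B.base_lev)
  interpret r: ring_hom_cring "lev A n" k "rho n"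
    by (intro ring_hom_cring.intro ring_hom_cring_axioms.intro Q.B.lev_cring k.is_cring rho_hom)
  note c = P_closed[OF e(1)] P_closed[OF e(2)] and g = gam_spec[OF e(1)] gam_spec[OF e(2)]
  note [simp] = c g(1,3)
  have prod: "(x \<otimes>\<^bsub>lev Q n\<^esub> x', f \<otimes>\<^bsub>lev AA n\<^esub> f') \<in> carrier (lev P n)"
    using cring.cring_simprules(5)[OF simplicial_cring.lev_cring[OF simplicial_P] e] by (simp add: P_sel)
  have um: "u n (x \<otimes>\<^bsub>lev Q n\<^esub> x') [^]\<^bsub>lev A n\<^esub> p = u n x [^]\<^bsub>lev A n\<^esub> p \<otimes>\<^bsub>lev A n\<^esub> u n x' [^]\<^bsub>lev A n\<^esub> p"
    using ring_hom_mult[OF u_hom] by (simp add: L.nat_pow_distrib)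
  let ?c = "u n x [^]\<^bsub>lev A n\<^esub> p \<otimes>\<^bsub>lev A n\<^esub> gam n x' f' \<oplus>\<^bsub>lev A n\<^esub> u n x' [^]\<^bsub>lev A n\<^esub> p \<otimes>\<^bsub>lev A n\<^esub> gam n x f \<oplus>\<^bsub>lev A n\<^esub>
      pA n \<otimes>\<^bsub>lev A n\<^esub> (gam n x f \<otimes>\<^bsub>lev A n\<^esub> gam n x' f')"
  have rearr: "(a \<oplus>\<^bsub>lev A n\<^esub> q \<otimes>\<^bsub>lev A n\<^esub> b) \<otimes>\<^bsub>lev A n\<^esub> (a' \<oplus>\<^bsub>lev A n\<^esub> q \<otimes>\<^bsub>lev A n\<^esub> b') =
      a \<otimes>\<^bsub>lev A n\<^esub> a' \<oplus>\<^bsub>lev A n\<^esub> q \<otimes>\<^bsub>lev A n\<^esub> (a \<otimes>\<^bsub>lev A n\<^esub> b' \<oplus>\<^bsub>lev A n\<^esub> a' \<otimes>\<^bsub>lev A n\<^esub> b \<oplus>\<^bsub>lev A n\<^esub> q \<otimes>\<^bsub>lev A n\<^esub> (b \<otimes>\<^bsub>lev A n\<^esub> b'))"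
    if "a \<in> carrier (lev A n)" "a' \<in> carrier (lev A n)" "b \<in> carrier (lev A n)" "b' \<in> carrier (lev A n)"
      "q \<in> carrier (lev A n)" for a a' b b' q
    using that by algebra
  have "gam n (x \<otimes>\<^bsub>lev Q n\<^esub> x') (f \<otimes>\<^bsub>lev AA n\<^esub> f') = ?c"
    by (rule gam_eq[OF prod]) (simp_all add: um AA_mult g(2,4) rearr)
  then have 1: "rho n (gam n (x \<otimes>\<^bsub>lev Q n\<^esub> x') (f \<otimes>\<^bsub>lev AA n\<^esub> f')) =
      pcls p R (eps n x [^]\<^bsub>R\<^esub> p) \<otimes>\<^bsub>k\<^esub> rho n (gam n x' f') \<oplus>\<^bsub>k\<^esub> pcls p R (eps n x' [^]\<^bsub>R\<^esub> p) \<otimes>\<^bsub>k\<^esub> rho n (gam n x f)"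
    using ring_hom_closed[OF R.pcls_hom] by (simp add: pcls_eps_pow)
  have cl: "(\<Oplus>\<^bsub>k\<^esub>j\<in>{Suc 0..n}. rho n (f {#j#})) \<in> carrier k" "(\<Oplus>\<^bsub>k\<^esub>j\<in>{Suc 0..n}. rho n (f' {#j#})) \<in> carrier k"
    "pcls p R (eps n x [^]\<^bsub>R\<^esub> p) \<in> carrier k" "pcls p R (eps n x' [^]\<^bsub>R\<^esub> p) \<in> carrier k"
    using ring_hom_closed[OF R.pcls_hom] by (auto intro!: k.finsum_closed)
  have 2: "(\<Oplus>\<^bsub>k\<^esub>j\<in>{Suc 0..n}. rho n ((f \<otimes>\<^bsub>lev AA n\<^esub> f') {#j#})) =
      pcls p R (eps n x [^]\<^bsub>R\<^esub> p) \<otimes>\<^bsub>k\<^esub> (\<Oplus>\<^bsub>k\<^esub>j\<in>{Suc 0..n}. rho n (f' {#j#})) \<oplus>\<^bsub>k\<^esub>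
      pcls p R (eps n x' [^]\<^bsub>R\<^esub> p) \<otimes>\<^bsub>k\<^esub> (\<Oplus>\<^bsub>k\<^esub>j\<in>{Suc 0..n}. rho n (f {#j#}))"
    (is "_ = ?a \<otimes>\<^bsub>k\<^esub> _ \<oplus>\<^bsub>k\<^esub> ?b \<otimes>\<^bsub>k\<^esub> _")
  proof -
    have "(\<Oplus>\<^bsub>k\<^esub>j\<in>{Suc 0..n}. rho n ((f \<otimes>\<^bsub>lev AA n\<^esub> f') {#j#})) =
        (\<Oplus>\<^bsub>k\<^esub>j\<in>{Suc 0..n}. ?a \<otimes>\<^bsub>k\<^esub> rho n (f' {#j#}) \<oplus>\<^bsub>k\<^esub> ?b \<otimes>\<^bsub>k\<^esub> rho n (f {#j#}))"
      using cl(3,4) by (intro k.finsum_cong') (auto simp: AA_mult rho_coeff_empty[OF e(1)] rho_coeff_empty[OF e(2)])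
    also have "\<dots> = (\<Oplus>\<^bsub>k\<^esub>j\<in>{Suc 0..n}. ?a \<otimes>\<^bsub>k\<^esub> rho n (f' {#j#})) \<oplus>\<^bsub>k\<^esub> (\<Oplus>\<^bsub>k\<^esub>j\<in>{Suc 0..n}. ?b \<otimes>\<^bsub>k\<^esub> rho n (f {#j#}))"
      using cl(3,4) by (intro k.finsum_addf) auto
    also have "(\<Oplus>\<^bsub>k\<^esub>j\<in>{Suc 0..n}. ?a \<otimes>\<^bsub>k\<^esub> rho n (f' {#j#})) = ?a \<otimes>\<^bsub>k\<^esub> (\<Oplus>\<^bsub>k\<^esub>j\<in>{Suc 0..n}. rho n (f' {#j#}))"
      using cl(3) by (intro k.finsum_rdistr[symmetric]) auto
    also have "(\<Oplus>\<^bsub>k\<^esub>j\<in>{Suc 0..n}. ?b \<otimes>\<^bsub>k\<^esub> rho n (f {#j#})) = ?b \<otimes>\<^bsub>k\<^esub> (\<Oplus>\<^bsub>k\<^esub>j\<in>{Suc 0..n}. rho n (f {#j#}))"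
      using cl(4) by (intro k.finsum_rdistr[symmetric]) auto
    finally show ?thesis .
  qed
  have "(s \<otimes>\<^bsub>k\<^esub> a \<oplus>\<^bsub>k\<^esub> t \<otimes>\<^bsub>k\<^esub> b) \<oplus>\<^bsub>k\<^esub> (s \<otimes>\<^bsub>k\<^esub> c \<oplus>\<^bsub>k\<^esub> t \<otimes>\<^bsub>k\<^esub> d) = s \<otimes>\<^bsub>k\<^esub> (a \<oplus>\<^bsub>k\<^esub> c) \<oplus>\<^bsub>k\<^esub> t \<otimes>\<^bsub>k\<^esub> (b \<oplus>\<^bsub>k\<^esub> d)"
    if "a \<in> carrier k" "b \<in> carrier k" "c \<in> carrier k" "d \<in> carrier k" "s \<in> carrier k" "t \<in> carrier k" for a b c d s t
    using that by (simp add: k.r_distr k.a_ac)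
  then show ?thesis
    unfolding lam_def 1 2 using cl by simp
qed

lemma lam_one: "lam n \<one>\<^bsub>lev Q n\<^esub> \<one>\<^bsub>lev AA n\<^esub> = \<zero>\<^bsub>k\<^esub>"
proof -
  interpret L: base_cring "lev A n" by (rule Q.B.base_lev)
  have P: "(\<one>\<^bsub>lev Q n\<^esub>, \<one>\<^bsub>lev AA n\<^esub>) \<in> carrier (lev P n)"
    using cring.cring_simprules(6)[OF simplicial_cring.lev_cring[OF simplicial_P], of n] by (simp add: P_sel)
  have "gam n \<one>\<^bsub>lev Q n\<^esub> \<one>\<^bsub>lev AA n\<^esub> = \<zero>\<^bsub>lev A n\<^esub>"
    by (rule gam_eq[OF P]) (simp_all add: AA_sel ring_hom_one[OF u_hom])
  then show ?thesis
    using rho.f_zero by (simp add: lam_def AA_sel mconst_def)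
qed

lemma lam_zero: "lam n \<zero>\<^bsub>lev Q n\<^esub> \<zero>\<^bsub>lev AA n\<^esub> = \<zero>\<^bsub>k\<^esub>"
proof -
  interpret L: base_cring "lev A n" by (rule Q.B.base_lev)
  interpret uh: ring_hom_cring "lev Q n" "lev A n" "u n"
    by (intro ring_hom_cring.intro ring_hom_cring_axioms.intro eps.X.lev_cring Q.B.lev_cring u_hom)
  have P: "(\<zero>\<^bsub>lev Q n\<^esub>, \<zero>\<^bsub>lev AA n\<^esub>) \<in> carrier (lev P n)"
    using cring.cring_simprules(2)[OF simplicial_cring.lev_cring[OF simplicial_P], of n] by (simp add: P_sel)
  \<comment> \<open>The exponent must be positive for the \<open>p\<close>-th power of zero to
    vanish.\<close>
  have "0 < p" using prime by (rule prime_gt_0_nat)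
  then have "gam n \<zero>\<^bsub>lev Q n\<^esub> \<zero>\<^bsub>lev AA n\<^esub> = \<zero>\<^bsub>lev A n\<^esub>"
    by (intro gam_eq[OF P]) (simp_all add: AA_sel L.nat_pow_zero)
  then show ?thesis
    using rho.f_zero by (simp add: lam_def AA_sel)
qed

section \<open>The correction \<open>lam\<close> and the simplicial structure\<close>

lemma frob_map_eq:
  "frob_map p Q n (x, f) = (bar_aug p Q n (f {#}), \<lambda>j\<in>{1..n}. bar_aug p Q n (f {#j#}))"
  by (simp add: frob_map_def bar_to_sqzero_def bar_map_def)

text \<open>Read off from the fact that \<open>frob_map\<close> is simplicial, which already
  contains the behaviour of linear coefficients under faces; \<open>aug\<close> then absorbs the
  faces of the coefficients themselves.\<close>

lemma rho_tuple_face: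
  assumes e: "(x, f) \<in> carrier (lev P (Suc n))" and i: "i \<le> Suc n" and j: "j \<in> {Suc 0..n}"
  shows "rho n (face AA n i f {#j#}) = (if j < i then rho (Suc n) (f {#j#})
    else if j = i then rho (Suc n) (f {#j#}) \<oplus>\<^bsub>k\<^esub> rho (Suc n) (f {#Suc j#}) else rho (Suc n) (f {#Suc j#}))"
proof -
  have "frob_map p Q n (face P n i (x, f)) = face Z n i (frob_map p Q (Suc n) (x, f))"
    using shomD(2)[OF shom_frob_map i e] .
  then have "bar_aug p Q n (face AA n i f {#j#}) =
      tuple_face (sself Qp) n i (\<lambda>j\<in>{1..Suc n}. bar_aug p Q (Suc n) (f {#j#})) j"
    using j by (auto simp: P_sel frob_map_eq sqzero_sel sshift_sel(5) dest!: fun_cong[where x = j])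
  moreover have "bar_aug p Q (Suc n) (f {#l#}) \<in> carrier (lev Qp (Suc n))" for l
    using P_closed(2)[OF e] ring_hom_closed[OF shomD(1)[OF eps.X.shom_bar_aug]] by simp
  ultimately show ?thesis
    using i j aug.f_add[of _ n] by (simp add: rho_def tuple_face_apply sself_sel aug_face)
qed

lemma rho_tuple_dgn:
  assumes e: "(x, f) \<in> carrier (lev P n)" and i: "i \<le> n" and j: "j \<in> {Suc 0..Suc n}"
  shows "rho (Suc n) (dgn AA n i f {#j#}) = (if j \<le> i then rho n (f {#j#})
    else if j = Suc i then \<zero>\<^bsub>k\<^esub> else rho n (f {#j - 1#}))"
proof -
  have "frob_map p Q (Suc n) (dgn P n i (x, f)) = dgn Z n i (frob_map p Q n (x, f))"
    using shomD(3)[OF shom_frob_map i e] .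
  then have "bar_aug p Q (Suc n) (dgn AA n i f {#j#}) =
      tuple_dgn (sself Qp) n i (\<lambda>j\<in>{1..n}. bar_aug p Q n (f {#j#})) j"
    using j by (auto simp: P_sel frob_map_eq sqzero_sel sshift_sel(6) dest!: fun_cong[where x = j])
  moreover have "bar_aug p Q n (f {#l#}) \<in> carrier (lev Qp n)" for l
    using P_closed(2)[OF e] ring_hom_closed[OF shomD(1)[OF eps.X.shom_bar_aug]] by simp
  moreover obtain l where "j = Suc l" using j by (cases j) auto
  ultimately show ?thesis
    using i j aug.f_zero[of "Suc n"] by (auto simp: rho_def tuple_dgn_apply sself_sel aug_dgn)
qed

lemma u_face: "i \<le> Suc n \<Longrightarrow> x \<in> carrier (lev Q (Suc n)) \<Longrightarrow> u n (face Q n i x) = face A n i (u (Suc n) x)"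
  using shomD(2)[OF eps.X.shom_bar_unit] .

lemma u_dgn: "i \<le> n \<Longrightarrow> x \<in> carrier (lev Q n) \<Longrightarrow> u (Suc n) (dgn Q n i x) = dgn A n i (u n x)"
  using shomD(3)[OF eps.X.shom_bar_unit] .

text \<open>All faces but the last respect constant coefficients and hence the quotient. By
  \<open>last_face_coeff_empty\<close> the last one adds \<open>p\<close> times a linear
  coefficient, so that coefficient is added to the quotient; the error \<open>p b\<close> dies under
  \<open>rho\<close>.\<close>

lemma gam_face:
  assumes e: "(x, f) \<in> carrier (lev P (Suc n))" and i: "i \<le> Suc n"
  shows "rho n (gam n (face Q n i x) (face AA n i f)) =
    (if i = Suc n then rho (Suc n) (gam (Suc n) x f) \<oplus>\<^bsub>k\<^esub> rho (Suc n) (f {#Suc n#}) else rho (Suc n) (gam (Suc n) x f))"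
proof -
  interpret L: base_cring "lev A n" by (rule Q.B.base_lev)
  interpret r: ring_hom_cring "lev A n" k "rho n"
    by (intro ring_hom_cring.intro ring_hom_cring_axioms.intro Q.B.lev_cring k.is_cring rho_hom)
  interpret d: ring_hom_cring "lev A (Suc n)" "lev A n" "face A n i"
    by (intro ring_hom_cring.intro ring_hom_cring_axioms.intro Q.B.lev_cring Q.B.face_hom i)
  note c = P_closed[OF e] and g = gam_spec[OF e]
  note [simp] = c g(1)
  have P: "(face Q n i x, face AA n i f) \<in> carrier (lev P n)"
    using simplicial_cring.face_closed[OF simplicial_P i e] by (simp add: P_sel)
  have dp: "face A n i (pA (Suc n)) = pA n"
    using ring_hom_pconst[OF Q.B.lev_cring Q.B.lev_cring d.homh] .
  have up: "face A n i (u (Suc n) x [^]\<^bsub>lev A (Suc n)\<^esub> p) = u n (face Q n i x) [^]\<^bsub>lev A n\<^esub> p"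
    using i by (simp add: u_face nat_pow_hom[OF Q.B.lev_cring Q.B.lev_cring d.homh])
  have df: "face A n i (f {#}) = u n (face Q n i x) [^]\<^bsub>lev A n\<^esub> p \<oplus>\<^bsub>lev A n\<^esub> pA n \<otimes>\<^bsub>lev A n\<^esub> face A n i (gam (Suc n) x f)"
    by (subst g(2)) (simp add: dp up pconst_closed[OF Q.B.lev_cring])
  show ?thesis
  proof (cases "i = Suc n")
    case False
    then have "face AA n i f {#} = face A n i (f {#})"
      using i Q.B.face_coeff_empty[of i n f p] by simp
    then have "gam n (face Q n i x) (face AA n i f) = face A n i (gam (Suc n) x f)"
      using df i by (intro gam_eq[OF P]) auto
    then show ?thesis using False i by (simp add: rho_face)
  next
    case True
    obtain b where b: "b \<in> carrier (lev A n)" "face AA n (Suc n) f {#} = face A n (Suc n) (f {#}) \<oplus>\<^bsub>lev A n\<^esub>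
        pA n \<otimes>\<^bsub>lev A n\<^esub> (face A n (Suc n) (f {#Suc n#}) \<oplus>\<^bsub>lev A n\<^esub> pA n \<otimes>\<^bsub>lev A n\<^esub> b)"
      using Q.B.last_face_coeff_empty[of f p n] by auto
    let ?c = "face A n i (gam (Suc n) x f) \<oplus>\<^bsub>lev A n\<^esub> (face A n i (f {#Suc n#}) \<oplus>\<^bsub>lev A n\<^esub> pA n \<otimes>\<^bsub>lev A n\<^esub> b)"
    have cl: "face A n i (gam (Suc n) x f) \<in> carrier (lev A n)" "face A n i (f {#Suc n#}) \<in> carrier (lev A n)"
      "u n (face Q n i x) [^]\<^bsub>lev A n\<^esub> p \<in> carrier (lev A n)"
      using i by auto
    have "gam n (face Q n i x) (face AA n i f) = ?c"
    proof (rule gam_eq[OF P])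
      show "?c \<in> carrier (lev A n)" using cl b(1) by simp
      show "face AA n i f {#} = u n (face Q n i x) [^]\<^bsub>lev A n\<^esub> p \<oplus>\<^bsub>lev A n\<^esub> pA n \<otimes>\<^bsub>lev A n\<^esub> ?c"
        using b df cl unfolding True by (simp add: L.r_distr L.a_assoc)
    qed
    then show ?thesis using True cl b(1) by (simp add: rho_face)
  qed
qed

text \<open>Face \<open>0\<close> loses the first linear coefficient, and the statement restores it
  because face \<open>0\<close> of the cofibre adds exactly its multiple of \<open>m\<close>. The
  last face moves the last linear coefficient into \<open>gam\<close>. Inner faces keep both
  parts.\<close>

lemma lam_face:
  assumes e: "(x, f) \<in> carrier (lev P (Suc n))" and i: "i \<le> Suc n"
  shows "(if i = 0 then rho (Suc n) (f {#Suc 0#}) \<oplus>\<^bsub>k\<^esub> lam n (face Q n i x) (face AA n i f)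
    else lam n (face Q n i x) (face AA n i f)) = lam (Suc n) x f"
proof -
  let ?v = "\<lambda>j. rho (Suc n) (f {#j#})"
  have v: "?v j \<in> carrier k" for j using P_closed(2)[OF e] by simp
  have G: "rho (Suc n) (gam (Suc n) x f) \<in> carrier k" using gam_spec(1)[OF e] by simp
  have "rho n (face AA n i f {#j#}) \<in> carrier k" if "j \<in> {Suc 0..n}" for j
    using rho_tuple_face[OF e i that] v by simp
  then have s: "(\<Oplus>\<^bsub>k\<^esub>j\<in>{Suc 0..n}. rho n (face AA n i f {#j#})) =
      (\<Oplus>\<^bsub>k\<^esub>j\<in>{Suc 0..n}. if j < i then ?v j else if j = i then ?v j \<oplus>\<^bsub>k\<^esub> ?v (Suc j) else ?v (Suc j))"
    using rho_tuple_face[OF e i] v by (intro k.finsum_cong') auto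
  have cl: "(\<Oplus>\<^bsub>k\<^esub>j\<in>{Suc 0..n}. if j < i then ?v j else if j = i then ?v j \<oplus>\<^bsub>k\<^esub> ?v (Suc j) else ?v (Suc j)) \<in> carrier k"
    using v by (intro k.finsum_closed) auto
  let ?T = "\<Oplus>\<^bsub>k\<^esub>j\<in>{Suc 0..n}. if j < i then ?v j else if j = i then ?v j \<oplus>\<^bsub>k\<^esub> ?v (Suc j) else ?v (Suc j)"
  let ?G = "rho (Suc n) (gam (Suc n) x f)" and ?S = "\<Oplus>\<^bsub>k\<^esub>j\<in>{Suc 0..Suc n}. ?v j"
  consider "i = 0" | "0 < i" "i \<le> n" | "i = Suc n" using i by linarith
  then show ?thesis
  proof cases
    case 1
    have "?v (Suc 0) \<oplus>\<^bsub>k\<^esub> ?T = ?S"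
      unfolding 1 by (rule k.tuple_face_sum(1)[OF v])
    moreover have "?v (Suc 0) \<oplus>\<^bsub>k\<^esub> (?G \<oplus>\<^bsub>k\<^esub> ?T) = ?G \<oplus>\<^bsub>k\<^esub> (?v (Suc 0) \<oplus>\<^bsub>k\<^esub> ?T)"
      by (rule k.a_lcomm[OF v G cl])
    ultimately show ?thesis
      unfolding lam_def s gam_face[OF e i] using 1 by simp
  next
    case 2
    have "?T = ?S" by (rule k.tuple_face_sum(2)[OF v 2])
    then show ?thesis
      unfolding lam_def s gam_face[OF e i] using 2 by simp
  next
    case 3
    have "?T \<oplus>\<^bsub>k\<^esub> ?v (Suc n) = ?S"
      unfolding 3 by (rule k.tuple_face_sum(3)[OF v])
    moreover have "?G \<oplus>\<^bsub>k\<^esub> ?v (Suc n) \<oplus>\<^bsub>k\<^esub> ?T = ?G \<oplus>\<^bsub>k\<^esub> (?T \<oplus>\<^bsub>k\<^esub> ?v (Suc n))"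
      unfolding k.a_assoc[OF G v cl] by (simp only: k.a_comm[OF v cl])
    ultimately show ?thesis
      unfolding lam_def s gam_face[OF e i] using 3 by simp
  qed
qed

text \<open>A degeneracy inserts a zero entry and keeps the constant coefficient, so neither summand
  of \<open>lam\<close> changes.\<close>

lemma lam_dgn:
  assumes e: "(x, f) \<in> carrier (lev P n)" and i: "i \<le> n"
  shows "lam (Suc n) (dgn Q n i x) (dgn AA n i f) = lam n x f"
proof -
  interpret d: ring_hom_cring "lev A n" "lev A (Suc n)" "dgn A n i"
    by (intro ring_hom_cring.intro ring_hom_cring_axioms.intro Q.B.lev_cring Q.B.dgn_hom i)
  note c = P_closed[OF e] and g = gam_spec[OF e]
  note [simp] = c g(1)
  have P: "(dgn Q n i x, dgn AA n i f) \<in> carrier (lev P (Suc n))"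
    using simplicial_cring.dgn_closed[OF simplicial_P i e] by (simp add: P_sel)
  have dp: "dgn A n i (pA n) = pA (Suc n)"
    using ring_hom_pconst[OF Q.B.lev_cring Q.B.lev_cring d.homh] .
  have up: "dgn A n i (u n x [^]\<^bsub>lev A n\<^esub> p) = u (Suc n) (dgn Q n i x) [^]\<^bsub>lev A (Suc n)\<^esub> p"
    using i by (simp add: u_dgn nat_pow_hom[OF Q.B.lev_cring Q.B.lev_cring d.homh])
  have "dgn AA n i f {#} = dgn A n i (f {#})"
    using i Q.B.dgn_coeff_empty[of i n f p] by simp
  also have "\<dots> = u (Suc n) (dgn Q n i x) [^]\<^bsub>lev A (Suc n)\<^esub> p \<oplus>\<^bsub>lev A (Suc n)\<^esub> pA (Suc n) \<otimes>\<^bsub>lev A (Suc n)\<^esub> dgn A n i (gam n x f)"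
    by (subst g(2)) (simp add: dp up pconst_closed[OF Q.B.lev_cring])
  finally have "gam (Suc n) (dgn Q n i x) (dgn AA n i f) = dgn A n i (gam n x f)"
    using i by (intro gam_eq[OF P]) auto
  then have 1: "rho (Suc n) (gam (Suc n) (dgn Q n i x) (dgn AA n i f)) = rho n (gam n x f)"
    using i by (simp add: rho_dgn)
  let ?v = "\<lambda>j. rho n (f {#j#})"
  have v: "?v j \<in> carrier k" for j by simp
  have "(\<Oplus>\<^bsub>k\<^esub>j\<in>{Suc 0..Suc n}. rho (Suc n) (dgn AA n i f {#j#})) =
      (\<Oplus>\<^bsub>k\<^esub>j\<in>{Suc 0..Suc n}. if j \<le> i then ?v j else if j = Suc i then \<zero>\<^bsub>k\<^esub> else ?v (j - 1))"
    using rho_tuple_dgn[OF e i] by (intro k.finsum_cong') auto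
  then show ?thesis
    unfolding lam_def 1 using k.tuple_dgn_sum[of ?v i n] i v by simp
qed

end

section \<open>The map to the arithmetic extension\<close>

context frobenius_square
begin

abbreviation "W \<equiv> W2 p R M m"

definition wmap :: "nat \<Rightarrow> ('q \<times> (nat multiset \<Rightarrow> nat multiset \<Rightarrow> 'q)) \<times> ('q set \<times> ('m \<times> (nat \<Rightarrow> 'q set))) \<Rightarrow> 'r \<times> 'm" where
  "wmap n = (\<lambda>((x, f), (a, (y, z))). (eps n x, y \<oplus>\<^bsub>M\<^esub> lam n x f \<odot>\<^bsub>M\<^esub> m))"

lemma wmap_apply [simp]: "wmap n ((x, f), (a, (y, z))) = (eps n x, y \<oplus>\<^bsub>M\<^esub> lam n x f \<odot>\<^bsub>M\<^esub> m)"
  by (simp add: wmap_def)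

text \<open>The fibre product condition forces the components in \<open>Q/p\<close> and in the
  shift, so an element of \<open>E\<close> amounts to one of \<open>frob_source\<close> together
  with an arbitrary \<open>y\<close> in \<open>M\<close>.\<close>

lemma E_iff:
  "((x, f), (a, (y, z))) \<in> carrier (lev E.E n) \<longleftrightarrow> (x, f) \<in> carrier (lev P n) \<and> y \<in> carrier M \<and>
    a = bar_aug p Q n (f {#}) \<and> z = (\<lambda>j\<in>{1..n}. bar_aug p Q n (f {#j#}))"
proof -
  have "bar_aug p Q n (f v) \<in> carrier (lev Qp n)" if "(x, f) \<in> carrier (lev P n)" for v
    using P_closed(2)[OF that] ring_hom_closed[OF shomD(1)[OF eps.X.shom_bar_aug]] by simp
  then show ?thesis
    by (auto simp: sfibprod_sel Y_sel frob_map_eq sqzero_map_def sshift_sel(1) sself_sel)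
qed

lemma E_cases:
  assumes "e \<in> carrier (lev E.E n)"
  obtains x f y where "e = ((x, f), (bar_aug p Q n (f {#}), (y, \<lambda>j\<in>{1..n}. bar_aug p Q n (f {#j#}))))"
    "(x, f) \<in> carrier (lev P n)" "y \<in> carrier M"
proof -
  obtain x f a y z where "e = ((x, f), (a, (y, z)))" by (metis surj_pair)
  then show thesis using that assms E_iff by auto
qed

lemma aug_coeff_empty:
  "(x, f) \<in> carrier (lev P n) \<Longrightarrow> aug n (bar_aug p Q n (f {#})) = pcls p R (eps n x [^]\<^bsub>R\<^esub> p)"
  using rho_coeff_empty by (simp add: rho_def)

lemma finsum_smult_distr:
  assumes "f \<in> I \<rightarrow> carrier k"
  shows "(\<Oplus>\<^bsub>k\<^esub>i\<in>I. f i) \<odot>\<^bsub>M\<^esub> m = (\<Oplus>\<^bsub>M\<^esub>i\<in>I. f i \<odot>\<^bsub>M\<^esub> m)"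
  using assms m by (induction I rule: infinite_finite_induct) (auto simp: Pi_def M.smult_l_distr)

text \<open>Matches the correction term in the addition of \<open>W2\<close>, a sum taken in
  \<open>M\<close>, with the one in \<open>lam_add\<close>, a sum taken before acting on
  \<open>m\<close>.\<close>

lemma binom_rest_smult:
  assumes "a \<in> carrier R" "b \<in> carrier R"
  shows "(\<Oplus>\<^bsub>M\<^esub>j\<in>{1..p - 1}. pcls p R ([((p choose j) div p)] \<cdot>\<^bsub>R\<^esub> (a [^]\<^bsub>R\<^esub> (p - j) \<otimes>\<^bsub>R\<^esub> b [^]\<^bsub>R\<^esub> j)) \<odot>\<^bsub>M\<^esub> m) =
    pcls p R (R.binom_rest p a b) \<odot>\<^bsub>M\<^esub> m"
proof -
  interpret c: ring_hom_cring R k "pcls p R"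
    by (intro ring_hom_cring.intro ring_hom_cring_axioms.intro cring_R k.is_cring R.pcls_hom)
  show ?thesis
    unfolding R.binom_rest_def using assms m by (simp add: c.hom_finsum finsum_smult_distr comp_def)
qed

lemma wmap_surj:
  assumes "w \<in> carrier W"
  shows "\<exists>e\<in>carrier (lev E.E n). wmap n e = w"
proof -
  obtain r y where w: "w = (r, y)" "r \<in> carrier R" "y \<in> carrier M" using assms by (auto simp: W2_sel)
  obtain x where x: "x \<in> carrier (lev Q n)" "eps n x = r" using weak_equiv_sconst_surj[OF we_eps w(2)] by blast
  interpret L: base_cring "lev A n" by (rule Q.B.base_lev)
  \<comment> \<open>The constant polynomial \<open>x ^ p\<close> lifts the Frobenius of
    \<open>x\<close>, so it pairs with \<open>x\<close> in \<open>frob_source\<close>; additivity of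
    this choice is irrelevant for a single element. The component in \<open>M\<close> then absorbs
    \<open>lam\<close>.\<close>
  let ?f = "mconst (lev A n) (u n x [^]\<^bsub>lev A n\<^esub> p)"
  have "?f \<in> carrier (lev AA n)" using x by (simp add: gbar_sel(1)[of True p A] L.mconst_closed)
  then have P: "(x, ?f) \<in> carrier (lev P n)"
    using x unfolding P_iff by (auto intro!: bexI[where x = "\<zero>\<^bsub>lev A n\<^esub>"])
  let ?y = "y \<ominus>\<^bsub>M\<^esub> lam n x ?f \<odot>\<^bsub>M\<^esub> m"
  have lm: "lam n x ?f \<odot>\<^bsub>M\<^esub> m \<in> carrier M" using P m by simp
  then have "((x, ?f), (bar_aug p Q n (?f {#}), (?y, \<lambda>j\<in>{1..n}. bar_aug p Q n (?f {#j#})))) \<in> carrier (lev E.E n)"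
    using P w by (simp add: E_iff)
  moreover have "?y \<oplus>\<^bsub>M\<^esub> lam n x ?f \<odot>\<^bsub>M\<^esub> m = y"
    using lm w(3) by (simp add: a_minus_def M.a_assoc M.l_neg)
  ultimately show ?thesis using x w by (intro bexI) auto
qed

text \<open>Everything is transported along the surjection \<open>wmap\<close> by
  \<open>simplicial_image\<close>: associativity and distributivity of the twisted operations of
  \<open>W2\<close> are inherited from \<open>E\<close>.\<close>

lemma simplicial_W2: "simplicial_cring (sconst W)"
  and shom_wmap: "shom E.E (sconst W) wmap"
proof -
  have cl: "wmap n e \<in> carrier W" if "e \<in> carrier (lev E.E n)" for n e
    using that m by (elim E_cases) (auto simp: W2_sel P_closed)
  have im: "carrier (lev (sconst W) n) = wmap n ` carrier (lev E.E n)" for n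
    using cl wmap_surj by (auto simp: image_iff) metis
  have mult: "wmap n (e \<otimes>\<^bsub>lev E.E n\<^esub> e') = wmap n e \<otimes>\<^bsub>lev (sconst W) n\<^esub> wmap n e'"
    if e: "e \<in> carrier (lev E.E n)" and e': "e' \<in> carrier (lev E.E n)" for n e e'
  proof -
    obtain x f y where 1: "e = ((x, f), (bar_aug p Q n (f {#}), (y, \<lambda>j\<in>{1..n}. bar_aug p Q n (f {#j#}))))"
      "(x, f) \<in> carrier (lev P n)" "y \<in> carrier M" using e by (rule E_cases)
    obtain x' f' y' where 2: "e' = ((x', f'), (bar_aug p Q n (f' {#}), (y', \<lambda>j\<in>{1..n}. bar_aug p Q n (f' {#j#}))))"
      "(x', f') \<in> carrier (lev P n)" "y' \<in> carrier M" using e' by (rule E_cases)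
    let ?a = "pcls p R (eps n x [^]\<^bsub>R\<^esub> p)" and ?b = "pcls p R (eps n x' [^]\<^bsub>R\<^esub> p)"
    have c: "?a \<in> carrier k" "?b \<in> carrier k"
      using P_closed[OF 1(2)] P_closed[OF 2(2)] ring_hom_closed[OF R.pcls_hom] by auto
    have r: "s \<odot>\<^bsub>M\<^esub> y' \<oplus>\<^bsub>M\<^esub> t \<odot>\<^bsub>M\<^esub> y \<oplus>\<^bsub>M\<^esub> (s \<otimes>\<^bsub>k\<^esub> l' \<oplus>\<^bsub>k\<^esub> t \<otimes>\<^bsub>k\<^esub> l) \<odot>\<^bsub>M\<^esub> m =
        s \<odot>\<^bsub>M\<^esub> (y' \<oplus>\<^bsub>M\<^esub> l' \<odot>\<^bsub>M\<^esub> m) \<oplus>\<^bsub>M\<^esub> t \<odot>\<^bsub>M\<^esub> (y \<oplus>\<^bsub>M\<^esub> l \<odot>\<^bsub>M\<^esub> m)"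
      if "s \<in> carrier k" "t \<in> carrier k" "l \<in> carrier k" "l' \<in> carrier k" for s t l l'
      using that 1(3) 2(3) m by (simp add: M.smult_l_distr M.smult_r_distr M.smult_assoc1 M.a_ac)
    have "wmap n (e \<otimes>\<^bsub>lev E.E n\<^esub> e') = (eps n (x \<otimes>\<^bsub>lev Q n\<^esub> x'),
        ?a \<odot>\<^bsub>M\<^esub> y' \<oplus>\<^bsub>M\<^esub> ?b \<odot>\<^bsub>M\<^esub> y \<oplus>\<^bsub>M\<^esub> lam n (x \<otimes>\<^bsub>lev Q n\<^esub> x') (f \<otimes>\<^bsub>lev AA n\<^esub> f') \<odot>\<^bsub>M\<^esub> m)"
      by (simp add: 1(1) 2(1) sfibprod_sel(2) P_sel Y_sel aug_coeff_empty[OF 1(2)] aug_coeff_empty[OF 2(2)])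
    then show ?thesis
      using r[OF c lam_closed[OF 1(2)] lam_closed[OF 2(2)]] ring_hom_mult[OF shomD(1)[OF eps.shom], of x n x'] P_closed[OF 1(2)] P_closed[OF 2(2)]
      by (simp add: lam_mult[OF 1(2) 2(2)] 1(1) 2(1) W2_sel)
  qed
  have add: "wmap n (e \<oplus>\<^bsub>lev E.E n\<^esub> e') = wmap n e \<oplus>\<^bsub>lev (sconst W) n\<^esub> wmap n e'"
    if e: "e \<in> carrier (lev E.E n)" and e': "e' \<in> carrier (lev E.E n)" for n e e'
  proof -
    obtain x f y where 1: "e = ((x, f), (bar_aug p Q n (f {#}), (y, \<lambda>j\<in>{1..n}. bar_aug p Q n (f {#j#}))))"
      "(x, f) \<in> carrier (lev P n)" "y \<in> carrier M" using e by (rule E_cases)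
    obtain x' f' y' where 2: "e' = ((x', f'), (bar_aug p Q n (f' {#}), (y', \<lambda>j\<in>{1..n}. bar_aug p Q n (f' {#j#}))))"
      "(x', f') \<in> carrier (lev P n)" "y' \<in> carrier M" using e' by (rule E_cases)
    have c: "eps n x \<in> carrier R" "eps n x' \<in> carrier R"
      using P_closed[OF 1(2)] P_closed[OF 2(2)] by auto
    have b: "pcls p R (R.binom_rest p (eps n x) (eps n x')) \<in> carrier k"
      using c R.binom_rest_closed ring_hom_closed[OF R.pcls_hom] by auto
    have r: "y \<oplus>\<^bsub>M\<^esub> y' \<oplus>\<^bsub>M\<^esub> (l \<oplus>\<^bsub>k\<^esub> l' \<ominus>\<^bsub>k\<^esub> s) \<odot>\<^bsub>M\<^esub> m =
        (y \<oplus>\<^bsub>M\<^esub> l \<odot>\<^bsub>M\<^esub> m) \<oplus>\<^bsub>M\<^esub> (y' \<oplus>\<^bsub>M\<^esub> l' \<odot>\<^bsub>M\<^esub> m) \<ominus>\<^bsub>M\<^esub> s \<odot>\<^bsub>M\<^esub> m"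
      if "s \<in> carrier k" "l \<in> carrier k" "l' \<in> carrier k" for s l l'
      using that 1(3) 2(3) m by (simp add: a_minus_def M.smult_l_distr M.smult_l_minus M.a_ac)
    have "wmap n (e \<oplus>\<^bsub>lev E.E n\<^esub> e') = (eps n (x \<oplus>\<^bsub>lev Q n\<^esub> x'),
        y \<oplus>\<^bsub>M\<^esub> y' \<oplus>\<^bsub>M\<^esub> lam n (x \<oplus>\<^bsub>lev Q n\<^esub> x') (f \<oplus>\<^bsub>lev AA n\<^esub> f') \<odot>\<^bsub>M\<^esub> m)"
      by (simp add: 1(1) 2(1) sfibprod_sel(3) P_sel Y_sel)
    then show ?thesis
      using r[OF b lam_closed[OF 1(2)] lam_closed[OF 2(2)]] eps.f_add[of x n x'] P_closed[OF 1(2)] P_closed[OF 2(2)]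
      by (simp add: lam_add[OF 1(2) 2(2)] 1(1) 2(1) W2_sel binom_rest_smult[OF c, simplified])
  qed
  have one: "wmap n \<one>\<^bsub>lev E.E n\<^esub> = \<one>\<^bsub>lev (sconst W) n\<^esub>" for n
    using ring_hom_one[OF shomD(1)[OF eps.shom], of n] m
    by (simp add: sfibprod_sel(4) P_sel Y_sel W2_sel lam_one)
  have zero: "wmap n \<zero>\<^bsub>lev E.E n\<^esub> = \<zero>\<^bsub>lev (sconst W) n\<^esub>" for n
    using eps.f_zero[of n] m
    by (simp add: sfibprod_sel(5) P_sel Y_sel W2_sel lam_zero)
  have fc: "face (sconst W) n i (wmap (Suc n) e) = wmap n (face E.E n i e)"
    if i: "i \<le> Suc n" and e: "e \<in> carrier (lev E.E (Suc n))" for n i e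
  proof -
    obtain x f y where 1: "e = ((x, f), (bar_aug p Q (Suc n) (f {#}), (y, \<lambda>j\<in>{1..Suc n}. bar_aug p Q (Suc n) (f {#j#}))))"
      "(x, f) \<in> carrier (lev P (Suc n))" "y \<in> carrier M" using e by (rule E_cases)
    have P: "(face Q n i x, face AA n i f) \<in> carrier (lev P n)"
      using simplicial_cring.face_closed[OF simplicial_P i 1(2)] by (simp add: P_sel)
    let ?l = "lam n (face Q n i x) (face AA n i f)" and ?s = "rho (Suc n) (f {#Suc 0#})"
    have cl: "?l \<in> carrier k" "?s \<in> carrier k" using P P_closed[OF 1(2)] by auto
    have ev: "eps n (face Q n i x) = eps (Suc n) x"
      using shomD(2)[OF eps.shom i] P_closed[OF 1(2)] by simp
    have ba: "bar_aug p Q (Suc n) (f {#Suc 0#}) \<in> carrier (lev Qp (Suc n))"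
      using P_closed(2)[OF 1(2)] ring_hom_closed[OF shomD(1)[OF eps.X.shom_bar_aug]] by simp
    \<comment> \<open>Face \<open>0\<close> of the cofibre adds the first linear coefficient times
      \<open>m\<close>, which is the term that \<open>lam_face\<close> calls for.\<close>
    have "wmap n (face E.E n i e) =
        (eps n (face Q n i x), (if i = 0 then y \<oplus>\<^bsub>M\<^esub> ?s \<odot>\<^bsub>M\<^esub> m else y) \<oplus>\<^bsub>M\<^esub> ?l \<odot>\<^bsub>M\<^esub> m)"
      using ba by (simp add: 1(1) sfibprod_sel(6) P_sel Y_sel aug_face rho_def)
    also have "\<dots> = (eps (Suc n) x, y \<oplus>\<^bsub>M\<^esub> (if i = 0 then ?s \<oplus>\<^bsub>k\<^esub> ?l else ?l) \<odot>\<^bsub>M\<^esub> m)"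
      using cl 1(3) m ev by (cases "i = 0") (simp_all add: M.smult_l_distr M.a_assoc)
    also have "(if i = 0 then ?s \<oplus>\<^bsub>k\<^esub> ?l else ?l) = lam (Suc n) x f" by (rule lam_face[OF 1(2) i])
    finally show ?thesis by (simp add: 1(1))
  qed
  have dg: "dgn (sconst W) n i (wmap n e) = wmap (Suc n) (dgn E.E n i e)"
    if i: "i \<le> n" and e: "e \<in> carrier (lev E.E n)" for n i e
  proof -
    obtain x f y where 1: "e = ((x, f), (bar_aug p Q n (f {#}), (y, \<lambda>j\<in>{1..n}. bar_aug p Q n (f {#j#}))))"
      "(x, f) \<in> carrier (lev P n)" "y \<in> carrier M" using e by (rule E_cases)
    have "eps (Suc n) (dgn Q n i x) = eps n x"
      using shomD(3)[OF eps.shom i] P_closed[OF 1(2)] by simp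
    then show ?thesis
      by (simp add: 1(1) sfibprod_sel(7) P_sel Y_sel lam_dgn[OF 1(2) i])
  qed
  show "simplicial_cring (sconst W)"
    by (rule simplicial_image(1)[where X = E.E and q = wmap])
      (rule E.simplicial_fibprod im mult add one zero fc dg; assumption?)+
  show "shom E.E (sconst W) wmap"
    by (rule simplicial_image(2)[where X = E.E and q = wmap])
      (rule E.simplicial_fibprod im mult add one zero fc dg; assumption?)+
qed

sublocale w: simplicial_hom E.E "sconst W" wmap
  by (intro simplicial_hom.intro simplicial_hom_axioms.intro E.simplicial_fibprod simplicial_W2 shom_wmap)

lemma cring_W2: "cring W"
  using w.Y.lev_cring[of 0] by simp

text \<open>The inclusion of the constant simplicial module \<open>M\<close> as the kernel of the
  projection from \<open>E\<close> to \<open>frob_source\<close>.\<close>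

definition kap :: "nat \<Rightarrow> 'm \<Rightarrow> ('q \<times> (nat multiset \<Rightarrow> nat multiset \<Rightarrow> 'q)) \<times> ('q set \<times> ('m \<times> (nat \<Rightarrow> 'q set)))" where
  "kap n y = (\<zero>\<^bsub>lev P n\<^esub>, (\<zero>\<^bsub>lev Qp n\<^esub>, (y, \<zero>\<^bsub>mlev (sshift (sself Qp)) n\<^esub>)))"

lemma kap_zero: "kap n \<zero>\<^bsub>M\<^esub> = \<zero>\<^bsub>lev E.E n\<^esub>"
  by (simp add: kap_def sfibprod_sel(5) Y_sel)

lemma frob_map_zero: "frob_map p Q n \<zero>\<^bsub>lev P n\<^esub> = (\<zero>\<^bsub>lev Qp n\<^esub>, \<zero>\<^bsub>mlev (sshift (sself Qp)) n\<^esub>)"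
  using E.f.f_zero[of n] by (simp add: sqzero_sel(5))

lemma kernel_kap:
  assumes "e \<in> carrier (lev E.E n)" "fst e = \<zero>\<^bsub>lev P n\<^esub>"
  shows "\<exists>y\<in>carrier M. e = kap n y"
proof -
  obtain q a y z where e: "e = (q, (a, (y, z)))" by (metis surj_pair)
  then have "frob_map p Q n \<zero>\<^bsub>lev P n\<^esub> = (a, z)" "y \<in> carrier M"
    using assms by (auto simp: sfibprod_sel(1) Y_sel sqzero_map_def)
  then show ?thesis using assms(2) e frob_map_zero by (auto simp: kap_def)
qed

lemma kap_closed: "y \<in> carrier M \<Longrightarrow> kap n y \<in> carrier (lev E.E n)"
proof -
  assume y: "y \<in> carrier M"
  have "\<zero>\<^bsub>lev E.E n\<^esub> \<in> carrier (lev E.E n)" by simp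
  then show ?thesis
    using y frob_map_zero[of n] by (auto simp: kap_def sfibprod_sel(1,5) Y_sel sqzero_map_def)
qed

lemma wmap_kap: "y \<in> carrier M \<Longrightarrow> wmap n (kap n y) = (\<zero>\<^bsub>R\<^esub>, y)"
  using eps.f_zero[of n] m by (simp add: kap_def P_sel lam_zero)

text \<open>The face is not computed: it lies in the kernel again, and there the component in
  \<open>M\<close> is determined by \<open>wmap\<close>, which is simplicial.\<close>

lemma kap_face:
  assumes y: "y \<in> carrier M" and i: "i \<le> Suc n"
  shows "face E.E n i (kap (Suc n) y) = kap n y"
proof -
  have "face E.E n i (kap (Suc n) y) \<in> carrier (lev E.E n)"
    using E.fst.X.face_closed[OF i kap_closed[OF y]] .
  moreover have "fst (face E.E n i (kap (Suc n) y)) = \<zero>\<^bsub>lev P n\<^esub>"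
    using ring_hom_zero[OF simplicial_cring.face_hom[OF simplicial_P i]] simplicial_cring.lev_cring[OF simplicial_P]
    by (simp add: kap_def sfibprod_sel(6) cring_def)
  ultimately obtain y' where y': "y' \<in> carrier M" "face E.E n i (kap (Suc n) y) = kap n y'"
    using kernel_kap by blast
  have "(\<zero>\<^bsub>R\<^esub>, y') = (\<zero>\<^bsub>R\<^esub>, y)"
    using shomD(2)[OF shom_wmap i kap_closed[OF y]] y y' by (simp add: wmap_kap)
  then show ?thesis using y' by simp
qed

text \<open>For odd \<open>n\<close> the number \<open>n + 2\<close> of faces is odd, so the
  alternating sum of equal terms leaves one copy: in odd degrees the elements of \<open>M\<close>
  are boundaries.\<close>

lemma bd_kap:
  assumes y: "y \<in> carrier M" and n: "odd n"
  shows "E.fst.X.bd n (kap (Suc n) y) = kap n y"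
proof -
  interpret L: base_cring "lev E.E n" by (rule E.fst.X.base_lev)
  have "E.fst.X.bd n (kap (Suc n) y) = (\<Oplus>\<^bsub>lev E.E n\<^esub>i\<in>{0..Suc n}. alt (lev E.E n) i (kap n y))"
    unfolding bnd_chains using y by (intro L.finsum_cong') (auto simp: kap_face kap_closed)
  also have "\<dots> = kap n y"
    using L.alt_sum_const[OF kap_closed[OF y], of "Suc n"] n by simp
  finally show ?thesis .
qed

text \<open>A five lemma by hand: \<open>E\<close> and \<open>W2\<close> are extensions of
  \<open>frob_source\<close> and of \<open>R\<close> by \<open>M\<close>, on which
  \<open>wmap\<close> is the identity, and the map between the quotients is a weak
  equivalence.\<close>

lemma quasi_iso_wmap: "quasi_iso (chains E.E) (chains (sconst W)) wmap"
  unfolding quasi_iso_def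
proof (intro conjI allI ballI impI)
  fix n c assume c: "c \<in> cycles (chains E.E) n" and bc: "wmap n c \<in> boundaries (chains (sconst W)) n"
  interpret L: base_cring "lev E.E n" by (rule E.fst.X.base_lev)
  interpret W: base_cring W using cring_W2 by (simp add: base_cring_def)
  have cE: "c \<in> carrier (lev E.E n)" using c by (simp add: E.fst.X.cycles_iff)
  then obtain x f y where c_eq: "c = ((x, f), (bar_aug p Q n (f {#}), (y, \<lambda>j\<in>{1..n}. bar_aug p Q n (f {#j#}))))"
    "(x, f) \<in> carrier (lev P n)" "y \<in> carrier M" by (rule E_cases)
  have "eps n x \<in> boundaries (chains (sconst R)) n"
    using bc P_closed(1)[OF c_eq(2)]
    by (auto simp: sconst_boundaries[OF cring_W2] sconst_boundaries[OF cring_R] c_eq(1) W2_sel(4) split: if_splits)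
  moreover have "(x, f) \<in> cycles (chains P) n"
    using E.fst.f_cycles[OF c] by (simp add: c_eq(1))
  ultimately have "(x, f) \<in> boundaries (chains P) n"
    using we_P unfolding weak_equiv_def quasi_iso_def by fastforce
  then obtain q where q: "q \<in> carrier (lev P (Suc n))" "E.f.X.bd n q = (x, f)"
    by (auto simp: boundaries_def)
  obtain a z where az: "frob_map p Q (Suc n) q = (a, z)" by (metis surj_pair)
  \<comment> \<open>A lift of \<open>q\<close> to \<open>E\<close> with zero component in
    \<open>M\<close>; subtracting its boundary from \<open>c\<close> leaves an element of the
    kernel.\<close>
  let ?e = "(q, (a, (\<zero>\<^bsub>M\<^esub>, z)))"
  have "(a, z) \<in> carrier (lev Z (Suc n))" using E.f.f_closed[OF q(1)] az by simp
  then have e: "?e \<in> carrier (lev E.E (Suc n))"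
    using q(1) az by (simp add: sfibprod_sel(1) Y_sel(1) sqzero_sel(1)[of Qp "sshift (sself Qp)"] sqzero_map_def)
  let ?d = "c \<ominus>\<^bsub>lev E.E n\<^esub> E.fst.X.bd n ?e"
  have d: "?d \<in> carrier (lev E.E n)" using cE e by simp
  have "fst ?d = \<zero>\<^bsub>lev P n\<^esub>"
    using E.fst.f_minus[of c n "E.fst.X.bd n ?e"] E.fst.bd_hom[OF e] cE e q c_eq(1) E.f.X.lev_simps(10)[OF c_eq(2)]
    by simp
  then obtain y' where y': "y' \<in> carrier M" "?d = kap n y'" using kernel_kap[OF d] by blast
  have ceq: "c = kap n y' \<oplus>\<^bsub>lev E.E n\<^esub> E.fst.X.bd n ?e"
    using y'(2) cE e by (simp flip: y'(2))
  show "c \<in> boundaries (chains E.E) n"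
  \<comment> \<open>In even degrees a constant object has no nonzero boundaries, so
    \<open>wmap\<close> forces the part in \<open>M\<close> to vanish. In odd degrees that part is
    itself a boundary by \<open>bd_kap\<close>.\<close>
  proof (cases "even n")
    case True
    have we: "wmap (Suc n) ?e \<in> carrier W" using w.f_closed[OF e] by simp
    have "wmap n c = \<zero>\<^bsub>W\<^esub>" using bc True by (simp add: sconst_boundaries[OF cring_W2])
    moreover have "wmap n (E.fst.X.bd n ?e) = \<zero>\<^bsub>W\<^esub>"
      using w.bd_hom[OF e] True we by (simp add: bnd_sconst[OF cring_W2])
    ultimately have "wmap n ?d = \<zero>\<^bsub>W\<^esub>"
      using w.f_minus[of c n "E.fst.X.bd n ?e"] cE e by simp
    then have "y' = \<zero>\<^bsub>M\<^esub>" using y' by (simp add: wmap_kap W2_sel(4))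
    then have "c = E.fst.X.bd n ?e" using ceq e by (simp add: kap_zero)
    then show ?thesis using e unfolding boundaries_def by auto
  next
    case False
    have "c = E.fst.X.bd n (kap (Suc n) y' \<oplus>\<^bsub>lev E.E (Suc n)\<^esub> ?e)"
      using ceq e bd_kap[OF y'(1) False] kap_closed[OF y'(1)] by (simp add: E.fst.X.bd_add)
    moreover have "kap (Suc n) y' \<oplus>\<^bsub>lev E.E (Suc n)\<^esub> ?e \<in> carrier (lev E.E (Suc n))"
      using e kap_closed[OF y'(1)] by simp
    ultimately show ?thesis unfolding boundaries_def chains_sel by (rule image_eqI)
  qed
next
  fix n d assume d: "d \<in> cycles (chains (sconst W)) n"
  interpret W: base_cring W using cring_W2 by (simp add: base_cring_def)
  have dW: "d \<in> carrier W" using d by (simp add: w.Y.cycles_iff)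
  show "\<exists>c\<in>cycles (chains E.E) n. d \<ominus>\<^bsub>grp (chains (sconst W)) n\<^esub> wmap n c \<in> boundaries (chains (sconst W)) n"
  proof (cases "n = 0")
    case True
    obtain e where "e \<in> carrier (lev E.E n)" "wmap n e = d" using wmap_surj[OF dW] by blast
    then show ?thesis
      using True dW by (intro bexI[where x = e]) (auto simp: E.fst.X.cycles_iff sconst_boundaries[OF cring_W2])
  next
    \<comment> \<open>In positive degrees every cycle of a constant object is a boundary, so zero is
      a preimage up to a boundary.\<close>
    case False
    have "\<zero>\<^bsub>lev E.E n\<^esub> \<in> cycles (chains E.E) n" by (auto simp: E.fst.X.cycles_iff)
    moreover have "d \<ominus>\<^bsub>W\<^esub> wmap n \<zero>\<^bsub>lev E.E n\<^esub> \<in> boundaries (chains (sconst W)) n"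
      using d dW False w.f_zero[of n] by (simp add: sconst_boundaries[OF cring_W2] sconst_cycles[OF cring_W2] split: if_splits)
    ultimately show ?thesis by (intro bexI[where x = "\<zero>\<^bsub>lev E.E n\<^esub>"]) simp_all
  qed
qed

end

theorem theorem1p1:
  fixes p :: nat and R :: "'r ring" and M :: "('r set, 'm) module" and m :: 'm
    and Q :: "'q sring" and eps :: "nat \<Rightarrow> 'q \<Rightarrow> 'r"
  assumes "prime p" and "cring R" and "module (modp p R) M" and "m \<in> carrier M"
    and "ptf_resolution p Q (sconst R) eps"
  shows "\<exists>(E :: (('q \<times> (nat multiset \<Rightarrow> nat multiset \<Rightarrow> 'q)) \<times>
                  ('q set \<times> ('m \<times> (nat \<Rightarrow> 'q set)))) sring) w top left.
    weak_equiv E (sconst (W2 p R M m)) w \<and>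
    weak_equiv (frob_source p Q) (sconst R) (\<lambda>n (x, f). eps n x) \<and>
    (\<forall>n. \<forall>e\<in>carrier (lev E n). fst (w n e) = eps n (fst (top n e))) \<and>
    derived_pullback_square
      E (frob_source p Q)
      (sqzero (smodp p Q) (cofib_elt p R Q eps M m)) (sqzero (smodp p Q) (sshift (sself (smodp p Q))))
      top left (frob_map p Q) (sqzero_map (\<lambda>n. snd))"
proof -
  interpret frobenius_square p R M m Q eps
    using assms by (intro frobenius_square.intro)
  have "weak_equiv E.E (sconst W) wmap"
    by (simp add: weak_equiv_def E.simplicial_fibprod simplicial_W2 shom_wmap quasi_iso_wmap)
  moreover have "fst (wmap n e) = eps n (fst (fst e))" for n e
    by (simp add: wmap_def split: prod.split)
  ultimately show ?thesis
    using we_P pullback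
    by (intro exI[where x = E.E] exI[where x = wmap] exI[where x = "\<lambda>n. fst"] exI[where x = "\<lambda>n. snd"]) simp
qed

end
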